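(* Let $l,n\ge 1$ be integers, let $R$ be a field, let $q,Q_0,\ldots,Q_{l-1}\in R$ be nonzero, put ${\bf q}=(Q_0,\ldots,Q_{l-1};q)$, and assume that the Ariki-Koike algebra $\mathcal{H}_n^{\bf q}$ over $R$ is split semisimple. Let $\boldsymbol{\lambda}=(\lambda^0,\lambda^1,\ldots,\lambda^{l-1})$ be an $l$-partition of $n$. Then the Schur element $s_{\boldsymbol{\lambda}}({\bf q})$ is given by $$s_{\boldsymbol{\lambda}}({\bf q})=(-1)^{n(l-1)}q^{-n(\bar{\boldsymbol{\lambda}})}(q-1)^{-n}\prod_{0\le s\le l-1}\ \prod_{(i,j)\in[\lambda^s]}\ \prod_{0\le t\le l-1}\left(q^{h_{i,j}^{\lambda^s,\lambda^t}}Q_sQ_t^{-1}-1\right),$$ or, in equivalent form, $$s_{\boldsymbol{\lambda}}({\bf q})=(-1)^{n(l-1)}q^{-n(\bar{\boldsymbol{\lambda}})}\prod_{0\le s\le l-1}\ \prod_{(i,j)\in[\lambda^s]}\left([h_{i,j}^{\lambda^s,\lambda^s}]_q\prod_{0\le t\le l-1,\ t\ne s}\left(q^{h_{i,j}^{\lambda^s,\lambda^t}}Q_sQ_t^{-1}-1\right)\right).$$ (If $q=1$, the first formula is to be read as the second one.)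
   Context: Partitions. A partition $\lambda=(\lambda_1,\lambda_2,\ldots)$ is a weakly decreasing sequence of non-negative integers with finite sum $|\lambda|$; its nodes are $[\lambda]=\{(i,j): i\ge1,\ 1\le j\le\lambda_i\}$; its conjugate is $\lambda'_k=\#\{i\ge 1:\lambda_i\ge k\}$; $n(\lambda)=\sum_{i\ge1}(i-1)\lambda_i$. For partitions $\lambda,\mu$ and $(i,j)\in[\lambda]$, the generalised hook length is $h_{i,j}^{\lambda,\mu}=\lambda_i-i+\mu'_j-j+1$. An $l$-partition of $n$ is an $l$-tuple $\boldsymbol{\lambda}=(\lambda^0,\ldots,\lambda^{l-1})$ of partitions with $\sum_s|\lambda^s|=n$; $\Pi^l_n$ is the set of these. $\bar{\boldsymbol{\lambda}}$ is the partition of $n$ obtained by arranging all the parts $\lambda^s_i$ ($0\le s\le l-1$, $i\ge1$) in decreasing order. For $m\in\mathbb{N}$, $[m]_q=1+q+\cdots+q^{m-1}$. Ariki-Koike algebra. $\mathcal{H}_n^{\bf q}$ is the unital associative $R$-algebra with generators $T_0,\ldots,T_{n-1}$ and relations $(T_0-Q_0)\cdots(T_0-Q_{l-1})=0$; $(T_i-q)(T_i+1)=0$ for $1\le i\le n-1$; $T_0T_1T_0T_1=T_1T_0T_1T_0$; $T_iT_{i+1}T_i=T_{i+1}T_iT_{i+1}$ for $1\le i\le n-2$; $T_iT_j=T_jT_i$ for $0\le i<j\le n-1$, $j-i>1$. Simple modules. In the split semisimple case the simple modules are, up to isomorphism, the $V^{\boldsymbol{\lambda}}$ ($\boldsymbol{\lambda}\in\Pi^l_n$)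 of Ariki and Koike: $V^{\boldsymbol{\lambda}}$ has a basis $(v_T)$ indexed by the standard $\boldsymbol{\lambda}$-tableaux $T$ (fillings of the nodes of $\lambda^0,\ldots,\lambda^{l-1}$ by $1,\ldots,n$, increasing along rows and columns in each component). If $k$ occupies the node $(i,j)$ of component $s$ of $T$, put $c_k=q^{j-i}Q_s$. Then $T_0v_T=Q_sv_T$, where $s$ is the component containing $1$; for $1\le k\le n-1$, $T_kv_T=qv_T$ (resp. $-v_T$) if $k,k+1$ lie in the same row (resp. column) of the same component, and otherwise $T_kv_T=a\,v_T+(1+a)v_{s_kT}$, where $s_kT$ is $T$ with $k,k+1$ exchanged and $a=(q-1)c_{k+1}/(c_{k+1}-c_k)$ (when $k,k+1$ lie in the same component, with contents $j-i$ differing by $d$, content of $k+1$ minus content of $k$, this is read as $a=q^d(q-1)/(q^d-1)$, with limiting value $1/d$ if $q=1$). The character of $V^{\boldsymbol{\lambda}}$ is denoted $\chi^{\boldsymbol{\lambda}}$. Schur elements. Let $L_k=q^{1-k}T_{k-1}\cdots T_1T_0T_1\cdots T_{k-1}$ for $1\le k\le n$, and for $w\in\mathfrak{S}_n$ let $T_w$ be the product of the $T_i$ ($1\le i\le n-1$) along a reduced expression of $w$. The elements $L_1^{c_1}\cdots L_n^{c_n}T_w$ ($0\le c_k<l$, $w\in\mathfrak{S}_n$) form an $R$-basis of $\mathcal{H}_n^{\bf q}$, and $\tau:\mathcal{H}_n^{\bf q}\to R$ is the $R$-linear form which is $1$ on the basis element $1$ and $0$ on all other basis elements (the symmetrizing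 form of Bremke-Malle and Malle-Mathas). The Schur elements are the elements $s_{\boldsymbol{\lambda}}({\bf q})\in R$ such that $\tau=\sum_{\boldsymbol{\lambda}\in\Pi^l_n}\frac{1}{s_{\boldsymbol{\lambda}}({\bf q})}\chi^{\boldsymbol{\lambda}}$. *)

theory Defs
  imports
    Complex_Main
    "HOL-Library.Poly_Mapping"
    "HOL-Library.FuncSet"
    "HOL-Library.Multiset"
    "HOL-Combinatorics.Permutations"
    "HOL-Algebra.QuotRing"
    "HOL-Algebra.Module"
begin

section \<open>Partitions and multipartitions\<close>

text \<open>
  Partitions are indexed from 1, as in the usual notation. The value at the unused
  index 0 is fixed to be 0, so that each partition is represented exactly once.
\<close>

definition is_partition :: "(nat \<Rightarrow> nat) \<Rightarrow> bool" where
  "is_partition p \<longleftrightarrow> p 0 = 0 \<and> (\<forall>i\<ge>1. p (Suc i) \<le> p i) \<and> finite {i. p i \<noteq> 0}"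

definition psize :: "(nat \<Rightarrow> nat) \<Rightarrow> nat" where
  "psize p = (\<Sum>i | p i \<noteq> 0. p i)"

definition young :: "(nat \<Rightarrow> nat) \<Rightarrow> (nat \<times> nat) set" where
  "young p = {(i, j). 1 \<le> i \<and> 1 \<le> j \<and> j \<le> p i}"

definition conj_part :: "(nat \<Rightarrow> nat) \<Rightarrow> nat \<Rightarrow> nat" where
  "conj_part p k = card {i. 1 \<le> i \<and> k \<le> p i}"

definition n_stat :: "(nat \<Rightarrow> nat) \<Rightarrow> nat" where
  "n_stat p = (\<Sum>i | p i \<noteq> 0. (i - 1) * p i)"

definition hook :: "(nat \<Rightarrow> nat) \<Rightarrow> (nat \<Rightarrow> nat) \<Rightarrow> nat \<Rightarrow> nat \<Rightarrow> int" where
  "hook p m i j = int (p i) - int i + int (conj_part m j) - int j + 1"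

type_synonym multipartition = "(nat \<Rightarrow> nat) list"

definition mp_size :: "multipartition \<Rightarrow> nat" where
  "mp_size \<Lambda> = (\<Sum>p\<leftarrow>\<Lambda>. psize p)"

definition multipartitions :: "nat \<Rightarrow> nat \<Rightarrow> multipartition set" where
  "multipartitions l n =
     {\<Lambda>. length \<Lambda> = l \<and> (\<forall>p\<in>set \<Lambda>. is_partition p) \<and> mp_size \<Lambda> = n}"

definition mp_parts :: "multipartition \<Rightarrow> nat multiset" where
  "mp_parts \<Lambda> = (\<Sum>p\<leftarrow>\<Lambda>. image_mset p (mset_set {i. p i \<noteq> 0}))"

definition mp_bar :: "multipartition \<Rightarrow> nat \<Rightarrow> nat" where
  "mp_bar \<Lambda> i =
     (if 1 \<le> i \<and> i \<le> size (mp_parts \<Lambda>)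
      then rev (sorted_list_of_multiset (mp_parts \<Lambda>)) ! (i - 1) else 0)"

definition q_int :: "'a::field \<Rightarrow> nat \<Rightarrow> 'a" where
  "q_int q m = (\<Sum>k<m. q ^ k)"


section \<open>Split semisimple algebras\<close>

text \<open>
  An algebra over a field, the latter given as a type, is a ring \<open>A\<close> together with a
  structure map \<open>\<eta>\<close> from the field to the centre of \<open>A\<close>. The library locale
  \<^locale>\<open>module\<close> requires a commutative base ring, whereas \<^locale>\<open>submodule\<close> does not.
\<close>

locale left_module = A?: ring A + M?: abelian_group M
  for A (structure) and M (structure) +
  assumes smult_closed: "a \<in> carrier A \<Longrightarrow> x \<in> carrier M \<Longrightarrow> a \<odot>\<^bsub>M\<^esub> x \<in> carrier M"
    and smult_l_distr: "a \<in> carrier A \<Longrightarrow> b \<in> carrier A \<Longrightarrow> x \<in> carrier M \<Longrightarrow>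
      (a \<oplus>\<^bsub>A\<^esub> b) \<odot>\<^bsub>M\<^esub> x = a \<odot>\<^bsub>M\<^esub> x \<oplus>\<^bsub>M\<^esub> b \<odot>\<^bsub>M\<^esub> x"
    and smult_r_distr: "a \<in> carrier A \<Longrightarrow> x \<in> carrier M \<Longrightarrow> y \<in> carrier M \<Longrightarrow>
      a \<odot>\<^bsub>M\<^esub> (x \<oplus>\<^bsub>M\<^esub> y) = a \<odot>\<^bsub>M\<^esub> x \<oplus>\<^bsub>M\<^esub> a \<odot>\<^bsub>M\<^esub> y"
    and smult_assoc: "a \<in> carrier A \<Longrightarrow> b \<in> carrier A \<Longrightarrow> x \<in> carrier M \<Longrightarrow>
      (a \<otimes>\<^bsub>A\<^esub> b) \<odot>\<^bsub>M\<^esub> x = a \<odot>\<^bsub>M\<^esub> (b \<odot>\<^bsub>M\<^esub> x)"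
    and smult_one: "x \<in> carrier M \<Longrightarrow> \<one>\<^bsub>A\<^esub> \<odot>\<^bsub>M\<^esub> x = x"

definition regular_module :: "('r, 'm) ring_scheme \<Rightarrow> ('r, 'r) module" where
  "regular_module A =
     \<lparr>carrier = carrier A, mult = mult A, one = one A, zero = zero A, add = add A,
      smult = mult A\<rparr>"

lemma (in ring) left_module_regular: "left_module R (regular_module R)"
proof -
  have "abelian_group (regular_module R)"
    by (rule abelian_groupI)
       (auto simp: regular_module_def a_ac intro: bexI[of _ "\<ominus> _"] l_neg)
  then show ?thesis
    by (intro left_module.intro left_module_axioms.intro ring_axioms)
       (auto simp: regular_module_def l_distr r_distr m_assoc)
qed

definition simple_module :: "('r, 'm) ring_scheme \<Rightarrow> ('r, 'v, 'k) module_scheme \<Rightarrow> bool" where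
  "simple_module A M \<longleftrightarrow>
     left_module A M \<and> carrier M \<noteq> {\<zero>\<^bsub>M\<^esub>} \<and>
     (\<forall>N. submodule N A M \<longrightarrow> N = {\<zero>\<^bsub>M\<^esub>} \<or> N = carrier M)"

definition semisimple_module :: "('r, 'm) ring_scheme \<Rightarrow> ('r, 'v, 'k) module_scheme \<Rightarrow> bool" where
  "semisimple_module A M \<longleftrightarrow>
     left_module A M \<and>
     (\<forall>N. submodule N A M \<longrightarrow>
        (\<exists>N'. submodule N' A M \<and> N \<inter> N' = {\<zero>\<^bsub>M\<^esub>} \<and> N <+>\<^bsub>M\<^esub> N' = carrier M))"

definition module_End ::
  "('r, 'm) ring_scheme \<Rightarrow> ('r, 'v, 'k) module_scheme \<Rightarrow> ('v \<Rightarrow> 'v) set" where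
  "module_End A M =
     {f \<in> carrier M \<rightarrow> carrier M.
        (\<forall>x\<in>carrier M. \<forall>y\<in>carrier M. f (x \<oplus>\<^bsub>M\<^esub> y) = f x \<oplus>\<^bsub>M\<^esub> f y) \<and>
        (\<forall>a\<in>carrier A. \<forall>x\<in>carrier M. f (a \<odot>\<^bsub>M\<^esub> x) = a \<odot>\<^bsub>M\<^esub> f x)}"

text \<open>
  Semisimple: the regular module is semisimple. Split: every simple module has only the
  scalars as endomorphisms. Simple modules are taken with carriers in the type \<open>'r set\<close>,
  which loses nothing: each is isomorphic to the quotient of the regular module by a
  maximal left ideal, whose elements are cosets.
\<close>

definition split_semisimple :: "('r, 'm) ring_scheme \<Rightarrow> ('a::field \<Rightarrow> 'r) \<Rightarrow> bool" where
  "split_semisimple A \<eta> \<longleftrightarrow>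
     semisimple_module A (regular_module A) \<and>
     (\<forall>S :: ('r, 'r set) module. simple_module A S \<longrightarrow>
        (\<forall>f \<in> module_End A S. \<exists>c. \<forall>x\<in>carrier S. f x = \<eta> c \<odot>\<^bsub>S\<^esub> x))"


section \<open>The Ariki-Koike algebra\<close>

text \<open>
  The free algebra on letters of type \<open>'g\<close> is the monoid algebra of the free monoid,
  which is written additively because \<^typ>\<open>'b \<Rightarrow>\<^sub>0 'a\<close> takes its exponents in an
  additive monoid.
\<close>

datatype 'g free_monoid = FM (letters: "'g list")

instantiation free_monoid :: (type) monoid_add
begin

definition zero_free_monoid :: "'a free_monoid" where
  "0 = FM []"

definition plus_free_monoid :: "'a free_monoid \<Rightarrow> 'a free_monoid \<Rightarrow> 'a free_monoid" where
  "u + v = FM (letters u @ letters v)"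

instance
  by standard (simp_all add: zero_free_monoid_def plus_free_monoid_def)

end

type_synonym 'a free_alg = "nat free_monoid \<Rightarrow>\<^sub>0 'a"

definition free_gen :: "nat \<Rightarrow> 'a::field free_alg" where
  "free_gen i = Poly_Mapping.single (FM [i]) 1"

definition free_const :: "'a::field \<Rightarrow> 'a free_alg" where
  "free_const c = Poly_Mapping.single 0 c"

definition free_algebra :: "nat \<Rightarrow> 'a::field free_alg ring" where
  "free_algebra n =
     \<lparr>carrier = {x. \<forall>w\<in>Poly_Mapping.keys x. set (letters w) \<subseteq> {..<n}},
      mult = (*), one = 1, zero = 0, add = (+)\<rparr>"

definition ak_relations :: "nat \<Rightarrow> nat \<Rightarrow> 'a::field \<Rightarrow> (nat \<Rightarrow> 'a) \<Rightarrow> 'a free_alg set" where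
  "ak_relations l n q Q =
     {\<Prod>s\<leftarrow>[0..<l]. free_gen 0 - free_const (Q s)} \<union>
     {(free_gen i - free_const q) * (free_gen i + 1) | i. 1 \<le> i \<and> i < n} \<union>
     (if 2 \<le> n
      then {free_gen 0 * free_gen 1 * free_gen 0 * free_gen 1
              - free_gen 1 * free_gen 0 * free_gen 1 * free_gen 0}
      else {}) \<union>
     {free_gen i * free_gen (i + 1) * free_gen i
        - free_gen (i + 1) * free_gen i * free_gen (i + 1) | i. 1 \<le> i \<and> i + 1 < n} \<union>
     {free_gen i * free_gen j - free_gen j * free_gen i | i j. i + 1 < j \<and> j < n}"

definition ak_ideal :: "nat \<Rightarrow> nat \<Rightarrow> 'a::field \<Rightarrow> (nat \<Rightarrow> 'a) \<Rightarrow> 'a free_alg set" where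
  "ak_ideal l n q Q = Idl\<^bsub>free_algebra n\<^esub> (ak_relations l n q Q)"

definition ak_algebra ::
  "nat \<Rightarrow> nat \<Rightarrow> 'a::field \<Rightarrow> (nat \<Rightarrow> 'a) \<Rightarrow> 'a free_alg set ring" where
  "ak_algebra l n q Q = free_algebra n Quot ak_ideal l n q Q"

definition ak_scalar ::
  "nat \<Rightarrow> nat \<Rightarrow> 'a::field \<Rightarrow> (nat \<Rightarrow> 'a) \<Rightarrow> 'a \<Rightarrow> 'a free_alg set" where
  "ak_scalar l n q Q c = ak_ideal l n q Q +>\<^bsub>free_algebra n\<^esub> free_const c"

definition ak_gen ::
  "nat \<Rightarrow> nat \<Rightarrow> 'a::field \<Rightarrow> (nat \<Rightarrow> 'a) \<Rightarrow> nat \<Rightarrow> 'a free_alg set" where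
  "ak_gen l n q Q i = ak_ideal l n q Q +>\<^bsub>free_algebra n\<^esub> free_gen i"

lemma free_algebra_simps:
  "mult (free_algebra n) = (*)" "one (free_algebra n) = 1"
  "zero (free_algebra n) = 0" "add (free_algebra n) = (+)"
  by (simp_all add: free_algebra_def)

lemma free_algebra_carrier_iff:
  "x \<in> carrier (free_algebra n) \<longleftrightarrow> (\<forall>w\<in>Poly_Mapping.keys x. set (letters w) \<subseteq> {..<n})"
  by (simp add: free_algebra_def)

lemma free_algebra_closed:
  fixes x y :: "'a::field free_alg"
  shows "x \<in> carrier (free_algebra n) \<Longrightarrow> y \<in> carrier (free_algebra n) \<Longrightarrow>
           x + y \<in> carrier (free_algebra n)"
    and "x \<in> carrier (free_algebra n) \<Longrightarrow> y \<in> carrier (free_algebra n) \<Longrightarrow>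
           x - y \<in> carrier (free_algebra n)"
    and "x \<in> carrier (free_algebra n) \<Longrightarrow> y \<in> carrier (free_algebra n) \<Longrightarrow>
           x * y \<in> carrier (free_algebra n)"
    and "x \<in> carrier (free_algebra n) \<Longrightarrow> - x \<in> carrier (free_algebra n)"
    and "(0 :: 'a free_alg) \<in> carrier (free_algebra n)"
    and "(1 :: 'a free_alg) \<in> carrier (free_algebra n)"
    and "free_const c \<in> carrier (free_algebra n)"
    and "i < n \<Longrightarrow> (free_gen i :: 'a free_alg) \<in> carrier (free_algebra n)"
proof -
  assume x: "x \<in> carrier (free_algebra n)" and y: "y \<in> carrier (free_algebra n)"
  show "x + y \<in> carrier (free_algebra n)"
    using x y Poly_Mapping.keys_add[of x y] unfolding free_algebra_carrier_iff by blast
  show "x - y \<in> carrier (free_algebra n)"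
    using x y keys_diff[of x y] unfolding free_algebra_carrier_iff by blast
  show "x * y \<in> carrier (free_algebra n)"
    unfolding free_algebra_carrier_iff
  proof
    fix w assume "w \<in> Poly_Mapping.keys (x * y)"
    then obtain u v where "w = u + v" "u \<in> Poly_Mapping.keys x" "v \<in> Poly_Mapping.keys y"
      using keys_mult[of x y] by blast
    then show "set (letters w) \<subseteq> {..<n}"
      using x y by (auto simp: free_algebra_carrier_iff plus_free_monoid_def)
  qed
next
  assume "x \<in> carrier (free_algebra n)"
  then show "- x \<in> carrier (free_algebra n)" by (simp add: free_algebra_carrier_iff)
next
  show "(0 :: 'a free_alg) \<in> carrier (free_algebra n)"
    by (simp add: free_algebra_carrier_iff)
  show "(1 :: 'a free_alg) \<in> carrier (free_algebra n)"
    by (simp add: free_algebra_carrier_iff zero_free_monoid_def)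
  show "free_const c \<in> carrier (free_algebra n)"
    by (simp add: free_algebra_carrier_iff free_const_def zero_free_monoid_def)
next
  assume "i < n"
  then show "(free_gen i :: 'a free_alg) \<in> carrier (free_algebra n)"
    by (simp add: free_algebra_carrier_iff free_gen_def)
qed

lemma ring_free_algebra: "ring (free_algebra n :: 'a::field free_alg ring)"
proof (rule ringI)
  show "abelian_group (free_algebra n :: 'a free_alg ring)"
  proof (rule abelian_groupI)
    fix x :: "'a free_alg" assume "x \<in> carrier (free_algebra n)"
    then show "\<exists>y\<in>carrier (free_algebra n). y \<oplus>\<^bsub>free_algebra n\<^esub> x = \<zero>\<^bsub>free_algebra n\<^esub>"
      by (intro bexI[of _ "- x"]) (auto simp: free_algebra_simps free_algebra_closed)
  qed (auto simp: free_algebra_simps free_algebra_closed add_ac)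
  show "monoid (free_algebra n :: 'a free_alg ring)"
    by (rule monoidI) (auto simp: free_algebra_simps free_algebra_closed mult.assoc)
qed (auto simp: free_algebra_simps distrib_left distrib_right)

lemma ak_relations_carrier:
  assumes "1 \<le> n"
  shows "ak_relations l n q Q \<subseteq> carrier (free_algebra n)"
proof -
  have "prod_list xs \<in> carrier (free_algebra n)"
    if "set xs \<subseteq> carrier (free_algebra n)" for xs :: "'a free_alg list"
    using that by (induction xs) (auto intro: free_algebra_closed)
  moreover have "set (map (\<lambda>s. free_gen 0 - free_const (Q s)) [0..<l]) \<subseteq> carrier (free_algebra n)"
    using assms by (auto intro!: free_algebra_closed)
  ultimately have "(\<Prod>s\<leftarrow>[0..<l]. free_gen 0 - free_const (Q s)) \<in> carrier (free_algebra n)"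
    by blast
  then show ?thesis
    unfolding ak_relations_def by (auto intro!: free_algebra_closed)
qed

lemma ideal_ak_ideal: "1 \<le> n \<Longrightarrow> ideal (ak_ideal l n q Q) (free_algebra n)"
  unfolding ak_ideal_def
  by (intro ring.genideal_ideal ring_free_algebra ak_relations_carrier)

lemma ring_ak_algebra: "1 \<le> n \<Longrightarrow> ring (ak_algebra l n q Q)"
  unfolding ak_algebra_def by (intro ideal.quotient_is_ring ideal_ak_ideal)


section \<open>The modules indexed by multipartitions\<close>

text \<open>
  The vector space with basis the standard tableaux is rendered as functions from
  tableaux to the field. A tableau assigns to the node \<open>(i, j)\<close> of component \<open>s\<close>, that is
  to the triple \<open>(s, i, j)\<close>, its entry, and takes the dummy value 0 off the diagram.
\<close>

type_synonym tableau = "nat \<times> nat \<times> nat \<Rightarrow> nat"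

definition mp_nodes :: "multipartition \<Rightarrow> (nat \<times> nat \<times> nat) set" where
  "mp_nodes \<Lambda> = {(s, i, j). s < length \<Lambda> \<and> (i, j) \<in> young (\<Lambda> ! s)}"

definition std_tableaux :: "multipartition \<Rightarrow> tableau set" where
  "std_tableaux \<Lambda> =
     {T. bij_betw T (mp_nodes \<Lambda>) {1..mp_size \<Lambda>} \<and> (\<forall>x. x \<notin> mp_nodes \<Lambda> \<longrightarrow> T x = 0) \<and>
         (\<forall>s i j j'. (s, i, j) \<in> mp_nodes \<Lambda> \<and> (s, i, j') \<in> mp_nodes \<Lambda> \<and> j < j' \<longrightarrow>
            T (s, i, j) < T (s, i, j')) \<and>
         (\<forall>s i i' j. (s, i, j) \<in> mp_nodes \<Lambda> \<and> (s, i', j) \<in> mp_nodes \<Lambda> \<and> i < i' \<longrightarrow>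
            T (s, i, j) < T (s, i', j))}"

definition node_of :: "multipartition \<Rightarrow> tableau \<Rightarrow> nat \<Rightarrow> nat \<times> nat \<times> nat" where
  "node_of \<Lambda> T k = inv_into (mp_nodes \<Lambda>) T k"

definition basis_vec :: "tableau \<Rightarrow> tableau \<Rightarrow> 'a::field" where
  "basis_vec T = (\<lambda>U. if U = T then 1 else 0)"

definition seminormal_coeff ::
  "'a::field \<Rightarrow> (nat \<Rightarrow> 'a) \<Rightarrow> nat \<times> nat \<times> nat \<Rightarrow> nat \<times> nat \<times> nat \<Rightarrow> 'a" where
  "seminormal_coeff q Q = (\<lambda>(s, i, j) (s', i', j').
     if s = s' then
       let d = (int j' - int i') - (int j - int i)
       in if q = 1 then 1 / of_int d else q powi d * (q - 1) / (q powi d - 1)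
     else
       let c = q powi (int j - int i) * Q s; c' = q powi (int j' - int i') * Q s'
       in (q - 1) * c' / (c' - c))"

text \<open>The image of the basis vector of \<open>T\<close> under the generator of index \<open>k\<close>:\<close>

definition gen_basis ::
  "'a::field \<Rightarrow> (nat \<Rightarrow> 'a) \<Rightarrow> multipartition \<Rightarrow> nat \<Rightarrow> tableau \<Rightarrow> tableau \<Rightarrow> 'a" where
  "gen_basis q Q \<Lambda> k T =
     (if k = 0 then (\<lambda>U. Q (fst (node_of \<Lambda> T 1)) * basis_vec T U)
      else
        let (s, i, j) = node_of \<Lambda> T k; (s', i', j') = node_of \<Lambda> T (k + 1)
        in if s = s' \<and> i = i' then (\<lambda>U. q * basis_vec T U)
           else if s = s' \<and> j = j' then (\<lambda>U. - basis_vec T U)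
           else
             let a = seminormal_coeff q Q (s, i, j) (s', i', j')
             in (\<lambda>U. a * basis_vec T U + (1 + a) * basis_vec (transpose k (k + 1) \<circ> T) U))"

definition gen_op ::
  "'a::field \<Rightarrow> (nat \<Rightarrow> 'a) \<Rightarrow> multipartition \<Rightarrow> nat \<Rightarrow> (tableau \<Rightarrow> 'a) \<Rightarrow> tableau \<Rightarrow> 'a" where
  "gen_op q Q \<Lambda> k v = (\<lambda>U. \<Sum>T\<in>std_tableaux \<Lambda>. v T * gen_basis q Q \<Lambda> k T U)"

definition free_op ::
  "'a::field \<Rightarrow> (nat \<Rightarrow> 'a) \<Rightarrow> multipartition \<Rightarrow> 'a free_alg \<Rightarrow> (tableau \<Rightarrow> 'a) \<Rightarrow> tableau \<Rightarrow> 'a"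
  where
  "free_op q Q \<Lambda> x v =
     (\<lambda>U. \<Sum>w\<in>Poly_Mapping.keys x. Poly_Mapping.lookup x w * foldr (gen_op q Q \<Lambda>) (letters w) v U)"

text \<open>
  An element of the algebra is a coset; it acts by the common action of its
  representatives.
\<close>

definition ak_op ::
  "'a::field \<Rightarrow> (nat \<Rightarrow> 'a) \<Rightarrow> multipartition \<Rightarrow> 'a free_alg set \<Rightarrow> (tableau \<Rightarrow> 'a) \<Rightarrow> tableau \<Rightarrow> 'a"
  where
  "ak_op q Q \<Lambda> X v = the_elem ((\<lambda>x. free_op q Q \<Lambda> x v) ` X)"

definition ak_character ::
  "'a::field \<Rightarrow> (nat \<Rightarrow> 'a) \<Rightarrow> multipartition \<Rightarrow> 'a free_alg set \<Rightarrow> 'a" where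
  "ak_character q Q \<Lambda> X = (\<Sum>T\<in>std_tableaux \<Lambda>. ak_op q Q \<Lambda> X (basis_vec T) T)"


section \<open>The symmetrizing form and the Schur elements\<close>

definition ak_word ::
  "nat \<Rightarrow> nat \<Rightarrow> 'a::field \<Rightarrow> (nat \<Rightarrow> 'a) \<Rightarrow> nat list \<Rightarrow> 'a free_alg set" where
  "ak_word l n q Q is =
     foldr (\<lambda>i X. ak_gen l n q Q i \<otimes>\<^bsub>ak_algebra l n q Q\<^esub> X) is \<one>\<^bsub>ak_algebra l n q Q\<^esub>"

definition ak_L ::
  "nat \<Rightarrow> nat \<Rightarrow> 'a::field \<Rightarrow> (nat \<Rightarrow> 'a) \<Rightarrow> nat \<Rightarrow> 'a free_alg set" where
  "ak_L l n q Q k =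
     ak_scalar l n q Q (q powi (1 - int k))
       \<otimes>\<^bsub>ak_algebra l n q Q\<^esub> ak_word l n q Q (rev [1..<k] @ [0] @ [1..<k])"

definition word_perm :: "nat list \<Rightarrow> nat \<Rightarrow> nat" where
  "word_perm is = foldr (\<lambda>i f. transpose i (i + 1) \<circ> f) is id"

definition reduced_expr :: "nat \<Rightarrow> (nat \<Rightarrow> nat) \<Rightarrow> nat list \<Rightarrow> bool" where
  "reduced_expr n w is \<longleftrightarrow>
     set is \<subseteq> {1..<n} \<and> word_perm is = w \<and>
     (\<forall>js. set js \<subseteq> {1..<n} \<and> word_perm js = w \<longrightarrow> length is \<le> length js)"

definition ak_T ::
  "nat \<Rightarrow> nat \<Rightarrow> 'a::field \<Rightarrow> (nat \<Rightarrow> 'a) \<Rightarrow> (nat \<Rightarrow> nat) \<Rightarrow> 'a free_alg set" where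
  "ak_T l n q Q w = ak_word l n q Q (SOME is. reduced_expr n w is)"

definition ak_basis ::
  "nat \<Rightarrow> nat \<Rightarrow> 'a::field \<Rightarrow> (nat \<Rightarrow> 'a) \<Rightarrow> (nat \<Rightarrow> nat) \<Rightarrow> (nat \<Rightarrow> nat) \<Rightarrow> 'a free_alg set" where
  "ak_basis l n q Q c w =
     foldr (\<lambda>k X. ak_L l n q Q k [^]\<^bsub>ak_algebra l n q Q\<^esub> c k \<otimes>\<^bsub>ak_algebra l n q Q\<^esub> X)
       [1..<n + 1] (ak_T l n q Q w)"

definition ak_linear_form ::
  "nat \<Rightarrow> nat \<Rightarrow> 'a::field \<Rightarrow> (nat \<Rightarrow> 'a) \<Rightarrow> ('a free_alg set \<Rightarrow> 'a) \<Rightarrow> bool" where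
  "ak_linear_form l n q Q f \<longleftrightarrow>
     (\<forall>X\<in>carrier (ak_algebra l n q Q). \<forall>Y\<in>carrier (ak_algebra l n q Q).
        f (X \<oplus>\<^bsub>ak_algebra l n q Q\<^esub> Y) = f X + f Y) \<and>
     (\<forall>c. \<forall>X\<in>carrier (ak_algebra l n q Q).
        f (ak_scalar l n q Q c \<otimes>\<^bsub>ak_algebra l n q Q\<^esub> X) = c * f X)"

definition ak_tau :: "nat \<Rightarrow> nat \<Rightarrow> 'a::field \<Rightarrow> (nat \<Rightarrow> 'a) \<Rightarrow> 'a free_alg set \<Rightarrow> 'a" where
  "ak_tau l n q Q = (THE f. f \<in> extensional (carrier (ak_algebra l n q Q)) \<and>
     ak_linear_form l n q Q f \<and>
     (\<forall>c \<in> {1..n} \<rightarrow> {..<l}. \<forall>w. w permutes {1..n} \<longrightarrow>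
        f (ak_basis l n q Q c w) = (if (\<forall>k\<in>{1..n}. c k = 0) \<and> w = id then 1 else 0)))"

definition schur_element ::
  "nat \<Rightarrow> nat \<Rightarrow> 'a::field \<Rightarrow> (nat \<Rightarrow> 'a) \<Rightarrow> multipartition \<Rightarrow> 'a" where
  "schur_element l n q Q = (THE s. s \<in> multipartitions l n \<rightarrow>\<^sub>E (UNIV - {0}) \<and>
     (\<forall>X\<in>carrier (ak_algebra l n q Q).
        ak_tau l n q Q X =
          (\<Sum>\<Lambda>\<in>multipartitions l n. 1 / s \<Lambda> * ak_character q Q \<Lambda> X)))"

end

theory Submission
  imports Defs "HOL-Computational_Algebra.Formal_Laurent_Series"
begin

text \<open>
  The algebra acts on functions on paths, that is on sequences of nodes in which every initial segment is a
  multidiagram, through the seminormal operators; paths are the standard tableaux, and the elements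
  \<open>L\<^sub>k\<close> are diagonal with the residue of the k-th node as eigenvalue. Call the parameters separated if
  \<open>[m]\<^sub>q\<close> is nonzero for \<open>1 \<le> m \<le> n\<close> and \<open>q\<^sup>d Q\<^sub>s \<noteq> Q\<^sub>t\<close> for \<open>|d| < n\<close> and distinct \<open>s, t\<close>.

  For separated parameters let \<open>S(\<mu>)\<close> be the product of hook lengths in question and let \<open>\<phi>\<close> be the sum over
  all paths of the diagonal matrix entry divided by \<open>S\<close> of the shape. The ratio \<open>S(\<mu>) / S(\<mu> + x)\<close> is, as a function
  of the addable node \<open>x\<close> of \<open>\<mu>\<close>, the weight of Lagrange interpolation at 0, so that
  \<open>\<Sum>\<^sub>x res(x)\<^sup>k S(\<mu>) / S(\<mu> + x)\<close> is 1 for \<open>k = 0\<close> and 0 for \<open>0 < k < l\<close>. Hence, by induction on \<open>n\<close>, \<open>\<phi>\<close> agrees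
  with \<open>\<tau>\<close> on the elements \<open>L\<^sub>1\<^sup>c\<^sup>1 \<cdots> L\<^sub>n\<^sup>c\<^sup>n T\<^sub>w\<close>, and these span the algebra. The characters are
  independent because polynomials in diagonal elements separate the paths.

  Semisimplicity implies separation. The element \<open>y\<close>, the product of all \<open>L\<^sub>k - Q\<^sub>t\<close> with \<open>t \<noteq> s\<close> times the sum
  of all \<open>T\<^sub>w\<close>, satisfies \<open>y h = \<chi>(h) y\<close> for a linear character \<open>\<chi>\<close>, and \<open>\<chi>(y)\<close> is the product of the quantities
  that have to be nonzero. If it vanished, then \<open>y\<^sup>2 = 0\<close>, which together with \<open>y h = \<chi>(h) y\<close> forces \<open>y = 0\<close> in a
  semisimple algebra. But \<open>\<tau>(y) \<noteq> 0\<close>; for arbitrary parameters, \<open>\<tau>\<close> is obtained by specialising it from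
  the separated parameters \<open>q + X\<close> and \<open>Q\<^sub>s + X\<^sup>n\<^sup>(\<^sup>s\<^sup>+\<^sup>1\<^sup>)\<close> over Laurent series.
\<close>

section \<open>Congruences modulo ideals\<close>

definition two_sided_ideal :: "'r::ring_1 set \<Rightarrow> bool" where
  "two_sided_ideal J \<longleftrightarrow> 0 \<in> J \<and> (\<forall>x\<in>J. \<forall>y\<in>J. x - y \<in> J) \<and> (\<forall>x\<in>J. \<forall>r. r * x \<in> J \<and> x * r \<in> J)"

lemma two_sided_idealD:
  assumes "two_sided_ideal J"
  shows "0 \<in> J" "x \<in> J \<Longrightarrow> y \<in> J \<Longrightarrow> x - y \<in> J" "x \<in> J \<Longrightarrow> - x \<in> J" "x \<in> J \<Longrightarrow> y \<in> J \<Longrightarrow> x + y \<in> J"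
    "x \<in> J \<Longrightarrow> r * x \<in> J" "x \<in> J \<Longrightarrow> x * r \<in> J"
proof -
  show zero: "0 \<in> J" and diff: "\<And>x y. x \<in> J \<Longrightarrow> y \<in> J \<Longrightarrow> x - y \<in> J"
    and "x \<in> J \<Longrightarrow> r * x \<in> J" "x \<in> J \<Longrightarrow> x * r \<in> J"
    using assms by (auto simp: two_sided_ideal_def)
  show uminus: "- x \<in> J" if "x \<in> J" for x using diff[OF zero that] by simp
  show "x + y \<in> J" if "x \<in> J" "y \<in> J" using diff[OF that(1) uminus[OF that(2)]] by simp
qed

text \<open>
  The ideal defining the algebra depends on parameters, so the quotient by it is not a type. Ring identities
  are therefore derived in the product of all quotients of the free algebra, whose components recover the
  congruence modulo any particular ideal.
\<close>

quotient_type (overloaded) 'r all_quotients =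
  "'r::ring_1 set \<Rightarrow> 'r" / "\<lambda>f g. \<forall>J. two_sided_ideal J \<longrightarrow> f J - g J \<in> J"
proof (rule equivpI)
  show "reflp (\<lambda>f g. \<forall>J. two_sided_ideal J \<longrightarrow> f J - g J \<in> (J :: 'r set))"
    by (auto simp: reflp_def two_sided_ideal_def)
  show "symp (\<lambda>f g. \<forall>J. two_sided_ideal J \<longrightarrow> f J - g J \<in> (J :: 'r set))"
    unfolding symp_def by (metis minus_diff_eq two_sided_idealD(3))
  show "transp (\<lambda>f g. \<forall>J. two_sided_ideal J \<longrightarrow> f J - g J \<in> (J :: 'r set))"
    unfolding transp_def by (metis diff_add_cancel add_diff_eq two_sided_idealD(4))
qed

instantiation all_quotients :: (ring_1) ring_1
begin

lift_definition zero_all_quotients :: "'a all_quotients" is "\<lambda>J. 0" .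
lift_definition one_all_quotients :: "'a all_quotients" is "\<lambda>J. 1" .
lift_definition plus_all_quotients :: "'a all_quotients \<Rightarrow> 'a all_quotients \<Rightarrow> 'a all_quotients"
  is "\<lambda>f g J. f J + g J"
proof -
  fix f f' g g' :: "'a set \<Rightarrow> 'a" and J :: "'a set"
  assume "\<And>J. two_sided_ideal J \<Longrightarrow> f J - f' J \<in> J" "\<And>J. two_sided_ideal J \<Longrightarrow> g J - g' J \<in> J"
    and J: "two_sided_ideal J"
  then have "(f J - f' J) + (g J - g' J) \<in> J" using two_sided_idealD(4)[OF J] J by blast
  then show "f J + g J - (f' J + g' J) \<in> J" by (simp add: algebra_simps)
qed
lift_definition minus_all_quotients :: "'a all_quotients \<Rightarrow> 'a all_quotients \<Rightarrow> 'a all_quotients"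
  is "\<lambda>f g J. f J - g J"
proof -
  fix f f' g g' :: "'a set \<Rightarrow> 'a" and J :: "'a set"
  assume "\<And>J. two_sided_ideal J \<Longrightarrow> f J - f' J \<in> J" "\<And>J. two_sided_ideal J \<Longrightarrow> g J - g' J \<in> J"
    and J: "two_sided_ideal J"
  then have "(f J - f' J) - (g J - g' J) \<in> J" using two_sided_idealD(2)[OF J] J by blast
  then show "f J - g J - (f' J - g' J) \<in> J" by (simp add: algebra_simps)
qed
lift_definition uminus_all_quotients :: "'a all_quotients \<Rightarrow> 'a all_quotients"
  is "\<lambda>f J. - f J"
  by (metis minus_diff_minus two_sided_idealD(3))
lift_definition times_all_quotients :: "'a all_quotients \<Rightarrow> 'a all_quotients \<Rightarrow> 'a all_quotients"
  is "\<lambda>f g J. f J * g J"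
proof -
  fix f f' g g' :: "'a set \<Rightarrow> 'a" and J :: "'a set"
  assume "\<And>J. two_sided_ideal J \<Longrightarrow> f J - f' J \<in> J" "\<And>J. two_sided_ideal J \<Longrightarrow> g J - g' J \<in> J"
    and J: "two_sided_ideal J"
  then have "(f J - f' J) * g J + f' J * (g J - g' J) \<in> J"
    by (intro two_sided_idealD(4)[OF J] two_sided_idealD(5)[OF J] two_sided_idealD(6)[OF J]) auto
  then show "f J * g J - f' J * g' J \<in> J" by (simp add: algebra_simps)
qed

instance
proof
  have "two_sided_ideal ({0} :: 'a set)" by (auto simp: two_sided_ideal_def)
  then show "(0 :: 'a all_quotients) \<noteq> 1"
    by transfer (metis diff_0 neg_equal_0_iff_equal singletonD zero_neq_one)
qed (transfer; simp add: algebra_simps two_sided_ideal_def)+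

end

lemma abs_all_quotients_eqD:
  assumes "abs_all_quotients f = abs_all_quotients g" "two_sided_ideal J"
  shows "f J - g J \<in> J"
  using assms by (simp add: all_quotients.abs_eq_iff)

section \<open>Words in the symmetric group\<close>

inductive braid_eq :: "nat list \<Rightarrow> nat list \<Rightarrow> bool" where
  braid_refl: "braid_eq u u"
| braid_sym: "braid_eq u v \<Longrightarrow> braid_eq v u"
| braid_trans: "braid_eq u v \<Longrightarrow> braid_eq v w \<Longrightarrow> braid_eq u w"
| far_swap: "Suc i < j \<Longrightarrow> braid_eq (u @ [i, j] @ v) (u @ [j, i] @ v)"
| braid_move: "braid_eq (u @ [i, Suc i, i] @ v) (u @ [Suc i, i, Suc i] @ v)"

declare braid_eq.braid_trans [trans]

lemma braid_eq_context:
  assumes "braid_eq u v"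
  shows "braid_eq (x @ u @ y) (x @ v @ y)"
  using assms
proof induction
  case (far_swap i j u v)
  then show ?case using braid_eq.far_swap[of i j "x @ u" "v @ y"] by simp
next
  case (braid_move u i v)
  then show ?case using braid_eq.braid_move[of "x @ u" i "v @ y"] by simp
qed (auto intro: braid_eq.intros)

lemma braid_eq_append_left: "braid_eq u v \<Longrightarrow> braid_eq (x @ u) (x @ v)"
  and braid_eq_append_right: "braid_eq u v \<Longrightarrow> braid_eq (u @ y) (v @ y)"
  using braid_eq_context[of u v x "[]"] braid_eq_context[of u v "[]" y] by simp_all

lemma braid_eq_length_set: "braid_eq u v \<Longrightarrow> length u = length v \<and> set u = set v"
  by (induction rule: braid_eq.induct) auto

lemma braid_eq_move_letter_front:
  assumes "\<forall>k\<in>set w. Suc k < i \<or> Suc i < k"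
  shows "braid_eq (w @ [i]) (i # w)"
  using assms
proof (induction w)
  case (Cons k w)
  have "braid_eq (k # w @ [i]) (k # i # w)"
    using braid_eq_append_left[of "w @ [i]" "i # w" "[k]"] Cons by simp
  also have "braid_eq (k # i # w) (i # k # w)"
    using Cons.prems braid_eq.far_swap[of k i "[]" w] braid_eq.braid_sym[OF braid_eq.far_swap[of i k "[]" w]]
    by auto
  finally show ?case by simp
qed (auto intro: braid_eq.braid_refl)

lemma word_perm_append: "word_perm (u @ v) = word_perm u \<circ> word_perm v"
  by (induction u) (auto simp: word_perm_def o_assoc)

lemma word_perm_Nil [simp]: "word_perm [] = id"
  and word_perm_Cons: "word_perm (i # u) = transpose i (Suc i) \<circ> word_perm u"
  by (auto simp: word_perm_def)

lemma word_perm_braid_eq: "braid_eq u v \<Longrightarrow> word_perm u = word_perm v"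
proof (induction rule: braid_eq.induct)
  case (far_swap i j u v)
  have "word_perm [i, j] = word_perm [j, i]"
    using far_swap by (auto simp: word_perm_def fun_eq_iff transpose_def)
  then show ?case by (simp only: word_perm_append)
next
  case (braid_move u i v)
  have "word_perm [i, Suc i, i] = word_perm [Suc i, i, Suc i]"
    by (auto simp: word_perm_def fun_eq_iff transpose_def)
  then show ?case by (simp only: word_perm_append)
qed auto

lemma word_perm_permutes: "set u \<subseteq> {1..<n} \<Longrightarrow> word_perm u permutes {1..n}"
proof (induction u)
  case (Cons i u)
  then have "transpose i (Suc i) permutes {1..n}" by (intro permutes_swap_id) auto
  moreover have "word_perm u permutes {1..n}" using Cons by simp
  ultimately show ?case unfolding word_perm_Cons by (rule permutes_compose[rotated])
qed (simp add: permutes_id[unfolded id_def] id_def)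

text \<open>
  The words \<open>normal_word j m\<close> represent each element of the symmetric group on \<open>{1..m}\<close> once,
  through the coset representatives \<open>s\<^sub>k\<cdots>s\<^sub>j\<close> of one symmetric group in the next.
\<close>

primrec normal_word :: "(nat \<Rightarrow> nat) \<Rightarrow> nat \<Rightarrow> nat list" where
  "normal_word j 0 = []"
| "normal_word j (Suc k) = normal_word j k @ rev [j (Suc k)..<Suc k]"

definition is_code :: "nat \<Rightarrow> (nat \<Rightarrow> nat) \<Rightarrow> bool" where
  "is_code m j \<longleftrightarrow> (\<forall>k\<in>{1..m}. 1 \<le> j k \<and> j k \<le> k)"

lemma is_code_Suc: "is_code (Suc m) j \<longleftrightarrow> is_code m j \<and> 1 \<le> j (Suc m) \<and> j (Suc m) \<le> Suc m"
  by (simp add: is_code_def atLeastAtMostSuc_conv) blast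

lemma normal_word_cong: "(\<And>k. k \<in> {1..m} \<Longrightarrow> j k = j' k) \<Longrightarrow> normal_word j m = normal_word j' m"
  by (induction m) auto

lemma set_normal_word: "is_code m j \<Longrightarrow> set (normal_word j m) \<subseteq> {1..<m}"
  by (induction m) (auto simp: is_code_Suc)

lemma rev_upt_append: "i \<le> j \<Longrightarrow> j \<le> k \<Longrightarrow> rev [i..<k] = rev [j..<k] @ rev [i..<j]"
  by (metis rev_append le_add_diff_inverse upt_add_eq_append)

lemma braid_eq_descending_letter:
  assumes "J < i" "i < m"
  shows "braid_eq (rev [J..<m] @ [i]) ((i - 1) # rev [J..<m])"
proof -
  have split: "rev [J..<m] = rev [Suc i..<m] @ [i, i - 1] @ rev [J..<i - 1]"
  proof -
    have "rev [J..<m] = rev [Suc i..<m] @ rev [J..<Suc i]"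
      using assms by (intro rev_upt_append) auto
    also have "rev [J..<Suc i] = rev [i - 1..<Suc i] @ rev [J..<i - 1]"
      using assms by (intro rev_upt_append) auto
    also have "rev [i - 1..<Suc i] = [i, i - 1]" using assms by (cases i) auto
    finally show ?thesis by simp
  qed
  have "braid_eq (rev [J..<i - 1] @ [i]) (i # rev [J..<i - 1])"
    by (rule braid_eq_move_letter_front) auto
  then have "braid_eq (rev [J..<m] @ [i]) (rev [Suc i..<m] @ [i, i - 1, i] @ rev [J..<i - 1])"
    unfolding split
    using braid_eq_append_left[of "rev [J..<i - 1] @ [i]" "i # rev [J..<i - 1]" "rev [Suc i..<m] @ [i, i - 1]"]
    by simp
  also have "braid_eq \<dots> (rev [Suc i..<m] @ [i - 1, i, i - 1] @ rev [J..<i - 1])"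
    using braid_eq.braid_sym[OF braid_eq.braid_move[of "rev [Suc i..<m]" "i - 1" "rev [J..<i - 1]"]] assms
    by simp
  also have "braid_eq \<dots> ((i - 1) # rev [J..<m])"
  proof -
    have "braid_eq (rev [Suc i..<m] @ [i - 1]) ((i - 1) # rev [Suc i..<m])"
      using assms by (intro braid_eq_move_letter_front) auto
    then show ?thesis unfolding split

      using braid_eq_append_right[of "rev [Suc i..<m] @ [i - 1]" "(i - 1) # rev [Suc i..<m]"
        "[i, i - 1] @ rev [J..<i - 1]"] by simp
  qed
  finally show ?thesis .
qed

lemma normal_word_update:
  assumes "is_code k j" "1 \<le> i" "i \<le> Suc k"
  shows "is_code (Suc k) (j(Suc k := i))"
    "normal_word (j(Suc k := i)) (Suc k) = normal_word j k @ rev [i..<Suc k]"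
  using assms by (auto simp: is_code_def intro: normal_word_cong)

definition braid_adjacent :: "nat list \<Rightarrow> nat \<Rightarrow> nat list \<Rightarrow> bool" where
  "braid_adjacent u i v \<longleftrightarrow> braid_eq (u @ [i]) v \<or> braid_eq u (v @ [i])"

lemma braid_adjacent_append:
  assumes "braid_adjacent u i' v" "braid_eq (w @ [i]) (i' # w)"
  shows "braid_adjacent (u @ w) i (v @ w)"
proof -
  have slide: "braid_eq ((x @ w) @ [i]) (x @ [i'] @ w)" for x
    using braid_eq_append_left[OF assms(2), of x] by simp
  from assms(1) consider (longer) "braid_eq (u @ [i']) v" | (shorter) "braid_eq u (v @ [i'])"
    by (auto simp: braid_adjacent_def)
  then show ?thesis
  proof cases
    case longer
    have "braid_eq (u @ [i'] @ w) (v @ w)" using braid_eq_append_right[OF longer, of w] by simp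
    with slide[of u] show ?thesis unfolding braid_adjacent_def by (blast intro: braid_eq.braid_trans)
  next
    case shorter
    have "braid_eq (u @ w) (v @ [i'] @ w)" using braid_eq_append_right[OF shorter, of w] by simp
    with slide[of v] show ?thesis
      unfolding braid_adjacent_def by (blast intro: braid_eq.braid_trans braid_eq.braid_sym)
  qed
qed

lemma word_perm_braid_adjacent:
  assumes "braid_adjacent u i v"
  shows "word_perm v = word_perm (u @ [i])"
  using assms unfolding braid_adjacent_def
proof
  assume "braid_eq u (v @ [i])"
  from word_perm_braid_eq[OF this] have "word_perm u = word_perm v \<circ> transpose i (Suc i)"
    by (simp add: word_perm_append word_perm_Cons)
  then show ?thesis by (simp add: word_perm_append word_perm_Cons o_assoc[symmetric])
qed (simp add: word_perm_braid_eq)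

lemma normal_word_snoc_slide:
  assumes "1 \<le> j (Suc k)" "j (Suc k) \<le> Suc k" "is_code k j'"
    and "braid_adjacent (normal_word j k) i' (normal_word j' k)"
    and "braid_eq (rev [j (Suc k)..<Suc k] @ [i]) (i' # rev [j (Suc k)..<Suc k])"
  shows "\<exists>j'. is_code (Suc k) j' \<and> braid_adjacent (normal_word j (Suc k)) i (normal_word j' (Suc k))"
proof -
  note update = normal_word_update[OF assms(3,1,2)]
  have "braid_adjacent (normal_word j (Suc k)) i (normal_word (j'(Suc k := j (Suc k))) (Suc k))"
    unfolding update(2) normal_word.simps(2)[of j] by (rule braid_adjacent_append[OF assms(4,5)])
  with update(1) show ?thesis by blast
qed

lemma normal_word_snoc_last:
  assumes "is_code k j" "1 \<le> J" "J \<le> Suc k"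
    and "rev [J..<Suc k] = rev [j (Suc k)..<Suc k] @ [i] \<or> rev [j (Suc k)..<Suc k] = rev [J..<Suc k] @ [i]"
  shows "\<exists>j'. is_code (Suc k) j' \<and> braid_adjacent (normal_word j (Suc k)) i (normal_word j' (Suc k))"
proof -
  note update = normal_word_update[OF assms(1-3)]
  have "braid_adjacent (normal_word j (Suc k)) i (normal_word (j(Suc k := J)) (Suc k))"
    unfolding update(2) normal_word.simps(2)[of j] braid_adjacent_def
    using assms(4) by (metis append_assoc braid_eq.braid_refl)
  with update(1) show ?thesis by blast
qed

lemma normal_word_snoc:
  assumes "is_code m j" "1 \<le> i" "i < m"
  shows "\<exists>j'. is_code m j' \<and> braid_adjacent (normal_word j m) i (normal_word j' m)"
  using assms
proof (induction m arbitrary: i)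
  case (Suc k)
  let ?J = "j (Suc k)"
  have code: "is_code k j" "1 \<le> ?J" "?J \<le> Suc k" using Suc.prems by (auto simp: is_code_Suc)
  have slide: ?case
    if "1 \<le> i'" "i' < k" "braid_eq (rev [?J..<Suc k] @ [i]) (i' # rev [?J..<Suc k])" for i'
    using Suc.IH[OF code(1) that(1,2)] normal_word_snoc_slide[where j = j and k = k, OF code(2,3) _ _ that(3)]
    by blast
  consider (above) "i + 1 < ?J" | (extend) "i + 1 = ?J" | (shorten) "i = ?J" | (below) "?J < i" by linarith
  then show ?case
  proof cases
    case above
    then show ?thesis using Suc.prems code by (intro slide[of i] braid_eq_move_letter_front) auto
  next
    case extend
    then have "rev [i..<Suc k] = rev [?J..<Suc k] @ [i]"
      using code rev_upt_append[of i ?J "Suc k"]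
      by (simp add: extend[symmetric] del: upt_Suc) (simp add: upt_rec)
    then show ?thesis using Suc.prems by (intro normal_word_snoc_last[where J = i] code) auto
  next
    case shorten
    then have "rev [?J..<Suc k] = rev [Suc i..<Suc k] @ [i]"
      using Suc.prems rev_upt_append[of i "Suc i" "Suc k"] by simp
    then show ?thesis using Suc.prems by (intro normal_word_snoc_last[where J = "Suc i"] code) auto
  next
    case below
    then show ?thesis using Suc.prems code by (intro slide[of "i - 1"] braid_eq_descending_letter) auto
  qed
qed simp

lemma normal_word_id: "normal_word (\<lambda>k. k) m = []" "is_code m (\<lambda>k. k)"
  by (induction m) (auto simp: is_code_def)

lemma normal_word_of_word:
  assumes "set u \<subseteq> {1..<m}"
  shows "\<exists>j. is_code m j \<and> word_perm (normal_word j m) = word_perm u \<and>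
    length (normal_word j m) \<le> length u \<and>
    (length (normal_word j m) = length u \<longrightarrow> braid_eq u (normal_word j m))"
  using assms
proof (induction u rule: rev_induct)
  case Nil
  then show ?case
    using normal_word_id[of m] by (intro exI[of _ "\<lambda>k. k"]) (auto intro: braid_eq.braid_refl)
next
  case (snoc i u)
  then obtain j where j: "is_code m j" "word_perm (normal_word j m) = word_perm u"
    "length (normal_word j m) \<le> length u"
    "length (normal_word j m) = length u \<longrightarrow> braid_eq u (normal_word j m)"
    by auto
  obtain j' where j': "is_code m j'" "braid_adjacent (normal_word j m) i (normal_word j' m)"
    using normal_word_snoc[OF j(1), of i] snoc.prems by auto
  have perm: "word_perm (normal_word j' m) = word_perm (u @ [i])"
    using word_perm_braid_adjacent[OF j'(2)] j(2) by (simp add: word_perm_append)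
  from j'(2) consider (longer) "braid_eq (normal_word j m @ [i]) (normal_word j' m)"
    | (shorter) "braid_eq (normal_word j m) (normal_word j' m @ [i])"
    by (auto simp: braid_adjacent_def)
  then show ?case
  proof cases
    case longer
    have length: "length (normal_word j' m) = Suc (length (normal_word j m))"
      using braid_eq_length_set[OF longer] by simp
    have "braid_eq (u @ [i]) (normal_word j' m)" if "length (normal_word j' m) = length (u @ [i])"
      using braid_eq_append_right[of u "normal_word j m" "[i]"] j(4) that length longer
      by (auto intro: braid_eq.braid_trans)
    then show ?thesis using j'(1) j(3) perm length by auto
  next
    case shorter
    have "length (normal_word j' m) < length (u @ [i])"
      using braid_eq_length_set[OF shorter] j(3) by simp
    then show ?thesis using j'(1) perm by auto
  qed
qed

lemma word_perm_descending: "J \<le> m \<Longrightarrow> word_perm (rev [J..<m]) J = m"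
  by (induction m) (auto simp: word_perm_Cons le_Suc_eq)

lemma word_perm_normal_word_last:
  assumes "is_code (Suc k) j"
  shows "word_perm (normal_word j (Suc k)) (j (Suc k)) = Suc k"
proof -
  have "word_perm (normal_word j k) permutes {1..k}"
    using assms by (intro word_perm_permutes set_normal_word) (simp add: is_code_Suc)
  then have "word_perm (normal_word j k) (Suc k) = Suc k" by (rule permutes_not_in) simp
  then show ?thesis
    using word_perm_descending[of "j (Suc k)" "Suc k"] assms
    by (simp add: word_perm_append is_code_Suc del: upt_Suc)
qed

lemma word_perm_bij: "bij (word_perm u)"
proof (induction u)
  case (Cons i u)
  then show ?case unfolding word_perm_Cons by (rule bij_comp) (rule bij_transpose)
qed (simp only: word_perm_Nil bij_id)

lemma normal_word_inj:
  assumes "is_code m j" "is_code m j'" "word_perm (normal_word j m) = word_perm (normal_word j' m)"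
  shows "normal_word j m = normal_word j' m"
  using assms
proof (induction m)
  case (Suc k)
  have "word_perm (normal_word j (Suc k)) (j (Suc k)) = word_perm (normal_word j (Suc k)) (j' (Suc k))"
    using word_perm_normal_word_last[OF Suc.prems(1)] word_perm_normal_word_last[OF Suc.prems(2)]
      Suc.prems(3) by simp
  then have last: "j (Suc k) = j' (Suc k)" using word_perm_bij by (metis bij_pointE)
  let ?coset = "word_perm (rev [j (Suc k)..<Suc k])"
  have "word_perm (normal_word j k) \<circ> ?coset = word_perm (normal_word j' k) \<circ> ?coset"
    using Suc.prems(3) unfolding normal_word.simps word_perm_append last .
  then have "word_perm (normal_word j k) = word_perm (normal_word j' k)"
    using word_perm_bij by (metis bij_is_surj surj_fun_eq)
  then show ?case using Suc last by (simp add: is_code_Suc)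
qed simp

lemma normal_word_surj:
  assumes "w permutes {1..m}"
  shows "\<exists>j. is_code m j \<and> word_perm (normal_word j m) = w"
  using assms
proof (induction m arbitrary: w)
  case 0
  then show ?case by (auto simp: is_code_def)
next
  case (Suc k)
  obtain J where J: "J \<in> {1..Suc k}" "w J = Suc k"
    using permutes_image[OF Suc.prems]
    by (metis atLeastAtMost_iff imageE le_add1 order_refl plus_1_eq_Suc)
  let ?coset = "word_perm (rev [J..<Suc k])"
  have coset: "?coset permutes {1..Suc k}" using J by (intro word_perm_permutes) auto
  let ?w = "w \<circ> inv_into UNIV ?coset"
  have "?w permutes {1..Suc k}"
    using permutes_compose[OF permutes_inv[OF coset] Suc.prems] .
  moreover have "?w (Suc k) = Suc k"
    using word_perm_descending[of J "Suc k"] J coset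
    by (metis atLeastAtMost_iff comp_apply permutes_inverses(2))
  ultimately have "?w permutes {1..k}"
    by (auto simp: permutes_def atLeastAtMostSuc_conv) (metis le_SucE)+
  then obtain j where j: "is_code k j" "word_perm (normal_word j k) = ?w" using Suc.IH by blast
  have update: "is_code (Suc k) (j(Suc k := J))"
    "normal_word (j(Suc k := J)) (Suc k) = normal_word j k @ rev [J..<Suc k]"
    using J normal_word_update[OF j(1), of J] by auto
  have "word_perm (normal_word (j(Suc k := J)) (Suc k)) = ?w \<circ> ?coset"
    unfolding update(2) word_perm_append j(2) ..
  also have "\<dots> = w" using permutes_inv_o(2)[OF coset] by (simp add: o_assoc[symmetric])
  finally show ?case using update(1) by blast
qed

lemma reduced_expr_exists:
  assumes "w permutes {1..n}"
  shows "\<exists>u. reduced_expr n w u"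
proof -
  obtain j where j: "is_code n j" "word_perm (normal_word j n) = w" using normal_word_surj[OF assms] by blast
  let ?P = "\<lambda>u. set u \<subseteq> {1..<n} \<and> word_perm u = w"
  have "?P (normal_word j n)" using j set_normal_word by blast
  then obtain u where "?P u" "\<forall>v. ?P v \<longrightarrow> length u \<le> length v"
    using ex_has_least_nat[of ?P "normal_word j n" length] by blast
  then show ?thesis by (auto simp: reduced_expr_def)
qed

lemma reduced_expr_braid_eq_normal_word:
  assumes "reduced_expr n w u"
  shows "\<exists>j. is_code n j \<and> word_perm (normal_word j n) = w \<and> braid_eq u (normal_word j n)"
proof -
  obtain j where j: "is_code n j" "word_perm (normal_word j n) = word_perm u"
     "length (normal_word j n) \<le> length u" "length (normal_word j n) = length u \<longrightarrow> braid_eq u (normal_word j n)"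
    using normal_word_of_word[of u n] assms by (auto simp: reduced_expr_def)
  moreover have "length u \<le> length (normal_word j n)"
    using assms j set_normal_word by (auto simp: reduced_expr_def)
  ultimately show ?thesis using assms by (auto simp: reduced_expr_def)
qed

section \<open>The spanning set of monomials\<close>

definition unital_subring :: "'a::ring_1 set \<Rightarrow> bool" where
  "unital_subring A \<longleftrightarrow> 1 \<in> A \<and> (\<forall>a\<in>A. \<forall>b\<in>A. a - b \<in> A \<and> a * b \<in> A)"

lemma unital_subringD:
  assumes "unital_subring A"
  shows "0 \<in> A" "1 \<in> A" "a \<in> A \<Longrightarrow> - a \<in> A" "a \<in> A \<Longrightarrow> b \<in> A \<Longrightarrow> a - b \<in> A" "a \<in> A \<Longrightarrow> b \<in> A \<Longrightarrow> a * b \<in> A"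
proof -
  show one: "1 \<in> A" and diff: "\<And>a b. a \<in> A \<Longrightarrow> b \<in> A \<Longrightarrow> a - b \<in> A"
    and "a \<in> A \<Longrightarrow> b \<in> A \<Longrightarrow> a * b \<in> A"
    using assms by (auto simp: unital_subring_def)
  show zero: "0 \<in> A" using diff[OF one one] by simp
  show "- a \<in> A" if "a \<in> A" using diff[OF zero that] by simp
qed

lemma unital_subring_UNIV [simp]: "unital_subring UNIV"
  by (simp add: unital_subring_def)

lemma commute_power: "x * y = y * x \<Longrightarrow> x * y ^ k = y ^ k * x" for x y :: "'a::monoid_mult"
  by (metis power_commuting_commutes)

lemma commute_prod_list:
  "(\<And>k. k \<in> set ks \<Longrightarrow> x * f k = f k * x) \<Longrightarrow> x * (\<Prod>k\<leftarrow>ks. f k) = (\<Prod>k\<leftarrow>ks. f k) * x"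
  for x :: "'a::monoid_mult"
proof (induction ks)
  case (Cons k ks)
  then have "x * (\<Prod>k\<leftarrow>ks. f k) = (\<Prod>k\<leftarrow>ks. f k) * x" "x * f k = f k * x" by auto
  then show ?case by (simp add: mult.assoc) (metis mult.assoc)
qed simp

lemma prod_list_mult_commuting:
  fixes f g :: "'b \<Rightarrow> 'a::monoid_mult"
  assumes "\<And>s t. s \<in> set ts \<Longrightarrow> t \<in> set ts \<Longrightarrow> f s * g t = g t * f s"
  shows "(\<Prod>t\<leftarrow>ts. f t) * (\<Prod>t\<leftarrow>ts. g t) = (\<Prod>t\<leftarrow>ts. f t * g t)"
  using assms
proof (induction ts)
  case (Cons t ts)
  have "(\<Prod>t\<leftarrow>ts. f t) * g t = g t * (\<Prod>t\<leftarrow>ts. f t)"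
    using commute_prod_list[of ts "g t" f] Cons.prems by simp
  then have "f t * (\<Prod>t\<leftarrow>ts. f t) * (g t * (\<Prod>t\<leftarrow>ts. g t)) =
      f t * g t * ((\<Prod>t\<leftarrow>ts. f t) * (\<Prod>t\<leftarrow>ts. g t))"
    by (metis mult.assoc)
  then show ?case using Cons by simp
qed simp

lemma commute_conjugate:
  fixes x y z :: "'a::monoid_mult"
  assumes "x * y = y * x" "x * z = z * x"
  shows "x * (y * z * y) = y * z * y * x"
  using assms by (metis mult.assoc)

lemma braid_commute_conjugate:
  fixes x y z :: "'a::monoid_mult"
  assumes braid: "x * y * x = y * x * y" and commute: "y * z = z * y"
  shows "x * (y * (x * z * x) * y) = y * (x * z * x) * y * x"
proof -
  have "x * (y * (x * z * x) * y) = (x * y * x) * z * (x * y)" by (simp only: mult.assoc)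
  also have "\<dots> = y * x * (y * z) * (x * y)" unfolding braid by (simp only: mult.assoc)
  also have "\<dots> = y * x * z * (y * x * y)" unfolding commute by (simp only: mult.assoc)
  also have "\<dots> = y * (x * z * x) * y * x" unfolding braid[symmetric] by (simp only: mult.assoc)
  finally show ?thesis .
qed

lemma upt_split_pair:
  assumes "1 \<le> i" "i < n"
  shows "[1..<n + 1] = [1..<i] @ [i, Suc i] @ [i + 2..<n + 1]"
proof -
  have "[1..<n + 1] = [1..<i] @ [i..<n + 1]"
    using assms upt_add_eq_append[of 1 i "n + 1 - i"] by simp
  also have "[i..<n + 1] = i # Suc i # [i + 2..<n + 1]"
    using assms by (simp add: upt_conv_Cons del: upt_Suc)
  finally show ?thesis by simp
qed

locale central_hom =
  fixes \<eta> :: "'k::comm_ring_1 \<Rightarrow> 'r::ring_1"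
  assumes eta_add: "\<eta> (a + b) = \<eta> a + \<eta> b"
    and eta_mult: "\<eta> (a * b) = \<eta> a * \<eta> b"
    and eta_one: "\<eta> 1 = 1"
    and eta_central: "\<eta> a * x = x * \<eta> a"
begin

lemma eta_zero: "\<eta> 0 = 0"
  using eta_add[of 0 0] by simp

lemma eta_minus: "\<eta> (- a) = - \<eta> a"
  using eta_add[of a "- a"] eta_zero by (simp add: add_eq_0_iff)

lemma eta_diff: "\<eta> (a - b) = \<eta> a - \<eta> b"
  using eta_add[of a "- b"] eta_minus by simp

lemma eta_sum: "\<eta> (\<Sum>i\<in>I. f i) = (\<Sum>i\<in>I. \<eta> (f i))"
  by (induction I rule: infinite_finite_induct) (simp_all add: eta_zero eta_add)

lemma eta_left_commute: "x * (\<eta> a * y) = \<eta> a * (x * y)"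
  by (metis eta_central mult.assoc)

inductive_set lin_span :: "'k set \<Rightarrow> 'r set \<Rightarrow> 'r set" for A :: "'k set" and B :: "'r set" where
  zero: "0 \<in> lin_span A B"
| step: "a \<in> A \<Longrightarrow> b \<in> B \<Longrightarrow> x \<in> lin_span A B \<Longrightarrow> \<eta> a * b + x \<in> lin_span A B"

lemma lin_span_add: "x \<in> lin_span A B \<Longrightarrow> y \<in> lin_span A B \<Longrightarrow> x + y \<in> lin_span A B"
  by (induction rule: lin_span.induct) (auto simp: add.assoc intro: lin_span.step)

lemma lin_span_sum: "(\<And>i. i \<in> I \<Longrightarrow> f i \<in> lin_span A B) \<Longrightarrow> (\<Sum>i\<in>I. f i) \<in> lin_span A B"
  by (induction I rule: infinite_finite_induct) (auto intro: lin_span.zero lin_span_add)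

lemma lin_span_scale:
  assumes "x \<in> lin_span A B" "a \<in> A" and A: "unital_subring A"
  shows "\<eta> a * x \<in> lin_span A B"
  using assms(1)
proof (induction rule: lin_span.induct)
  case (step b y x)
  have "\<eta> a * (\<eta> b * y + x) = \<eta> (a * b) * y + \<eta> a * x"
    by (simp add: distrib_left eta_mult mult.assoc)
  then show ?case using step assms(2) unital_subringD(5)[OF A] by (auto intro!: lin_span.step)
qed (auto intro: lin_span.zero)

lemma lin_span_base_scale: "b \<in> B \<Longrightarrow> a \<in> A \<Longrightarrow> \<eta> a * b \<in> lin_span A B"
  using lin_span.step[of a A b B 0] lin_span.zero by simp

lemma lin_span_base: "b \<in> B \<Longrightarrow> unital_subring A \<Longrightarrow> b \<in> lin_span A B"
  using lin_span_base_scale[of b B 1 A] unital_subringD(2)[of A] by (simp add: eta_one)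

lemma lin_span_mono: "x \<in> lin_span A B \<Longrightarrow> B \<subseteq> C \<Longrightarrow> x \<in> lin_span A C"
  by (induction rule: lin_span.induct) (auto intro: lin_span.intros)

lemma lin_span_sandwich:
  assumes "x \<in> lin_span A B" and A: "unital_subring A" and "\<And>b. b \<in> B \<Longrightarrow> u * b * v \<in> lin_span A C"
  shows "u * x * v \<in> lin_span A C"
  using assms(1)
proof (induction rule: lin_span.induct)
  case (step a b x)
  have "u * (\<eta> a * b + x) * v = \<eta> a * (u * b * v) + u * x * v"
    by (simp add: distrib_left distrib_right mult.assoc eta_left_commute[of u])
  then show ?case using step assms by (auto intro!: lin_span_add lin_span_scale)
qed (auto intro: lin_span.zero)

lemma lin_span_mult_left:
  assumes "x \<in> lin_span A B" "unital_subring A" "\<And>b. b \<in> B \<Longrightarrow> u * b \<in> lin_span A C"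
  shows "u * x \<in> lin_span A C"
  using lin_span_sandwich[of x A B u 1 C] assms by simp

lemma lin_span_mult_right:
  assumes "x \<in> lin_span A B" "unital_subring A" "\<And>b. b \<in> B \<Longrightarrow> b * u \<in> lin_span A C"
  shows "x * u \<in> lin_span A C"
  using lin_span_sandwich[of x A B 1 u C] assms by simp

lemma linear_factor_mult_sum:
  "(x - \<eta> a) * (\<Sum>j\<le>d. \<eta> (g j) * x ^ j) =
    (\<Sum>j\<le>Suc d. \<eta> ((if j = 0 then 0 else g (j - 1)) - a * (if j \<le> d then g j else 0)) * x ^ j)"
proof -
  have "(x - \<eta> a) * (\<Sum>j\<le>d. \<eta> (g j) * x ^ j) =
      (\<Sum>j\<le>d. \<eta> (g j) * x ^ Suc j) - (\<Sum>j\<le>d. \<eta> (a * g j) * x ^ j)"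
    by (simp add: left_diff_distrib sum_distrib_left eta_left_commute[of x] eta_mult mult.assoc sum_subtractf)
  also have "(\<Sum>j\<le>d. \<eta> (g j) * x ^ Suc j) = (\<Sum>j\<le>Suc d. \<eta> (if j = 0 then 0 else g (j - 1)) * x ^ j)"
    by (subst sum.atMost_Suc_shift) (simp add: eta_zero)
  also have "(\<Sum>j\<le>d. \<eta> (a * g j) * x ^ j) = (\<Sum>j\<le>Suc d. \<eta> (a * (if j \<le> d then g j else 0)) * x ^ j)"
    by (simp add: eta_zero)
  also have "(\<Sum>j\<le>Suc d. \<eta> (if j = 0 then 0 else g (j - 1)) * x ^ j) - \<dots> =
      (\<Sum>j\<le>Suc d. \<eta> ((if j = 0 then 0 else g (j - 1)) - a * (if j \<le> d then g j else 0)) * x ^ j)"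
    unfolding eta_diff left_diff_distrib by (rule sum_subtractf[symmetric])
  finally show ?thesis .
qed

lemma prod_linear_expand:
  assumes A: "unital_subring A" and Q: "\<And>t. t \<in> set ts \<Longrightarrow> Q t \<in> A"
  shows "\<exists>g. (\<forall>x. (\<Prod>t\<leftarrow>ts. x - \<eta> (Q t)) = (\<Sum>j\<le>length ts. \<eta> (g j) * x ^ j)) \<and>
    g (length ts) = 1 \<and> (\<forall>j. g j \<in> A) \<and> g 0 = (\<Prod>t\<leftarrow>ts. - Q t)"
  using Q
proof (induction ts)
  case Nil
  then show ?case
    using unital_subringD[OF A] by (intro exI[of _ "\<lambda>j. if j = 0 then 1 else 0"]) (auto simp: eta_one)
next
  case (Cons t ts)
  then obtain g where g: "\<And>x. (\<Prod>t\<leftarrow>ts. x - \<eta> (Q t)) = (\<Sum>j\<le>length ts. \<eta> (g j) * x ^ j)"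
    "g (length ts) = 1" "\<And>j. g j \<in> A" "g 0 = (\<Prod>t\<leftarrow>ts. - Q t)" by auto
  define h where
    "h j = (if j = 0 then 0 else g (j - 1)) - Q t * (if j \<le> length ts then g j else 0)" for j
  have "(\<Prod>t\<leftarrow>t # ts. x - \<eta> (Q t)) = (\<Sum>j\<le>length (t # ts). \<eta> (h j) * x ^ j)" for x
    using linear_factor_mult_sum[of x "Q t" g "length ts"] unfolding h_def
    by (simp only: list.map prod_list.Cons g(1) list.size add_Suc_right add_0_right)
  moreover have "h (length (t # ts)) = 1" using g by (simp add: h_def)
  moreover have "h j \<in> A" for j using unital_subringD[OF A] g Cons.prems by (auto simp: h_def)
  moreover have "h 0 = (\<Prod>t\<leftarrow>t # ts. - Q t)" using g by (simp add: h_def)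
  ultimately show ?case by blast
qed

end

locale ak_ring = central_hom \<eta> for \<eta> :: "'k::field \<Rightarrow> 'r::ring_1" +
  fixes l n :: nat and q :: 'k and Q :: "nat \<Rightarrow> 'k" and T :: "nat \<Rightarrow> 'r"
  assumes l: "1 \<le> l" and q0: "q \<noteq> 0"
    and cyclotomic: "(\<Prod>s\<leftarrow>[0..<l]. T 0 - \<eta> (Q s)) = 0"
    and quadratic: "1 \<le> i \<Longrightarrow> i < n \<Longrightarrow> T i * T i = \<eta> (q - 1) * T i + \<eta> q"
    and braid0: "2 \<le> n \<Longrightarrow> T 0 * T 1 * T 0 * T 1 = T 1 * T 0 * T 1 * T 0"
    and braid: "1 \<le> i \<Longrightarrow> i + 1 < n \<Longrightarrow> T i * T (i + 1) * T i = T (i + 1) * T i * T (i + 1)"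
    and far_commute: "i + 1 < j \<Longrightarrow> j < n \<Longrightarrow> T i * T j = T j * T i"
begin

lemma far_commute_sym:
  "i + 1 < j \<or> j + 1 < i \<Longrightarrow> i < n \<Longrightarrow> j < n \<Longrightarrow> T i * T j = T j * T i"
  using far_commute[of i j] far_commute[of j i] by auto

definition T_word :: "nat list \<Rightarrow> 'r" where
  "T_word u = (\<Prod>i\<leftarrow>u. T i)"

lemma T_word_simps [simp]:
  "T_word [] = 1" "T_word (i # u) = T i * T_word u" "T_word (u @ v) = T_word u * T_word v"
  by (auto simp: T_word_def)

lemma T_word_commute: "(\<And>i. i \<in> set u \<Longrightarrow> T i * x = x * T i) \<Longrightarrow> T_word u * x = x * T_word u"
  unfolding T_word_def by (rule commute_prod_list[symmetric]) simp

lemma T_word_braid_eq: "braid_eq u v \<Longrightarrow> set u \<subseteq> {1..<n} \<Longrightarrow> T_word u = T_word v"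
proof (induction rule: braid_eq.induct)
  case (braid_sym u v)
  then show ?case using braid_eq_length_set by metis
next
  case (braid_trans u v w)
  then show ?case using braid_eq_length_set by metis
next
  case (far_swap i j u v)
  then have "T i * T j = T j * T i" by (intro far_commute) auto
  then have "T i * (T j * x) = T j * (T i * x)" for x by (metis mult.assoc)
  then show ?case by simp
next
  case (braid_move u i v)
  then have "T i * T (Suc i) * T i = T (Suc i) * T i * T (Suc i)" using braid[of i] by simp
  then have "T i * (T (Suc i) * (T i * x)) = T (Suc i) * (T i * (T (Suc i) * x))" for x
    by (metis mult.assoc)
  then show ?case by simp
qed simp

definition L :: "nat \<Rightarrow> 'r" where
  "L k = \<eta> (q powi (1 - int k)) * T_word (rev [1..<k] @ [0] @ [1..<k])"

lemmas eta_shift = eta_left_commute[of "T i" for i] eta_left_commute[of "L k" for k]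
  eta_left_commute[of "T_word u" for u] eta_left_commute[of "L k ^ m" for k m]

lemma L_1: "L (Suc 0) = T 0"
  by (simp add: L_def eta_one)

lemma L_Suc:
  assumes "1 \<le> k"
  shows "L (Suc k) = \<eta> (inverse q) * (T k * L k * T k)"
proof -
  have "q powi (- 1 + (1 - int k)) = inverse q * q powi (1 - int k)"
    using q0 by (subst power_int_add) simp_all
  then have "q powi (1 - int (Suc k)) = inverse q * q powi (1 - int k)" by simp
  then show ?thesis using assms by (simp add: L_def eta_mult mult.assoc eta_shift)
qed

lemma q_mult_L_Suc: "1 \<le> k \<Longrightarrow> \<eta> q * L (Suc k) = T k * L k * T k"
  using q0 by (simp add: L_Suc mult.assoc[symmetric] eta_mult[symmetric] eta_one)

lemma eta_q_cancel:
  assumes "\<eta> q * x = \<eta> q * y"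
  shows "x = y"
proof -
  have "\<eta> (inverse q) * (\<eta> q * x) = \<eta> (inverse q) * (\<eta> q * y)" by (simp only: assms)
  then show ?thesis using q0 by (simp add: mult.assoc[symmetric] eta_mult[symmetric] eta_one)
qed

lemma commute_L_Suc:
  assumes "1 \<le> k" "x * (T k * L k * T k) = T k * L k * T k * x"
  shows "x * L (Suc k) = L (Suc k) * x"
  by (simp only: L_Suc[OF assms(1)] eta_left_commute[of x] assms(2)) (simp only: mult.assoc)

lemma T_L_commute:
  assumes "1 \<le> k" "k \<le> n" "1 \<le> j" "j < n" "j \<noteq> k" "Suc j \<noteq> k"
  shows "T j * L k = L k * T j"
  using assms
proof (induction k arbitrary: j rule: less_induct)
  case (less k)
  show ?case
  proof (cases "k = 1")
    case True
    then show ?thesis using less.prems far_commute[of 0 j] by (simp add: L_1)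
  next
    case False
    then obtain m where m: "k = Suc m" "1 \<le> m" using less.prems by (cases k) auto
    have "T j * (T m * L m * T m) = T m * L m * T m * T j"
    proof (cases "Suc j = m")
      case True
      have "T j * T m * T j = T m * T j * T m" using braid[of j] True less.prems m by simp
      moreover have "T m * L j = L j * T m" using less.prems m True by (intro less.IH) auto
      ultimately have "T j * (T m * (T j * L j * T j) * T m) = T m * (T j * L j * T j) * T m * T j"
        by (rule braid_commute_conjugate)
      moreover have "\<eta> q * (T m * L m * T m) = T m * (T j * L j * T j) * T m"
        using q_mult_L_Suc[of j] True less.prems(3) eta_left_commute[of "T m" q] by (metis mult.assoc)
      ultimately have "\<eta> q * (T j * (T m * L m * T m)) = \<eta> q * (T m * L m * T m * T j)"
        by (metis eta_left_commute mult.assoc)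
      then show ?thesis by (rule eta_q_cancel)
    next
      case False
      then show ?thesis using less.prems m
        by (intro commute_conjugate far_commute_sym less.IH) auto
    qed
    then show ?thesis unfolding m(1) by (rule commute_L_Suc[OF m(2)])
  qed
qed

lemma T0_L_commute:
  assumes "1 \<le> k" "k \<le> n"
  shows "T 0 * L k = L k * T 0"
  using assms
proof (induction k rule: nat_induct_at_least)
  case base
  then show ?case by (simp add: L_1)
next
  case (Suc m)
  have "T 0 * (T m * L m * T m) = T m * L m * T m * T 0"
  proof (cases "m = 1")
    case True
    then show ?thesis using braid0 Suc.prems by (simp add: L_1 mult.assoc)
  next
    case False
    then show ?thesis using Suc by (intro commute_conjugate far_commute) auto
  qed
  then show ?case by (rule commute_L_Suc[OF Suc.hyps(1)])
qed

lemma L_commute: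
  assumes "1 \<le> j" "1 \<le> k" "j \<le> n" "k \<le> n"
  shows "L j * L k = L k * L j"
proof -
  have commute_less: "L j * L k = L k * L j" if "1 \<le> j" "j < k" "k \<le> n" for j k
  proof -
    have "T i * L k = L k * T i" if "i \<in> set (rev [1..<j] @ [0] @ [1..<j])" for i
      using that T0_L_commute[of k] T_L_commute[of k i] \<open>1 \<le> j\<close> \<open>j < k\<close> \<open>k \<le> n\<close>
      by (cases "i = 0") auto
    then have "T_word (rev [1..<j] @ [0] @ [1..<j]) * L k = L k * T_word (rev [1..<j] @ [0] @ [1..<j])"
      by (rule T_word_commute)
    then show ?thesis
      unfolding L_def[of j] mult.assoc eta_left_commute[of "L k"] by simp
  qed
  from commute_less[of j k] commute_less[of k j] assms show ?thesis
    by (cases j k rule: linorder_cases) auto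
qed

lemma L_power_commute:
  assumes "1 \<le> j" "1 \<le> k" "j \<le> n" "k \<le> n"
  shows "L j ^ a * L k = L k * L j ^ a"
  using commute_power[OF L_commute[OF assms(2,1,4,3)]] by simp

lemma T_mult_L:
  assumes "1 \<le> i" "i < n"
  shows "T i * L i = L (Suc i) * T i - \<eta> (q - 1) * L (Suc i)"
proof -
  have "\<eta> q * (L (Suc i) * T i) = T i * L i * (T i * T i)"
    using q_mult_L_Suc[of i] assms by (simp add: mult.assoc[symmetric])
  also have "\<dots> = \<eta> (q - 1) * (T i * L i * T i) + \<eta> q * (T i * L i)"
    using assms by (simp add: quadratic distrib_left mult.assoc eta_shift eta_central[of q])
  also have "\<dots> = \<eta> q * (\<eta> (q - 1) * L (Suc i) + T i * L i)"
    using q_mult_L_Suc[of i] assms by (metis distrib_left eta_left_commute)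
  finally have "L (Suc i) * T i = \<eta> (q - 1) * L (Suc i) + T i * L i" by (rule eta_q_cancel)
  then show ?thesis by simp
qed

lemma T_mult_L_Suc:
  assumes "1 \<le> i" "i < n"
  shows "T i * L (Suc i) = L i * T i + \<eta> (q - 1) * L (Suc i)"
proof -
  have "\<eta> q * (T i * L (Suc i)) = (T i * T i) * L i * T i"
    using q_mult_L_Suc[of i] assms by (metis mult.assoc eta_left_commute)
  also have "\<dots> = \<eta> (q - 1) * (T i * L i * T i) + \<eta> q * (L i * T i)"
    using assms by (simp add: quadratic distrib_right mult.assoc)
  also have "\<dots> = \<eta> q * (L i * T i + \<eta> (q - 1) * L (Suc i))"
    using q_mult_L_Suc[of i] assms by (metis distrib_left eta_left_commute add.commute)
  finally show ?thesis by (rule eta_q_cancel)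
qed

lemma T_commute_L_mult_L_Suc:
  assumes "1 \<le> i" "i < n"
  shows "T i * (L i * L (Suc i)) = L i * L (Suc i) * T i"
proof -
  have "T i * (L i * L (Suc i)) = L (Suc i) * (T i * L (Suc i)) - \<eta> (q - 1) * (L (Suc i) * L (Suc i))"
    by (simp add: mult.assoc[symmetric] T_mult_L[OF assms] left_diff_distrib)
  also have "\<dots> = L (Suc i) * L i * T i"
    by (simp add: T_mult_L_Suc[OF assms] distrib_left eta_shift mult.assoc)
  finally show ?thesis using L_commute[of i "Suc i"] assms by simp
qed

definition L_pairs :: "nat \<Rightarrow> nat \<Rightarrow> 'r set" where
  "L_pairs i m = {L i ^ a * L (Suc i) ^ b | a b. a \<le> m \<and> b \<le> m}"

lemma L_pairsI: "a \<le> m \<Longrightarrow> b \<le> m \<Longrightarrow> L i ^ a * L (Suc i) ^ b \<in> L_pairs i m"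
  by (auto simp: L_pairs_def)

lemma L_pairsE:
  assumes "x \<in> L_pairs i m"
  obtains a b where "x = L i ^ a * L (Suc i) ^ b" "a \<le> m" "b \<le> m"
  using assms by (auto simp: L_pairs_def)

lemma L_pairs_mono: "x \<in> lin_span A (L_pairs i m') \<Longrightarrow> m' \<le> m \<Longrightarrow> x \<in> lin_span A (L_pairs i m)"
  by (erule lin_span_mono) (force simp: L_pairs_def)

lemma L_pair_mult:
  assumes "1 \<le> i" "i < n"
  shows "L i ^ a * L (Suc i) ^ b * L i = L i ^ Suc a * L (Suc i) ^ b"
    and "L i ^ a * L (Suc i) ^ b * L (Suc i) = L i ^ a * L (Suc i) ^ Suc b"
    and "L i * L (Suc i) * (L i ^ a * L (Suc i) ^ b) = L i ^ Suc a * L (Suc i) ^ Suc b"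
proof -
  have commute: "L (Suc i) ^ b * L i = L i * L (Suc i) ^ b" "L (Suc i) * L i ^ a = L i ^ a * L (Suc i)" for a b
    using L_power_commute[of "Suc i" i b] L_power_commute[of i "Suc i" a] assms by simp_all
  show "L i ^ a * L (Suc i) ^ b * L i = L i ^ Suc a * L (Suc i) ^ b"
    by (simp only: mult.assoc commute) (simp only: mult.assoc[symmetric] power_Suc2)
  show "L i ^ a * L (Suc i) ^ b * L (Suc i) = L i ^ a * L (Suc i) ^ Suc b"
    by (simp only: mult.assoc power_Suc2)
  have "L i * L (Suc i) * (L i ^ a * L (Suc i) ^ b) = L i * (L (Suc i) * L i ^ a) * L (Suc i) ^ b"
    by (simp only: mult.assoc)
  then show "L i * L (Suc i) * (L i ^ a * L (Suc i) ^ b) = L i ^ Suc a * L (Suc i) ^ Suc b"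
    by (simp only: commute mult.assoc power_Suc)
qed

lemma L_pairs_mult:
  assumes i: "1 \<le> i" "i < n" and A: "unital_subring A" and x: "x \<in> lin_span A (L_pairs i m)"
  shows "x * L i \<in> lin_span A (L_pairs i (Suc m))" "x * L (Suc i) \<in> lin_span A (L_pairs i (Suc m))"
    "L i * L (Suc i) * x \<in> lin_span A (L_pairs i (Suc m))"
proof -
  have base: "L i ^ a * L (Suc i) ^ b \<in> lin_span A (L_pairs i (Suc m))" if "a \<le> Suc m" "b \<le> Suc m" for a b
    using that by (intro lin_span_base[OF _ A] L_pairsI)
  show "x * L i \<in> lin_span A (L_pairs i (Suc m))"
    by (rule lin_span_mult_right[OF x A], erule L_pairsE) (simp only: L_pair_mult[OF i], rule base; simp)
  show "x * L (Suc i) \<in> lin_span A (L_pairs i (Suc m))"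
    by (rule lin_span_mult_right[OF x A], erule L_pairsE) (simp only: L_pair_mult[OF i], rule base; simp)
  show "L i * L (Suc i) * x \<in> lin_span A (L_pairs i (Suc m))"
    by (rule lin_span_mult_left[OF x A], erule L_pairsE) (simp only: L_pair_mult[OF i], rule base; simp)
qed

lemma T_mult_L_power:
  assumes i: "1 \<le> i" "i < n" and A: "unital_subring A" "q \<in> A"
  shows "\<exists>r\<in>lin_span A (L_pairs i a). T i * L i ^ a = L (Suc i) ^ a * T i + r"
proof (induction a)
  case (Suc a)
  then obtain r where r: "r \<in> lin_span A (L_pairs i a)" "T i * L i ^ a = L (Suc i) ^ a * T i + r" by blast
  have "T i * L i ^ Suc a = T i * L i ^ a * L i" by (simp only: power_Suc2 mult.assoc)
  also have "\<dots> = L (Suc i) ^ a * (T i * L i) + r * L i" by (simp add: r distrib_right mult.assoc)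
  also have "\<dots> = L (Suc i) ^ Suc a * T i + (\<eta> (- (q - 1)) * (L i ^ 0 * L (Suc i) ^ Suc a) + r * L i)"
    by (simp only: T_mult_L[OF i] power_Suc2 eta_minus)
       (simp add: right_diff_distrib mult.assoc eta_shift)
  finally have "T i * L i ^ Suc a = \<dots>" .
  moreover have "\<eta> (- (q - 1)) * (L i ^ 0 * L (Suc i) ^ Suc a) + r * L i \<in> lin_span A (L_pairs i (Suc a))"
    using unital_subringD[OF A(1)] A(2)
    by (intro lin_span_add lin_span_base_scale L_pairsI L_pairs_mult(1)[OF i A(1) r(1)]) auto
  ultimately show ?case by blast
qed (auto intro: bexI[of _ 0] lin_span.zero)

lemma T_mult_L_Suc_power:
  assumes i: "1 \<le> i" "i < n" and A: "unital_subring A" "q \<in> A"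
  shows "\<exists>r\<in>lin_span A (L_pairs i a). T i * L (Suc i) ^ a = L i ^ a * T i + r"
proof (induction a)
  case (Suc a)
  then obtain r where r: "r \<in> lin_span A (L_pairs i a)" "T i * L (Suc i) ^ a = L i ^ a * T i + r" by blast
  have "T i * L (Suc i) ^ Suc a = T i * L (Suc i) ^ a * L (Suc i)" by (simp only: power_Suc2 mult.assoc)
  also have "\<dots> = L i ^ a * (T i * L (Suc i)) + r * L (Suc i)" by (simp add: r distrib_right mult.assoc)
  also have "\<dots> = L i ^ Suc a * T i + (\<eta> (q - 1) * (L i ^ a * L (Suc i) ^ 1) + r * L (Suc i))"
    by (simp only: T_mult_L_Suc[OF i] power_Suc2) (simp add: distrib_left mult.assoc eta_shift)
  finally have "T i * L (Suc i) ^ Suc a = \<dots>" .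
  moreover have "\<eta> (q - 1) * (L i ^ a * L (Suc i) ^ 1) + r * L (Suc i) \<in> lin_span A (L_pairs i (Suc a))"
    using unital_subringD[OF A(1)] A(2)
    by (intro lin_span_add lin_span_base_scale L_pairsI L_pairs_mult(2)[OF i A(1) r(1)]) auto
  ultimately show ?case by blast
qed (auto intro: bexI[of _ 0] lin_span.zero)

lemma T_mult_L_pair:
  assumes i: "1 \<le> i" "i < n" and A: "unital_subring A" "q \<in> A" and "a \<le> m" "b \<le> m"
  shows "\<exists>r\<in>lin_span A (L_pairs i m). T i * (L i ^ a * L (Suc i) ^ b) = L i ^ b * L (Suc i) ^ a * T i + r"
  using assms(5,6)
proof (induction m arbitrary: a b)
  case (Suc m)
  consider (left_zero) "a = 0" | (right_zero) "b = 0" | (positive) a' b' where "a = Suc a'" "b = Suc b'"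
    by (metis not0_implies_Suc)
  then show ?case
  proof cases
    case left_zero
    then show ?thesis using T_mult_L_Suc_power[OF i A, of b] L_pairs_mono Suc.prems by auto
  next
    case right_zero
    then show ?thesis using T_mult_L_power[OF i A, of a] L_pairs_mono Suc.prems by auto
  next
    case (positive a' b')
    let ?Z = "L i * L (Suc i)"
    obtain r where r: "r \<in> lin_span A (L_pairs i m)"
      "T i * (L i ^ a' * L (Suc i) ^ b') = L i ^ b' * L (Suc i) ^ a' * T i + r"
      using Suc.IH[of a' b'] Suc.prems positive by auto
    have "T i * (L i ^ a * L (Suc i) ^ b) = ?Z * (T i * (L i ^ a' * L (Suc i) ^ b'))"
      unfolding positive L_pair_mult(3)[OF i, symmetric] by (metis T_commute_L_mult_L_Suc[OF i] mult.assoc)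
    also have "\<dots> = ?Z * (L i ^ b' * L (Suc i) ^ a') * T i + ?Z * r"
      unfolding r(2) by (simp only: distrib_left mult.assoc)
    finally show ?thesis
      unfolding positive L_pair_mult(3)[OF i] using L_pairs_mult(3)[OF i A(1) r(1)] by blast
  qed
qed (auto intro: bexI[of _ 0] lin_span.zero)

lemma T_word_normal_word_mult_T:
  assumes A: "unital_subring A" "q \<in> A" and j: "is_code n j" and i: "1 \<le> i" "i < n"
  shows "T_word (normal_word j n) * T i \<in> lin_span A {T_word (normal_word j n) | j. is_code n j}"
    (is "_ \<in> lin_span A ?B")
proof -
  obtain j' where j': "is_code n j'" "braid_adjacent (normal_word j n) i (normal_word j' n)"
    using normal_word_snoc[OF j i] by blast
  have words: "T_word (normal_word j' n) \<in> ?B" "T_word (normal_word j n) \<in> ?B" using j' j by auto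
  from j'(2) show ?thesis unfolding braid_adjacent_def
  proof
    assume "braid_eq (normal_word j n @ [i]) (normal_word j' n)"
    then have "T_word (normal_word j n @ [i]) = T_word (normal_word j' n)"
      using set_normal_word[OF j] i by (intro T_word_braid_eq) auto
    then show ?thesis using lin_span_base[OF words(1) A(1)] by simp
  next
    assume "braid_eq (normal_word j n) (normal_word j' n @ [i])"
    then have shorter: "T_word (normal_word j n) = T_word (normal_word j' n @ [i])"
      using set_normal_word[OF j] by (intro T_word_braid_eq) auto
    have "T_word (normal_word j n) * T i = T_word (normal_word j' n) * (T i * T i)"
      by (simp add: shorter mult.assoc)
    also have "\<dots> = \<eta> (q - 1) * T_word (normal_word j n) + \<eta> q * T_word (normal_word j' n)"
      using i by (simp add: quadratic shorter distrib_left eta_shift eta_central[of q])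
    finally show ?thesis
      using unital_subringD[OF A(1)] A words by (auto intro!: lin_span_add lin_span_base_scale)
  qed
qed

lemma T_word_in_lin_span:
  assumes A: "unital_subring A" "q \<in> A" and u: "set u \<subseteq> {1..<n}"
  shows "T_word u \<in> lin_span A {T_word (normal_word j n) | j. is_code n j}" (is "_ \<in> lin_span A ?B")
  using u
proof (induction u rule: rev_induct)
  case Nil
  have "T_word (normal_word (\<lambda>k. k) n) \<in> ?B" using normal_word_id by blast
  then show ?case using A normal_word_id by (simp add: lin_span_base)
next
  case (snoc i u)
  have "T_word u * T i \<in> lin_span A ?B"
  proof (rule lin_span_mult_right[OF _ A(1)])
    show "T_word u \<in> lin_span A ?B" using snoc by simp
    fix b assume "b \<in> ?B"
    then show "b * T i \<in> lin_span A ?B" using T_word_normal_word_mult_T[OF A] snoc.prems by auto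
  qed
  then show ?case by simp
qed

definition L_monomial :: "(nat \<Rightarrow> nat) \<Rightarrow> 'r" where
  "L_monomial c = (\<Prod>k\<leftarrow>[1..<n + 1]. L k ^ c k)"

lemma L_monomial_zero: "L_monomial (\<lambda>_. 0) = 1"
proof -
  have "(\<Prod>k\<leftarrow>ks. L k ^ 0) = 1" for ks :: "nat list" by (induction ks) auto
  then show ?thesis unfolding L_monomial_def .
qed

lemma L_monomial_split:
  assumes "1 \<le> i" "i < n"
  shows "(\<Prod>k\<leftarrow>[1..<i]. L k ^ c k) * (L i ^ a * L (Suc i) ^ b) * (\<Prod>k\<leftarrow>[i + 2..<n + 1]. L k ^ c k)
    = L_monomial (c(i := a, Suc i := b))"
proof -
  have maps: "map (\<lambda>k. L k ^ (c(i := a, Suc i := b)) k) [1..<i] = map (\<lambda>k. L k ^ c k) [1..<i]"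
    "map (\<lambda>k. L k ^ (c(i := a, Suc i := b)) k) [i + 2..<n + 1] = map (\<lambda>k. L k ^ c k) [i + 2..<n + 1]"
    by (auto simp del: upt_Suc)
  show ?thesis unfolding L_monomial_def upt_split_pair[OF assms] map_append list.map maps prod_list.append
    by (simp add: mult.assoc del: upt_Suc)
qed

lemma L_monomial_update_1:
  assumes "1 \<le> n"
  shows "L_monomial (c(1 := a)) = T 0 ^ a * (\<Prod>k\<leftarrow>[2..<n + 1]. L k ^ c k)"
proof -
  have upt: "[1..<n + 1] = 1 # [2..<n + 1]"
    using assms by (simp add: upt_conv_Cons numeral_2_eq_2 del: upt_Suc)
  have map: "map (\<lambda>k. L k ^ (c(1 := a)) k) [2..<n + 1] = map (\<lambda>k. L k ^ c k) [2..<n + 1]"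
    by (auto simp del: upt_Suc)
  show ?thesis unfolding L_monomial_def upt list.map map by (simp add: L_1 del: upt_Suc)
qed

definition L_word_monomials :: "'r set" where
  "L_word_monomials = {L_monomial c * T_word u | c u. (\<forall>k\<in>{1..n}. c k < l) \<and> set u \<subseteq> {1..<n}}"

lemma L_word_monomialsI:
  "(\<forall>k\<in>{1..n}. c k < l) \<Longrightarrow> set u \<subseteq> {1..<n} \<Longrightarrow> L_monomial c * T_word u \<in> L_word_monomials"
  unfolding L_word_monomials_def by blast

lemma T_mult_L_word_monomial:
  assumes i: "1 \<le> i" "i < n" and A: "unital_subring A" "q \<in> A"
    and c: "\<forall>k\<in>{1..n}. c k < l" and u: "set u \<subseteq> {1..<n}"
  shows "T i * (L_monomial c * T_word u) \<in> lin_span A L_word_monomials"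
proof -
  define low where "low = (\<Prod>k\<leftarrow>[1..<i]. L k ^ c k)"
  define high where "high = (\<Prod>k\<leftarrow>[i + 2..<n + 1]. L k ^ c k)"
  have commute: "T i * low = low * T i" "T i * high = high * T i"
    unfolding low_def high_def using i by (intro commute_prod_list commute_power T_L_commute; auto)+
  have split: "low * (L i ^ a * L (Suc i) ^ b) * high = L_monomial (c(i := a, Suc i := b))" for a b
    unfolding low_def high_def by (rule L_monomial_split[OF i])
  have "c i < l" "c (Suc i) < l" using c i by auto
  then have bounds: "c i \<le> l - 1" "c (Suc i) \<le> l - 1" by simp_all
  obtain r where r: "r \<in> lin_span A (L_pairs i (l - 1))"
    "T i * (L i ^ c i * L (Suc i) ^ c (Suc i)) = L i ^ c (Suc i) * L (Suc i) ^ c i * T i + r"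
    using T_mult_L_pair[OF i A bounds] by blast
  have "T i * (L_monomial c * T_word u) = T i * low * (L i ^ c i * L (Suc i) ^ c (Suc i)) * high * T_word u"
    using split[of "c i" "c (Suc i)"] by (simp add: mult.assoc)
  also have "\<dots> = low * (T i * (L i ^ c i * L (Suc i) ^ c (Suc i))) * high * T_word u"
    by (simp only: commute mult.assoc)
  also have "\<dots> = low * (L i ^ c (Suc i) * L (Suc i) ^ c i) * (T i * high) * T_word u +
      low * r * (high * T_word u)"
    unfolding r(2) by (simp only: distrib_left distrib_right mult.assoc)
  also have "\<dots> = L_monomial (c(i := c (Suc i), Suc i := c i)) * T_word (i # u) + low * r * (high * T_word u)"
    unfolding commute split[symmetric] by (simp add: mult.assoc)
  finally have expand: "T i * (L_monomial c * T_word u) = \<dots>" .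
  have "L_monomial (c(i := c (Suc i), Suc i := c i)) * T_word (i # u) \<in> L_word_monomials"
    using c u i by (intro L_word_monomialsI) auto
  moreover have "low * r * (high * T_word u) \<in> lin_span A L_word_monomials"
  proof (rule lin_span_sandwich[OF r(1) A(1)])
    fix y assume "y \<in> L_pairs i (l - 1)"
    then obtain a b where y: "y = L i ^ a * L (Suc i) ^ b" "a \<le> l - 1" "b \<le> l - 1" by (rule L_pairsE)
    have "L_monomial (c(i := a, Suc i := b)) * T_word u \<in> L_word_monomials"
      using c u y l by (intro L_word_monomialsI) auto
    then show "low * y * (high * T_word u) \<in> lin_span A L_word_monomials"
      using A(1) unfolding y split[symmetric] by (simp add: lin_span_base mult.assoc)
  qed
  ultimately show ?thesis using A(1) by (simp add: expand lin_span_add lin_span_base)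
qed

lemma T0_power_l:
  assumes A: "unital_subring A" "\<And>s. s < l \<Longrightarrow> Q s \<in> A"
  shows "\<exists>g. (\<forall>j. g j \<in> A) \<and> T 0 ^ l = (\<Sum>j<l. \<eta> (g j) * T 0 ^ j)"
proof -
  obtain g where g: "\<And>x. (\<Prod>s\<leftarrow>[0..<l]. x - \<eta> (Q s)) = (\<Sum>j\<le>l. \<eta> (g j) * x ^ j)" "g l = 1" "\<And>j. g j \<in> A"
    using prod_linear_expand[OF A(1), of "[0..<l]" Q] A(2) by auto
  have "T 0 ^ l + (\<Sum>j<l. \<eta> (g j) * T 0 ^ j) = (\<Prod>s\<leftarrow>[0..<l]. T 0 - \<eta> (Q s))"
    unfolding g(1) using g(2) by (simp add: lessThan_Suc_atMost[symmetric] eta_one add.commute)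
  then have "T 0 ^ l = (\<Sum>j<l. \<eta> (- g j) * T 0 ^ j)"
    using cyclotomic by (simp add: add_eq_0_iff2 sum_negf eta_minus)
  then show ?thesis using g(3) unital_subringD(3)[OF A(1)] by (intro exI[of _ "\<lambda>j. - g j"]) simp
qed

lemma T0_mult_L_word_monomial:
  assumes n: "1 \<le> n" and A: "unital_subring A" "\<And>s. s < l \<Longrightarrow> Q s \<in> A"
    and c: "\<forall>k\<in>{1..n}. c k < l" and u: "set u \<subseteq> {1..<n}"
  shows "T 0 * (L_monomial c * T_word u) \<in> lin_span A L_word_monomials"
proof -
  define high where "high = (\<Prod>k\<leftarrow>[2..<n + 1]. L k ^ c k)"
  have split: "L_monomial (c(1 := a)) = T 0 ^ a * high" for a
    unfolding high_def by (rule L_monomial_update_1[OF n])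
  have mem: "T 0 ^ a * high * T_word u \<in> L_word_monomials" if "a < l" for a
    using that c u unfolding split[symmetric] by (intro L_word_monomialsI) auto
  have expand: "T 0 * (L_monomial c * T_word u) = T 0 ^ Suc (c 1) * high * T_word u"
    using split[of "c 1"] by (simp add: mult.assoc)
  show ?thesis
  proof (cases "Suc (c 1) < l")
    case True
    then show ?thesis unfolding expand by (intro lin_span_base mem A)
  next
    case False
    then have "Suc (c 1) = l" using c n by force
    moreover obtain g where g: "\<And>j. g j \<in> A" "T 0 ^ l = (\<Sum>j<l. \<eta> (g j) * T 0 ^ j)"
      using T0_power_l[OF A] by blast
    ultimately have "T 0 * (L_monomial c * T_word u) = (\<Sum>j<l. \<eta> (g j) * (T 0 ^ j * high * T_word u))"
      unfolding expand by (simp add: sum_distrib_right mult.assoc)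
    then show ?thesis using g(1) mem by (simp only:) (intro lin_span_sum lin_span_base_scale; simp)
  qed
qed

lemma T_word_in_span_L_word_monomials:
  assumes n: "1 \<le> n" and A: "unital_subring A" "q \<in> A" "\<And>s. s < l \<Longrightarrow> Q s \<in> A" and u: "set u \<subseteq> {..<n}"
  shows "T_word u \<in> lin_span A L_word_monomials"
  using u
proof (induction u)
  case Nil
  have "L_monomial (\<lambda>_. 0) * T_word [] \<in> L_word_monomials" using l by (intro L_word_monomialsI) auto
  then show ?case using A(1) by (simp add: L_monomial_zero lin_span_base)
next
  case (Cons i u)
  have "T i * T_word u \<in> lin_span A L_word_monomials"
  proof (rule lin_span_mult_left[OF _ A(1)])
    show "T_word u \<in> lin_span A L_word_monomials" using Cons by simp
    fix b assume "b \<in> L_word_monomials"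
    then obtain c v where b: "b = L_monomial c * T_word v" "\<forall>k\<in>{1..n}. c k < l" "set v \<subseteq> {1..<n}"
      by (auto simp: L_word_monomials_def)
    show "T i * b \<in> lin_span A L_word_monomials"
      using T0_mult_L_word_monomial[OF n A(1,3) b(2,3)] T_mult_L_word_monomial[OF _ _ A(1,2) b(2,3), of i]
        Cons.prems unfolding b(1) by (cases "i = 0") auto
  qed
  then show ?case by simp
qed

definition normal_monomials :: "'r set" where
  "normal_monomials = {L_monomial c * T_word (normal_word j n) | c j. (\<forall>k\<in>{1..n}. c k < l) \<and> is_code n j}"

theorem T_word_in_span_normal_monomials:
  assumes n: "1 \<le> n" and A: "unital_subring A" "q \<in> A" "\<And>s. s < l \<Longrightarrow> Q s \<in> A" and u: "set u \<subseteq> {..<n}"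
  shows "T_word u \<in> lin_span A normal_monomials"
proof -
  have "1 * T_word u \<in> lin_span A normal_monomials"
  proof (rule lin_span_mult_left[OF T_word_in_span_L_word_monomials[OF n A u] A(1)])
    fix b assume "b \<in> L_word_monomials"
    then obtain c v where b: "b = L_monomial c * T_word v" "\<forall>k\<in>{1..n}. c k < l" "set v \<subseteq> {1..<n}"
      by (auto simp: L_word_monomials_def)
    have "L_monomial c * T_word v \<in> lin_span A normal_monomials"
    proof (rule lin_span_mult_left[OF T_word_in_lin_span[OF A(1,2) b(3)] A(1)])
      fix x assume "x \<in> {T_word (normal_word j n) | j. is_code n j}"
      then have "L_monomial c * x \<in> normal_monomials" using b(2) by (auto simp: normal_monomials_def)
      then show "L_monomial c * x \<in> lin_span A normal_monomials" using A(1) by (simp add: lin_span_base)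
    qed
    then show "1 * b \<in> lin_span A normal_monomials" using b by simp
  qed
  then show ?thesis by simp
qed

end

section \<open>Elements spanning one-dimensional modules\<close>

context ak_ring
begin

definition coset_sum :: "nat \<Rightarrow> 'r" where
  "coset_sum m = (\<Sum>j=1..Suc m. T_word (rev [j..<Suc m]))"

primrec symmetrizer :: "nat \<Rightarrow> 'r" where
  "symmetrizer 0 = 1"
| "symmetrizer (Suc m) = symmetrizer m * coset_sum m"

lemma descending_word_mult_T:
  assumes "Suc m \<le> n" "1 \<le> i" "i < Suc m" and j: "1 \<le> j" "j \<le> Suc m" "j \<noteq> i" "j \<noteq> Suc i"
  shows "\<exists>i'. 1 \<le> i' \<and> i' < m \<and> T_word (rev [j..<Suc m]) * T i = T i' * T_word (rev [j..<Suc m])"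
proof -
  obtain i' where i': "1 \<le> i'" "i' < m" "braid_eq (rev [j..<Suc m] @ [i]) (i' # rev [j..<Suc m])"
  proof (cases "i < j")
    case True
    then show ?thesis using that[of i] assms braid_eq_move_letter_front[of "rev [j..<Suc m]" i]
      by (auto simp del: upt_Suc)
  next
    case False
    then show ?thesis using that[of "i - 1"] assms braid_eq_descending_letter[of j i "Suc m"]
      by (auto simp del: upt_Suc)
  qed
  have "T_word (rev [j..<Suc m] @ [i]) = T_word (i' # rev [j..<Suc m])"
    using assms by (intro T_word_braid_eq[OF i'(3)]) auto
  then show ?thesis using i'(1,2) by (auto simp del: upt_Suc)
qed

lemma mult_T_plus_one_T:
  assumes "1 \<le> i" "i < n"
  shows "(x * T i + x) * T i = \<eta> q * (x * T i + x)"
proof -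
  have "(x * T i + x) * T i = x * (\<eta> (q - 1) * T i + \<eta> q) + x * T i"
    using assms by (simp add: distrib_right mult.assoc quadratic)
  also have "\<dots> = \<eta> (q - 1) * (x * T i) + \<eta> q * x + x * T i"
    by (simp add: distrib_left eta_left_commute[of x] eta_central[of q x])
  also have "\<dots> = \<eta> q * (x * T i + x)" by (simp add: eta_diff eta_one algebra_simps)
  finally show ?thesis .
qed

lemma symmetrizer_T:
  assumes "m \<le> n" "1 \<le> i" "i < m"
  shows "symmetrizer m * T i = \<eta> q * symmetrizer m"
  using assms
proof (induction m arbitrary: i)
  case (Suc m)
  define y where "y j = symmetrizer m * T_word (rev [j..<Suc m])" for j
  let ?rest = "{1..Suc m} - {i, Suc i}"
  have "rev [i..<Suc m] = rev [Suc i..<Suc m] @ [i]"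
    using Suc.prems rev_upt_append[of i "Suc i" "Suc m"] by (simp del: upt_Suc) (simp add: upt_rec)
  then have y_i: "y i = y (Suc i) * T i" by (simp add: y_def mult.assoc del: upt_Suc)
  have y_other: "y j * T i = \<eta> q * y j" if j: "j \<in> ?rest" for j
  proof -
    obtain i' where i': "1 \<le> i'" "i' < m"
      "T_word (rev [j..<Suc m]) * T i = T i' * T_word (rev [j..<Suc m])"
      using descending_word_mult_T[of m i j] Suc.prems j by auto
    have "y j * T i = symmetrizer m * T i' * T_word (rev [j..<Suc m])"
      unfolding y_def by (simp only: mult.assoc i'(3))
    also have "\<dots> = \<eta> q * y j" using Suc.IH[of i'] i' Suc.prems by (simp add: y_def mult.assoc del: upt_Suc)
    finally show ?thesis .
  qed
  have "{1..Suc m} = insert i (insert (Suc i) ?rest)" using Suc.prems by auto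
  then have "(\<Sum>j=1..Suc m. y j) = (\<Sum>j\<in>insert i (insert (Suc i) ?rest). y j)" by (rule arg_cong)
  moreover have "symmetrizer (Suc m) = (\<Sum>j=1..Suc m. y j)"
    by (simp add: y_def coset_sum_def sum_distrib_left del: upt_Suc sum.cl_ivl_Suc)
  ultimately have sum_y: "symmetrizer (Suc m) = y (Suc i) * T i + y (Suc i) + (\<Sum>j\<in>?rest. y j)"
    by (simp add: y_i add.assoc)
  have "symmetrizer (Suc m) * T i = (y (Suc i) * T i + y (Suc i)) * T i + (\<Sum>j\<in>?rest. y j * T i)"
    unfolding sum_y distrib_right sum_distrib_right ..
  also have "\<dots> = \<eta> q * (y (Suc i) * T i + y (Suc i)) + (\<Sum>j\<in>?rest. \<eta> q * y j)"
    using Suc.prems y_other by (simp add: mult_T_plus_one_T)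
  finally show ?case by (simp only: sum_y distrib_left sum_distrib_left)
qed simp

definition other_indices :: "nat \<Rightarrow> nat list" where
  "other_indices s = [0..<s] @ [Suc s..<l]"

definition L_factor :: "nat \<Rightarrow> nat \<Rightarrow> 'r" where
  "L_factor s k = (\<Prod>t\<leftarrow>other_indices s. L k - \<eta> (Q t))"

definition L_product :: "nat \<Rightarrow> 'r" where
  "L_product s = (\<Prod>k\<leftarrow>[1..<n + 1]. L_factor s k)"

lemma commute_minus_eta: "x * y = y * x \<Longrightarrow> x * (y - \<eta> a) = (y - \<eta> a) * x"
  by (simp add: left_diff_distrib right_diff_distrib eta_central)

lemma L_L_factor_commute:
  assumes "1 \<le> j" "1 \<le> k" "j \<le> n" "k \<le> n"
  shows "L j * L_factor s k = L_factor s k * L j"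
  unfolding L_factor_def by (intro commute_prod_list commute_minus_eta L_commute assms)

lemma T_L_factor_commute:
  assumes "1 \<le> i" "i < n" "1 \<le> k" "k \<le> n" "i \<noteq> k" "Suc i \<noteq> k"
  shows "T i * L_factor s k = L_factor s k * T i"
  unfolding L_factor_def by (intro commute_prod_list commute_minus_eta T_L_commute assms)

lemma T_commute_shifted_pair:
  assumes i: "1 \<le> i" "i < n"
  shows "T i * ((L i - \<eta> a) * (L (Suc i) - \<eta> a)) = (L i - \<eta> a) * (L (Suc i) - \<eta> a) * T i"
proof -
  have expand: "(L i - \<eta> a) * (L (Suc i) - \<eta> a) =
      L i * L (Suc i) - \<eta> a * (L i + L (Suc i)) + \<eta> (a * a)"
    by (simp add: left_diff_distrib right_diff_distrib distrib_left eta_central[of a "L i"] eta_mult)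
  have "T i * (L i + L (Suc i)) = (L i + L (Suc i)) * T i"
    by (simp add: distrib_left distrib_right T_mult_L[OF i] T_mult_L_Suc[OF i])
  then have "T i * (\<eta> a * (L i + L (Suc i))) = \<eta> a * (L i + L (Suc i)) * T i"
    by (simp only: eta_left_commute[of "T i"] mult.assoc)
  then show ?thesis unfolding expand
    by (simp only: distrib_left distrib_right left_diff_distrib right_diff_distrib
        T_commute_L_mult_L_Suc[OF i] eta_central[of "a * a"])
qed

lemma T_commute_L_factor_pair:
  assumes i: "1 \<le> i" "i < n"
  shows "T i * (L_factor s i * L_factor s (Suc i)) = L_factor s i * L_factor s (Suc i) * T i"
proof -
  have "(L i - \<eta> (Q t)) * (L (Suc i) - \<eta> (Q r)) = (L (Suc i) - \<eta> (Q r)) * (L i - \<eta> (Q t))" for t r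
    using L_commute[of i "Suc i"] i by (intro commute_minus_eta commute_minus_eta[symmetric]) auto
  then have "L_factor s i * L_factor s (Suc i) =
      (\<Prod>t\<leftarrow>other_indices s. (L i - \<eta> (Q t)) * (L (Suc i) - \<eta> (Q t)))"
    unfolding L_factor_def by (intro prod_list_mult_commuting)
  then show ?thesis by (simp only:) (rule commute_prod_list, rule T_commute_shifted_pair[OF i])
qed

lemma T_L_product_commute:
  assumes i: "1 \<le> i" "i < n"
  shows "T i * L_product s = L_product s * T i"
proof -
  define low where "low = (\<Prod>k\<leftarrow>[1..<i]. L_factor s k)"
  define high where "high = (\<Prod>k\<leftarrow>[i + 2..<n + 1]. L_factor s k)"
  have "T i * low = low * T i" "T i * high = high * T i"
    unfolding low_def high_def using i by (intro commute_prod_list T_L_factor_commute; auto)+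
  moreover have "L_product s = low * (L_factor s i * L_factor s (Suc i)) * high"
    unfolding L_product_def upt_split_pair[OF i] by (simp add: low_def high_def mult.assoc)
  ultimately show ?thesis using T_commute_L_factor_pair[OF i, of s] by (metis mult.assoc)
qed

lemma L_factor_1_T0:
  assumes "s < l"
  shows "L_factor s 1 * T 0 = \<eta> (Q s) * L_factor s 1"
proof -
  let ?low = "\<Prod>t\<leftarrow>[0..<s]. T 0 - \<eta> (Q t)" and ?high = "\<Prod>t\<leftarrow>[Suc s..<l]. T 0 - \<eta> (Q t)"
  have "[0..<l] = [0..<s] @ s # [Suc s..<l]"
    using assms upt_add_eq_append[of 0 s "l - s"] by (simp add: upt_conv_Cons)
  then have "0 = ?low * ((T 0 - \<eta> (Q s)) * ?high)" using cyclotomic by simp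
  also have "(T 0 - \<eta> (Q s)) * ?high = ?high * (T 0 - \<eta> (Q s))"
    by (intro commute_prod_list commute_minus_eta commute_minus_eta[symmetric] refl)
  finally have "L_factor s 1 * (T 0 - \<eta> (Q s)) = 0"
    by (simp add: L_factor_def other_indices_def L_1 mult.assoc)
  then show ?thesis by (simp add: right_diff_distrib eta_central)
qed

lemma L_product_T0:
  assumes "1 \<le> n" "s < l"
  shows "L_product s * T 0 = \<eta> (Q s) * L_product s"
proof -
  define high where "high = (\<Prod>k\<leftarrow>[2..<n + 1]. L_factor s k)"
  have "[1..<n + 1] = 1 # [2..<n + 1]"
    using assms by (simp add: upt_conv_Cons numeral_2_eq_2 del: upt_Suc)
  then have split: "L_product s = L_factor s 1 * high"
    unfolding L_product_def by (simp add: high_def del: upt_Suc)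
  have "high * T 0 = T 0 * high"
    unfolding high_def L_1[symmetric] using assms
    by (intro commute_prod_list[symmetric] L_L_factor_commute) auto
  then have "L_product s * T 0 = L_factor s 1 * T 0 * high" by (simp only: split mult.assoc)
  also have "\<dots> = \<eta> (Q s) * L_product s" by (simp only: L_factor_1_T0[OF assms(2)] split mult.assoc)
  finally show ?thesis .
qed

lemma L_product_symmetrizer_commute:
  assumes "m \<le> n"
  shows "L_product s * symmetrizer m = symmetrizer m * L_product s"
  using assms
proof (induction m)
  case (Suc m)
  have "T_word (rev [j..<Suc m]) * L_product s = L_product s * T_word (rev [j..<Suc m])"
    if "j \<in> {1..Suc m}" for j
    using T_L_product_commute Suc.prems that by (intro T_word_commute) auto
  then have "L_product s * coset_sum m = coset_sum m * L_product s"
    unfolding coset_sum_def sum_distrib_left sum_distrib_right by (intro sum.cong) auto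
  moreover have "L_product s * symmetrizer m = symmetrizer m * L_product s" using Suc by simp
  ultimately show ?case unfolding symmetrizer.simps by (metis mult.assoc)
qed simp

definition char_element :: "nat \<Rightarrow> 'r" where
  "char_element s = L_product s * symmetrizer n"

lemma char_element_T:
  assumes "1 \<le> i" "i < n"
  shows "char_element s * T i = \<eta> q * char_element s"
  using symmetrizer_T[of n i] assms
  by (simp add: char_element_def mult.assoc eta_left_commute[of "L_product s"])

lemma char_element_T0:
  assumes "1 \<le> n" "s < l"
  shows "char_element s * T 0 = \<eta> (Q s) * char_element s"
  using L_product_T0[OF assms]
  by (simp add: char_element_def L_product_symmetrizer_commute mult.assoc
      eta_left_commute[of "symmetrizer n"])

definition linear_char :: "nat \<Rightarrow> nat list \<Rightarrow> 'k" where
  "linear_char s u = (\<Prod>i\<leftarrow>u. if i = 0 then Q s else q)"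

lemma linear_char_pos: "0 \<notin> set u \<Longrightarrow> linear_char s u = q ^ length u"
  by (induction u) (auto simp: linear_char_def)

lemma char_element_prod_list:
  assumes "\<And>x. x \<in> set xs \<Longrightarrow> char_element s * f x = \<eta> (g x) * char_element s"
  shows "char_element s * (\<Prod>x\<leftarrow>xs. f x) = \<eta> (\<Prod>x\<leftarrow>xs. g x) * char_element s"
  using assms
proof (induction xs)
  case (Cons x xs)
  have "char_element s * (f x * (\<Prod>x\<leftarrow>xs. f x)) = \<eta> (g x) * (char_element s * (\<Prod>x\<leftarrow>xs. f x))"
    using Cons.prems by (simp add: mult.assoc[symmetric])
  then show ?case using Cons by (simp add: eta_mult mult.assoc)
qed (simp add: eta_one)

lemma char_element_word:
  assumes "1 \<le> n" "s < l" "set u \<subseteq> {..<n}"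
  shows "char_element s * T_word u = \<eta> (linear_char s u) * char_element s"
  unfolding T_word_def linear_char_def using assms char_element_T0 char_element_T
  by (intro char_element_prod_list) auto

lemma char_element_L:
  assumes "1 \<le> k" "k \<le> n" "s < l"
  shows "char_element s * L k = \<eta> (q ^ (k - 1) * Q s) * char_element s"
proof -
  let ?u = "rev [1..<k] @ [0] @ [1..<k]"
  have "linear_char s ?u = linear_char s (rev [1..<k]) * Q s * linear_char s [1..<k]"
    by (simp add: linear_char_def)
  also have "\<dots> = q ^ (k - 1) * Q s * q ^ (k - 1)" by (simp add: linear_char_pos)
  finally have "q powi (1 - int k) * linear_char s ?u = q ^ (k - 1) * Q s"
    using q0 assms by (simp add: power_int_def nat_diff_distrib power_inverse)
  moreover have "char_element s * T_word ?u = \<eta> (linear_char s ?u) * char_element s"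
    using assms by (intro char_element_word) auto
  ultimately show ?thesis
    unfolding L_def eta_left_commute[of "char_element s"]
    by (simp only: mult.assoc[symmetric] eta_mult[symmetric])
qed

lemma char_element_coset_sum:
  assumes "Suc m \<le> n" "s < l"
  shows "char_element s * coset_sum m = \<eta> (q_int q (Suc m)) * char_element s"
proof -
  have "char_element s * T_word (rev [j..<Suc m]) = \<eta> (q ^ (Suc m - j)) * char_element s"
    if "j \<in> {1..Suc m}" for j
    using char_element_word[of s "rev [j..<Suc m]"] linear_char_pos[of "rev [j..<Suc m]" s] assms that
    by (force simp del: upt_Suc)
  then have "char_element s * coset_sum m = \<eta> (\<Sum>j=1..Suc m. q ^ (Suc m - j)) * char_element s"
    unfolding coset_sum_def sum_distrib_left eta_sum sum_distrib_right by (intro sum.cong) auto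
  also have "(\<Sum>j=1..Suc m. q ^ (Suc m - j)) = q_int q (Suc m)"
    unfolding q_int_def
    by (rule sum.reindex_bij_witness[of _ "\<lambda>k. Suc m - k" "\<lambda>j. Suc m - j"]) auto
  finally show ?thesis .
qed

lemma char_element_symmetrizer:
  assumes "m \<le> n" "s < l"
  shows "char_element s * symmetrizer m = \<eta> (\<Prod>k=1..m. q_int q k) * char_element s"
  using assms(1)
proof (induction m)
  case (Suc m)
  then have "char_element s * symmetrizer (Suc m) =
      \<eta> (\<Prod>k=1..m. q_int q k) * (char_element s * coset_sum m)"
    by (simp add: mult.assoc[symmetric])
  also have "\<dots> = \<eta> (\<Prod>k=1..m. q_int q k) * (\<eta> (q_int q (Suc m)) * char_element s)"
    using char_element_coset_sum[OF _ assms(2)] Suc.prems by simp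
  finally show ?case by (simp add: eta_mult mult.assoc)
qed (simp add: eta_one)

definition char_square :: "nat \<Rightarrow> 'k" where
  "char_square s =
     (\<Prod>k\<leftarrow>[1..<n + 1]. \<Prod>t\<leftarrow>other_indices s. q ^ (k - 1) * Q s - Q t) * (\<Prod>k=1..n. q_int q k)"

lemma char_element_square:
  assumes "s < l"
  shows "char_element s * char_element s = \<eta> (char_square s) * char_element s"
proof -
  let ?c = "\<Prod>k\<leftarrow>[1..<n + 1]. \<Prod>t\<leftarrow>other_indices s. q ^ (k - 1) * Q s - Q t"
  have "char_element s * L_factor s k =
      \<eta> (\<Prod>t\<leftarrow>other_indices s. q ^ (k - 1) * Q s - Q t) * char_element s"
    if "k \<in> set [1..<n + 1]" for k
  proof -
    have "1 \<le> k" "k \<le> n" using that by auto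
    from char_element_L[OF this assms] show ?thesis
      unfolding L_factor_def by (intro char_element_prod_list)
        (simp add: right_diff_distrib left_diff_distrib eta_diff eta_central)
  qed
  then have "char_element s * L_product s = \<eta> ?c * char_element s"
    unfolding L_product_def by (rule char_element_prod_list)
  then have "char_element s * (L_product s * symmetrizer n) = \<eta> ?c * (char_element s * symmetrizer n)"
    by (simp only: mult.assoc[symmetric])
  then show ?thesis using char_element_symmetrizer[OF order_refl assms]
    by (simp only: char_element_def[symmetric] char_square_def eta_mult mult.assoc)
qed

definition nontrivial_words :: "nat \<Rightarrow> 'r set" where
  "nontrivial_words m = {T_word (normal_word j m) | j. is_code m j \<and> normal_word j m \<noteq> []}"

lemma nontrivial_words_SucI:
  assumes "is_code m j" "1 \<le> i" "i \<le> Suc m" "normal_word j m \<noteq> [] \<or> i \<le> m"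
  shows "T_word (normal_word j m) * T_word (rev [i..<Suc m]) \<in> nontrivial_words (Suc m)"
proof -
  note update = normal_word_update[OF assms(1-3)]
  have "normal_word j m @ rev [i..<Suc m] \<noteq> []" using assms(4) by auto
  then show ?thesis
    unfolding nontrivial_words_def T_word_simps(3)[symmetric] update(2)[symmetric] using update(1) by blast
qed

lemma symmetrizer_expand: "\<exists>r \<in> lin_span UNIV (nontrivial_words m). symmetrizer m = 1 + r"
proof (induction m)
  case (Suc m)
  let ?span = "lin_span UNIV (nontrivial_words (Suc m))"
  obtain r where r: "r \<in> lin_span UNIV (nontrivial_words m)" "symmetrizer m = 1 + r" using Suc by blast
  have "T_word (rev [i..<Suc m]) \<in> ?span" if "i \<in> {1..m}" for i
    using nontrivial_words_SucI[OF normal_word_id(2), of i m] that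
    unfolding normal_word_id(1) T_word_simps(1) mult_1_left by (intro lin_span_base) auto
  then have rest: "(\<Sum>i=1..m. T_word (rev [i..<Suc m])) \<in> ?span" by (rule lin_span_sum)
  have "r * T_word (rev [i..<Suc m]) \<in> ?span" if i: "i \<in> {1..Suc m}" for i
  proof (rule lin_span_mult_right[OF r(1)])
    fix b assume "b \<in> nontrivial_words m"
    then show "b * T_word (rev [i..<Suc m]) \<in> ?span"
      using nontrivial_words_SucI[of m _ i] i unfolding nontrivial_words_def[of m]
      by (auto intro!: lin_span_base)
  qed simp
  then have "r * coset_sum m \<in> ?span" unfolding coset_sum_def sum_distrib_left by (rule lin_span_sum)
  moreover have "coset_sum m = 1 + (\<Sum>i=1..m. T_word (rev [i..<Suc m]))"
    by (simp add: coset_sum_def add.commute)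
  then have "symmetrizer (Suc m) = 1 + ((\<Sum>i=1..m. T_word (rev [i..<Suc m])) + r * coset_sum m)"
    by (simp only: symmetrizer.simps r distrib_right mult_1_left add.assoc)
  ultimately show ?case using rest lin_span_add by blast
qed (auto intro: bexI[of _ 0] lin_span.zero)

definition nontrivial_L_monomials :: "nat list \<Rightarrow> 'r set" where
  "nontrivial_L_monomials ks =
     {(\<Prod>k\<leftarrow>ks. L k ^ c k) | c. (\<forall>k\<in>set ks. c k < l) \<and> \<not> (\<forall>k\<in>set ks. c k = 0)}"

lemma nontrivial_L_monomials_ConsI:
  assumes "k \<notin> set ks" "a < l" "\<forall>k\<in>set ks. c k < l" "a \<noteq> 0 \<or> \<not> (\<forall>k\<in>set ks. c k = 0)"
  shows "L k ^ a * (\<Prod>k\<leftarrow>ks. L k ^ c k) \<in> nontrivial_L_monomials (k # ks)"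
proof -
  have "(\<Prod>i\<leftarrow>k # ks. L i ^ (c(k := a)) i) = L k ^ a * (\<Prod>i\<leftarrow>ks. L i ^ c i)"
    using assms(1) by (auto intro!: arg_cong2[of _ _ _ _ "(*)"] arg_cong[of _ _ prod_list])
  moreover have "(\<Prod>i\<leftarrow>k # ks. L i ^ (c(k := a)) i) \<in> nontrivial_L_monomials (k # ks)"
    unfolding nontrivial_L_monomials_def using assms by (intro CollectI exI[of _ "c(k := a)"]) auto
  ultimately show ?thesis by simp
qed

lemma nontrivial_L_monomials_Cons_span:
  assumes "k \<notin> set ks"
  shows "j < l \<Longrightarrow> r \<in> lin_span UNIV (nontrivial_L_monomials ks) \<Longrightarrow>
      L k ^ j * r \<in> lin_span UNIV (nontrivial_L_monomials (k # ks))"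
    and "0 < j \<Longrightarrow> j < l \<Longrightarrow> L k ^ j * \<eta> a \<in> lin_span UNIV (nontrivial_L_monomials (k # ks))"
proof -
  show "L k ^ j * r \<in> lin_span UNIV (nontrivial_L_monomials (k # ks))"
    if j: "j < l" and r: "r \<in> lin_span UNIV (nontrivial_L_monomials ks)"
  proof (rule lin_span_mult_left[OF r])
    fix b assume "b \<in> nontrivial_L_monomials ks"
    then obtain c where "b = (\<Prod>k\<leftarrow>ks. L k ^ c k)" "\<forall>k\<in>set ks. c k < l" "\<not> (\<forall>k\<in>set ks. c k = 0)"
      unfolding nontrivial_L_monomials_def by blast
    then show "L k ^ j * b \<in> lin_span UNIV (nontrivial_L_monomials (k # ks))"
      using nontrivial_L_monomials_ConsI[OF assms j] by (simp add: lin_span_base)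
  qed simp
  show "L k ^ j * \<eta> a \<in> lin_span UNIV (nontrivial_L_monomials (k # ks))" if "0 < j" "j < l"
  proof -
    have "(\<Prod>k\<leftarrow>ks. L k ^ 0) = 1" by (induction ks) auto
    then have "L k ^ j \<in> nontrivial_L_monomials (k # ks)"
      using nontrivial_L_monomials_ConsI[OF assms, of j "\<lambda>_. 0"] that by simp
    then have "\<eta> a * L k ^ j \<in> lin_span UNIV (nontrivial_L_monomials (k # ks))"
      by (intro lin_span_base_scale) auto
    then show ?thesis by (simp only: eta_central)
  qed
qed

lemma L_factor_expand:
  assumes "s < l"
  shows "\<exists>g. \<forall>k. L_factor s k = \<eta> (\<Prod>t\<leftarrow>other_indices s. - Q t) + (\<Sum>j=1..l - 1. \<eta> (g j) * L k ^ j)"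
proof -
  have "length (other_indices s) = l - 1" using assms by (simp add: other_indices_def)
  then obtain g where "\<And>x. (\<Prod>t\<leftarrow>other_indices s. x - \<eta> (Q t)) = (\<Sum>j\<le>l - 1. \<eta> (g j) * x ^ j)"
    "g 0 = (\<Prod>t\<leftarrow>other_indices s. - Q t)"
    using prod_linear_expand[OF unital_subring_UNIV, of "other_indices s" Q] by auto
  then show ?thesis
    unfolding L_factor_def
    by (intro exI[of _ g]) (simp add: sum.atMost_shift sum.atLeast1_atMost_eq)
qed

lemma L_product_expand:
  assumes "s < l"
  shows "\<exists>r \<in> lin_span UNIV (nontrivial_L_monomials [1..<n + 1]).
    L_product s = \<eta> ((\<Prod>t\<leftarrow>other_indices s. - Q t) ^ n) + r"
proof -
  let ?\<kappa> = "\<Prod>t\<leftarrow>other_indices s. - Q t"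
  obtain g where g: "\<And>k. L_factor s k = \<eta> ?\<kappa> + (\<Sum>j=1..l - 1. \<eta> (g j) * L k ^ j)"
    using L_factor_expand[OF assms] by blast
  have "\<exists>r\<in>lin_span UNIV (nontrivial_L_monomials ks).
      (\<Prod>k\<leftarrow>ks. L_factor s k) = \<eta> (?\<kappa> ^ length ks) + r" if "distinct ks" for ks
    using that
  proof (induction ks)
    case (Cons k ks)
    let ?span = "lin_span UNIV (nontrivial_L_monomials (k # ks))"
    obtain r where r: "r \<in> lin_span UNIV (nontrivial_L_monomials ks)"
      "(\<Prod>k\<leftarrow>ks. L_factor s k) = \<eta> (?\<kappa> ^ length ks) + r"
      using Cons by auto
    have k: "k \<notin> set ks" using Cons.prems by simp
    note span = nontrivial_L_monomials_Cons_span[OF k]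
    have "(\<Sum>j=1..l - 1. \<eta> (g j) * (L k ^ j * \<eta> (?\<kappa> ^ length ks))) \<in> ?span"
      by (intro lin_span_sum lin_span_scale span(2)) auto
    moreover have "(\<Sum>j=1..l - 1. \<eta> (g j) * (L k ^ j * r)) \<in> ?span"
      by (intro lin_span_sum lin_span_scale span(1) r(1)) auto
    moreover have "\<eta> ?\<kappa> * r \<in> ?span" using span(1)[OF _ r(1), of 0] l by (simp add: lin_span_scale)
    moreover have "(\<Prod>k\<leftarrow>k # ks. L_factor s k) = \<eta> (?\<kappa> ^ length (k # ks)) + (\<eta> ?\<kappa> * r +
        ((\<Sum>j=1..l - 1. \<eta> (g j) * (L k ^ j * \<eta> (?\<kappa> ^ length ks))) + (\<Sum>j=1..l - 1. \<eta> (g j) * (L k ^ j * r))))"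
      by (simp add: r(2) g[of k] distrib_left distrib_right sum_distrib_right sum.distrib mult.assoc eta_mult
        add.assoc)
    ultimately show ?case using lin_span_add by blast
  qed (auto intro: bexI[of _ 0] lin_span.zero simp: eta_one)
  from this[of "[1..<n + 1]"] show ?thesis unfolding L_product_def by (simp del: upt_Suc)
qed

definition nontrivial_monomials :: "'r set" where
  "nontrivial_monomials = {L_monomial c * T_word (normal_word j n) | c j.
     (\<forall>k\<in>{1..n}. c k < l) \<and> is_code n j \<and> \<not> ((\<forall>k\<in>{1..n}. c k = 0) \<and> normal_word j n = [])}"

lemma nontrivial_monomialsI:
  "(\<forall>k\<in>{1..n}. c k < l) \<Longrightarrow> is_code n j \<Longrightarrow> \<not> ((\<forall>k\<in>{1..n}. c k = 0) \<and> normal_word j n = []) \<Longrightarrow>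
    L_monomial c * T_word (normal_word j n) \<in> lin_span UNIV nontrivial_monomials"
  unfolding nontrivial_monomials_def by (intro lin_span_base) auto

lemma nontrivial_monomials_mult_word:
  assumes r: "r \<in> lin_span UNIV (nontrivial_L_monomials [1..<n + 1])" and j: "is_code n j"
  shows "r * T_word (normal_word j n) \<in> lin_span UNIV nontrivial_monomials"
proof (rule lin_span_mult_right[OF r])
  fix b assume "b \<in> nontrivial_L_monomials [1..<n + 1]"
  moreover have "set [1..<n + 1] = {1..n}" by auto
  ultimately obtain c where "b = L_monomial c" "\<forall>k\<in>{1..n}. c k < l" "\<not> (\<forall>k\<in>{1..n}. c k = 0)"
    unfolding nontrivial_L_monomials_def L_monomial_def by auto
  then show "b * T_word (normal_word j n) \<in> lin_span UNIV nontrivial_monomials"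
    using nontrivial_monomialsI[OF _ j] by simp
qed simp

theorem char_element_expand:
  assumes "s < l"
  shows "\<exists>r \<in> lin_span UNIV nontrivial_monomials.
    char_element s = \<eta> ((\<Prod>t\<leftarrow>other_indices s. - Q t) ^ n) + r"
proof -
  let ?\<kappa> = "(\<Prod>t\<leftarrow>other_indices s. - Q t) ^ n" and ?span = "lin_span UNIV nontrivial_monomials"
  obtain v where v: "v \<in> lin_span UNIV (nontrivial_L_monomials [1..<n + 1])" "L_product s = \<eta> ?\<kappa> + v"
    using L_product_expand[OF assms] by blast
  obtain w where w: "w \<in> lin_span UNIV (nontrivial_words n)" "symmetrizer n = 1 + w"
    using symmetrizer_expand by blast
  have "v \<in> ?span"
    using nontrivial_monomials_mult_word[OF v(1) normal_word_id(2)] by (simp add: normal_word_id(1))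
  moreover have "1 * w \<in> ?span"
  proof (rule lin_span_mult_left[OF w(1)])
    fix b assume "b \<in> nontrivial_words n"
    then show "1 * b \<in> ?span"
      using nontrivial_monomialsI[of "\<lambda>_. 0"] l by (auto simp: nontrivial_words_def L_monomial_zero)
  qed simp
  then have "\<eta> ?\<kappa> * w \<in> ?span" by (simp add: lin_span_scale)
  moreover have "v * w \<in> ?span"
    using nontrivial_monomials_mult_word[OF v(1)]
    by (intro lin_span_mult_left[OF w(1)]) (auto simp: nontrivial_words_def)
  moreover have "char_element s = \<eta> ?\<kappa> + (v + (\<eta> ?\<kappa> * w + v * w))"
    by (simp add: char_element_def v(2) w(2) distrib_left distrib_right add_ac)
  ultimately show ?thesis using lin_span_add by blast
qed

end

section \<open>The seminormal representation on paths\<close>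

lemma poly_mapping_add_induct [case_names zero step]:
  fixes x :: "'b \<Rightarrow>\<^sub>0 'a::ab_group_add"
  assumes "P 0" and "\<And>x w c. w \<notin> Poly_Mapping.keys x \<Longrightarrow> c \<noteq> 0 \<Longrightarrow> P x \<Longrightarrow> P (Poly_Mapping.single w c + x)"
  shows "P x"
proof (induction x rule: update_induct)
  case (update f a b)
  have "Poly_Mapping.update a b f = Poly_Mapping.single a b + f"
  proof (rule poly_mapping_eqI)
    fix k
    show "Poly_Mapping.lookup (Poly_Mapping.update a b f) k =
        Poly_Mapping.lookup (Poly_Mapping.single a b + f) k"
      using update(1) by (auto simp: lookup_update lookup_add lookup_single in_keys_iff when_def)
  qed
  then show ?case using assms(2) update by simp
qed (rule assms(1))

definition rep :: "(nat \<Rightarrow> ('x \<Rightarrow> 'k) \<Rightarrow> 'x \<Rightarrow> 'k) \<Rightarrow> 'k::field free_alg \<Rightarrow> ('x \<Rightarrow> 'k) \<Rightarrow> 'x \<Rightarrow> 'k" where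
  "rep G x v = (\<lambda>u. \<Sum>w\<in>Poly_Mapping.keys x. Poly_Mapping.lookup x w * foldr G (letters w) v u)"

definition linear_ops :: "(nat \<Rightarrow> ('x \<Rightarrow> 'k::field) \<Rightarrow> 'x \<Rightarrow> 'k) \<Rightarrow> bool" where
  "linear_ops G \<longleftrightarrow> (\<forall>k v v' c. G k (\<lambda>u. c * v u + v' u) = (\<lambda>u. c * G k v u + G k v' u))"

lemma foldr_linear:
  assumes "linear_ops G"
  shows "foldr G ks (\<lambda>u. c * v u + v' u) = (\<lambda>u. c * foldr G ks v u + foldr G ks v' u)"
proof (induction ks)
  case (Cons k ks)
  then show ?case using assms unfolding linear_ops_def by simp
qed simp

lemma foldr_linear_zero:
  assumes "linear_ops G"
  shows "foldr G ks (\<lambda>u. 0) = (\<lambda>u. 0)"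
  using foldr_linear[OF assms, of ks "-1" "\<lambda>u. 0" "\<lambda>u. 0"] by (simp add: fun_eq_iff)

lemma foldr_linear_sum:
  assumes "linear_ops G" "finite S"
  shows "foldr G ks (\<lambda>u. \<Sum>i\<in>S. c i * v i u) = (\<lambda>u. \<Sum>i\<in>S. c i * foldr G ks (v i) u)"
  using assms(2)
proof (induction S rule: finite_induct)
  case (insert i S)
  then show ?case
    using foldr_linear[OF assms(1), of ks "c i" "v i" "\<lambda>u. \<Sum>i\<in>S. c i * v i u"] by simp
qed (simp add: foldr_linear_zero[OF assms(1)])

lemma rep_superset:
  assumes "finite S" "Poly_Mapping.keys x \<subseteq> S"
  shows "rep G x v u = (\<Sum>w\<in>S. Poly_Mapping.lookup x w * foldr G (letters w) v u)"
  unfolding rep_def using assms by (intro sum.mono_neutral_left) (auto simp: in_keys_iff)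

lemma rep_add: "rep G (x + y) v u = rep G x v u + rep G y v u"
proof -
  let ?S = "Poly_Mapping.keys x \<union> Poly_Mapping.keys y"
  have "finite ?S" "Poly_Mapping.keys (x + y) \<subseteq> ?S" using Poly_Mapping.keys_add[of x y] by auto
  then show ?thesis
    by (simp add: rep_superset[of ?S] lookup_add distrib_right sum.distrib)
qed

lemma rep_zero: "rep G 0 v u = 0" by (simp add: rep_def)

lemma rep_uminus: "rep G (- x) v u = - rep G x v u"
  using rep_add[of G x "- x" v u] by (simp add: rep_zero eq_neg_iff_add_eq_0 add.commute)

lemma rep_diff: "rep G (x - y) v u = rep G x v u - rep G y v u"
  using rep_add[of G x "- y" v u] by (simp add: rep_uminus)

lemma rep_single: "rep G (Poly_Mapping.single w c) v u = c * foldr G (letters w) v u"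
  by (simp add: rep_def)

lemma rep_gen: "rep G (free_gen i) v = G i v"
  by (simp add: rep_single free_gen_def fun_eq_iff)

lemma rep_const: "rep G (free_const c) v u = c * v u"
  by (simp add: rep_single free_const_def zero_free_monoid_def)

lemma rep_one: "rep G 1 v = v"
  using rep_const[of G 1 v] by (simp add: free_const_def fun_eq_iff)

lemma rep_linear_sum:
  assumes "linear_ops G" "finite S"
  shows "rep G x (\<lambda>u. \<Sum>i\<in>S. c i * v i u) u = (\<Sum>i\<in>S. c i * rep G x (v i) u)"
  unfolding rep_def foldr_linear_sum[OF assms]
  by (simp add: sum_distrib_left sum.swap[of _ S] mult.left_commute)

lemma rep_mult:
  assumes "linear_ops G"
  shows "rep G (x * y) v = rep G x (rep G y v)"
proof -
  have "rep G (x * y) v u = rep G x (rep G y v) u" for u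
  proof (induction x rule: poly_mapping_add_induct)
    case (step x w c)
    have "rep G (Poly_Mapping.single w c * y) v u = c * foldr G (letters w) (rep G y v) u"
    proof (induction y rule: poly_mapping_add_induct)
      case zero
      then show ?case using foldr_linear_zero[OF assms] by (simp add: rep_zero[abs_def] rep_def)
    next
      case (step y w' c')
      have "rep G (Poly_Mapping.single w' c' + y) v = (\<lambda>u. c' * foldr G (letters w') v u + rep G y v u)"
        by (simp add: rep_add rep_single fun_eq_iff)
      then show ?case
        using step by (simp add: distrib_left rep_add mult_single rep_single foldr_linear[OF assms]
            plus_free_monoid_def)
    qed
    then show ?case using step by (simp add: distrib_right rep_add rep_single)
  qed (simp add: rep_zero)
  then show ?thesis by blast
qed

lemma rep_intertwine:
  assumes intertwine: "\<And>k v p. k \<in> K \<Longrightarrow> p \<in> W \<Longrightarrow> G k v (\<iota> p) = G' k (\<lambda>r. v (\<iota> r)) p"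
    and local: "\<And>k v v' p. k \<in> K \<Longrightarrow> p \<in> W \<Longrightarrow> (\<And>r. r \<in> W \<Longrightarrow> v r = v' r) \<Longrightarrow> G' k v p = G' k v' p"
    and x: "\<And>w. w \<in> Poly_Mapping.keys x \<Longrightarrow> set (letters w) \<subseteq> K" and p: "p \<in> W"
  shows "rep G x v (\<iota> p) = rep G' x (\<lambda>r. v (\<iota> r)) p"
proof -
  have "foldr G ks v (\<iota> p) = foldr G' ks (\<lambda>r. v (\<iota> r)) p" if "set ks \<subseteq> K" "p \<in> W" for ks p
    using that
  proof (induction ks arbitrary: p)
    case (Cons k ks)
    have "foldr G (k # ks) v (\<iota> p) = G' k (\<lambda>r. foldr G ks v (\<iota> r)) p"
      using intertwine[of k p] Cons.prems by simp
    also have "\<dots> = G' k (foldr G' ks (\<lambda>r. v (\<iota> r))) p" using Cons by (intro local) auto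
    finally show ?case by simp
  qed simp
  then show ?thesis unfolding rep_def using x p by (intro sum.cong refl) auto
qed

lemma rep_cong:
  assumes local: "\<And>k v v' p. k \<in> K \<Longrightarrow> p \<in> W \<Longrightarrow> (\<And>r. r \<in> W \<Longrightarrow> v r = v' r) \<Longrightarrow> G k v p = G k v' p"
    and x: "\<And>w. w \<in> Poly_Mapping.keys x \<Longrightarrow> set (letters w) \<subseteq> K" and p: "p \<in> W"
    and v: "\<And>r. r \<in> W \<Longrightarrow> v r = v' r"
  shows "rep G x v p = rep G x v' p"
proof -
  have "foldr G ks v p = foldr G ks v' p" if "set ks \<subseteq> K" "p \<in> W" for ks p
    using that
  proof (induction ks arbitrary: p)
    case (Cons k ks)
    then show ?case by (simp, intro local) auto
  qed (use v in simp)
  then show ?thesis unfolding rep_def using x p by (intro sum.cong refl) auto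
qed

lemma free_algebra_single_add:
  assumes "Poly_Mapping.single w c + x \<in> carrier (free_algebra n)" "w \<notin> Poly_Mapping.keys x" "c \<noteq> 0"
  shows "set (letters w) \<subseteq> {..<n}" "x \<in> carrier (free_algebra n)"
proof -
  have keys: "Poly_Mapping.keys (Poly_Mapping.single w c + x) = insert w (Poly_Mapping.keys x)"
    using assms(2,3) by (auto simp: in_keys_iff lookup_add lookup_single when_def split: if_splits)
  show "set (letters w) \<subseteq> {..<n}" "x \<in> carrier (free_algebra n)"
    using assms(1) unfolding free_algebra_carrier_iff keys by auto
qed

lemma ak_relationsE:
  assumes "r \<in> ak_relations l n q Q"
  obtains (cyclotomic) "r = (\<Prod>s\<leftarrow>[0..<l]. free_gen 0 - free_const (Q s))"
    | (quadratic) i where "1 \<le> i" "i < n" "r = (free_gen i - free_const q) * (free_gen i + 1)"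
    | (braid0) "2 \<le> n"
        "r = free_gen 0 * free_gen 1 * free_gen 0 * free_gen 1 -
            free_gen 1 * free_gen 0 * free_gen 1 * free_gen 0"
    | (braid) i where "1 \<le> i" "i + 1 < n"
        "r = free_gen i * free_gen (i + 1) * free_gen i - free_gen (i + 1) * free_gen i * free_gen (i + 1)"
    | (far_commute) i j where "i + 1 < j" "j < n" "r = free_gen i * free_gen j - free_gen j * free_gen i"
  using assms unfolding ak_relations_def by (auto split: if_splits)

lemma ideal_free_algebraI:
  fixes N :: "'k::field free_alg set"
  assumes "N \<subseteq> carrier (free_algebra n)" "0 \<in> N" "\<And>x y. x \<in> N \<Longrightarrow> y \<in> N \<Longrightarrow> x + y \<in> N"
    "\<And>x r. x \<in> N \<Longrightarrow> r \<in> carrier (free_algebra n) \<Longrightarrow> r * x \<in> N"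
    "\<And>x r. x \<in> N \<Longrightarrow> r \<in> carrier (free_algebra n) \<Longrightarrow> x * r \<in> N"
  shows "ideal N (free_algebra n)"
proof (rule idealI)
  show "ring (free_algebra n :: 'k free_alg ring)" by (rule ring_free_algebra)
  interpret R: ring "free_algebra n :: 'k free_alg ring" by (rule ring_free_algebra)
  show "subgroup N (add_monoid (free_algebra n))"
  proof (rule R.add.subgroupI)
    show "N \<subseteq> carrier (free_algebra n)" "N \<noteq> {}" using assms(1,2) by auto
    fix x assume x: "x \<in> N"
    have "- 1 * x \<in> N" using assms(4)[OF x, of "- 1"] by (simp add: free_algebra_closed)
    moreover have "\<ominus>\<^bsub>free_algebra n\<^esub> x = - x"
      using x assms(1) by (intro R.minus_equality) (auto simp: free_algebra_simps free_algebra_closed)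
    ultimately show "\<ominus>\<^bsub>free_algebra n\<^esub> x \<in> N" by simp
  qed (use assms(3) in \<open>simp add: free_algebra_simps\<close>)
qed (use assms in \<open>auto simp: free_algebra_simps\<close>)

type_synonym node = "nat \<times> nat \<times> nat"

definition content :: "node \<Rightarrow> int" where
  "content x = (case x of (s, i, j) \<Rightarrow> int j - int i)"

definition addable :: "nat \<Rightarrow> node set \<Rightarrow> node \<Rightarrow> bool" where
  "addable l D x = (case x of (s, i, j) \<Rightarrow> s < l \<and> 1 \<le> i \<and> 1 \<le> j \<and> (s, i, j) \<notin> D \<and>
     (1 < i \<longrightarrow> (s, i - 1, j) \<in> D) \<and> (1 < j \<longrightarrow> (s, i, j - 1) \<in> D))"

primrec path_from :: "nat \<Rightarrow> node set \<Rightarrow> node list \<Rightarrow> bool" where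
  "path_from l D [] = True"
| "path_from l D (x # p) = (addable l D x \<and> path_from l (insert x D) p)"

abbreviation "path l \<equiv> path_from l {}"

definition paths :: "nat \<Rightarrow> nat \<Rightarrow> node list set" where
  "paths l n = {p. path l p \<and> length p = n}"

lemma path_from_append: "path_from l D (u @ w) \<longleftrightarrow> path_from l D u \<and> path_from l (set u \<union> D) w"
  by (induction u arbitrary: D) auto

lemma path_from_distinct: "path_from l D p \<Longrightarrow> distinct p \<and> set p \<inter> D = {}"
  by (induction p arbitrary: D) (auto simp: addable_def)

definition closed_diagram :: "nat \<Rightarrow> node set \<Rightarrow> bool" where
  "closed_diagram l D \<longleftrightarrow> (\<forall>s i j. (s, i, j) \<in> D \<longrightarrow> s < l \<and> 1 \<le> i \<and> 1 \<le> j \<and>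
     (1 < i \<longrightarrow> (s, i - 1, j) \<in> D) \<and> (1 < j \<longrightarrow> (s, i, j - 1) \<in> D))"

lemma closed_diagram_insert: "closed_diagram l D \<Longrightarrow> addable l D x \<Longrightarrow> closed_diagram l (insert x D)"
  by (auto simp: closed_diagram_def addable_def split: prod.splits)

lemma path_from_closed: "closed_diagram l D \<Longrightarrow> path_from l D p \<Longrightarrow> closed_diagram l (set p \<union> D)"
proof (induction p arbitrary: D)
  case (Cons x p)
  then show ?case using Cons.IH[of "insert x D"] closed_diagram_insert by auto
qed simp

lemma path_closed: "path l p \<Longrightarrow> closed_diagram l (set p)"
  using path_from_closed[of l "{}" p] by (simp add: closed_diagram_def)

lemma path_distinct: "path l p \<Longrightarrow> distinct p" using path_from_distinct by blast

lemma closed_diagram_down: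
  assumes "closed_diagram l D" "(s, i, j) \<in> D" "1 \<le> i'" "i' \<le> i" "1 \<le> j'" "j' \<le> j"
  shows "(s, i', j') \<in> D"
proof -
  have up: "(s, i - k, j) \<in> D" if "k < i" for k using that
  proof (induction k)
    case (Suc k)
    then have "(s, i - k - 1, j) \<in> D" using assms(1) unfolding closed_diagram_def
      by (metis Suc_lessD less_diff_conv plus_1_eq_Suc)
    then show ?case by simp
  qed (use assms in simp)
  have left: "(s, i', j - k) \<in> D" if "k < j" for k using that
  proof (induction k)
    case 0
    then show ?case using up[of "i - i'"] assms by simp
  next
    case (Suc k)
    then have "(s, i', j - k - 1) \<in> D" using assms(1) unfolding closed_diagram_def
      by (metis Suc_lessD less_diff_conv plus_1_eq_Suc)
    then show ?case by simp
  qed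
  from left[of "j - j'"] assms show ?thesis by simp
qed

lemma arm_plus_leg_le_card:
  assumes D: "closed_diagram l D" "finite D" and x: "(s, i, j) \<in> D" and y: "(t, i', j') \<in> D"
  shows "j + i' \<le> card D + (if s = t then 1 else 0)"
proof -
  have "1 \<le> i" "1 \<le> j" "1 \<le> i'" "1 \<le> j'" using D(1) x y by (auto simp: closed_diagram_def)
  let ?row = "(\<lambda>k. (s, 1, k)) ` {1..j}" and ?col = "(\<lambda>k. (t, k, 1)) ` {(if s = t then 2 else 1)..i'}"
  have "?row \<subseteq> D" using closed_diagram_down[OF D(1) x] \<open>1 \<le> i\<close> by auto
  moreover have "?col \<subseteq> D" using closed_diagram_down[OF D(1) y] \<open>1 \<le> j'\<close> by (auto split: if_splits)
  ultimately have "card (?row \<union> ?col) \<le> card D" using D(2) by (intro card_mono) auto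
  moreover have "card (?row \<union> ?col) = j + (i' - (if s = t then 1 else 0))"
    by (cases "s = t"; subst card_Un_disjoint) (auto simp: card_image inj_on_def)
  ultimately show ?thesis using \<open>1 \<le> i'\<close> by (simp split: if_splits)
qed

lemma content_diff_less:
  assumes "closed_diagram l D" "finite D" "x \<in> D" "y \<in> D"
  shows "\<bar>content x - content y\<bar> < int (card D) - (if fst x = fst y then 0 else 1)"
proof -
  obtain s i j t i' j' where xy: "x = (s, i, j)" "y = (t, i', j')" by (cases x, cases y) auto
  have "1 \<le> i" "1 \<le> j" "1 \<le> i'" "1 \<le> j'" using assms xy by (auto simp: closed_diagram_def)
  then show ?thesis
    using arm_plus_leg_le_card[of l D s i j t i' j'] arm_plus_leg_le_card[of l D t i' j' s i j] assms
    by (auto simp: content_def xy split: if_splits)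
qed

definition adjacent :: "node \<Rightarrow> node \<Rightarrow> bool" where
  "adjacent x y = (case x of (s, i, j) \<Rightarrow> y = (s, i, Suc j) \<or> y = (s, Suc i, j))"

lemma addable_swap:
  assumes x: "addable l D x" and y: "addable l (insert x D) y"
  shows "addable l D y \<and> addable l (insert y D) x \<longleftrightarrow> \<not> adjacent x y"
proof
  obtain s i j where y_eq: "y = (s, i, j)" by (cases y) auto
  assume "\<not> adjacent x y"
  then have "1 < i \<Longrightarrow> (s, i - 1, j) \<noteq> x" "1 < j \<Longrightarrow> (s, i, j - 1) \<noteq> x" by (auto simp: adjacent_def y_eq)
  then have "addable l D y" using y by (simp add: addable_def y_eq)
  moreover have "y \<noteq> x" using y by (auto simp: addable_def y_eq)
  then have "addable l (insert y D) x" using x by (simp add: addable_def split: prod.splits)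
  ultimately show "addable l D y \<and> addable l (insert y D) x" ..
next
  assume "addable l D y \<and> addable l (insert y D) x"
  then show "\<not> adjacent x y" using x by (auto simp: addable_def adjacent_def)
qed

lemma addable_distinct_content:
  assumes D: "closed_diagram l D" and x: "addable l D x" and y: "addable l D y"
    and "fst x = fst y" "x \<noteq> y"
  shows "content x \<noteq> content y"
proof
  assume same_content: "content x = content y"
  have no_lower: False if lower: "addable l D (s, i, j)" "addable l D (s, i', j')" "i < i'"
     and diagonal: "int j - int i = int j' - int i'" for s i j i' j'
  proof -
    have "(s, i' - 1, j') \<in> D" "1 \<le> i" "1 \<le> j" using lower by (auto simp: addable_def)
    from closed_diagram_down[OF D this(1), of i j] this(2,3) lower(3) diagonal have "(s, i, j) \<in> D" by auto
    then show False using lower(1) by (simp add: addable_def)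
  qed
  obtain s i j i' j' where xy: "x = (s, i, j)" "y = (s, i', j')" using assms(4) by (cases x, cases y) auto
  then show False using no_lower[of s i j i' j'] no_lower[of s i' j' i j] assms same_content
    by (cases i i' rule: linorder_cases) (auto simp: content_def)
qed

lemma consecutive_distinct_content:
  assumes D: "closed_diagram l D" and x: "addable l D x" and y: "addable l (insert x D) y"
    and "fst x = fst y"
  shows "content x \<noteq> content y"
proof (cases "adjacent x y")
  case True
  then show ?thesis by (auto simp: adjacent_def content_def split: prod.splits)
next
  case False
  then have "addable l D y" using addable_swap[OF x y] by simp
  moreover have "x \<noteq> y" using y by (auto simp: addable_def split: prod.splits)
  ultimately show ?thesis using addable_distinct_content[OF D x] assms by blast
qed

lemma next_but_one_distinct_content:
  assumes D: "closed_diagram l D" and x: "addable l D x" and y: "addable l (insert x D) y"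
    and z: "addable l (insert y (insert x D)) z" and "fst x = fst z"
  shows "content x \<noteq> content z"
proof -
  consider (yz) "\<not> adjacent y z" | (xy) "\<not> adjacent x y" | (both) "adjacent x y" "adjacent y z" by blast
  then show ?thesis
  proof cases
    case yz
    then have "addable l (insert x D) z" using addable_swap[OF y z] by simp
    then show ?thesis using consecutive_distinct_content[OF D x] assms by blast
  next
    case xy
    then have "addable l D y" "addable l (insert y D) x" using addable_swap[OF x y] by auto
    then show ?thesis
      using consecutive_distinct_content[of l "insert y D" x z] closed_diagram_insert[OF D] z assms
      by (simp add: insert_commute)
  next
    case both
    show ?thesis
    proof
      assume same_content: "content x = content z"
      obtain s i j where x_eq: "x = (s, i, j)" by (cases x) auto
      from both same_content have z_eq: "z = (s, Suc i, Suc j)"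
        and y_eq: "y = (s, i, Suc j) \<or> y = (s, Suc i, j)"
        by (auto simp: x_eq adjacent_def content_def)
      have "1 \<le> i" "1 \<le> j" using x by (auto simp: x_eq addable_def)
      then have "(s, Suc i, j) \<in> insert y (insert x D)" "(s, i, Suc j) \<in> insert y (insert x D)"
        using z by (auto simp: z_eq addable_def)
      then have "(s, Suc i, j) \<in> D \<or> (s, i, Suc j) \<in> D" using y_eq x_eq by auto
      then have "(s, i, j) \<in> D"
        using closed_diagram_down[OF D] \<open>1 \<le> i\<close> \<open>1 \<le> j\<close> by (metis le_SucI order_refl)
      then show False using x by (simp add: x_eq addable_def)
    qed
  qed
qed

lemma length_paths: "p \<in> paths l n \<Longrightarrow> length p = n" and path_paths: "p \<in> paths l n \<Longrightarrow> path l p"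
  by (auto simp: paths_def)

lemma paths_Suc: "paths l (Suc n) = {p @ [x] | p x. p \<in> paths l n \<and> addable l (set p) x}"
proof -
  have "p \<in> {p @ [x] | p x. p \<in> paths l n \<and> addable l (set p) x}" if "p \<in> paths l (Suc n)" for p
    using that by (cases p rule: rev_cases) (auto simp: paths_def path_from_append)
  then show ?thesis by (auto simp: paths_def path_from_append)
qed

lemma finite_addable:
  assumes "finite D"
  shows "finite {x. addable l D x}"
proof -
  let ?X = "{..<l} \<times> {1} \<times> {1} \<union> (\<lambda>(s, i, j). (s, Suc i, j)) ` D \<union> (\<lambda>(s, i, j). (s, i, Suc j)) ` D"
  have "{x. addable l D x} \<subseteq> ?X"
  proof
    fix x assume "x \<in> {x. addable l D x}"
    then obtain s i j where x: "x = (s, i, j)" "addable l D (s, i, j)" by (cases x) auto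
    have "1 \<le> i" "1 \<le> j" using x(2) by (auto simp: addable_def)
    then consider (below) "1 < i" | (right) "1 < j" | (corner) "i = 1" "j = 1" by linarith
    then show "x \<in> ?X"
    proof cases
      case below
      then have "(s, i - 1, j) \<in> D" "Suc (i - 1) = i" using x by (auto simp: addable_def)
      then show ?thesis using x by (force intro: rev_image_eqI)
    next
      case right
      then have "(s, i, j - 1) \<in> D" "Suc (j - 1) = j" using x by (auto simp: addable_def)
      then show ?thesis using x by (force intro: rev_image_eqI)
    qed (use x in \<open>auto simp: addable_def\<close>)
  qed
  then show ?thesis using assms by (auto intro: finite_subset)
qed

lemma finite_paths: "finite (paths l n)"
proof (induction n)
  case (Suc n)
  have "paths l (Suc n) = (\<Union>p\<in>paths l n. (\<lambda>x. p @ [x]) ` {x. addable l (set p) x})"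
    unfolding paths_Suc by auto
  then show ?case using Suc by (simp add: finite_addable)
qed (simp add: paths_def)

definition residue :: "'k::field \<Rightarrow> (nat \<Rightarrow> 'k) \<Rightarrow> node \<Rightarrow> 'k" where
  "residue q Q x = q powi content x * Q (fst x)"

definition path_op :: "nat \<Rightarrow> 'k::field \<Rightarrow> (nat \<Rightarrow> 'k) \<Rightarrow> nat \<Rightarrow> (node list \<Rightarrow> 'k) \<Rightarrow> node list \<Rightarrow> 'k" where
  "path_op l q Q k v p =
     (if k = 0 then Q (fst (hd p)) * v p
      else
        let x = p ! (k - 1); y = p ! k; a = seminormal_coeff q Q x y; p' = p[k - 1 := y, k := x]
        in a * v p + (if path l p' then (q - a) * v p' else 0))"

lemma path_op_0: "path_op l q Q 0 v p = Q (fst (hd p)) * v p"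
  by (simp add: path_op_def)

lemma path_op_swap:
  assumes "k = Suc (length u)"
  shows "path_op l q Q k v (u @ x # y # w) = seminormal_coeff q Q x y * v (u @ x # y # w) +
    (if path l (u @ y # x # w) then (q - seminormal_coeff q Q x y) * v (u @ y # x # w) else 0)"
  using assms by (simp add: path_op_def Let_def nth_append list_update_append)

lemma linear_path_op: "linear_ops (path_op l q Q)"
  unfolding linear_ops_def path_op_def Let_def by (auto simp: fun_eq_iff algebra_simps)

lemma split_at_consecutive:
  assumes "1 \<le> k" "k < length p"
  obtains u x y w where "p = u @ x # y # w" "k = Suc (length u)"
proof -
  have "p = take (k - 1) p @ drop (k - 1) p" by simp
  also have "drop (k - 1) p = p ! (k - 1) # drop (Suc (k - 1)) p"
    using assms by (intro Cons_nth_drop_Suc[symmetric]) simp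
  also have "drop (Suc (k - 1)) p = p ! k # drop (Suc k) p"
    using assms by (simp add: Cons_nth_drop_Suc)
  finally have "p = take (k - 1) p @ p ! (k - 1) # p ! k # drop (Suc k) p" .
  moreover have "k = Suc (length (take (k - 1) p))" using assms by simp
  ultimately show thesis using that by blast
qed

lemma path_op_cong:
  assumes "k < n" "p \<in> paths l n" "\<And>r. r \<in> paths l n \<Longrightarrow> set r = set p \<Longrightarrow> v r = v' r"
  shows "path_op l q Q k v p = path_op l q Q k v' p"
proof (cases "k = 0")
  case True
  then show ?thesis using assms by (simp add: path_op_0)
next
  case False
  then have "1 \<le> k" "k < length p" using assms length_paths[of p l n] by auto
  then obtain u x y w where p: "p = u @ x # y # w" "k = Suc (length u)" by (rule split_at_consecutive)
  have "v (u @ x # y # w) = v' (u @ x # y # w)" using assms p by blast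
  moreover have "v (u @ y # x # w) = v' (u @ y # x # w)" if "path l (u @ y # x # w)"
    using that assms(2) p by (intro assms(3)) (auto simp: paths_def)
  ultimately show ?thesis unfolding p(1) path_op_swap[OF p(2)] by simp
qed

lemma path_rep_cong:
  assumes x: "x \<in> carrier (free_algebra m)" and p: "p \<in> paths l m"
    and v: "\<And>r. r \<in> paths l m \<Longrightarrow> set r = set p \<Longrightarrow> v r = v' r"
  shows "rep (path_op l q Q) x v p = rep (path_op l q Q) x v' p"
proof (rule rep_cong[of "{..<m}" "{r\<in>paths l m. set r = set p}"])
  show "\<And>w. w \<in> Poly_Mapping.keys x \<Longrightarrow> set (letters w) \<subseteq> {..<m}"
    using x by (simp add: free_algebra_carrier_iff)
  show "path_op l q Q k v r = path_op l q Q k v' r" if "k \<in> {..<m}" "r \<in> {r\<in>paths l m. set r = set p}"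
    "\<And>r. r \<in> {r\<in>paths l m. set r = set p} \<Longrightarrow> v r = v' r" for k v v' r
    using that by (intro path_op_cong[of k m r l]) auto
qed (use p v in auto)

lemma path_rep_zero: "rep (path_op l q Q) x (\<lambda>_. 0) p = 0"
  by (simp add: rep_def foldr_linear_zero[OF linear_path_op])

lemma q_int_eq: "(q - 1) * q_int q m = q ^ m - 1" for q :: "'k::field"
  unfolding q_int_def using power_diff_1_eq[of q m] by (simp add: mult.commute)

lemma q_int_1: "q_int 1 m = of_nat m"
  by (simp add: q_int_def)

lemma divide_diff_flip: "X / (X - Y) = - (X / (Y - X))" for X Y :: "'k::field"
  using minus_divide_right[of X "Y - X"] by simp

lemma divide_diff_sum:
  fixes X Y :: "'k::field"
  assumes "X \<noteq> Y"
  shows "Y / (Y - X) + X / (X - Y) = 1"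
  unfolding divide_diff_flip[of X Y] using assms by (simp add: diff_divide_distrib[symmetric])

locale separated =
  fixes l n :: nat and q :: "'k::field" and Q :: "nat \<Rightarrow> 'k"
  assumes l: "1 \<le> l" and q0: "q \<noteq> 0" and Q0: "s < l \<Longrightarrow> Q s \<noteq> 0"
    and q_int_nonzero: "1 \<le> m \<Longrightarrow> m \<le> n \<Longrightarrow> q_int q m \<noteq> 0"
    and Q_separated: "s < l \<Longrightarrow> t < l \<Longrightarrow> s \<noteq> t \<Longrightarrow> \<bar>d\<bar> < int n \<Longrightarrow> q powi d * Q s \<noteq> Q t"
begin

abbreviation "a \<equiv> seminormal_coeff q Q"
abbreviation "res \<equiv> residue q Q"
abbreviation "F \<equiv> path_op l q Q"

lemma powi_nonzero: "q powi d \<noteq> 0" using q0 by simp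

lemma of_int_nonzero:
  assumes "q = 1" "d \<noteq> 0" "\<bar>d\<bar> \<le> int n"
  shows "of_int d \<noteq> (0 :: 'k)"
proof -
  have "q_int q (nat \<bar>d\<bar>) \<noteq> 0" using assms by (intro q_int_nonzero) auto
  then have "of_nat (nat \<bar>d\<bar>) \<noteq> (0 :: 'k)" using assms by (simp add: q_int_1)
  moreover have "d = int (nat \<bar>d\<bar>) \<or> d = - int (nat \<bar>d\<bar>)" by auto
  ultimately show ?thesis by (metis of_int_of_nat_eq of_int_minus neg_equal_0_iff_equal)
qed

lemma powi_neq_1:
  assumes "q \<noteq> 1" "d \<noteq> 0" "\<bar>d\<bar> \<le> int n"
  shows "q powi d \<noteq> 1"
proof -
  have "q_int q (nat \<bar>d\<bar>) \<noteq> 0" using assms by (intro q_int_nonzero) auto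
  then have power: "q ^ nat \<bar>d\<bar> \<noteq> 1" using q_int_eq[of q "nat \<bar>d\<bar>"] assms by auto
  show ?thesis
  proof (cases "d \<ge> 0")
    case True
    then show ?thesis using power by (simp add: power_int_nonneg_exp)
  next
    case False
    then have "q powi d = inverse (q ^ nat \<bar>d\<bar>)" by (simp add: power_int_def power_inverse)
    then show ?thesis using power by (metis inverse_1 inverse_inverse_eq)
  qed
qed

definition distinguishable :: "node \<Rightarrow> node \<Rightarrow> bool" where
  "distinguishable x y \<longleftrightarrow> fst x < l \<and> fst y < l \<and>
     (if fst x = fst y \<and> q = 1 then of_int (content y - content x) \<noteq> (0 :: 'k) else res x \<noteq> res y)"

lemma distinguishable_sym: "distinguishable x y \<Longrightarrow> distinguishable y x"
  by (auto simp: distinguishable_def)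

lemma distinguishableI:
  assumes "fst x < l" "fst y < l" "fst x = fst y \<Longrightarrow> content x \<noteq> content y \<and> \<bar>content x - content y\<bar> \<le> int n"
    "fst x \<noteq> fst y \<Longrightarrow> \<bar>content x - content y\<bar> < int n"
  shows "distinguishable x y"
proof (cases "fst x = fst y")
  case True
  show ?thesis
  proof (cases "q = 1")
    case q: True
    have "of_int (content y - content x) \<noteq> (0 :: 'k)" using assms True by (intro of_int_nonzero[OF q]) auto
    then show ?thesis unfolding distinguishable_def using assms True q by simp
  next
    case q: False
    have "q powi (content x - content y) \<noteq> 1" using assms True by (intro powi_neq_1 q) auto
    then have "q powi content x \<noteq> q powi content y" using powi_nonzero by (simp add: power_int_diff q0)
    then show ?thesis using True q assms Q0[of "fst x"] by (auto simp: distinguishable_def residue_def)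
  qed
next
  case False
  have "q powi (content x - content y) * Q (fst x) \<noteq> Q (fst y)" using assms False by (intro Q_separated) auto
  then have "res x \<noteq> res y" using powi_nonzero by (auto simp: residue_def power_int_diff q0 field_simps)
  then show ?thesis using False assms by (simp add: distinguishable_def)
qed

lemma seminormal_coeff_eq_residue:
  assumes "q \<noteq> 1" "distinguishable x y"
  shows "a x y = (q - 1) * res y / (res y - res x)"
proof (cases "fst x = fst y")
  case True
  obtain s i j i' j' where xy: "x = (s, i, j)" "y = (s, i', j')" using True by (cases x, cases y) auto
  let ?d = "content y - content x"
  have "a x y = q powi ?d * (q - 1) / (q powi ?d - 1)"
    using assms by (simp add: seminormal_coeff_def xy content_def Let_def)
  moreover have "Q s \<noteq> 0" using assms Q0 by (auto simp: distinguishable_def xy)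
  moreover have "q powi ?d * res x = res y" using powi_nonzero by (simp add: residue_def xy power_int_diff q0)
  moreover have "res x \<noteq> 0" using calculation(2) powi_nonzero by (simp add: residue_def xy)
  moreover have "res x \<noteq> res y" using assms by (simp add: distinguishable_def)
  moreover have "q powi ?d \<noteq> 1" using calculation(3,5) by auto
  moreover have "(q - 1) * (D * X) / (D * X - X) = D * (q - 1) / (D - 1)" if "X \<noteq> 0" for D X :: 'k
  proof -
    have "(q - 1) * (D * X) / (D * X - X) = (D * (q - 1) * X) / ((D - 1) * X)"
      by (simp add: algebra_simps)
    then show ?thesis using that by simp
  qed
  ultimately have "a x y = (q - 1) * (q powi ?d * res x) / (q powi ?d * res x - res x)" by metis
  then show ?thesis using \<open>q powi ?d * res x = res y\<close> by simp
next
  case False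
  then show ?thesis
    by (cases x, cases y) (simp add: seminormal_coeff_def residue_def content_def Let_def)
qed

lemma seminormal_coeff_q_1:
  assumes "q = 1"
  shows "a x y = (if fst x = fst y then 1 / of_int (content y - content x) else 0)"
  using assms by (cases x, cases y) (simp add: seminormal_coeff_def content_def Let_def)

lemma seminormal_coeff_add_swap:
  assumes "distinguishable x y"
  shows "a x y + a y x = q - 1"
proof (cases "q = 1")
  case True
  have "of_int (content x - content y) = - (of_int (content y - content x) :: 'k)" by simp
  then have "1 / of_int (content y - content x) + 1 / of_int (content x - content y) = (0 :: 'k)"
    by (simp only: divide_minus_right) simp
  then show ?thesis unfolding seminormal_coeff_q_1[OF True] by (auto simp: True)
next
  case False
  have "res x \<noteq> res y" using assms False by (simp add: distinguishable_def)
  then have "res y / (res y - res x) + res x / (res x - res y) = 1" by (rule divide_diff_sum)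
  then have "(q - 1) * (res y / (res y - res x) + res x / (res x - res y)) = q - 1" by simp
  then show ?thesis using seminormal_coeff_eq_residue[OF False assms]
    seminormal_coeff_eq_residue[OF False distinguishable_sym[OF assms]]
    by (simp add: distrib_left)
qed

lemma seminormal_coeff_residue_swap:
  assumes "distinguishable x y"
  shows "a x y * res x + a y x * res y = 0"
proof (cases "q = 1")
  case True
  have "a x y + a y x = 0" using seminormal_coeff_add_swap[OF assms] True by simp
  moreover have "a x y = 0 \<or> Q (fst x) = Q (fst y)" unfolding seminormal_coeff_q_1[OF True] by auto
  moreover have "res z = Q (fst z)" for z using True by (simp add: residue_def)
  ultimately show ?thesis by (auto simp: distrib_right[symmetric] add_eq_0_iff)
next
  case False
  have "res x \<noteq> res y" using assms False by (simp add: distinguishable_def)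
  moreover
  have "(q - 1) * Y / (Y - X) * X + (q - 1) * X / (X - Y) * Y = 0" if "X \<noteq> Y" for X Y :: 'k
    unfolding times_divide_eq_right[symmetric] divide_diff_flip[of X Y] by simp
  ultimately show ?thesis using seminormal_coeff_eq_residue[OF False assms]
    seminormal_coeff_eq_residue[OF False distinguishable_sym[OF assms]]
    by simp
qed

lemma seminormal_coeff_yang_baxter:
  assumes "distinguishable x y" "distinguishable y z" "distinguishable x z"
  shows "a x y * a y z = a x z * (a x y + a y z - (q - 1))"
proof (cases "q = 1")
  case True
  show ?thesis
  proof (cases "fst x = fst y \<and> fst y = fst z")
    case same: True
    let ?u = "of_int (content y - content x) :: 'k" and ?v = "of_int (content z - content y) :: 'k"
    have nonzero: "?u \<noteq> 0" "?v \<noteq> 0" "?u + ?v \<noteq> 0"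
      using assms same True unfolding distinguishable_def by auto
    have "a x y = 1 / ?u" "a y z = 1 / ?v" "a x z = 1 / (?u + ?v)" unfolding seminormal_coeff_q_1[OF True]
      using same by simp_all
    moreover have "1 / U * (1 / V) = 1 / (U + V) * (1 / U + 1 / V - (q - 1))"
      if "U \<noteq> 0" "V \<noteq> 0" "U + V \<noteq> 0" for U V :: 'k
      unfolding True using that by (simp add: add_frac_eq) (simp add: add.commute)
    ultimately show ?thesis using nonzero by metis
  next
    case False
    then show ?thesis unfolding seminormal_coeff_q_1[OF True] by (auto simp: True)
  qed
next
  case False
  have distinct: "res x \<noteq> res y" "res y \<noteq> res z" "res x \<noteq> res z" using assms False
    by (auto simp: distinguishable_def)
  have partial_fractions: "Y / (Y - X) * (Z / (Z - Y)) = Z / (Z - X) * (Y / (Y - X) + Z / (Z - Y) - 1)"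
    if "X \<noteq> Y" "Y \<noteq> Z" "X \<noteq> Z" for X Y Z :: 'k
    using that by (simp add: divide_simps) (simp add: algebra_simps)
  have ring: "c * c * (W * (U + V - 1)) = c * W * (c * U + c * V - c)" for c U V W :: 'k
    by (simp add: algebra_simps)
  have "a x y * a y z = (q - 1) * (q - 1) * (res y / (res y - res x) * (res z / (res z - res y)))"
    using seminormal_coeff_eq_residue[OF False] assms by simp
  also have "\<dots> = (q - 1) * (res z / (res z - res x)) *
     ((q - 1) * (res y / (res y - res x)) + (q - 1) * (res z / (res z - res y)) - (q - 1))"
    unfolding partial_fractions[OF distinct] using ring by blast
  finally show ?thesis using seminormal_coeff_eq_residue[OF False] assms by simp
qed

lemma seminormal_coeff_same_row: "a (s, i, j) (s, i, Suc j) = q"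
  by (simp add: seminormal_coeff_def)

lemma seminormal_coeff_same_column: "a (s, i, j) (s, Suc i, j) = - 1"
proof -
  have "inverse q - 1 = - (inverse q * (q - 1))" using q0 by (simp add: right_diff_distrib)
  then show ?thesis using q0 by (simp add: seminormal_coeff_def Let_def power_int_minus)
qed

lemma seminormal_coeff_adjacent: "adjacent x y \<Longrightarrow> a x y = q \<or> a x y = - 1"
  using seminormal_coeff_same_row seminormal_coeff_same_column by (auto simp: adjacent_def split: prod.splits)

lemma content_diff_path:
  assumes "path l p" "length p \<le> n" "x \<in> set p" "y \<in> set p"
  shows "\<bar>content x - content y\<bar> < int n"
  using content_diff_less[OF path_closed[OF assms(1)] _ assms(3,4)] assms(2) card_length[of p]
  by (simp split: if_splits)

lemma path_distinguishable_consecutive: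
  assumes "path l (u @ x # y # w)" "length (u @ x # y # w) \<le> n"
  shows "distinguishable x y"
proof -
  have D: "closed_diagram l (set u)" "addable l (set u) x" "addable l (insert x (set u)) y"
    using assms path_closed by (auto simp: path_from_append)
  then show ?thesis
    using content_diff_path[OF assms, of x y] consecutive_distinct_content[OF D]
    by (intro distinguishableI) (auto simp: addable_def split: prod.splits)
qed

lemma path_distinguishable_next_but_one:
  assumes "path l (u @ x # y # z # w)" "length (u @ x # y # z # w) \<le> n"
  shows "distinguishable x z"
proof -
  have D: "closed_diagram l (set u)" "addable l (set u) x" "addable l (insert x (set u)) y"
    "addable l (insert y (insert x (set u))) z"
    using assms path_closed by (auto simp: path_from_append)
  then show ?thesis
    using content_diff_path[OF assms, of x z] next_but_one_distinct_content[OF D]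
    by (intro distinguishableI) (auto simp: addable_def split: prod.splits)
qed

lemma path_swap_iff:
  assumes "path l (u @ x # y # w)"
  shows "path l (u @ y # x # w) \<longleftrightarrow> \<not> adjacent x y"
  using assms addable_swap[of l "set u" x y] by (auto simp: path_from_append insert_commute)

lemma path_op_quadratic:
  assumes "p \<in> paths l n" "1 \<le> k" "k < n"
  shows "F k (F k v) p = (q - 1) * F k v p + q * v p"
proof -
  have "1 \<le> k" "k < length p" using assms length_paths by auto
  then obtain u x y w where p: "p = u @ x # y # w" "k = Suc (length u)" by (rule split_at_consecutive)
  have path: "path l (u @ x # y # w)" "length (u @ x # y # w) \<le> n" using assms p by (auto simp: paths_def)
  have swap: "a y x = q - 1 - a x y"
    using seminormal_coeff_add_swap[OF path_distinguishable_consecutive[OF path]] by (simp add: algebra_simps)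
  show ?thesis
  proof (cases "adjacent x y")
    case True
    then show ?thesis unfolding p(1) path_op_swap[OF p(2)]
      using path_swap_iff[OF path(1)] seminormal_coeff_adjacent[OF True] by (auto simp: algebra_simps)
  next
    case False
    then show ?thesis unfolding p(1) path_op_swap[OF p(2)]
      using path_swap_iff[OF path(1)] path(1) by (simp add: swap) (simp add: algebra_simps)
  qed
qed

lemma yang_baxter_degenerate:
  fixes A_eq B_eq C :: 'k
  assumes relation: "A * B = C * (A + B - (q - 1))" and "A = q \<or> A = - 1"
  shows "A * B * (A - B) = C * ((q - B) * (1 + B))"
  using assms(2)
proof
  assume A_eq: "A = q"
  have "A * B = C * (1 + B)" using relation by (simp add: A_eq algebra_simps)
  then have "A * B * (A - B) = C * (1 + B) * (A - B)" by (rule arg_cong)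
  then show ?thesis unfolding A_eq by (simp only: mult_ac)
next
  assume A_eq: "A = - 1"
  have B_eq: "B = C * (q - B)" using relation by (simp add: A_eq algebra_simps)
  have "A * B * (A - B) = B * (1 + B)" by (simp add: A_eq algebra_simps)
  also have "\<dots> = C * (q - B) * (1 + B)" by (rule arg_cong[OF B_eq, of "\<lambda>t. t * (1 + B)"])
  finally show ?thesis by (simp only: mult.assoc)
qed

lemma yang_baxter_diagonal:
  fixes A B C :: 'k
  assumes relation: "A * B = C * (A + B - (q - 1))"
    and eigenvalues: "P \<Longrightarrow> A = q \<or> A = - 1" "R \<Longrightarrow> B = q \<or> B = - 1"
  shows "A * B * (A - B) +
    C * ((if P then 0 else (q - A) * (1 + A)) - (if R then 0 else (q - B) * (1 + B))) = 0"
proof -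
  have relation': "B * A = C * (B + A - (q - 1))" using relation by (simp only: mult.commute add.commute)
  consider (both) "P" "R" | (left) "P" "\<not> R" | (right) "\<not> P" "R" | (neither) "\<not> P" "\<not> R" by blast
  then show ?thesis
  proof cases
    case both
    then have "A = B" using eigenvalues relation q0 by auto
    then show ?thesis using both by simp
  next
    case left
    then show ?thesis using yang_baxter_degenerate[OF relation eigenvalues(1)] by (simp add: algebra_simps)
  next
    case right
    then show ?thesis using yang_baxter_degenerate[OF relation' eigenvalues(2)] by (simp add: algebra_simps)
  next
    case neither
    have "A * B * (A - B) = C * (A + B - (q - 1)) * (A - B)" by (simp only: relation)
    then show ?thesis using neither by (simp add: algebra_simps)
  qed
qed

lemma path_op_braid_expand:
  fixes x y z :: node
  assumes path: "path l (u @ x # y # z # w)" "length (u @ x # y # z # w) \<le> n" and k: "k = Suc (length u)"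
  defines "A \<equiv> a x y" and "B \<equiv> a y z" and "C \<equiv> a x z"
  shows "F k (F (Suc k) (F k v)) (u @ x # y # z # w) - F (Suc k) (F k (F (Suc k) v)) (u @ x # y # z # w) =
    v (u @ x # y # z # w) * (A * B * (A - B) + C * ((if adjacent x y then 0 else (q - A) * (1 + A)) -
      (if adjacent y z then 0 else (q - B) * (1 + B)))) +
    (if adjacent x y then 0 else v (u @ y # x # z # w) * (q - A) * (A * B - C * (A + B - (q - 1)))) -
    (if adjacent y z then 0 else v (u @ x # z # y # w) * (q - B) * (A * B - C * (A + B - (q - 1))))"
proof -
  have F_k: "F k v (u @ r # s # t # w) = a r s * v (u @ r # s # t # w) +
      (if path l (u @ s # r # t # w) then (q - a r s) * v (u @ s # r # t # w) else 0)" for r s t v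
    by (rule path_op_swap[OF k])
  have F_Suc_k: "F (Suc k) v (u @ r # s # t # w) = a s t * v (u @ r # s # t # w) +
      (if path l (u @ r # t # s # w) then (q - a s t) * v (u @ r # t # s # w) else 0)" for r s t v
    using path_op_swap[of "Suc k" "u @ [r]" l q Q v s t w] k by simp
  have "distinguishable x y" "distinguishable y z" "distinguishable x z"
    using path_distinguishable_consecutive[of u x y "z # w"]
      path_distinguishable_consecutive[of "u @ [x]" y z w] path_distinguishable_next_but_one[OF path] path
    by auto
  then have coeffs: "a x y = A" "a y z = B" "a x z = C"
      "a y x = q - 1 - A" "a z y = q - 1 - B" "a z x = q - 1 - C"
    using seminormal_coeff_add_swap by (auto simp: A_def B_def C_def eq_diff_eq add.commute)
  have first_swap: "path l (u @ y # x # z # w) \<longleftrightarrow> \<not> adjacent x y"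
      "path l (u @ x # z # y # w) \<longleftrightarrow> \<not> adjacent y z"
    using path_swap_iff[of u x y "z # w"] path_swap_iff[of "u @ [x]" y z w] path by auto
  have second_swap: "path l (u @ y # x # z # w) \<Longrightarrow> path l (u @ y # z # x # w) \<longleftrightarrow> \<not> adjacent x z"
      "path l (u @ x # z # y # w) \<Longrightarrow> path l (u @ z # x # y # w) \<longleftrightarrow> \<not> adjacent x z"
    using path_swap_iff[of "u @ [y]" x z w] path_swap_iff[of u x z "y # w"] by auto
  have third_swap: "path l (u @ y # z # x # w) \<Longrightarrow> path l (u @ z # y # x # w) \<longleftrightarrow> \<not> adjacent y z"
      "path l (u @ z # x # y # w) \<Longrightarrow> path l (u @ z # y # x # w) \<longleftrightarrow> \<not> adjacent x y"
    using path_swap_iff[of u y z "x # w"] path_swap_iff[of "u @ [z]" x y w] by auto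
  show ?thesis
    using second_swap third_swap
    by (cases "adjacent x y"; cases "adjacent y z"; cases "adjacent x z";
        simp add: F_k F_Suc_k coeffs first_swap path(1))
       (simp_all add: algebra_simps)
qed

lemma path_op_braid:
  assumes "p \<in> paths l n" "1 \<le> k" "k + 1 < n"
  shows "F k (F (Suc k) (F k v)) p = F (Suc k) (F k (F (Suc k) v)) p"
proof -
  have "1 \<le> k" "k < length p" using assms length_paths by auto
  then obtain u x y w' where split: "p = u @ x # y # w'" "k = Suc (length u)" by (rule split_at_consecutive)
  then obtain z w where "w' = z # w" using assms length_paths[OF assms(1)] by (cases w') auto
  with split have p: "p = u @ x # y # z # w" by simp
  have path: "path l (u @ x # y # z # w)" "length (u @ x # y # z # w) \<le> n"
    using assms p by (auto simp: paths_def)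
  have "distinguishable x y" "distinguishable y z" "distinguishable x z"
    using path_distinguishable_consecutive[of u x y "z # w"]
      path_distinguishable_consecutive[of "u @ [x]" y z w] path_distinguishable_next_but_one[OF path] path
    by auto
  from seminormal_coeff_yang_baxter[OF this]
  have "F k (F (Suc k) (F k v)) p - F (Suc k) (F k (F (Suc k) v)) p = 0"
    unfolding p path_op_braid_expand[OF path split(2)]
    using yang_baxter_diagonal[of "a x y" "a y z" "a x z" "adjacent x y" "adjacent y z"]
      seminormal_coeff_adjacent by simp
  then show ?thesis by simp
qed

lemma path_op_far_commute:
  assumes p: "p \<in> paths l n" and k: "1 \<le> k" "k + 1 < m" "m < n"
  shows "F k (F m v) p = F m (F k v) p"
proof -
  have "1 \<le> k" "k < length p" using assms length_paths by auto
  then obtain u x y w where xy: "p = u @ x # y # w" "k = Suc (length u)" by (rule split_at_consecutive)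
  have "1 \<le> m - k - 1" "m - k - 1 < length w" using xy k length_paths[OF p] by auto
  then obtain u' x' y' w' where xy': "w = u' @ x' # y' # w'" "m - k - 1 = Suc (length u')"
    by (rule split_at_consecutive)
  have m: "m = Suc (length (u @ r # s # u'))" for r s using xy xy' k by auto
  have F_k: "F k v (u @ r # s # w) = a r s * v (u @ r # s # w) +
     (if path l (u @ s # r # w) then (q - a r s) * v (u @ s # r # w) else 0)" for r s w v
    by (rule path_op_swap[OF xy(2)])
  have F_m: "F m v (u @ r # s # u' @ r' # s' # w') = a r' s' * v (u @ r # s # u' @ r' # s' # w') +
     (if path l (u @ r # s # u' @ s' # r' # w') then (q - a r' s') * v (u @ r # s # u' @ s' # r' # w') else 0)"
    for r s r' s' v using path_op_swap[OF m[of r s], of l q Q v r' s' w'] by simp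
  have "path l (u @ x # y # u' @ x' # y' # w')" using p xy xy' by (simp add: paths_def)
  then have "path l (u @ y # x # u' @ y' # x' # w') \<longleftrightarrow>
      path l (u @ y # x # u' @ x' # y' # w') \<and> path l (u @ x # y # u' @ y' # x' # w')"
    by (auto simp: path_from_append insert_commute)
  then show ?thesis unfolding xy(1) xy'(1) by (simp add: F_k F_m) (simp add: algebra_simps)
qed

lemma path_op_0_commute:
  assumes p: "p \<in> paths l n" and k: "1 < k" "k < n"
  shows "F 0 (F k v) p = F k (F 0 v) p"
proof -
  have "1 \<le> k" "k < length p" using assms length_paths by auto
  then obtain u x y w where xy: "p = u @ x # y # w" "k = Suc (length u)" by (rule split_at_consecutive)
  then have "u \<noteq> []" using k by auto
  then show ?thesis unfolding xy(1) path_op_swap[OF xy(2)] path_op_0 by (simp add: algebra_simps)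
qed

lemma path_op_conjugate_diagonal:
  assumes path: "path l (u @ x # y # w)" "length (u @ x # y # w) \<le> n" and k: "k = Suc (length u)"
    and X: "\<And>r s v. path l (u @ r # s # w) \<Longrightarrow> X v (u @ r # s # w) = c * res r * v (u @ r # s # w)"
  shows "F k (X (F k v)) (u @ x # y # w) = c * (q * res y * v (u @ x # y # w))"
proof -
  have xy: "distinguishable x y" using path_distinguishable_consecutive[OF path] .
  define A where "A = a x y"
  have coeffs: "a x y = A" "a y x = q - 1 - A"
    using seminormal_coeff_add_swap[OF xy] by (auto simp: A_def algebra_simps)
  have residues: "A * res x + (q - 1 - A) * res y = 0"
    using seminormal_coeff_residue_swap[OF xy] by (simp add: coeffs)
  show ?thesis
  proof (cases "adjacent x y")
    case True
    then have "F k (X (F k v)) (u @ x # y # w) = c * (A * A * res x * v (u @ x # y # w))"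
      unfolding path_op_swap[OF k] using path_swap_iff[OF path(1)] path(1)
      by (simp add: X path_op_swap[OF k] coeffs mult_ac)
    moreover have "A * A * res x = q * res y"
    proof -
      have "A * res x = (A - (q - 1)) * res y" using residues by (simp add: algebra_simps)
      then have "A * (A * res x) = A * ((A - (q - 1)) * res y)" by (rule arg_cong)
      moreover have "A * (A - (q - 1)) = q"
        using seminormal_coeff_adjacent[OF True] by (auto simp: A_def algebra_simps)
      ultimately show ?thesis by (metis mult.assoc)
    qed
    ultimately show ?thesis by simp
  next
    case False
    then have "F k (X (F k v)) (u @ x # y # w) =
      c * ((A * A * res x + (q - A) * (1 + A) * res y) * v (u @ x # y # w) +
       (q - A) * (A * res x + (q - 1 - A) * res y) * v (u @ y # x # w))"
      unfolding path_op_swap[OF k] using path_swap_iff[OF path(1)] path(1)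
      by (simp add: X path_op_swap[OF k] coeffs) (simp add: algebra_simps)
    moreover have "A * A * res x + (q - A) * (1 + A) * res y =
        q * res y + A * (A * res x + (q - 1 - A) * res y)"
      by (simp add: algebra_simps)
    ultimately show ?thesis using residues by simp
  qed
qed

lemma path_op_L_word:
  assumes "p \<in> paths l n" "1 \<le> k" "k \<le> n"
  shows "foldr F (rev [1..<k] @ [0] @ [1..<k]) v p = q ^ (k - 1) * res (p ! (k - 1)) * v p"
  using assms(2,1,3)
proof (induction k arbitrary: p v rule: nat_induct_at_least)
  case base
  then have "length p = n" "1 \<le> n" by (auto simp: paths_def)
  then obtain x w where p: "p = x # w" by (cases p) auto
  then have "content x = 0"
    using base by (auto simp: paths_def addable_def content_def split: prod.splits)
  then show ?case using p by (simp add: path_op_0 residue_def)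
next
  case (Suc k)
  define X where "X = foldr F (rev [1..<k] @ [0] @ [1..<k])"
  have "1 \<le> k" "k < length p" using Suc length_paths by auto
  then obtain u x y w where p: "p = u @ x # y # w" "k = Suc (length u)" by (rule split_at_consecutive)
  have path: "path l (u @ x # y # w)" "length (u @ x # y # w) \<le> n" using Suc p by (auto simp: paths_def)
  have "X v' (u @ r # s # w) = q ^ (k - 1) * res r * v' (u @ r # s # w)"
    if "path l (u @ r # s # w)" for r s v'
    using Suc.IH[of "u @ r # s # w" v', folded X_def] that Suc.prems p by (auto simp: paths_def nth_append)
  from path_op_conjugate_diagonal[where X = X and v = v, OF path p(2) this]
  have "F k (X (F k v)) p = q ^ (k - 1) * (q * res y * v p)" unfolding p(1) .
  moreover have "foldr F (rev [1..<Suc k] @ [0] @ [1..<Suc k]) v = F k (X (F k v))"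
    using Suc.hyps by (simp add: X_def)
  moreover have "p ! (Suc k - 1) = y" using p by (simp add: nth_append)
  moreover have "q ^ (Suc k - 1) = q ^ (k - 1) * q" using Suc.hyps by (cases k) auto
  ultimately show ?case by simp
qed

lemma path_op_0_braid:
  assumes "p \<in> paths l n" "2 \<le> n"
  shows "F 0 (F 1 (F 0 (F 1 v))) p = F 1 (F 0 (F 1 (F 0 v))) p"
proof -
  have path_op_L2: "F 1 (F 0 (F 1 v)) r = q * res (r ! 1) * v r" if "r \<in> paths l n" for r v
    using path_op_L_word[OF that, of 2 v] assms(2) by (simp add: upt_rec)
  show ?thesis unfolding path_op_L2[OF assms(1)] path_op_0 using path_op_L2[OF assms(1)] by simp
qed

lemma rep_cyclotomic:
  assumes "p \<in> paths l n" "1 \<le> n"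
  shows "rep F (\<Prod>s\<leftarrow>[0..<l]. free_gen 0 - free_const (Q s)) v p = 0"
proof -
  have "rep F (\<Prod>s\<leftarrow>ss. free_gen 0 - free_const (Q s)) v p = (\<Prod>s\<leftarrow>ss. Q (fst (hd p)) - Q s) * v p" for ss v
    by (induction ss arbitrary: v)
       (simp_all add: rep_one rep_mult[OF linear_path_op] rep_diff rep_gen rep_const path_op_0 algebra_simps)
  moreover have "fst (hd p) < l"
    using assms by (cases p) (auto simp: paths_def addable_def split: prod.splits)
  then have "(\<Prod>s\<leftarrow>[0..<l]. Q (fst (hd p)) - Q s) = 0" by (auto simp: prod_list_zero_iff)
  ultimately show ?thesis by simp
qed

lemma rep_ak_relations:
  assumes "r \<in> ak_relations l n q Q" "p \<in> paths l n" "1 \<le> n"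
  shows "rep F r v p = 0"
proof -
  note rep_rules = rep_mult[OF linear_path_op] rep_diff rep_add rep_gen rep_const rep_one
  from assms(1) show ?thesis
  proof (cases rule: ak_relationsE)
    case cyclotomic
    then show ?thesis using rep_cyclotomic assms by simp
  next
    case (quadratic i)
    have "rep F (free_gen i + 1) v = (\<lambda>u. 1 * F i v u + v u)" by (simp add: rep_rules fun_eq_iff)
    then have "rep F r v p = F i (\<lambda>u. 1 * F i v u + v u) p - q * (1 * F i v p + v p)"
      unfolding quadratic(3) by (simp only: rep_rules)
    also have "F i (\<lambda>u. 1 * F i v u + v u) = (\<lambda>u. 1 * F i (F i v) u + F i v u)"
      using linear_path_op[of l q Q] unfolding linear_ops_def by blast
    finally show ?thesis using path_op_quadratic[OF assms(2) quadratic(1,2)] by (simp add: algebra_simps)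
  next
    case braid0
    then show ?thesis using path_op_0_braid[OF assms(2)] by (simp add: rep_rules)
  next
    case (braid i)
    then show ?thesis using path_op_braid[OF assms(2), of i] by (simp add: rep_rules)
  next
    case (far_commute i j)
    then show ?thesis using path_op_far_commute[OF assms(2), of i j] path_op_0_commute[OF assms(2), of j]
      by (cases "i = 0") (simp_all add: rep_rules)
  qed
qed

lemma rep_ak_ideal:
  assumes "x \<in> ak_ideal l n q Q" "p \<in> paths l n" "1 \<le> n"
  shows "rep F x v p = 0"
proof -
  let ?J = "{x \<in> carrier (free_algebra n). \<forall>v. \<forall>p\<in>paths l n. rep F x v p = 0}"
  have "ideal ?J (free_algebra n)"
  proof (rule ideal_free_algebraI)
    fix x r :: "'k free_alg" assume x: "x \<in> ?J" and r: "r \<in> carrier (free_algebra n)"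
    have "rep F (r * x) v p = 0" if "p \<in> paths l n" for v p
    proof -
      have "rep F (r * x) v p = rep F r (\<lambda>_. 0) p"
        unfolding rep_mult[OF linear_path_op] using x that by (intro path_rep_cong[OF r that]) auto
      then show ?thesis by (simp add: path_rep_zero)
    qed
    then show "r * x \<in> ?J" using x r free_algebra_closed(3) by auto
    show "x * r \<in> ?J" using x r free_algebra_closed(3) by (auto simp: rep_mult[OF linear_path_op])
  qed (auto simp: rep_zero rep_add free_algebra_closed)
  moreover have "ak_relations l n q Q \<subseteq> ?J"
    using ak_relations_carrier[OF assms(3)] rep_ak_relations[OF _ _ assms(3)] by blast
  ultimately have "ak_ideal l n q Q \<subseteq> ?J"
    unfolding ak_ideal_def by (intro ring.genideal_minimal[OF ring_free_algebra])
  then show ?thesis using assms by blast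
qed

end

section \<open>Hook lengths\<close>

lemma partition_antimono:
  assumes "is_partition p" "1 \<le> i" "i \<le> i'"
  shows "p i' \<le> p i"
proof -
  have "p (i + k) \<le> p i" for k
  proof (induction k)
    case (Suc k)
    have "p (Suc (i + k)) \<le> p (i + k)" using assms unfolding is_partition_def by simp
    then show ?case using Suc by simp
  qed simp
  from this[of "i' - i"] assms show ?thesis by simp
qed

lemma partition_set_finite:
  assumes "is_partition p" "1 \<le> j"
  shows "finite {i. 1 \<le> i \<and> j \<le> p i}"
proof (rule finite_subset)
  show "{i. 1 \<le> i \<and> j \<le> p i} \<subseteq> {i. p i \<noteq> 0}" using assms by auto
  show "finite {i. p i \<noteq> 0}" using assms by (simp add: is_partition_def)
qed

lemma conj_part_iff:
  assumes p: "is_partition p" "1 \<le> i" "1 \<le> j"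
  shows "i \<le> conj_part p j \<longleftrightarrow> j \<le> p i"
proof
  let ?S = "{i. 1 \<le> i \<and> j \<le> p i}"
  have fin: "finite ?S" by (rule partition_set_finite) (use p in auto)
  show "i \<le> conj_part p j" if "j \<le> p i"
  proof -
    have "{1..i} \<subseteq> ?S" using that partition_antimono[OF p(1)] by (auto intro: le_trans)
    then show ?thesis unfolding conj_part_def using card_mono[OF fin, of "{1..i}"] by simp
  qed
  show "j \<le> p i" if "i \<le> conj_part p j"
  proof (rule ccontr)
    assume "\<not> j \<le> p i"
    then have "?S \<subseteq> {1..<i}"
      using partition_antimono[OF p(1) p(2)] by (auto simp: not_le) (meson le_less_trans not_le)
    from card_mono[OF _ this] have "card ?S \<le> i - 1" by simp
    then show False using that p(2) by (simp add: conj_part_def)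
  qed
qed

lemma conj_part_antimono:
  assumes p: "is_partition p" "1 \<le> j" "j \<le> j'"
  shows "conj_part p j' \<le> conj_part p j"
proof (cases "conj_part p j' = 0")
  case False
  then have "1 \<le> conj_part p j'" by simp
  then show ?thesis using conj_part_iff[OF p(1), of "conj_part p j'" j']
    conj_part_iff[OF p(1), of "conj_part p j'" j] p
    by simp
qed simp

lemma young_finite:
  assumes "is_partition p"
  shows "finite (young p)"
proof -
  have "young p \<subseteq> (SIGMA i:{i. p i \<noteq> 0}. {1..p i})" by (auto simp: young_def)
  moreover have "finite (SIGMA i:{i. p i \<noteq> 0}. {1..p i})"
    using assms by (intro finite_SigmaI) (auto simp: is_partition_def)
  ultimately show ?thesis by (rule finite_subset)
qed

lemma young_iff_conj: "is_partition p \<Longrightarrow> (i, j) \<in> young p \<longleftrightarrow> 1 \<le> i \<and> 1 \<le> j \<and> i \<le> conj_part p j"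
  using conj_part_iff[of p i j] by (auto simp: young_def)

lemma part_zero_iff:
  assumes "is_partition p" "1 \<le> i"
  shows "p i = 0 \<longleftrightarrow> conj_part p 1 < i"
  using conj_part_iff[OF assms, of 1] by auto

lemma psize_eq_sum_rows:
  assumes p: "is_partition p" "conj_part p 1 \<le> N"
  shows "psize p = (\<Sum>i=1..N. p i)"
proof -
  have "p i = 0" if "i \<notin> {1..N}" for i
  proof (cases "i = 0")
    case True
    then show ?thesis using p(1) by (simp add: is_partition_def)
  next
    case False
    then show ?thesis using that part_zero_iff[OF p(1), of i] p(2) by simp
  qed
  then have "{i. p i \<noteq> 0} \<subseteq> {1..N}" by (metis (mono_tags) mem_Collect_eq subsetI)
  then show ?thesis unfolding psize_def by (intro sum.mono_neutral_left) auto
qed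

lemma row_plus_column_le_psize:
  assumes p: "is_partition p"
  shows "p 1 + conj_part p 1 \<le> psize p + 1"
proof (cases "conj_part p 1")
  case 0
  then show ?thesis using part_zero_iff[OF p, of 1] by simp
next
  case (Suc N)
  have "psize p = p 1 + (\<Sum>i=2..Suc N. p i)"
    using psize_eq_sum_rows[OF p, of "Suc N"] Suc by (simp add: sum.atLeast_Suc_atMost numeral_2_eq_2)
  moreover have "(\<Sum>i=2..Suc N. 1) \<le> (\<Sum>i=2..Suc N. p i)"
  proof (rule sum_mono)
    fix i assume "i \<in> {2..Suc N}"
    then show "1 \<le> p i" using part_zero_iff[OF p, of i] Suc by auto
  qed
  ultimately show ?thesis using Suc by simp
qed

lemma conj_part_le_psize: "is_partition p \<Longrightarrow> conj_part p 1 \<le> psize p"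
  using row_plus_column_le_psize[of p] part_zero_iff[of p 1] by (cases "p 1 = 0") auto

lemma part_le_psize: "is_partition p \<Longrightarrow> p i \<le> psize p"
  using row_plus_column_le_psize[of p] partition_antimono[of p 1 i] part_zero_iff[of p 1]
  by (cases "i = 0"; cases "p 1 = 0") (auto simp: is_partition_def)

lemma card_young: assumes "is_partition p" shows "card (young p) = psize p"
proof -
  have "young p = (SIGMA i:{1..conj_part p 1}. {1..p i})"
    using part_zero_iff[OF assms] by (auto simp: young_def)
      (metis One_nat_def le_zero_eq not_less not_less_eq_eq)
  then show ?thesis using psize_eq_sum_rows[OF assms order_refl] by simp
qed

lemma prod_int_interval_concat:
  fixes f :: "int \<Rightarrow> 'a::comm_monoid_mult"
  assumes "a \<le> b + 1" "b \<le> c"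
  shows "(\<Prod>h\<in>{a..b}. f h) * (\<Prod>h\<in>{b + 1..c}. f h) = (\<Prod>h\<in>{a..c}. f h)"
  using assms by (subst prod.union_disjoint[symmetric]) (auto intro!: prod.cong)

lemma prod_shifted_interval:
  fixes f :: "int \<Rightarrow> 'a::comm_monoid_mult"
  shows "(\<Prod>i\<in>{a<..b}. f (int i - c)) = (\<Prod>h\<in>{int a - c + 1..int b - c}. f h)"
  by (rule prod.reindex_bij_witness[of _ "\<lambda>h. nat (h + c)" "\<lambda>i. int i - c"]) auto

lemma prod_beta_numbers_complement:
  fixes f :: "int \<Rightarrow> 'a::comm_monoid_mult"
  assumes p: "is_partition p" "conj_part p 1 \<le> N" "1 \<le> b"
  shows "(\<Prod>j\<in>{1..<b}. f (int (conj_part p j) - int j + 1)) *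
    (\<Prod>i\<in>{conj_part p b<..N}. f (int i - int (p i))) =
    (\<Prod>h\<in>{int (conj_part p b) - int b + 2..int N}. f h)"
  using assms(3)
proof (induction b rule: nat_induct_at_least)
  case base
  have "(\<Prod>i\<in>{conj_part p 1<..N}. f (int i - int (p i))) = (\<Prod>i\<in>{conj_part p 1<..N}. f (int i - 0))"
  proof (rule prod.cong[OF refl])
    fix i assume "i \<in> {conj_part p 1<..N}"
    then have "p i = 0" using part_zero_iff[OF p(1), of i] by auto
    then show "f (int i - int (p i)) = f (int i - 0)" by simp
  qed
  also have "\<dots> = (\<Prod>h\<in>{int (conj_part p 1) + 1..int N}. f h)" unfolding prod_shifted_interval by simp
  finally show ?case by (simp add: add.commute)
next
  case (Suc b)
  let ?r = "conj_part p b" and ?r' = "conj_part p (Suc b)"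
  let ?J = "\<Prod>j\<in>{1..<b}. f (int (conj_part p j) - int j + 1)" and ?g = "\<lambda>i. f (int i - int (p i))"
  have b_pos: "1 \<le> b" by (rule Suc.hyps)
  have r: "?r' \<le> ?r" "?r \<le> N"
    using conj_part_antimono[OF p(1), of b "Suc b"] conj_part_antimono[OF p(1), of 1 b] Suc p by auto
  have row_length: "p i = b" if "i \<in> {?r'<..?r}" for i
    using that conj_part_iff[OF p(1), of i b] conj_part_iff[OF p(1), of i "Suc b"] Suc by auto
  have "{?r'<..N} = {?r'<..?r} \<union> {?r<..N}" using r by auto
  then have "(\<Prod>i\<in>{?r'<..N}. ?g i) = (\<Prod>i\<in>{?r'<..?r}. ?g i) * (\<Prod>i\<in>{?r<..N}. ?g i)"
    by (simp add: prod.union_disjoint)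
  also have "(\<Prod>i\<in>{?r'<..?r}. ?g i) = (\<Prod>i\<in>{?r'<..?r}. f (int i - int b))"
    using row_length by (intro prod.cong) auto
  also have "\<dots> = (\<Prod>h\<in>{int ?r' - int b + 1..int ?r - int b}. f h)" by (rule prod_shifted_interval)
  finally have "(\<Prod>j\<in>{1..<Suc b}. f (int (conj_part p j) - int j + 1)) * (\<Prod>i\<in>{?r'<..N}. ?g i) =
      (\<Prod>h\<in>{int ?r' - int b + 1..int ?r - int b}. f h) * f (int ?r - int b + 1) * (?J * (\<Prod>i\<in>{?r<..N}. ?g i))"
    using b_pos by (simp add: mult_ac)
  also have "\<dots> = (\<Prod>h\<in>{int ?r' - int b + 1..int ?r - int b + 1}. f h) *
      (\<Prod>h\<in>{int ?r - int b + 1 + 1..int N}. f h)"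
    unfolding Suc.IH using prod_int_interval_concat[of "int ?r' - int b + 1" "int ?r - int b" "int ?r - int b + 1" f] r
    by (simp add: add.commute)
  also have "\<dots> = (\<Prod>h\<in>{int ?r' - int b + 1..int N}. f h)" using r Suc by (intro prod_int_interval_concat) auto
  finally show ?case by (simp add: algebra_simps)
qed

definition add_box :: "(nat \<Rightarrow> nat) \<Rightarrow> nat \<Rightarrow> nat \<Rightarrow> nat" where
  "add_box p k = p(k := Suc (p k))"

lemma young_add_box: "1 \<le> k \<Longrightarrow> young (add_box p k) = insert (k, Suc (p k)) (young p)"
  by (auto simp: young_def add_box_def split: if_splits)

lemma conj_part_add_box:
  assumes p: "is_partition p" "is_partition (add_box p k)" "1 \<le> k" "1 \<le> j"
  shows "conj_part (add_box p k) j = (if j = Suc (p k) then Suc (conj_part p j) else conj_part p j)"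
    and "conj_part p (Suc (p k)) = k - 1"
proof -
  let ?S = "{i. 1 \<le> i \<and> j \<le> p i}"
  have fin: "finite ?S" by (rule partition_set_finite) (use p in auto)
  have "{i. 1 \<le> i \<and> j \<le> add_box p k i} = (if j = Suc (p k) then insert k ?S else ?S)"
    using p(3) by (auto simp: add_box_def)
  then show "conj_part (add_box p k) j = (if j = Suc (p k) then Suc (conj_part p j) else conj_part p j)"
    unfolding conj_part_def using fin by auto
  show "conj_part p (Suc (p k)) = k - 1"
  proof (rule antisym)
    show "conj_part p (Suc (p k)) \<le> k - 1"
      using conj_part_iff[OF p(1,3), of "Suc (p k)"] by auto
    show "k - 1 \<le> conj_part p (Suc (p k))"
    proof (cases "k = 1")
      case False
      then have "add_box p k k \<le> add_box p k (k - 1)"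
        using partition_antimono[OF p(2), of "k - 1" k] p(3) by simp
      then have "Suc (p k) \<le> p (k - 1)" using False p(3) by (simp add: add_box_def split: if_splits)
      then show ?thesis using conj_part_iff[OF p(1), of "k - 1" "Suc (p k)"] False p(3) by simp
    qed simp
  qed
qed

abbreviation hook_prod :: "(int \<Rightarrow> 'a::comm_monoid_mult) \<Rightarrow> (nat \<Rightarrow> nat) \<Rightarrow> (nat \<Rightarrow> nat) \<Rightarrow> 'a" where
  "hook_prod f p m \<equiv> \<Prod>(i, j)\<in>young p. f (hook p m i j)"

lemma add_box_row_le:
  assumes "is_partition p" "is_partition (add_box p k)" "1 \<le> k"
  shows "k \<le> Suc (conj_part p 1)"
  using conj_part_add_box(2)[OF assms, of 1] conj_part_antimono[OF assms(1), of 1 "Suc (p k)"] by simp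

lemma prod_young_split:
  assumes p: "is_partition p" "1 \<le> k" "1 \<le> b"
  shows "(\<Prod>(i, j)\<in>young p. g i j) = (\<Prod>(i, j)\<in>{x\<in>young p. fst x \<noteq> k}. g i j) * (\<Prod>j\<in>{1..p k}. g k j)"
    and "(\<Prod>(i, j)\<in>young p. g i j) = (\<Prod>(i, j)\<in>{x\<in>young p. snd x \<noteq> b}. g i j) * (\<Prod>i\<in>{1..conj_part p b}. g i b)"
proof -
  have split: "prod h (young p) = prod h {x\<in>young p. P x} * prod h {x\<in>young p. \<not> P x}" for P
    and h :: "nat \<times> nat \<Rightarrow> 'a"
    using young_finite[OF p(1)] by (subst prod.union_disjoint[symmetric]) (auto intro!: prod.cong)
  have "{x\<in>young p. \<not> fst x \<noteq> k} = Pair k ` {1..p k}" using p by (auto simp: young_def)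
  then have "(\<Prod>(i, j)\<in>{x\<in>young p. \<not> fst x \<noteq> k}. g i j) = (\<Prod>j\<in>{1..p k}. g k j)"
    by (simp add: prod.reindex inj_on_def)
  then show "(\<Prod>(i, j)\<in>young p. g i j) = (\<Prod>(i, j)\<in>{x\<in>young p. fst x \<noteq> k}. g i j) * (\<Prod>j\<in>{1..p k}. g k j)"
    using split[of "\<lambda>(i, j). g i j" "\<lambda>x. fst x \<noteq> k"] by simp
  have "{x\<in>young p. \<not> snd x \<noteq> b} = (\<lambda>i. (i, b)) ` {1..conj_part p b}"
    using p young_iff_conj[OF p(1)] by auto
  then have "(\<Prod>(i, j)\<in>{x\<in>young p. \<not> snd x \<noteq> b}. g i j) = (\<Prod>i\<in>{1..conj_part p b}. g i b)"
    by (simp add: prod.reindex inj_on_def)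
  then show "(\<Prod>(i, j)\<in>young p. g i j) = (\<Prod>(i, j)\<in>{x\<in>young p. snd x \<noteq> b}. g i j) *
      (\<Prod>i\<in>{1..conj_part p b}. g i b)"
    using split[of "\<lambda>(i, j). g i j" "\<lambda>x. snd x \<noteq> b"] by simp
qed

lemma hook_prod_add_box_left:
  assumes p: "is_partition p" "is_partition (add_box p k)" "1 \<le> k"
    and b_eq: "b = Suc (p k)" and c_eq: "c = int b - int k"
  shows "hook_prod f (add_box p k) m * (\<Prod>j\<in>{1..<b}. f (c + int (conj_part m j) - int j)) =
    hook_prod f p m * (\<Prod>j\<in>{1..b}. f (c + int (conj_part m j) - int j + 1))"
proof -
  let ?p = "add_box p k"
  have same: "{x\<in>young ?p. fst x \<noteq> k} = {x\<in>young p. fst x \<noteq> k}" using p(3) by (auto simp: young_add_box)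
  have "(\<Prod>(i, j)\<in>{x\<in>young ?p. fst x \<noteq> k}. f (hook ?p m i j)) =
      (\<Prod>(i, j)\<in>{x\<in>young p. fst x \<noteq> k}. f (hook p m i j))"
    unfolding same by (intro prod.cong) (auto simp: hook_def add_box_def)
  moreover have "(\<Prod>j\<in>{1..?p k}. f (hook ?p m k j)) = (\<Prod>j\<in>{1..b}. f (c + int (conj_part m j) - int j + 1))"
    by (intro prod.cong) (auto simp: hook_def add_box_def b_eq c_eq algebra_simps)
  moreover have "(\<Prod>j\<in>{1..p k}. f (hook p m k j)) = (\<Prod>j\<in>{1..<b}. f (c + int (conj_part m j) - int j))"
    by (intro prod.cong) (auto simp: hook_def b_eq c_eq algebra_simps)
  ultimately show ?thesis
    unfolding prod_young_split(1)[OF p(2,3), of 1 "\<lambda>i j. f (hook ?p m i j)", OF order_refl]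
      prod_young_split(1)[OF p(1,3), of 1 "\<lambda>i j. f (hook p m i j)", OF order_refl]
    by (simp only: mult_ac)
qed

lemma hook_prod_add_box_right:
  assumes p: "is_partition p" "is_partition (add_box p k)" "1 \<le> k" and m: "is_partition m"
    and b_eq: "b = Suc (p k)" and c_eq: "c = int b - int k"
  shows "hook_prod g m (add_box p k) * (\<Prod>i\<in>{1..conj_part m b}. g (int (m i) - int i - c)) =
    hook_prod g m p * (\<Prod>i\<in>{1..conj_part m b}. g (int (m i) - int i - c + 1))"
proof -
  let ?p = "add_box p k"
  have b_pos: "1 \<le> b" using b_eq by simp
  have legs: "conj_part p b = k - 1" "conj_part ?p b = k"
    using conj_part_add_box[OF p, of b] p(3) b_eq by auto
  have "(\<Prod>(i, j)\<in>{x\<in>young m. snd x \<noteq> b}. g (hook m ?p i j)) =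
      (\<Prod>(i, j)\<in>{x\<in>young m. snd x \<noteq> b}. g (hook m p i j))"
    using conj_part_add_box(1)[OF p] b_eq by (intro prod.cong) (auto simp: hook_def young_def)
  moreover have "(\<Prod>i\<in>{1..conj_part m b}. g (hook m ?p i b)) =
      (\<Prod>i\<in>{1..conj_part m b}. g (int (m i) - int i - c + 1))"
    using legs by (intro prod.cong) (auto simp: hook_def c_eq algebra_simps)
  moreover have "(\<Prod>i\<in>{1..conj_part m b}. g (hook m p i b)) = (\<Prod>i\<in>{1..conj_part m b}. g (int (m i) - int i - c))"
    using legs p(3) by (intro prod.cong) (auto simp: hook_def c_eq algebra_simps of_nat_diff)
  ultimately show ?thesis
    unfolding prod_young_split(2)[OF m order_refl b_pos, of "\<lambda>i j. g (hook m ?p i j)"]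
      prod_young_split(2)[OF m order_refl b_pos, of "\<lambda>i j. g (hook m p i j)"]
    by (simp only: mult_ac)
qed

lemma hook_prod_add_box_right_ratio:
  fixes f g :: "int \<Rightarrow> 'a::field" and q :: 'a
  assumes p: "is_partition p" "is_partition (add_box p k)" "1 \<le> k" and m: "is_partition m"
    and b_eq: "b = Suc (p k)" and c_eq: "c = int b - int k"
    and reflect: "\<And>h. g (h + 1) * f (- h) = q * f (- h - 1) * g h"
    and nonzero: "\<And>i. 1 \<le> i \<Longrightarrow> i \<le> conj_part m b \<Longrightarrow> g (int (m i) - int i - c) \<noteq> 0"
  shows "hook_prod g m (add_box p k) * (\<Prod>i\<in>{1..conj_part m b}. f (c - (int (m i) - int i))) =
     hook_prod g m p * q ^ conj_part m b * (\<Prod>i\<in>{1..conj_part m b}. f (c - (int (m i) - int i + 1)))"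
proof -
  let ?I = "{1..conj_part m b}"
  let ?G = "\<Prod>i\<in>?I. g (int (m i) - int i - c)" and ?G' = "\<Prod>i\<in>?I. g (int (m i) - int i - c + 1)"
  let ?F = "\<Prod>i\<in>?I. f (c - (int (m i) - int i))" and ?F' = "\<Prod>i\<in>?I. f (c - (int (m i) - int i + 1))"
  have "?G' * ?F = (\<Prod>i\<in>?I. q * f (c - (int (m i) - int i + 1)) * g (int (m i) - int i - c))"
    unfolding prod.distrib[symmetric]
  proof (intro prod.cong refl)
    fix i
    show "g (int (m i) - int i - c + 1) * f (c - (int (m i) - int i)) =
       q * f (c - (int (m i) - int i + 1)) * g (int (m i) - int i - c)"
      using reflect[of "int (m i) - int i - c"] by (simp add: algebra_simps)
  qed
  also have "\<dots> = q ^ conj_part m b * ?F' * ?G" by (simp add: prod.distrib)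
  finally have reflected: "?G' * ?F = q ^ conj_part m b * ?F' * ?G" .
  have "hook_prod g m (add_box p k) * ?F * ?G = hook_prod g m (add_box p k) * ?G * ?F" by (simp only: mult_ac)
  also have "\<dots> = hook_prod g m p * (?G' * ?F)"
    unfolding hook_prod_add_box_right[OF p m b_eq c_eq] by (simp only: mult.assoc)
  also have "\<dots> = hook_prod g m p * q ^ conj_part m b * ?F' * ?G" unfolding reflected by (simp only: mult_ac)
  finally show ?thesis using nonzero by (simp add: prod_zero_iff)
qed

lemma hook_prod_add_box_left_ratio:
  fixes f :: "int \<Rightarrow> 'a::field"
  assumes p: "is_partition p" "is_partition (add_box p k)" "1 \<le> k"
    and m: "is_partition m" "conj_part m 1 \<le> N"
    and b_eq: "b = Suc (p k)" and c_eq: "c = int b - int k"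
    and nonzero: "\<And>h. int (conj_part m b) - int b < h \<Longrightarrow> h < int N \<Longrightarrow> f (c + h) \<noteq> 0"
  shows "hook_prod f (add_box p k) m * (\<Prod>i\<in>{conj_part m b<..N}. f (c - (int (m i) - int i))) =
     hook_prod f p m * (\<Prod>i\<in>{conj_part m b<..Suc N}. f (c - (int (m i) - int i + 1)))"
proof -
  define F where "F h = f (c + h)" for h
  let ?r = "conj_part m b" and ?p = "add_box p k"
  let ?top = "F (int ?r - int b + 1)" and ?mid = "\<Prod>h\<in>{int ?r - int b + 2..int N}. F h"
  let ?low = "\<Prod>h\<in>{int ?r - int b + 1..int N - 1}. F h"
  let ?U = "\<Prod>i\<in>{?r<..N}. F (int i - int (m i))" and ?V = "\<Prod>i\<in>{?r<..N}. F (int i - 1 - int (m i))"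
  let ?J = "\<Prod>j\<in>{1..<b}. F (int (conj_part m j) - int j)"
  let ?J' = "\<Prod>j\<in>{1..<b}. F (int (conj_part m j) - int j + 1)"
  have b_pos: "1 \<le> b" by (simp add: b_eq)
  have r: "?r \<le> N" using conj_part_antimono[OF m(1), of 1 b] b_pos m(2) by simp
  have low: "?low \<noteq> 0" using nonzero by (auto simp: F_def prod_zero_iff)
  have upper: "?J' * ?U = ?mid"
    using prod_beta_numbers_complement[OF m b_pos, of F] .
  have "?J * ?V = (\<Prod>h\<in>{int ?r - int b + 2..int N}. F (h - 1))"
    using prod_beta_numbers_complement[OF m b_pos, of "\<lambda>h. F (h - 1)"] by (simp add: algebra_simps)
  also have "\<dots> = ?low"
    by (rule prod.reindex_bij_witness[of _ "\<lambda>h. h + 1" "\<lambda>h. h - 1"]) auto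
  finally have lower: "?J * ?V = ?low" .
  have "{1..b} = insert b {1..<b}" using b_pos by auto
  then have row: "hook_prod f ?p m * ?J = hook_prod f p m * (?top * ?J')"
    using hook_prod_add_box_left[OF p b_eq c_eq, of f m] by (simp add: F_def algebra_simps)
  have "?top * ?mid = (\<Prod>h\<in>{int ?r - int b + 1..int N}. F h)"
    using prod_int_interval_concat[of "int ?r - int b + 1" "int ?r - int b + 1" "int N" F] r b_pos
    by (simp add: algebra_simps)
  also have "\<dots> = ?low * F (int N)"
    using prod_int_interval_concat[of "int ?r - int b + 1" "int N - 1" "int N" F] r b_pos by simp
  finally have interval: "?top * ?mid = ?low * F (int N)" .
  have "?low * (hook_prod f ?p m * ?U) = hook_prod f ?p m * ?J * ?V * ?U"
    unfolding lower[symmetric] by (simp only: mult_ac)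
  also have "\<dots> = hook_prod f p m * (?top * (?J' * ?U)) * ?V" unfolding row by (simp only: mult_ac)
  also have "\<dots> = ?low * (hook_prod f p m * (?V * F (int N)))"
    unfolding upper interval by (simp only: mult_ac)
  finally have "hook_prod f ?p m * ?U = hook_prod f p m * (?V * F (int N))" using low by simp
  moreover have "{?r<..Suc N} = insert (Suc N) {?r<..N}" using r by auto
  moreover have "m (Suc N) = 0" using part_zero_iff[OF m(1), of "Suc N"] m(2) by simp
  ultimately show ?thesis by (simp add: F_def algebra_simps)
qed

lemma hook_prod_cross_ratio:
  fixes f g :: "int \<Rightarrow> 'a::field" and q :: 'a
  assumes p: "is_partition p" "is_partition (add_box p k)" "1 \<le> k" and m: "is_partition m"
    and reflect: "\<And>h. g (h + 1) * f (- h) = q * f (- h - 1) * g h"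
    and nonzero: "\<And>h. \<bar>h\<bar> < int n \<Longrightarrow> f h \<noteq> 0" "\<And>h. \<bar>h\<bar> < int n \<Longrightarrow> g h \<noteq> 0"
    and size: "psize p + psize m < n"
    and N_eq: "N = conj_part m 1" and c_eq: "c = int (Suc (p k)) - int k"
  shows "hook_prod f (add_box p k) m * hook_prod g m (add_box p k) * (\<Prod>i=1..N. f (c - (int (m i) - int i))) =
    hook_prod f p m * hook_prod g m p * q ^ conj_part m (Suc (p k)) *
      (\<Prod>i=1..Suc N. f (c - (int (m i) - int i + 1)))"
proof -
  define b where "b = Suc (p k)"
  let ?r = "conj_part m b" and ?p = "add_box p k"
  have c_eq_b: "c = int b - int k" using c_eq b_def by simp
  have r: "?r \<le> N" using conj_part_antimono[OF m, of 1 b] b_def N_eq by simp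
  have bounds: "N \<le> psize m" "p k \<le> psize p" "k \<le> Suc (psize p)"
    using conj_part_le_psize[OF m] conj_part_le_psize[OF p(1)] part_le_psize[OF p(1)] add_box_row_le[OF p] N_eq
    by auto
  have split: "(\<Prod>i=1..M. h i) = (\<Prod>i\<in>{1..?r}. h i) * (\<Prod>i\<in>{?r<..M}. h i)" if "?r \<le> M"
    for h :: "nat \<Rightarrow> 'a" and M
    using that by (subst prod.union_disjoint[symmetric]) (auto intro!: prod.cong)
  have "g (int (m i) - int i - c) \<noteq> 0" if i: "1 \<le> i" "i \<le> ?r" for i
  proof -
    have "b \<le> m i" using conj_part_iff[OF m, of i b] i b_def by simp
    moreover have "m i \<le> psize m" using part_le_psize[OF m] .
    ultimately show ?thesis using i r bounds size p(3) c_eq_b b_def by (intro nonzero) auto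
  qed
  then have right: "hook_prod g m ?p * (\<Prod>i\<in>{1..?r}. f (c - (int (m i) - int i))) =
      hook_prod g m p * q ^ ?r * (\<Prod>i\<in>{1..?r}. f (c - (int (m i) - int i + 1)))"
    by (rule hook_prod_add_box_right_ratio[OF p m b_def c_eq_b reflect])
  have "f (c + h) \<noteq> 0" if "int ?r - int b < h" "h < int N" for h
    using that bounds size p(3) c_eq_b b_def by (intro nonzero) auto
  then have left: "hook_prod f ?p m * (\<Prod>i\<in>{?r<..N}. f (c - (int (m i) - int i))) =
      hook_prod f p m * (\<Prod>i\<in>{?r<..Suc N}. f (c - (int (m i) - int i + 1)))"
    by (rule hook_prod_add_box_left_ratio[OF p m eq_refl[OF N_eq[symmetric]] b_def c_eq_b])
  have "hook_prod f ?p m * hook_prod g m ?p * (\<Prod>i=1..N. f (c - (int (m i) - int i))) =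
      (hook_prod f ?p m * (\<Prod>i\<in>{?r<..N}. f (c - (int (m i) - int i)))) *
      (hook_prod g m ?p * (\<Prod>i\<in>{1..?r}. f (c - (int (m i) - int i))))"
    unfolding split[OF r] by (simp only: mult_ac)
  also have "\<dots> = hook_prod f p m * hook_prod g m p * q ^ ?r *
      ((\<Prod>i\<in>{1..?r}. f (c - (int (m i) - int i + 1))) * (\<Prod>i\<in>{?r<..Suc N}. f (c - (int (m i) - int i + 1))))"
    unfolding left right by (simp only: mult_ac)
  finally show ?thesis unfolding b_def[symmetric] split[OF le_SucI[OF r]] .
qed

lemma hook_prod_same_right_ratio:
  fixes f :: "int \<Rightarrow> 'a::field" and q :: 'a
  assumes p: "is_partition p" "is_partition (add_box p k)" "1 \<le> k"
    and reflect: "\<And>h. f (h + 1) * f (- h) = q * f (- h - 1) * f h"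
    and nonzero: "\<And>h. 0 < h \<Longrightarrow> h \<le> int n \<Longrightarrow> f h \<noteq> 0" and size: "psize p < n"
    and c_eq: "c = int (Suc (p k)) - int k"
  shows "hook_prod f p (add_box p k) * (\<Prod>i\<in>{1..<k}. f (c - (int (p i) - int i))) =
    hook_prod f p p * q ^ (k - 1) * (\<Prod>i\<in>{1..<k}. f (c - (int (p i) - int i + 1)))"
proof -
  have leg: "conj_part p (Suc (p k)) = k - 1" using conj_part_add_box(2)[OF p, of 1] by simp
  have bound: "p 1 + k \<le> psize p + 2" using row_plus_column_le_psize[OF p(1)] add_box_row_le[OF p] by simp
  have "f (int (p i) - int i - c) \<noteq> 0" if i: "1 \<le> i" "i \<le> k - 1" for i
  proof (rule nonzero)
    have "Suc (p k) \<le> p i" using conj_part_iff[OF p(1) i(1), of "Suc (p k)"] leg i by simp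
    then show "0 < int (p i) - int i - c" using i c_eq by auto
    show "int (p i) - int i - c \<le> int n" using partition_antimono[OF p(1) _ i(1)] i c_eq bound size by auto
  qed
  then show ?thesis
    using hook_prod_add_box_right_ratio[where f = f and g = f and q = q, OF p p(1) refl c_eq reflect] p(3)
    unfolding leg atLeastLessThanSuc_atLeastAtMost[symmetric] by simp
qed

lemma hook_prod_same_left_ratio:
  fixes f :: "int \<Rightarrow> 'a::field"
  assumes p: "is_partition p" "is_partition (add_box p k)" "1 \<le> k"
    and nonzero: "\<And>h. 0 < h \<Longrightarrow> h \<le> int n \<Longrightarrow> f h \<noteq> 0" and size: "psize p < n"
    and N_eq: "N = max (conj_part p 1) k" and c_eq: "c = int (Suc (p k)) - int k"
  shows "hook_prod f (add_box p k) (add_box p k) * (\<Prod>i\<in>{k<..N}. f (c - (int (p i) - int i))) =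
    hook_prod f p (add_box p k) * (\<Prod>i\<in>{k<..Suc N}. f (c - (int (p i) - int i + 1)))"
proof -
  let ?p = "add_box p k"
  have leg: "conj_part ?p (Suc (p k)) = k" using conj_part_add_box[OF p, of "Suc (p k)"] p(3) by simp
  have rows: "conj_part ?p 1 \<le> N"
    using conj_part_add_box[OF p, of 1] add_box_row_le[OF p] N_eq p(3) by (auto simp: max_def)
  have "f (c + h) \<noteq> 0" if "int k - int (Suc (p k)) < h" "h < int N" for h
    using that row_plus_column_le_psize[OF p(1)] partition_antimono[OF p(1) _ p(3)] add_box_row_le[OF p] c_eq
      size N_eq p(3)
    by (intro nonzero) auto
  from hook_prod_add_box_left_ratio[where f = f and N = N, OF p p(2) rows refl c_eq, unfolded leg, OF this]
  show ?thesis by (simp add: add_box_def)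
qed

lemma hook_prod_same_ratio:
  fixes f :: "int \<Rightarrow> 'a::field" and q :: 'a
  assumes p: "is_partition p" "is_partition (add_box p k)" "1 \<le> k"
    and f_one: "f 1 = 1" and reflect: "\<And>h. f (h + 1) * f (- h) = q * f (- h - 1) * f h"
    and nonzero: "\<And>h. 0 < h \<Longrightarrow> h \<le> int n \<Longrightarrow> f h \<noteq> 0"
    and size: "psize p < n"
    and N_eq: "N = conj_part p 1" and c_eq: "c = int (Suc (p k)) - int k"
  shows "hook_prod f (add_box p k) (add_box p k) * (\<Prod>i=1..N. f (c - (int (p i) - int i))) =
    hook_prod f p p * q ^ conj_part p (Suc (p k)) *
      (\<Prod>i\<in>{1..Suc N} - {k}. f (c - (int (p i) - int i + 1)))"
proof -
  let ?p = "add_box p k"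
  let ?f = "\<lambda>i. f (c - (int (p i) - int i))" and ?f' = "\<lambda>i. f (c - (int (p i) - int i + 1))"
  have right: "hook_prod f p ?p * (\<Prod>i\<in>{1..<k}. ?f i) = hook_prod f p p * q ^ (k - 1) * (\<Prod>i\<in>{1..<k}. ?f' i)"
    by (rule hook_prod_same_right_ratio[OF p reflect nonzero size c_eq])
  have left: "hook_prod f ?p ?p * (\<Prod>i\<in>{k<..max N k}. ?f i) = hook_prod f p ?p * (\<Prod>i\<in>{k<..Suc (max N k)}. ?f' i)"
    unfolding N_eq by (rule hook_prod_same_left_ratio[OF p nonzero size refl c_eq])
  have leg: "conj_part p (Suc (p k)) = k - 1" using conj_part_add_box(2)[OF p, of 1] by simp
  show ?thesis
  proof (cases "k \<le> N")
    case True
    have union: "(\<Prod>i\<in>{1..<k} \<union> {k<..M}. h i) = (\<Prod>i\<in>{1..<k}. h i) * (\<Prod>i\<in>{k<..M}. h i)"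
      for h :: "nat \<Rightarrow> 'a" and M by (rule prod.union_disjoint) auto
    have "?f k = 1" using f_one by (simp add: c_eq)
    moreover have "{1..N} = insert k ({1..<k} \<union> {k<..N})" "{1..Suc N} - {k} = {1..<k} \<union> {k<..Suc N}"
      using True p(3) by auto
    ultimately have products: "(\<Prod>i=1..N. ?f i) = (\<Prod>i\<in>{1..<k}. ?f i) * (\<Prod>i\<in>{k<..N}. ?f i)"
      "(\<Prod>i\<in>{1..Suc N} - {k}. ?f' i) = (\<Prod>i\<in>{1..<k}. ?f' i) * (\<Prod>i\<in>{k<..Suc N}. ?f' i)"
      by (simp_all add: union[unfolded One_nat_def])
    have "hook_prod f ?p ?p * (\<Prod>i=1..N. ?f i) =
        (hook_prod f ?p ?p * (\<Prod>i\<in>{k<..N}. ?f i)) * (\<Prod>i\<in>{1..<k}. ?f i)"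
      unfolding products by (simp only: mult_ac)
    also have "\<dots> = (hook_prod f p ?p * (\<Prod>i\<in>{1..<k}. ?f i)) * (\<Prod>i\<in>{k<..Suc N}. ?f' i)"
      using left True by (simp add: max_absorb1 mult_ac)
    also have "\<dots> = hook_prod f p p * q ^ (k - 1) * (\<Prod>i\<in>{1..Suc N} - {k}. ?f' i)"
      unfolding right products by (simp only: mult_ac)
    finally show ?thesis by (simp add: leg)
  next
    case False
    then have k: "k = Suc N" using add_box_row_le[OF p] N_eq by simp
    then have "p k = 0" "p (Suc k) = 0" using part_zero_iff[OF p(1)] N_eq p(3) by auto
    then have "?f' (Suc k) = 1" using f_one by (simp add: c_eq)
    moreover have "{k<..Suc k} = {Suc k}" "{1..Suc N} - {k} = {1..<k}" "{1..N} = {1..<k}" using k by auto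
    ultimately show ?thesis using left right k leg by (simp add: mult_ac)
  qed
qed

lemma upper_set_decreasing_list:
  "sorted_wrt (\<ge>) xs \<Longrightarrow>
    {k. k < length xs \<and> j \<le> xs ! k} = {..<length (filter (\<lambda>x. j \<le> x) xs)}"
  for xs :: "'a::linorder list"
proof (induction xs)
  case (Cons x xs)
  show ?case
  proof (cases "j \<le> x")
    case True
    have "{k. k < length (x # xs) \<and> j \<le> (x # xs) ! k} = insert 0 (Suc ` {k. k < length xs \<and> j \<le> xs ! k})"
      (is "?L = ?R")
    proof (rule Set.set_eqI)
      fix k show "k \<in> ?L \<longleftrightarrow> k \<in> ?R" using True by (cases k) auto
    qed
    then show ?thesis using Cons True by (simp add: lessThan_Suc_eq_insert_0)
  next
    case False
    then have "\<not> j \<le> y" if "y \<in> set xs" for y using Cons.prems that by (auto dest: order_trans)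
    then have "filter (\<lambda>x. j \<le> x) (x # xs) = []" using False by (simp add: filter_empty_conv)
    moreover have "\<not> j \<le> (x # xs) ! k" if "k < length (x # xs)" for k
      using \<open>\<And>y. y \<in> set xs \<Longrightarrow> \<not> j \<le> y\<close> False nth_mem[OF that] by auto
    ultimately show ?thesis by auto
  qed
qed simp

lemma sum_index_mult_decreasing_list:
  assumes "sorted_wrt (\<ge>) xs" "\<forall>x\<in>set xs. x \<le> M"
  shows "(\<Sum>k<length xs. k * xs ! k) = (\<Sum>j=1..M. \<Sum>k<length (filter (\<lambda>x. j \<le> x) xs). k)"
proof -
  have "(\<Sum>k<length xs. k * xs ! k) = (\<Sum>k<length xs. \<Sum>j=1..M. if j \<le> xs ! k then k else 0)"
  proof (rule sum.cong[OF refl])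
    fix k assume "k \<in> {..<length xs}"
    then have "xs ! k \<le> M" using assms(2) by simp
    then have "{j\<in>{1..M}. j \<le> xs ! k} = {1..xs ! k}" by auto
    then have "(\<Sum>j=1..M. if j \<le> xs ! k then k else 0) = (\<Sum>j\<in>{1..xs ! k}. k)"
      by (simp add: sum.inter_filter[symmetric])
    then show "k * xs ! k = (\<Sum>j=1..M. if j \<le> xs ! k then k else 0)" by simp
  qed
  also have "\<dots> = (\<Sum>j=1..M. \<Sum>k<length xs. if j \<le> xs ! k then k else 0)" by (rule sum.swap)
  also have "\<dots> = (\<Sum>j=1..M. \<Sum>k\<in>{k. k < length xs \<and> j \<le> xs ! k}. k)"
    by (simp add: sum.inter_filter[symmetric] lessThan_def)
  finally show ?thesis by (simp only: upper_set_decreasing_list[OF assms(1)])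
qed

lemma size_filter_mp_parts:
  assumes "\<forall>p\<in>set \<Lambda>. is_partition p" "1 \<le> j"
  shows "size {#x \<in># mp_parts \<Lambda>. j \<le> x#} = (\<Sum>p\<leftarrow>\<Lambda>. conj_part p j)"
  using assms(1) unfolding mp_parts_def
proof (induction \<Lambda>)
  case (Cons p \<Lambda>)
  have support: "finite {i. p i \<noteq> 0}" "p 0 = 0" using Cons.prems by (auto simp: is_partition_def)
  have "size {#x \<in># image_mset p (mset_set {i. p i \<noteq> 0}). j \<le> x#} = card {i. p i \<noteq> 0 \<and> j \<le> p i}"
    using support by (simp add: filter_mset_image_mset)
  also have "{i. p i \<noteq> 0 \<and> j \<le> p i} = {i. 1 \<le> i \<and> j \<le> p i}"
    using support assms(2) by (auto) (metis One_nat_def Suc_leI gr0I le_zero_eq not_one_le_zero)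
  finally show ?case using Cons by (simp add: conj_part_def)
qed simp

lemma n_stat_mp_bar:
  assumes "\<forall>p\<in>set \<Lambda>. is_partition p" "\<forall>p\<in>set \<Lambda>. \<forall>i. p i \<le> M"
  shows "n_stat (mp_bar \<Lambda>) = (\<Sum>j=1..M. \<Sum>k<(\<Sum>p\<leftarrow>\<Lambda>. conj_part p j). k)"
proof -
  define xs where "xs = rev (sorted_list_of_multiset (mp_parts \<Lambda>))"
  have mset: "mset xs = mp_parts \<Lambda>" by (simp add: xs_def)
  then have length: "length xs = size (mp_parts \<Lambda>)" by (metis size_mset)
  have decreasing: "sorted_wrt (\<ge>) xs" by (simp add: xs_def sorted_wrt_rev)
  have "x \<le> M" if "x \<in># mp_parts \<Lambda>" for x
    using that assms(2) unfolding mp_parts_def by (induction \<Lambda>) (auto split: if_splits)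
  then have bounded: "\<forall>x\<in>set xs. x \<le> M" using mset by (metis set_mset_mset)
  have "n_stat (mp_bar \<Lambda>) = (\<Sum>i=1..length xs. (i - 1) * mp_bar \<Lambda> i)"
    unfolding n_stat_def
  proof (rule sum.mono_neutral_left)
    show "{i. mp_bar \<Lambda> i \<noteq> 0} \<subseteq> {1..length xs}" by (auto simp: mp_bar_def length split: if_splits)
  qed auto
  also have "\<dots> = (\<Sum>k<length xs. k * xs ! k)"
    by (rule sum.reindex_bij_witness[of _ "Suc" "\<lambda>i. i - 1"])
       (auto simp: mp_bar_def length[symmetric] xs_def[symmetric])
  also have "\<dots> = (\<Sum>j=1..M. \<Sum>k<(\<Sum>p\<leftarrow>\<Lambda>. conj_part p j). k)"
    unfolding sum_index_mult_decreasing_list[OF decreasing bounded]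
  proof (rule sum.cong[OF refl])
    fix j assume "j \<in> {1..M}"
    then have "length (filter (\<lambda>x. j \<le> x) xs) = (\<Sum>p\<leftarrow>\<Lambda>. conj_part p j)"
      using size_filter_mp_parts[OF assms(1), of j] mset by (metis atLeastAtMost_iff mset_filter size_mset)
    then show "(\<Sum>k<length (filter (\<lambda>x. j \<le> x) xs). k) = (\<Sum>k<(\<Sum>p\<leftarrow>\<Lambda>. conj_part p j). k)"
      by (rule arg_cong)
  qed
  finally show ?thesis .
qed

lemma sum_list_update_nat:
  "s < length xs \<Longrightarrow> (\<Sum>x\<leftarrow>xs[s := y]. g x) + g (xs ! s) = (\<Sum>x\<leftarrow>xs. g x) + g y" for g :: "'b \<Rightarrow> nat"
  by (induction xs arbitrary: s) (auto simp: nth_Cons split: nat.splits)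

lemma part_le_mp_size:
  assumes "is_partition p" "p \<in> set \<Lambda>"
  shows "p i \<le> mp_size \<Lambda>"
  using part_le_psize[OF assms(1)] member_le_sum_list[of "psize p" "map psize \<Lambda>"] assms(2)
  unfolding mp_size_def by (fastforce intro: le_trans)

lemma n_stat_add_box:
  assumes \<Lambda>: "\<forall>p\<in>set \<Lambda>. is_partition p" "is_partition (add_box (\<Lambda> ! s) k)" "s < length \<Lambda>" "1 \<le> k"
  shows "n_stat (mp_bar (\<Lambda>[s := add_box (\<Lambda> ! s) k])) =
    n_stat (mp_bar \<Lambda>) + (\<Sum>p\<leftarrow>\<Lambda>. conj_part p (Suc ((\<Lambda> ! s) k)))"
proof -
  let ?p = "\<Lambda> ! s" and ?b = "Suc ((\<Lambda> ! s) k)" and ?\<Lambda> = "\<Lambda>[s := add_box (\<Lambda> ! s) k]"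
  let ?M = "Suc (mp_size \<Lambda>)"
  have p: "is_partition ?p" "?p \<in> set \<Lambda>" using \<Lambda> by simp_all
  have set: "r = add_box ?p k \<or> r \<in> set \<Lambda>" if "r \<in> set ?\<Lambda>" for r
    using that set_update_subset_insert[of \<Lambda> s "add_box ?p k"] by auto
  then have \<Lambda>': "\<forall>p\<in>set ?\<Lambda>. is_partition p" using \<Lambda> by auto
  have bounded: "\<forall>p\<in>set \<Lambda>. \<forall>i. p i \<le> ?M" using part_le_mp_size \<Lambda>(1) by (auto intro: le_SucI)
  have b_bounds: "?b \<in> {1..?M}" using part_le_mp_size[OF p] by simp
  have bounded': "\<forall>p\<in>set ?\<Lambda>. \<forall>i. p i \<le> ?M" using set bounded b_bounds p(2) by (fastforce simp: add_box_def)
  have legs: "(\<Sum>p\<leftarrow>?\<Lambda>. conj_part p j) = (\<Sum>p\<leftarrow>\<Lambda>. conj_part p j) + (if j = ?b then 1 else 0)" if "1 \<le> j" for j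
    using sum_list_update_nat[OF \<Lambda>(3), where y = "add_box ?p k" and g = "\<lambda>p. conj_part p j"]
      conj_part_add_box(1)[OF p(1) \<Lambda>(2,4) that] by (auto split: if_splits)
  have "n_stat (mp_bar ?\<Lambda>) = (\<Sum>j=1..?M. \<Sum>k<(\<Sum>p\<leftarrow>?\<Lambda>. conj_part p j). k)"
    by (rule n_stat_mp_bar[OF \<Lambda>' bounded'])
  also have "\<dots> = (\<Sum>j=1..?M. (\<Sum>k<(\<Sum>p\<leftarrow>\<Lambda>. conj_part p j). k) +
      (if j = ?b then (\<Sum>p\<leftarrow>\<Lambda>. conj_part p ?b) else 0))"
    using legs by (intro sum.cong) auto
  also have "\<dots> = n_stat (mp_bar \<Lambda>) + (\<Sum>p\<leftarrow>\<Lambda>. conj_part p ?b)"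
    using b_bounds unfolding sum.distrib n_stat_mp_bar[OF \<Lambda>(1) bounded] by (simp del: sum.cl_ivl_Suc)
  finally show ?thesis .
qed

definition q_number :: "'a::field \<Rightarrow> int \<Rightarrow> 'a" where
  "q_number q h = (if q = 1 then of_int h else (q powi h - 1) / (q - 1))"

lemma q_int_eq_q_number: "q_int q m = q_number q (int m)"
proof (cases "q = 1")
  case False
  then show ?thesis using q_int_eq[of q m] by (simp add: q_number_def field_simps)
qed (simp add: q_number_def q_int_1)

lemma q_number_1: "q_number q 1 = 1" by (simp add: q_number_def)

lemma q_number_0: "q_number q 0 = 0" by (simp add: q_number_def)

lemma q_number_reflect:
  fixes q :: "'a::field"
  assumes "q \<noteq> 0"
  shows "q_number q (h + 1) * q_number q (- h) = q * q_number q (- h - 1) * q_number q h"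
proof (cases "q = 1")
  case True
  then show ?thesis by (simp add: q_number_def algebra_simps)
next
  case False
  define D where "D = q powi h"
  have D_nonzero: "D \<noteq> 0" using assms by (simp add: D_def)
  have powers: "q powi (h + 1) = D * q" "q powi (- h) = inverse D" "q powi (- h - 1) = inverse D * inverse q"
    using assms power_int_add[of q h 1] power_int_minus[of q "h + 1"]
    by (auto simp: D_def power_int_minus)
  have "(D * q - 1) * (inverse D - 1) = q * (inverse D * inverse q - 1) * (D - 1)"
    using D_nonzero assms by (simp add: field_simps)
  then show ?thesis using False
    by (simp add: q_number_def powers D_def[symmetric] times_divide_times_eq)
qed

lemma hook_pos:
  assumes "is_partition p" "(i, j) \<in> young p"
  shows "1 \<le> hook p p i j"
  using assms young_iff_conj[OF assms(1), of i j] by (auto simp: hook_def young_def)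

definition schur_formula :: "nat \<Rightarrow> nat \<Rightarrow> 'a::field \<Rightarrow> (nat \<Rightarrow> 'a) \<Rightarrow> multipartition \<Rightarrow> 'a" where
  "schur_formula l m q Q \<Lambda> =
     (-1) ^ (m * (l - 1)) * q powi (- int (n_stat (mp_bar \<Lambda>))) *
        (\<Prod>s<l. \<Prod>(i, j)\<in>young (\<Lambda> ! s).
           q_int q (nat (hook (\<Lambda> ! s) (\<Lambda> ! s) i j)) *
           (\<Prod>t\<in>{..<l} - {s}.
              (q powi hook (\<Lambda> ! s) (\<Lambda> ! t) i j * Q s * inverse (Q t) - 1)))"

definition cross_factor :: "'a::field \<Rightarrow> (nat \<Rightarrow> 'a) \<Rightarrow> nat \<Rightarrow> nat \<Rightarrow> int \<Rightarrow> 'a" where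
  "cross_factor q Q s t h = q powi h * Q s * inverse (Q t) - 1"

lemma cross_factor_reflect:
  fixes q :: "'a::field"
  assumes "q \<noteq> 0" "Q s \<noteq> 0" "Q t \<noteq> 0"
  shows "cross_factor q Q t s (h + 1) * cross_factor q Q s t (- h) =
      q * cross_factor q Q s t (- h - 1) * cross_factor q Q t s h"
proof -
  define D where "D = q powi h"
  have D_nonzero: "D \<noteq> 0" using assms by (simp add: D_def)
  have powers: "q powi (h + 1) = D * q" "q powi (- h) = inverse D" "q powi (- h - 1) = inverse D * inverse q"
    using assms power_int_add[of q h 1] power_int_minus[of q "h + 1"]
    by (auto simp: D_def power_int_minus)
  show ?thesis unfolding cross_factor_def powers D_def[symmetric] using D_nonzero assms
    by (simp add: field_simps)
qed

definition self_hooks :: "nat \<Rightarrow> 'a::field \<Rightarrow> multipartition \<Rightarrow> 'a" where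
  "self_hooks l q \<Lambda> = (\<Prod>s<l. hook_prod (q_number q) (\<Lambda> ! s) (\<Lambda> ! s))"

definition cross_hooks :: "nat \<Rightarrow> 'a::field \<Rightarrow> (nat \<Rightarrow> 'a) \<Rightarrow> multipartition \<Rightarrow> 'a" where
  "cross_hooks l q Q \<Lambda> =
     (\<Prod>s<l. \<Prod>t\<in>{..<l} - {s}. hook_prod (cross_factor q Q s t) (\<Lambda> ! s) (\<Lambda> ! t))"

lemma schur_formula_eq_hook_prods:
  assumes "\<Lambda> \<in> multipartitions l m"
  shows "schur_formula l m q Q \<Lambda> =
     (-1) ^ (m * (l - 1)) * q powi (- int (n_stat (mp_bar \<Lambda>))) * (self_hooks l q \<Lambda> * cross_hooks l q Q \<Lambda>)"
proof -
  have component: "(\<Prod>(i, j)\<in>young (\<Lambda> ! s). q_int q (nat (hook (\<Lambda> ! s) (\<Lambda> ! s) i j)) *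
        (\<Prod>t\<in>{..<l} - {s}. (q powi hook (\<Lambda> ! s) (\<Lambda> ! t) i j * Q s * inverse (Q t) - 1))) =
      hook_prod (q_number q) (\<Lambda> ! s) (\<Lambda> ! s) *
        (\<Prod>t\<in>{..<l} - {s}. hook_prod (cross_factor q Q s t) (\<Lambda> ! s) (\<Lambda> ! t))"
    (is "(\<Prod>(i, j)\<in>_. ?factor i j) = _") if "s < l" for s
  proof -
    have "is_partition (\<Lambda> ! s)" using assms that by (auto simp: multipartitions_def)
    then have "?factor i j = q_number q (hook (\<Lambda> ! s) (\<Lambda> ! s) i j) *
        (\<Prod>t\<in>{..<l} - {s}. cross_factor q Q s t (hook (\<Lambda> ! s) (\<Lambda> ! t) i j))" if "(i, j) \<in> young (\<Lambda> ! s)" for i j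
      using hook_pos that by (fastforce simp: q_int_eq_q_number cross_factor_def)
    then have "(\<Prod>(i, j)\<in>young (\<Lambda> ! s). ?factor i j) =
        (\<Prod>(i, j)\<in>young (\<Lambda> ! s). q_number q (hook (\<Lambda> ! s) (\<Lambda> ! s) i j) *
          (\<Prod>t\<in>{..<l} - {s}. cross_factor q Q s t (hook (\<Lambda> ! s) (\<Lambda> ! t) i j)))"
      by (intro prod.cong) auto
    then show ?thesis by (simp only: case_prod_beta' prod.distrib prod.swap[of _ "{..<l} - {s}"])
  qed
  have "(\<Prod>s<l. \<Prod>(i, j)\<in>young (\<Lambda> ! s). q_int q (nat (hook (\<Lambda> ! s) (\<Lambda> ! s) i j)) *
        (\<Prod>t\<in>{..<l} - {s}. (q powi hook (\<Lambda> ! s) (\<Lambda> ! t) i j * Q s * inverse (Q t) - 1))) =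
      self_hooks l q \<Lambda> * cross_hooks l q Q \<Lambda>"
    unfolding self_hooks_def cross_hooks_def prod.distrib[symmetric]
    by (rule prod.cong[OF refl], rule component) simp
  then show ?thesis unfolding schur_formula_def by simp
qed

lemma prod_off_diagonal_remove:
  fixes B :: "nat \<Rightarrow> nat \<Rightarrow> 'a::comm_monoid_mult"
  assumes "s < l"
  shows "(\<Prod>s'<l. \<Prod>t\<in>{..<l} - {s'}. B s' t) =
    (\<Prod>t\<in>{..<l} - {s}. B s t * B t s) * (\<Prod>s'\<in>{..<l} - {s}. \<Prod>t\<in>{..<l} - {s'} - {s}. B s' t)"
proof -
  have "(\<Prod>s'<l. \<Prod>t\<in>{..<l} - {s'}. B s' t) =
     (\<Prod>t\<in>{..<l} - {s}. B s t) * (\<Prod>s'\<in>{..<l} - {s}. \<Prod>t\<in>{..<l} - {s'}. B s' t)"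
    using assms by (subst prod.remove[of _ s]) auto
  also have "(\<Prod>s'\<in>{..<l} - {s}. \<Prod>t\<in>{..<l} - {s'}. B s' t) =
     (\<Prod>s'\<in>{..<l} - {s}. B s' s * (\<Prod>t\<in>{..<l} - {s'} - {s}. B s' t))"
    using assms by (intro prod.cong refl prod.remove) auto
  finally show ?thesis by (simp add: prod.distrib mult_ac)
qed

lemma sum_psize:
  assumes "\<Lambda> \<in> multipartitions l m"
  shows "(\<Sum>s<l. psize (\<Lambda> ! s)) = m"
proof -
  have "length \<Lambda> = l" "(\<Sum>p\<leftarrow>\<Lambda>. psize p) = m" using assms by (auto simp: multipartitions_def mp_size_def)
  then show ?thesis by (simp add: sum_list_sum_nth atLeast0LessThan)
qed

lemma psize_le_mp_size:
  assumes "\<Lambda> \<in> multipartitions l m"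
  shows "s < l \<Longrightarrow> psize (\<Lambda> ! s) \<le> m"
    and "s < l \<Longrightarrow> t < l \<Longrightarrow> s \<noteq> t \<Longrightarrow> psize (\<Lambda> ! s) + psize (\<Lambda> ! t) \<le> m"
proof -
  show "psize (\<Lambda> ! s) \<le> m" if "s < l"
    unfolding sum_psize[OF assms, symmetric] using that by (intro member_le_sum) auto
  show "psize (\<Lambda> ! s) + psize (\<Lambda> ! t) \<le> m" if "s < l" "t < l" "s \<noteq> t"
  proof -
    have "(\<Sum>r\<in>{s, t}. psize (\<Lambda> ! r)) \<le> (\<Sum>s<l. psize (\<Lambda> ! s))" using that by (intro sum_mono2) auto
    then show ?thesis using that sum_psize[OF assms] by simp
  qed
qed

context separated
begin

lemma q_number_nonzero: "0 < \<bar>h\<bar> \<Longrightarrow> \<bar>h\<bar> \<le> int n \<Longrightarrow> q_number q h \<noteq> 0"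
  using of_int_nonzero[of h] powi_neq_1[of h] by (auto simp: q_number_def)

lemma cross_factor_nonzero:
  assumes "s < l" "t < l" "s \<noteq> t" "\<bar>h\<bar> < int n"
  shows "cross_factor q Q s t h \<noteq> 0"
  using Q_separated[OF assms] Q0[OF assms(2)] by (auto simp: cross_factor_def field_simps)

definition num_rows :: "multipartition \<Rightarrow> nat \<Rightarrow> nat" where "num_rows \<Lambda> t = conj_part (\<Lambda> ! t) 1"

definition row_next :: "multipartition \<Rightarrow> nat \<Rightarrow> nat \<Rightarrow> node" where "row_next \<Lambda> t i = (t, i, Suc ((\<Lambda> ! t) i))"

definition row_last :: "multipartition \<Rightarrow> nat \<Rightarrow> nat \<Rightarrow> node" where "row_last \<Lambda> t i = (t, i, (\<Lambda> ! t) i)"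

lemma content_row_next: "content (row_next \<Lambda> t i) = int ((\<Lambda> ! t) i) - int i + 1"
  and content_row_last: "content (row_last \<Lambda> t i) = int ((\<Lambda> ! t) i) - int i"
  by (auto simp: content_def row_next_def row_last_def)

definition weight_numer :: "multipartition \<Rightarrow> nat \<Rightarrow> int \<Rightarrow> 'k" where
  "weight_numer \<Lambda> s c = (\<Prod>i=1..num_rows \<Lambda> s. q_number q (c - content (row_last \<Lambda> s i))) *
     (\<Prod>t\<in>{..<l} - {s}. \<Prod>i=1..num_rows \<Lambda> t. cross_factor q Q s t (c - content (row_last \<Lambda> t i)))"

definition weight_denom :: "multipartition \<Rightarrow> nat \<Rightarrow> nat \<Rightarrow> 'k" where
  "weight_denom \<Lambda> s k = (\<Prod>i\<in>{1..Suc (num_rows \<Lambda> s)} - {k}. q_number q (content (row_next \<Lambda> s k) - content (row_next \<Lambda> s i))) *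
     (\<Prod>t\<in>{..<l} - {s}. \<Prod>i=1..Suc (num_rows \<Lambda> t). cross_factor q Q s t
       (content (row_next \<Lambda> s k) - content (row_next \<Lambda> t i)))"

definition box_weight :: "multipartition \<Rightarrow> nat \<Rightarrow> nat \<Rightarrow> 'k" where
  "box_weight \<Lambda> s k = (-1) ^ (l - 1) * weight_numer \<Lambda> s (content (row_next \<Lambda> s k)) / weight_denom \<Lambda> s k"

lemma self_hooks_add_box:
  assumes \<Lambda>: "\<Lambda> \<in> multipartitions l m" "m < n" "s < l" "1 \<le> k" "is_partition (add_box (\<Lambda> ! s) k)"
    and c_eq: "c = content (row_next \<Lambda> s k)"
  shows "self_hooks l q (\<Lambda>[s := add_box (\<Lambda> ! s) k]) *
      (\<Prod>i=1..num_rows \<Lambda> s. q_number q (c - content (row_last \<Lambda> s i))) =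
    self_hooks l q \<Lambda> * q ^ conj_part (\<Lambda> ! s) (Suc ((\<Lambda> ! s) k)) *
      (\<Prod>i\<in>{1..Suc (num_rows \<Lambda> s)} - {k}. q_number q (c - content (row_next \<Lambda> s i)))"
proof -
  let ?p = "add_box (\<Lambda> ! s) k" and ?rest = "\<Prod>t\<in>{..<l} - {s}. hook_prod (q_number q) (\<Lambda> ! t) (\<Lambda> ! t)"
  have \<Lambda>_s: "length \<Lambda> = l" "is_partition (\<Lambda> ! s)" using \<Lambda>(1,3) by (auto simp: multipartitions_def)
  have component: "hook_prod (q_number q) ?p ?p * (\<Prod>i=1..num_rows \<Lambda> s. q_number q (c - content (row_last \<Lambda> s i))) =
     hook_prod (q_number q) (\<Lambda> ! s) (\<Lambda> ! s) * q ^ conj_part (\<Lambda> ! s) (Suc ((\<Lambda> ! s) k)) *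
       (\<Prod>i\<in>{1..Suc (num_rows \<Lambda> s)} - {k}. q_number q (c - content (row_next \<Lambda> s i)))"
    unfolding c_eq content_row_next content_row_last
    using psize_le_mp_size(1)[OF \<Lambda>(1,3)] \<Lambda>(2)
    by (intro hook_prod_same_ratio[OF \<Lambda>_s(2) \<Lambda>(5,4), where n = n])
       (use q_number_nonzero in \<open>auto simp: q_number_1 q_number_reflect q0 num_rows_def\<close>)
  have totals: "self_hooks l q \<Lambda> = hook_prod (q_number q) (\<Lambda> ! s) (\<Lambda> ! s) * ?rest"
    "self_hooks l q (\<Lambda>[s := ?p]) = hook_prod (q_number q) ?p ?p * ?rest"
    using \<Lambda>(3) \<Lambda>_s(1) unfolding self_hooks_def by (simp_all add: prod.remove[of "{..<l}" s])
  show ?thesis using arg_cong[OF component, of "\<lambda>x. x * ?rest"] unfolding totals by (simp only: mult_ac)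
qed

lemma cross_hooks_add_box:
  assumes \<Lambda>: "\<Lambda> \<in> multipartitions l m" "m < n" "s < l" "1 \<le> k" "is_partition (add_box (\<Lambda> ! s) k)"
    and c_eq: "c = content (row_next \<Lambda> s k)"
  shows "cross_hooks l q Q (\<Lambda>[s := add_box (\<Lambda> ! s) k]) *
      (\<Prod>t\<in>{..<l} - {s}. \<Prod>i=1..num_rows \<Lambda> t. cross_factor q Q s t (c - content (row_last \<Lambda> t i))) =
    cross_hooks l q Q \<Lambda> * (\<Prod>t\<in>{..<l} - {s}. q ^ conj_part (\<Lambda> ! t) (Suc ((\<Lambda> ! s) k))) *
      (\<Prod>t\<in>{..<l} - {s}. \<Prod>i=1..Suc (num_rows \<Lambda> t). cross_factor q Q s t (c - content (row_next \<Lambda> t i)))"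
proof -
  let ?p = "add_box (\<Lambda> ! s) k" and ?\<Lambda> = "\<Lambda>[s := add_box (\<Lambda> ! s) k]"
  let ?B = "\<lambda>\<Lambda> s t. hook_prod (cross_factor q Q s t) (\<Lambda> ! s) (\<Lambda> ! t)"
  define rest where "rest = (\<Prod>s'\<in>{..<l} - {s}. \<Prod>t\<in>{..<l} - {s'} - {s}. ?B \<Lambda> s' t)"
  have length: "length \<Lambda> = l" and partition: "is_partition (\<Lambda> ! t)" if "t < l" for t
    using \<Lambda>(1) that by (auto simp: multipartitions_def)
  have nth: "?\<Lambda> ! s = ?p" "t \<noteq> s \<Longrightarrow> ?\<Lambda> ! t = \<Lambda> ! t" for t
    using length \<Lambda>(3) by auto
  have pair: "?B ?\<Lambda> s t * ?B ?\<Lambda> t s * (\<Prod>i=1..num_rows \<Lambda> t. cross_factor q Q s t (c - content (row_last \<Lambda> t i))) =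
     ?B \<Lambda> s t * ?B \<Lambda> t s * q ^ conj_part (\<Lambda> ! t) (Suc ((\<Lambda> ! s) k)) *
       (\<Prod>i=1..Suc (num_rows \<Lambda> t). cross_factor q Q s t (c - content (row_next \<Lambda> t i)))"
    if "t \<in> {..<l} - {s}" for t
  proof -
    have t: "t < l" "t \<noteq> s" using that by auto
    show ?thesis unfolding nth(1) nth(2)[OF t(2)] c_eq content_row_next content_row_last
      using psize_le_mp_size(2)[OF \<Lambda>(1,3) t(1)] t \<Lambda>(2)
      by (intro hook_prod_cross_ratio[OF partition[OF \<Lambda>(3)] \<Lambda>(5,4) partition[OF t(1)], where n = n])
         (use cross_factor_nonzero \<Lambda>(3) in \<open>auto simp: cross_factor_reflect q0 Q0 num_rows_def\<close>)
  qed
  have "(\<Prod>s'\<in>{..<l} - {s}. \<Prod>t\<in>{..<l} - {s'} - {s}. ?B ?\<Lambda> s' t) = rest"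
    unfolding rest_def by (intro prod.cong) (auto simp: nth)
  then have total': "cross_hooks l q Q ?\<Lambda> = (\<Prod>t\<in>{..<l} - {s}. ?B ?\<Lambda> s t * ?B ?\<Lambda> t s) * rest"
    unfolding cross_hooks_def using prod_off_diagonal_remove[OF \<Lambda>(3), of "?B ?\<Lambda>"] by simp
  have total: "cross_hooks l q Q \<Lambda> = (\<Prod>t\<in>{..<l} - {s}. ?B \<Lambda> s t * ?B \<Lambda> t s) * rest"
    unfolding cross_hooks_def rest_def by (rule prod_off_diagonal_remove[OF \<Lambda>(3), of "?B \<Lambda>"])
  have "(\<Prod>t\<in>{..<l} - {s}. ?B ?\<Lambda> s t * ?B ?\<Lambda> t s) *
      (\<Prod>t\<in>{..<l} - {s}. \<Prod>i=1..num_rows \<Lambda> t. cross_factor q Q s t (c - content (row_last \<Lambda> t i))) =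
      (\<Prod>t\<in>{..<l} - {s}. ?B \<Lambda> s t * ?B \<Lambda> t s) * (\<Prod>t\<in>{..<l} - {s}. q ^ conj_part (\<Lambda> ! t) (Suc ((\<Lambda> ! s) k))) *
      (\<Prod>t\<in>{..<l} - {s}. \<Prod>i=1..Suc (num_rows \<Lambda> t). cross_factor q Q s t (c - content (row_next \<Lambda> t i)))"
    unfolding prod.distrib[symmetric] by (rule prod.cong[OF refl], rule pair)
  then show ?thesis unfolding total total' by (simp only: mult_ac)
qed

lemma schur_formula_add_box:
  assumes \<Lambda>: "\<Lambda> \<in> multipartitions l m" "m < n" "s < l" "1 \<le> k" "is_partition (add_box (\<Lambda> ! s) k)"
    and \<Lambda>': "\<Lambda>' = \<Lambda>[s := add_box (\<Lambda> ! s) k]" "\<Lambda>' \<in> multipartitions l (Suc m)"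
  shows "schur_formula l (Suc m) q Q \<Lambda>' * weight_numer \<Lambda> s (content (row_next \<Lambda> s k)) =
    (-1) ^ (l - 1) * schur_formula l m q Q \<Lambda> * weight_denom \<Lambda> s k"
proof -
  let ?leg = "\<lambda>p. conj_part p (Suc ((\<Lambda> ! s) k))"
  define legs where "legs = (\<Sum>p\<leftarrow>\<Lambda>. ?leg p)"
  have length: "length \<Lambda> = l" using \<Lambda>(1) by (simp add: multipartitions_def)
  have "q ^ legs = (\<Prod>t<l. q ^ ?leg (\<Lambda> ! t))"
    by (simp add: legs_def sum_list_sum_nth atLeast0LessThan length power_sum)
  also have "\<dots> = q ^ ?leg (\<Lambda> ! s) * (\<Prod>t\<in>{..<l} - {s}. q ^ ?leg (\<Lambda> ! t))"
    using \<Lambda>(3) by (intro prod.remove) auto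
  finally have hooks: "self_hooks l q \<Lambda>' * cross_hooks l q Q \<Lambda>' * weight_numer \<Lambda> s (content (row_next \<Lambda> s k)) =
      self_hooks l q \<Lambda> * cross_hooks l q Q \<Lambda> * q ^ legs * weight_denom \<Lambda> s k"
    using arg_cong2[OF self_hooks_add_box[OF \<Lambda> refl] cross_hooks_add_box[OF \<Lambda> refl], of "(*)"]
    unfolding weight_numer_def weight_denom_def \<Lambda>'(1) by (simp only: mult_ac)
  have "n_stat (mp_bar \<Lambda>') = n_stat (mp_bar \<Lambda>) + legs"
    unfolding \<Lambda>'(1) legs_def using \<Lambda> length by (intro n_stat_add_box) (auto simp: multipartitions_def)
  then have powers: "q powi (- int (n_stat (mp_bar \<Lambda>))) = q powi (- int (n_stat (mp_bar \<Lambda>'))) * q ^ legs"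
    using q0 by (simp add: power_int_diff power_int_minus)
  show ?thesis
    using arg_cong[OF hooks, of "\<lambda>x. (-1) ^ (l - 1) * (-1) ^ (m * (l - 1)) *
        q powi (- int (n_stat (mp_bar \<Lambda>'))) * x"]
    unfolding schur_formula_eq_hook_prods[OF \<Lambda>(1)] schur_formula_eq_hook_prods[OF \<Lambda>'(2)] mult_Suc power_add
      powers
    by (simp only: mult_ac)
qed

end

section \<open>Lagrange interpolation at the residues of the addable nodes\<close>

lemma prod_linear_monic:
  fixes e :: "'i \<Rightarrow> 'a::field"
  assumes "finite J"
  shows "degree (\<Prod>i\<in>J. [:- e i, 1:]) = card J" "coeff (\<Prod>i\<in>J. [:- e i, 1:]) (card J) = 1"
proof -
  show degree: "degree (\<Prod>i\<in>J. [:- e i, 1:]) = card J" by (simp add: degree_prod_sum_eq)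
  show "coeff (\<Prod>i\<in>J. [:- e i, 1:]) (card J) = 1"
    using lead_coeff_prod[of "\<lambda>i. [:- e i, 1:]" J] unfolding degree by simp
qed

lemma lagrange_interpolation:
  fixes z :: "'i \<Rightarrow> 'a::field"
  assumes I: "finite I" "inj_on z I" and P: "degree P < card I"
  shows "P = (\<Sum>x\<in>I. Polynomial.smult (poly P (z x) / (\<Prod>y\<in>I - {x}. z x - z y)) (\<Prod>y\<in>I - {x}. [:- z y, 1:]))"
    (is "P = ?L")
proof -
  have "degree (\<Prod>y\<in>I - {x}. [:- z y, 1:]) \<le> card I - 1" if "x \<in> I" for x
    using that I(1) by (simp add: prod_linear_monic(1))
  then have "degree ?L \<le> card I - 1"
    by (intro degree_sum_le I(1)) (use degree_smult_le le_trans in blast)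
  moreover have "poly ?L (z w) = poly P (z w)" if w: "w \<in> I" for w
  proof -
    have "(\<Prod>y\<in>I - {x}. z w - z y) = (if x = w then \<Prod>y\<in>I - {x}. z x - z y else 0)" if "x \<in> I" for x
      using w I(1) by (auto intro!: prod_zero)
    then have "poly ?L (z w) = (\<Sum>x\<in>I. if x = w then poly P (z x) / (\<Prod>y\<in>I - {x}. z x - z y) *
        (\<Prod>y\<in>I - {x}. z x - z y) else 0)"
      unfolding poly_sum by (intro sum.cong) (auto simp: poly_prod)
    also have "\<dots> = poly P (z w) / (\<Prod>y\<in>I - {w}. z w - z y) * (\<Prod>y\<in>I - {w}. z w - z y)" using w I(1) by simp
    also have "(\<Prod>y\<in>I - {w}. z w - z y) \<noteq> 0" using I w by (auto simp: inj_on_def)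
    then have "poly P (z w) / (\<Prod>y\<in>I - {w}. z w - z y) * (\<Prod>y\<in>I - {w}. z w - z y) = poly P (z w)" by simp
    finally show ?thesis .
  qed
  ultimately show ?thesis using P I
    by (intro poly_eqI_degree[of "z ` I"]) (auto simp: card_image)
qed

lemma lagrange_sum_at_0:
  fixes z :: "'i \<Rightarrow> 'a::field"
  assumes "finite I" "inj_on z I" "degree P < card I"
  shows "(\<Sum>x\<in>I. poly P (z x) * (\<Prod>y\<in>I - {x}. - z y / (z x - z y))) = poly P 0"
proof -
  have "poly P 0 = (\<Sum>x\<in>I. poly P (z x) / (\<Prod>y\<in>I - {x}. z x - z y) * (\<Prod>y\<in>I - {x}. - z y))"
    by (subst lagrange_interpolation[OF assms]) (simp add: poly_sum poly_prod)
  then show ?thesis by (simp only: prod_dividef times_divide_eq_right times_divide_eq_left)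
qed

lemma lagrange_sum_top_coeff:
  fixes z :: "'i \<Rightarrow> 'a::field"
  assumes "finite I" "inj_on z I" "degree P < card I"
  shows "(\<Sum>x\<in>I. poly P (z x) / (\<Prod>y\<in>I - {x}. z x - z y)) = coeff P (card I - 1)"
proof -
  have "coeff (\<Prod>y\<in>I - {x}. [:- z y, 1:]) (card I - 1) = 1" if "x \<in> I" for x
    using prod_linear_monic(2)[of "I - {x}" z] that assms(1) by simp
  then show ?thesis
    by (subst (2) lagrange_interpolation[OF assms]) (simp add: coeff_sum)
qed

lemma prod_Sigma_remove:
  fixes l :: nat and J :: "nat \<Rightarrow> 'b set" and h :: "nat \<times> 'b \<Rightarrow> 'a::comm_monoid_mult"
  assumes "s < l" "\<And>t. finite (J t)"
  shows "(\<Prod>x\<in>Sigma {..<l} J. h x) = (\<Prod>i\<in>J s. h (s, i)) * (\<Prod>t\<in>{..<l} - {s}. \<Prod>i\<in>J t. h (t, i))"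
proof -
  have "(\<Prod>x\<in>Sigma {..<l} J. h x) = (\<Prod>t<l. \<Prod>i\<in>J t. h (t, i))"
    using assms(2) by (subst prod.Sigma) auto
  also have "\<dots> = (\<Prod>i\<in>J s. h (s, i)) * (\<Prod>t\<in>{..<l} - {s}. \<Prod>i\<in>J t. h (t, i))"
    using assms(1) by (intro prod.remove) auto
  finally show ?thesis .
qed

context separated
begin

definition residue_factor :: "node \<Rightarrow> node \<Rightarrow> 'k" where
  "residue_factor x y = (res x - res y) / (- res y)"

lemma residue_factor_same_component:
  assumes "q \<noteq> 1" "fst x = fst y" "fst y < l"
  shows "residue_factor x y = (1 - q) * q_number q (content x - content y)"
proof -
  have "Q (fst y) \<noteq> 0" using Q0 assms by simp
  then have "(res x - res y) / res y = q powi (content x - content y) - 1"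
    using powi_nonzero[of "content y"] assms(2) by (simp add: residue_def power_int_diff q0 field_simps)
  then have "residue_factor x y = - (q powi (content x - content y) - 1)"
    by (simp only: residue_factor_def divide_minus_right)
  also have "\<dots> = (1 - q) * q_number q (content x - content y)"
    using assms(1) minus_divide_left[of "q - 1"]
    by (simp add: q_number_def divide_eq_eq eq_divide_eq algebra_simps)
  finally show ?thesis .
qed

lemma residue_factor_other_component:
  assumes "fst y < l"
  shows "residue_factor x y = - cross_factor q Q (fst x) (fst y) (content x - content y)"
proof -
  have "Q (fst y) \<noteq> 0" using Q0 assms by simp
  then have "(res x - res y) / res y = cross_factor q Q (fst x) (fst y) (content x - content y)"
    using powi_nonzero[of "content y"] by (simp add: residue_def cross_factor_def power_int_diff q0 field_simps)
  then show ?thesis by (simp add: residue_factor_def divide_minus_right)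
qed

lemma prod_residue_factor:
  assumes "q \<noteq> 1" "fst x < l" "\<And>t. finite (J t)" "\<And>t i. fst (y t i) = t"
  shows "(\<Prod>(t, i)\<in>Sigma {..<l} J. residue_factor x (y t i)) =
    (1 - q) ^ card (J (fst x)) * (\<Prod>t\<in>{..<l} - {fst x}. (-1) ^ card (J t)) *
    ((\<Prod>i\<in>J (fst x). q_number q (content x - content (y (fst x) i))) *
     (\<Prod>t\<in>{..<l} - {fst x}. \<Prod>i\<in>J t. cross_factor q Q (fst x) t (content x - content (y t i))))"
proof -
  have "(\<Prod>i\<in>J (fst x). residue_factor x (y (fst x) i)) =
      (1 - q) ^ card (J (fst x)) * (\<Prod>i\<in>J (fst x). q_number q (content x - content (y (fst x) i)))"
    using assms by (simp add: residue_factor_same_component prod.distrib)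
  moreover have "(\<Prod>i\<in>J t. residue_factor x (y t i)) =
      (-1) ^ card (J t) * (\<Prod>i\<in>J t. cross_factor q Q (fst x) t (content x - content (y t i)))" if "t < l" for t
    using prod.distrib[of "\<lambda>_. -1" "\<lambda>i. cross_factor q Q (fst x) t (content x - content (y t i))" "J t"]
      assms(4) that
    by (simp add: residue_factor_other_component)
  ultimately show ?thesis
    using prod_Sigma_remove[where J = J and h = "\<lambda>(t, i). residue_factor x (y t i)", OF assms(2,3)]
    by (simp add: prod.distrib mult_ac)
qed

lemma residue_nonzero: "fst x < l \<Longrightarrow> res x \<noteq> 0" using Q0 powi_nonzero by (simp add: residue_def)

context
  fixes \<Lambda> m assumes \<Lambda>: "\<Lambda> \<in> multipartitions l m" and m: "m < n"
begin

lemma component_partition: "s < l \<Longrightarrow> is_partition (\<Lambda> ! s)" using \<Lambda> by (auto simp: multipartitions_def)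

lemma content_row_next_bounds:
  assumes "s < l" "1 \<le> i" "i \<le> Suc (num_rows \<Lambda> s)"
  shows "- int (num_rows \<Lambda> s) \<le> content (row_next \<Lambda> s i)" "content (row_next \<Lambda> s i) \<le> int ((\<Lambda> ! s) 1)"
proof -
  show "content (row_next \<Lambda> s i) \<le> int ((\<Lambda> ! s) 1)"
    using partition_antimono[OF component_partition[OF assms(1)], of 1 i] assms by (simp add: content_row_next)
  show "- int (num_rows \<Lambda> s) \<le> content (row_next \<Lambda> s i)" using assms by (simp add: content_row_next)
qed

lemma content_row_last_bounds:
  assumes "s < l" "1 \<le> i" "i \<le> num_rows \<Lambda> s"
  shows "- int (num_rows \<Lambda> s) \<le> content (row_last \<Lambda> s i)" "content (row_last \<Lambda> s i) \<le> int ((\<Lambda> ! s) 1)"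
  using content_row_next_bounds[of s i] assms part_zero_iff[OF component_partition[OF assms(1)], of i]
  by (auto simp: content_row_next content_row_last num_rows_def)

lemma row_plus_num_rows_le: "s < l \<Longrightarrow> (\<Lambda> ! s) 1 + num_rows \<Lambda> s \<le> n"
  using row_plus_column_le_psize[OF component_partition, of s] psize_le_mp_size(1)[OF \<Lambda>, of s] m
  by (simp add: num_rows_def)

lemma row_plus_other_num_rows_less:
  assumes "s < l" "t < l" "s \<noteq> t"
  shows "(\<Lambda> ! s) 1 + num_rows \<Lambda> t < n"
  using part_le_psize[OF component_partition[OF assms(1)], of 1]
    conj_part_le_psize[OF component_partition[OF assms(2)]]
    psize_le_mp_size(2)[OF \<Lambda> assms] m by (simp add: num_rows_def)

lemma distinguishable_from_bounds:
  assumes "fst x = s" "fst y = t" "s < l" "t < l"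
    "- int (num_rows \<Lambda> s) \<le> content x" "content x \<le> int ((\<Lambda> ! s) 1)"
    "- int (num_rows \<Lambda> t) \<le> content y" "content y \<le> int ((\<Lambda> ! t) 1)"
    "s = t \<Longrightarrow> content x \<noteq> content y"
  shows "distinguishable x y"
  using assms row_plus_num_rows_le[of s] row_plus_other_num_rows_less[of s t]
    row_plus_other_num_rows_less[of t s]
  by (intro distinguishableI) auto

lemma content_row_next_inj:
  assumes "s < l" "1 \<le> i" "1 \<le> j" "i \<noteq> j"
  shows "content (row_next \<Lambda> s i) \<noteq> content (row_next \<Lambda> s j)"
  using partition_antimono[OF component_partition[OF assms(1)], of i j]
    partition_antimono[OF component_partition[OF assms(1)], of j i] assms
  by (cases i j rule: linorder_cases) (auto simp: content_row_next)

lemma distinguishable_row_next: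
  assumes "s < l" "1 \<le> i" "i \<le> Suc (num_rows \<Lambda> s)" "t < l" "1 \<le> j" "j \<le> Suc (num_rows \<Lambda> t)" "(s, i) \<noteq> (t, j)"
  shows "distinguishable (row_next \<Lambda> s i) (row_next \<Lambda> t j)"
proof (rule distinguishable_from_bounds[of _ s _ t])
  show "fst (row_next \<Lambda> s i) = s" "fst (row_next \<Lambda> t j) = t" by (auto simp: row_next_def)
  show "content (row_next \<Lambda> s i) \<noteq> content (row_next \<Lambda> t j)" if "s = t"
    using content_row_next_inj[of s i j] assms that by auto
qed (use assms content_row_next_bounds in auto)

lemma distinguishable_row_last_next:
  assumes "s < l" "1 \<le> k" "k \<le> Suc (num_rows \<Lambda> s)" "u < l" "1 \<le> v" "v \<le> num_rows \<Lambda> u"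
    "(\<Lambda> ! u) (Suc v) < (\<Lambda> ! u) v"
  shows "distinguishable (row_last \<Lambda> u v) (row_next \<Lambda> s k)"
proof (rule distinguishable_from_bounds[of _ u _ s])
  show "fst (row_last \<Lambda> u v) = u" "fst (row_next \<Lambda> s k) = s" by (auto simp: row_next_def row_last_def)
  show "content (row_last \<Lambda> u v) \<noteq> content (row_next \<Lambda> s k)" if same: "u = s"
  proof (cases "k \<le> v")
    case True
    then show ?thesis using partition_antimono[OF component_partition[OF assms(4)], of k v] assms same
      by (simp add: content_row_last content_row_next)
  next
    case False
    then show ?thesis using partition_antimono[OF component_partition[OF assms(4)], of "Suc v" k] assms same
      by (simp add: content_row_last content_row_next)
  qed
qed (use assms content_row_next_bounds content_row_last_bounds in auto)

lemma weight_denom_nonzero: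
  assumes "s < l" "1 \<le> k" "k \<le> Suc (num_rows \<Lambda> s)"
  shows "weight_denom \<Lambda> s k \<noteq> 0"
proof -
  have "q_number q (content (row_next \<Lambda> s k) - content (row_next \<Lambda> s i)) \<noteq> 0"
    if "i \<in> {1..Suc (num_rows \<Lambda> s)} - {k}" for i
    using content_row_next_bounds[of s k] content_row_next_bounds[of s i] content_row_next_inj[of s k i]
      row_plus_num_rows_le[of s] that assms by (intro q_number_nonzero) auto
  moreover have "cross_factor q Q s t (content (row_next \<Lambda> s k) - content (row_next \<Lambda> t i)) \<noteq> 0"
    if "t \<in> {..<l} - {s}" "i \<in> {1..Suc (num_rows \<Lambda> t)}" for t i
    using content_row_next_bounds[of s k] content_row_next_bounds[of t i] row_plus_other_num_rows_less[of s t]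
      row_plus_other_num_rows_less[of t s] that assms
    by (intro cross_factor_nonzero) auto
  ultimately show ?thesis unfolding weight_denom_def by (simp add: prod_zero_iff)
qed

lemma box_weight_zero:
  assumes "s < l" "1 < k" "k \<le> Suc (num_rows \<Lambda> s)" "(\<Lambda> ! s) k = (\<Lambda> ! s) (k - 1)"
  shows "box_weight \<Lambda> s k = 0"
proof -
  have "content (row_next \<Lambda> s k) = content (row_last \<Lambda> s (k - 1))" using assms
    by (simp add: content_row_last content_row_next)
  then have "(\<Prod>i=1..num_rows \<Lambda> s. q_number q (content (row_next \<Lambda> s k) - content (row_last \<Lambda> s i))) = 0"
    using assms by (intro prod_zero) (auto simp: q_number_0 intro!: bexI[of _ "k - 1"])
  then show ?thesis by (simp add: box_weight_def weight_numer_def)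
qed

definition row_indices :: "(nat \<times> nat) set" where
  "row_indices = (SIGMA t:{..<l}. {1..num_rows \<Lambda> t})"

definition next_row_indices :: "(nat \<times> nat) set" where
  "next_row_indices = (SIGMA t:{..<l}. {1..Suc (num_rows \<Lambda> t)})"

lemma finite_row_indices: "finite row_indices" by (simp add: row_indices_def)

lemma box_weight_eq_residue_factors:
  assumes q: "q \<noteq> 1" and sk: "s < l" "1 \<le> k" "k \<le> Suc (num_rows \<Lambda> s)"
  shows "box_weight \<Lambda> s k =
    (\<Prod>(t, i)\<in>row_indices. residue_factor (row_next \<Lambda> s k) (row_last \<Lambda> t i)) *
    (\<Prod>(t, i)\<in>next_row_indices - {(s, k)}. inverse (residue_factor (row_next \<Lambda> s k) (row_next \<Lambda> t i)))"
proof -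
  define x where "x = row_next \<Lambda> s k"
  define scale where "scale = (1 - q) ^ num_rows \<Lambda> s * (\<Prod>t\<in>{..<l} - {s}. (-1) ^ num_rows \<Lambda> t)"
  have fst: "fst x = s" "fst (row_last \<Lambda> t i) = t" "fst (row_next \<Lambda> t i) = t" for t i
    by (auto simp: x_def row_last_def row_next_def)
  have numer: "(\<Prod>(t, i)\<in>row_indices. residue_factor x (row_last \<Lambda> t i)) = scale * weight_numer \<Lambda> s (content x)"
    unfolding row_indices_def weight_numer_def scale_def
    using prod_residue_factor[of x "\<lambda>t. {1..num_rows \<Lambda> t}" "row_last \<Lambda>"] q sk(1) by (simp add: fst)
  define J where "J t = (if t = s then {1..Suc (num_rows \<Lambda> s)} - {k} else {1..Suc (num_rows \<Lambda> t)})" for t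
  have "next_row_indices - {(s, k)} = Sigma {..<l} J"
    by (auto simp: next_row_indices_def J_def split: if_splits)
  then have "(\<Prod>(t, i)\<in>next_row_indices - {(s, k)}. residue_factor x (row_next \<Lambda> t i)) =
      (1 - q) ^ num_rows \<Lambda> s * (\<Prod>t\<in>{..<l} - {s}. (-1) ^ Suc (num_rows \<Lambda> t)) * weight_denom \<Lambda> s k"
    unfolding weight_denom_def x_def[symmetric]
    using prod_residue_factor[of x J "row_next \<Lambda>"] q sk by (simp add: fst J_def del: power_Suc prod.cl_ivl_Suc)
  also have "(\<Prod>t\<in>{..<l} - {s}. (-1 :: 'k) ^ Suc (num_rows \<Lambda> t)) =
      (-1) ^ (l - 1) * (\<Prod>t\<in>{..<l} - {s}. (-1) ^ num_rows \<Lambda> t)"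
    using sk(1) unfolding power_Suc prod.distrib by simp
  finally have denom: "(\<Prod>(t, i)\<in>next_row_indices - {(s, k)}. residue_factor x (row_next \<Lambda> t i)) =
      scale * ((-1) ^ (l - 1) * weight_denom \<Lambda> s k)"
    unfolding scale_def by (simp only: mult_ac)
  have "scale \<noteq> 0" using q by (simp add: scale_def prod_zero_iff)
  then have "box_weight \<Lambda> s k = scale * weight_numer \<Lambda> s (content x) / (scale *
      ((-1) ^ (l - 1) * weight_denom \<Lambda> s k))"
    by (simp add: box_weight_def x_def[symmetric] minus_one_power_iff)
  then show ?thesis
    unfolding x_def[symmetric] numer[symmetric] denom[symmetric]
    by (simp add: divide_inverse prod_inversef[symmetric, unfolded comp_def] case_prod_beta')
qed

lemma sum_box_weight_eq_poly_at_0: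
  assumes q: "q \<noteq> 1"
    and interpolates: "\<And>s k. s < l \<Longrightarrow> 1 \<le> k \<Longrightarrow> k \<le> Suc (num_rows \<Lambda> s) \<Longrightarrow>
      (\<Prod>(t, i)\<in>row_indices. residue_factor (row_next \<Lambda> s k) (row_last \<Lambda> t i)) * g s k =
        poly P (res (row_next \<Lambda> s k))"
    and degree: "degree P < card row_indices + l"
  shows "(\<Sum>s<l. \<Sum>k=1..Suc (num_rows \<Lambda> s). box_weight \<Lambda> s k * g s k) = poly P 0"
proof -
  define z where "z y = res (row_next \<Lambda> (fst y) (snd y))" for y
  have inj: "inj_on z next_row_indices"
  proof (rule inj_onI, rule ccontr)
    fix x y assume xy: "x \<in> next_row_indices" "y \<in> next_row_indices" "z x = z y" "x \<noteq> y"
    then have "distinguishable (row_next \<Lambda> (fst x) (snd x)) (row_next \<Lambda> (fst y) (snd y))"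
      by (intro distinguishable_row_next) (auto simp: next_row_indices_def)
    then show False using xy q by (simp add: distinguishable_def z_def)
  qed
  have card: "card next_row_indices = card row_indices + l"
    by (simp add: row_indices_def next_row_indices_def sum_Suc)
  have "(\<Sum>s<l. \<Sum>k=1..Suc (num_rows \<Lambda> s). box_weight \<Lambda> s k * g s k) =
     (\<Sum>(s, k)\<in>next_row_indices. box_weight \<Lambda> s k * g s k)"
    unfolding next_row_indices_def by (subst sum.Sigma) auto
  also have "\<dots> = (\<Sum>x\<in>next_row_indices. poly P (z x) * (\<Prod>y\<in>next_row_indices - {x}. - z y / (z x - z y)))"
  proof (rule sum.cong[OF refl], clarify)
    fix s k assume "(s, k) \<in> next_row_indices"
    then have sk: "s < l" "1 \<le> k" "k \<le> Suc (num_rows \<Lambda> s)" by (auto simp: next_row_indices_def)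
    have "box_weight \<Lambda> s k * g s k = poly P (z (s, k)) *
        (\<Prod>(t, i)\<in>next_row_indices - {(s, k)}. inverse (residue_factor (row_next \<Lambda> s k) (row_next \<Lambda> t i)))"
      unfolding box_weight_eq_residue_factors[OF q sk] z_def fst_conv snd_conv interpolates[OF sk, symmetric]
      by (simp only: mult_ac)
    then show "box_weight \<Lambda> s k * g s k = poly P (z (s, k)) *
        (\<Prod>y\<in>next_row_indices - {(s, k)}. - z y / (z (s, k) - z y))"
      by (simp add: residue_factor_def z_def case_prod_beta' del: divide_minus_right)
  qed
  also have "\<dots> = poly P 0"
    using degree card by (intro lagrange_sum_at_0 inj) (simp_all add: next_row_indices_def)
  finally show ?thesis .
qed

definition parameter_weight :: "nat \<Rightarrow> 'k" where
  "parameter_weight s = (\<Prod>t\<in>{..<l} - {s}. - Q t / (Q s - Q t))"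

lemma box_weight_q_1:
  assumes q: "q = 1" and s: "s < l"
  shows "box_weight \<Lambda> s k = parameter_weight s *
    ((\<Prod>i=1..num_rows \<Lambda> s. of_int (content (row_next \<Lambda> s k)) - of_int (content (row_last \<Lambda> s i))) /
     (\<Prod>i\<in>{1..Suc (num_rows \<Lambda> s)} - {k}. of_int (content (row_next \<Lambda> s k)) - of_int (content (row_next \<Lambda> s i))))"
    (is "_ = _ * (?A / ?B)")
proof -
  define C where "C t = (Q s - Q t) / Q t" for t
  have nonzero: "Q t \<noteq> 0" "Q s - Q t \<noteq> 0" if "t \<in> {..<l} - {s}" for t
    using Q0[of t] Q_separated[of s t 0] that s m by auto
  have cross: "(\<Prod>t\<in>{..<l} - {s}. \<Prod>i=1..r t. cross_factor q Q s t (h t i)) = (\<Prod>t\<in>{..<l} - {s}. C t ^ r t)"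
    for r h
    using nonzero by (intro prod.cong) (auto simp: cross_factor_def C_def q divide_inverse left_diff_distrib)
  have "q_number q h = of_int h" for h using q by (simp add: q_number_def)
  then have "box_weight \<Lambda> s k = (-1) ^ (l - 1) *
      (?A * (\<Prod>t\<in>{..<l} - {s}. C t ^ num_rows \<Lambda> t)) / (?B * (\<Prod>t\<in>{..<l} - {s}. C t ^ Suc (num_rows \<Lambda> t)))"
    unfolding box_weight_def weight_numer_def weight_denom_def cross by simp
  also have "\<dots> = (-1) ^ (l - 1) * (\<Prod>t\<in>{..<l} - {s}. C t ^ num_rows \<Lambda> t / C t ^ Suc (num_rows \<Lambda> t)) * (?A / ?B)"
    unfolding prod_dividef by (simp only: times_divide_times_eq times_divide_eq_right times_divide_eq_left
      divide_divide_eq_left mult_ac)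
  also have "(-1) ^ (l - 1) * (\<Prod>t\<in>{..<l} - {s}. C t ^ num_rows \<Lambda> t / C t ^ Suc (num_rows \<Lambda> t)) =
      (\<Prod>t\<in>{..<l} - {s}. -1 * (C t ^ num_rows \<Lambda> t / C t ^ Suc (num_rows \<Lambda> t)))"
    unfolding prod.distrib using s by simp
  also have "\<dots> = parameter_weight s"
    unfolding parameter_weight_def using nonzero by (intro prod.cong) (auto simp: C_def)
  finally show ?thesis .
qed

lemma component_sum_box_weight_q_1:
  assumes q: "q = 1" and s: "s < l"
    and interpolates: "\<And>k. 1 \<le> k \<Longrightarrow> k \<le> Suc (num_rows \<Lambda> s) \<Longrightarrow>
      (\<Prod>i=1..num_rows \<Lambda> s. of_int (content (row_next \<Lambda> s k)) - of_int (content (row_last \<Lambda> s i))) * g k =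
        poly P (of_int (content (row_next \<Lambda> s k)))"
    and degree: "degree P \<le> num_rows \<Lambda> s"
  shows "(\<Sum>k=1..Suc (num_rows \<Lambda> s). box_weight \<Lambda> s k * g k) = parameter_weight s * coeff P (num_rows \<Lambda> s)"
proof -
  define z where "z k = (of_int (content (row_next \<Lambda> s k)) :: 'k)" for k
  let ?I = "{1..Suc (num_rows \<Lambda> s)}"
  have inj: "inj_on z ?I"
  proof (rule inj_onI, rule ccontr)
    fix x y assume xy: "x \<in> ?I" "y \<in> ?I" "z x = z y" "x \<noteq> y"
    then have "distinguishable (row_next \<Lambda> s x) (row_next \<Lambda> s y)" by (intro distinguishable_row_next s) auto
    then show False using xy q unfolding distinguishable_def by (simp add: z_def row_next_def)
  qed
  have "(\<Sum>k\<in>?I. box_weight \<Lambda> s k * g k) =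
    (\<Sum>k\<in>?I. parameter_weight s * (poly P (z k) / (\<Prod>i\<in>?I - {k}. z k - z i)))"
  proof (rule sum.cong[OF refl])
    fix k assume "k \<in> ?I"
    then have k: "1 \<le> k" "k \<le> Suc (num_rows \<Lambda> s)" by auto
    show "box_weight \<Lambda> s k * g k = parameter_weight s * (poly P (z k) / (\<Prod>i\<in>?I - {k}. z k - z i))"
      unfolding box_weight_q_1[OF q s] z_def interpolates[OF k, symmetric]
      by (simp only: mult.assoc times_divide_eq_left)
  qed
  also have "\<dots> = parameter_weight s * coeff P (card ?I - 1)"
    unfolding sum_distrib_left[symmetric] using degree by (subst lagrange_sum_top_coeff[OF _ inj]) auto
  finally show ?thesis by simp
qed

definition row_last_poly :: "(nat \<times> nat) set \<Rightarrow> 'k poly" where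
  "row_last_poly R = (\<Prod>(t, i)\<in>R. Polynomial.smult (1 / (- res (row_last \<Lambda> t i))) [:- res (row_last \<Lambda> t i), 1:])"

lemma poly_row_last_poly: "poly (row_last_poly R) (res x) = (\<Prod>(t, i)\<in>R. residue_factor x (row_last \<Lambda> t i))"
  unfolding row_last_poly_def poly_prod case_prod_beta' poly_smult residue_factor_def by simp

lemma poly_row_last_poly_0:
  assumes "R \<subseteq> row_indices"
  shows "poly (row_last_poly R) 0 = 1"
  unfolding row_last_poly_def poly_prod
  using assms residue_nonzero by (intro prod.neutral) (auto simp: row_indices_def row_last_def)

lemma degree_row_last_poly:
  assumes "finite R"
  shows "degree (row_last_poly R) \<le> card R"
proof -
  have "degree (row_last_poly R) \<le> sum (degree \<circ> (\<lambda>(t, i). Polynomial.smult (1 / (- res (row_last \<Lambda> t i))) [:- res (row_last \<Lambda> t i), 1:])) R"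
    unfolding row_last_poly_def by (rule degree_prod_sum_le[OF assms])
  also have "\<dots> \<le> (\<Sum>y\<in>R. 1)" by (intro sum_mono) (simp add: degree_smult_le case_prod_beta')
  finally show ?thesis by simp
qed

lemma sum_box_weight_residue_power_q_neq_1:
  assumes "q \<noteq> 1" "r < l"
  shows "(\<Sum>s<l. \<Sum>k=1..Suc (num_rows \<Lambda> s). box_weight \<Lambda> s k * res (row_next \<Lambda> s k) ^ r) =
      (if r = 0 then 1 else 0)"
proof -
  define P where "P = row_last_poly row_indices * monom 1 r"
  have "degree P \<le> degree (row_last_poly row_indices) + degree (monom (1 :: 'k) r)"
    unfolding P_def by (rule degree_mult_le)
  then have "degree P < card row_indices + l"
    using degree_row_last_poly[OF finite_row_indices] assms(2) by (simp add: degree_monom_eq)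
  then have "(\<Sum>s<l. \<Sum>k=1..Suc (num_rows \<Lambda> s). box_weight \<Lambda> s k * res (row_next \<Lambda> s k) ^ r) = poly P 0"
    by (intro sum_box_weight_eq_poly_at_0[OF assms(1)]) (auto simp: P_def poly_row_last_poly poly_monom)
  then show ?thesis by (simp add: P_def poly_row_last_poly_0 poly_monom)
qed

lemma sum_box_weight_residue_power_q_1:
  assumes q: "q = 1" and r: "r < l"
  shows "(\<Sum>s<l. \<Sum>k=1..Suc (num_rows \<Lambda> s). box_weight \<Lambda> s k * res (row_next \<Lambda> s k) ^ r) =
      (if r = 0 then 1 else 0)"
proof -
  have component: "(\<Sum>k=1..Suc (num_rows \<Lambda> s). box_weight \<Lambda> s k * res (row_next \<Lambda> s k) ^ r) =
      parameter_weight s * Q s ^ r"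
    if s: "s < l" for s
  proof -
    define e where "e i = (of_int (content (row_last \<Lambda> s i)) :: 'k)" for i
    define P where "P = Polynomial.smult (Q s ^ r) (\<Prod>i=1..num_rows \<Lambda> s. [:- e i, 1:])"
    have "res (row_next \<Lambda> s k) = Q s" for k using q by (simp add: residue_def row_next_def)
    then have "(\<Prod>i=1..num_rows \<Lambda> s. of_int (content (row_next \<Lambda> s k)) - of_int (content (row_last \<Lambda> s i))) * res (row_next \<Lambda> s k) ^ r =
        poly P (of_int (content (row_next \<Lambda> s k)))" for k
      by (simp add: P_def poly_prod e_def algebra_simps)
    moreover have "degree P \<le> num_rows \<Lambda> s" "coeff P (num_rows \<Lambda> s) = Q s ^ r"
      using degree_smult_le[of "Q s ^ r" "\<Prod>i=1..num_rows \<Lambda> s. [:- e i, 1:]"]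
        prod_linear_monic[of "{1..num_rows \<Lambda> s}" e]
      by (simp_all add: P_def)
    ultimately show ?thesis using component_sum_box_weight_q_1[OF q s, of "\<lambda>k. res (row_next \<Lambda> s k) ^ r" P]
      by simp
  qed
  have inj: "inj_on Q {..<l}"
  proof (rule inj_onI, rule ccontr)
    fix s t assume "s \<in> {..<l}" "t \<in> {..<l}" "Q s = Q t" "s \<noteq> t"
    then show False using Q_separated[of s t 0] m by simp
  qed
  have "(\<Sum>s<l. \<Sum>k=1..Suc (num_rows \<Lambda> s). box_weight \<Lambda> s k * res (row_next \<Lambda> s k) ^ r) =
     (\<Sum>s\<in>{..<l}. poly (monom 1 r) (Q s) * (\<Prod>t\<in>{..<l} - {s}. - Q t / (Q s - Q t)))"
    using component by (intro sum.cong) (simp_all add: poly_monom parameter_weight_def mult.commute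
      del: sum.cl_ivl_Suc)
  also have "\<dots> = poly (monom 1 r) 0" using r by (intro lagrange_sum_at_0 inj) (auto simp: degree_monom_eq)
  finally show ?thesis by (simp add: poly_monom)
qed

theorem sum_box_weight_residue_power:
  assumes "r < l"
  shows "(\<Sum>s<l. \<Sum>k=1..Suc (num_rows \<Lambda> s). box_weight \<Lambda> s k * res (row_next \<Lambda> s k) ^ r) =
      (if r = 0 then 1 else 0)"
  using assms sum_box_weight_residue_power_q_1 sum_box_weight_residue_power_q_neq_1 by blast

lemma sum_box_weight_residue_power_coeff_q_neq_1:
  assumes q: "q \<noteq> 1" and r: "r < l" and uv: "u < l" "1 \<le> v" "v \<le> num_rows \<Lambda> u" "(\<Lambda> ! u) (Suc v) < (\<Lambda> ! u) v"
  shows "(\<Sum>s<l. \<Sum>k=1..Suc (num_rows \<Lambda> s). box_weight \<Lambda> s k *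
      (res (row_next \<Lambda> s k) ^ r * a (row_last \<Lambda> u v) (row_next \<Lambda> s k))) = 0"
proof -
  define e where "e = res (row_last \<Lambda> u v)"
  define P where "P = row_last_poly (row_indices - {(u, v)}) * monom ((q - 1) / (- e)) (Suc r)"
  have uv_row: "(u, v) \<in> row_indices" using uv by (simp add: row_indices_def)
  have "degree P \<le> degree (row_last_poly (row_indices - {(u, v)})) + degree (monom ((q - 1) / (- e)) (Suc r))"
    unfolding P_def by (rule degree_mult_le)
  also have "\<dots> \<le> card (row_indices - {(u, v)}) + Suc r"
    using finite_row_indices by (intro add_mono degree_row_last_poly degree_monom_le) simp
  also have "\<dots> = card row_indices + r" using card_Suc_Diff1[OF finite_row_indices uv_row] by simp
  finally have degree: "degree P < card row_indices + l" using r by simp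
  have "(\<Sum>s<l. \<Sum>k=1..Suc (num_rows \<Lambda> s). box_weight \<Lambda> s k *
      (res (row_next \<Lambda> s k) ^ r * a (row_last \<Lambda> u v) (row_next \<Lambda> s k))) = poly P 0"
  proof (rule sum_box_weight_eq_poly_at_0[OF q _ degree])
    fix s k assume sk: "s < l" "1 \<le> k" "k \<le> Suc (num_rows \<Lambda> s)"
    let ?x = "row_next \<Lambda> s k"
    have distinguishable: "distinguishable (row_last \<Lambda> u v) ?x"
      by (rule distinguishable_row_last_next[OF sk uv])
    have coefficient: "a (row_last \<Lambda> u v) ?x = (q - 1) * res ?x / (res ?x - e)"
      using seminormal_coeff_eq_residue[OF q distinguishable] by (simp add: e_def)
    have "res ?x - e \<noteq> 0" using distinguishable q by (auto simp: distinguishable_def e_def)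
    then have cancel: "residue_factor ?x (row_last \<Lambda> u v) * (res ?x ^ r * a (row_last \<Lambda> u v) ?x) =
        (q - 1) / (- e) * res ?x ^ Suc r"
      unfolding coefficient residue_factor_def e_def[symmetric] by simp
    show "(\<Prod>(t, i)\<in>row_indices. residue_factor ?x (row_last \<Lambda> t i)) * (res ?x ^ r * a (row_last \<Lambda> u v) ?x) =
        poly P (res ?x)"
      unfolding prod.remove[OF finite_row_indices uv_row] P_def poly_mult poly_row_last_poly poly_monom
        cancel[symmetric]
      by (simp only: prod.case mult_ac)
  qed
  then show ?thesis by (simp add: P_def poly_monom)
qed

lemma sum_box_weight_residue_power_coeff_q_1:
  assumes q: "q = 1" and uv: "u < l" "1 \<le> v" "v \<le> num_rows \<Lambda> u" "(\<Lambda> ! u) (Suc v) < (\<Lambda> ! u) v"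
  shows "(\<Sum>k=1..Suc (num_rows \<Lambda> u). box_weight \<Lambda> u k *
      (res (row_next \<Lambda> u k) ^ r * a (row_last \<Lambda> u v) (row_next \<Lambda> u k))) = 0"
proof -
  define e where "e i = (of_int (content (row_last \<Lambda> u i)) :: 'k)" for i
  define P where "P = Polynomial.smult (Q u ^ r) (\<Prod>i\<in>{1..num_rows \<Lambda> u} - {v}. [:- e i, 1:])"
  have degree: "degree P \<le> num_rows \<Lambda> u - 1"
    using degree_smult_le[of "Q u ^ r" "\<Prod>i\<in>{1..num_rows \<Lambda> u} - {v}. [:- e i, 1:]"]
      prod_linear_monic(1)[of "{1..num_rows \<Lambda> u} - {v}" e] uv by (simp add: P_def)
  have "(\<Sum>k=1..Suc (num_rows \<Lambda> u). box_weight \<Lambda> u k * (res (row_next \<Lambda> u k) ^ r * a (row_last \<Lambda> u v) (row_next \<Lambda> u k))) =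
     parameter_weight u * coeff P (num_rows \<Lambda> u)"
  proof (rule component_sum_box_weight_q_1[OF q uv(1)])
    fix k assume k: "1 \<le> k" "k \<le> Suc (num_rows \<Lambda> u)"
    let ?d = "of_int (content (row_next \<Lambda> u k)) :: 'k"
    have coefficient: "a (row_last \<Lambda> u v) (row_next \<Lambda> u k) = 1 / (?d - e v)"
      unfolding seminormal_coeff_q_1[OF q] by (simp add: row_last_def row_next_def e_def)
    have nonzero: "?d - e v \<noteq> 0"
      using distinguishable_row_last_next[OF uv(1) k uv] q
      unfolding distinguishable_def by (simp add: e_def row_last_def row_next_def)
    have residue: "res (row_next \<Lambda> u k) = Q u" using q by (simp add: residue_def row_next_def)
    have remove: "(\<Prod>i=1..num_rows \<Lambda> u. ?d - e i) = (?d - e v) * (\<Prod>i\<in>{1..num_rows \<Lambda> u} - {v}. ?d - e i)"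
      using uv by (intro prod.remove) auto
    have "poly P ?d = Q u ^ r * (\<Prod>i\<in>{1..num_rows \<Lambda> u} - {v}. ?d - e i)" by (simp add: P_def poly_prod)
    then show "(\<Prod>i=1..num_rows \<Lambda> u. ?d - of_int (content (row_last \<Lambda> u i))) *
        (res (row_next \<Lambda> u k) ^ r * a (row_last \<Lambda> u v) (row_next \<Lambda> u k)) = poly P ?d"
      unfolding e_def[symmetric] coefficient residue remove using nonzero by simp
  qed (use degree in simp)
  also have "coeff P (num_rows \<Lambda> u) = 0" using degree uv by (intro coeff_eq_0) simp
  finally show ?thesis by simp
qed

theorem sum_box_weight_residue_power_coeff:
  assumes r: "r < l" and uv: "u < l" "1 \<le> v" "v \<le> num_rows \<Lambda> u" "(\<Lambda> ! u) (Suc v) < (\<Lambda> ! u) v"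
  shows "(\<Sum>s<l. \<Sum>k=1..Suc (num_rows \<Lambda> s). box_weight \<Lambda> s k *
      (res (row_next \<Lambda> s k) ^ r * a (row_last \<Lambda> u v) (row_next \<Lambda> s k))) = 0"
proof (cases "q = 1")
  case True
  show ?thesis
  proof (rule sum.neutral, rule ballI)
    fix s assume "s \<in> {..<l}"
    show "(\<Sum>k=1..Suc (num_rows \<Lambda> s). box_weight \<Lambda> s k *
        (res (row_next \<Lambda> s k) ^ r * a (row_last \<Lambda> u v) (row_next \<Lambda> s k))) = 0"
    proof (cases "s = u")
      case False
      then have "a (row_last \<Lambda> u v) (row_next \<Lambda> s k) = 0" for k
        unfolding seminormal_coeff_q_1[OF True] by (simp add: row_last_def row_next_def)
      then show ?thesis by (simp del: sum.cl_ivl_Suc)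
    qed (use sum_box_weight_residue_power_coeff_q_1[OF True uv] in simp)
  qed
qed (rule sum_box_weight_residue_power_coeff_q_neq_1[OF _ assms])

end

end

section \<open>The weighted trace\<close>

definition shape :: "nat \<Rightarrow> node set \<Rightarrow> multipartition" where
  "shape l D = map (\<lambda>s i. card {j. (s, i, j) \<in> D}) [0..<l]"

lemma length_shape [simp]: "length (shape l D) = l" by (simp add: shape_def)

lemma shape_nth: "s < l \<Longrightarrow> (shape l D ! s) i = card {j. (s, i, j) \<in> D}" by (simp add: shape_def)

lemma finite_down_closed_interval:
  assumes "finite (A :: nat set)" "\<And>j. j \<in> A \<Longrightarrow> 1 \<le> j" "\<And>j. j \<in> A \<Longrightarrow> 1 < j \<Longrightarrow> j - 1 \<in> A"
  shows "A = {1..card A}"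
proof (cases "A = {}")
  case False
  define M where "M = Max A"
  have M: "M \<in> A" "\<And>j. j \<in> A \<Longrightarrow> j \<le> M" using assms(1) False by (auto simp: M_def)
  have down: "M - k \<in> A" if "k < M" for k using that
  proof (induction k)
    case (Suc k)
    then have "M - k - 1 \<in> A" by (intro assms(3)) auto
    then show ?case by simp
  qed (use M in simp)
  have "A = {1..M}"
  proof
    show "A \<subseteq> {1..M}" using M assms(2) by auto
    show "{1..M} \<subseteq> A"
    proof
      fix j assume "j \<in> {1..M}"
      then show "j \<in> A" using down[of "M - j"] by auto
    qed
  qed
  then show ?thesis by (metis card_atLeastAtMost diff_Suc_1)
qed simp

lemma shape_row:
  assumes D: "closed_diagram l D" "finite D" and s: "s < l"
  shows "{j. (s, i, j) \<in> D} = {1..(shape l D ! s) i}"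
proof -
  have "finite {j. (s, i, j) \<in> D}"
    using D(2) by (rule finite_surj[of D _ "\<lambda>x. snd (snd x)"]) force
  then show ?thesis using D(1) unfolding shape_nth[OF s] closed_diagram_def
    by (intro finite_down_closed_interval) auto
qed

lemma in_shape_iff:
  assumes D: "closed_diagram l D" "finite D"
  shows "(s, i, j) \<in> D \<longleftrightarrow> s < l \<and> 1 \<le> i \<and> 1 \<le> j \<and> j \<le> (shape l D ! s) i"
proof -
  have "(s, i, j) \<in> D \<Longrightarrow> s < l \<and> 1 \<le> i" using D(1) unfolding closed_diagram_def by blast
  moreover have "(s, i, j) \<in> D \<longleftrightarrow> 1 \<le> j \<and> j \<le> (shape l D ! s) i" if "s < l"
    using eqset_imp_iff[OF shape_row[OF D that, of i], of j] by simp
  ultimately show ?thesis by blast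
qed

lemma shape_partition:
  assumes D: "closed_diagram l D" "finite D" and s: "s < l"
  shows "is_partition (shape l D ! s)"
  unfolding is_partition_def
proof (intro conjI allI impI)
  let ?p = "shape l D ! s"
  have "{j. (s, 0, j) \<in> D} = {}" using D(1) unfolding closed_diagram_def by fastforce
  then show "?p 0 = 0" by (simp add: shape_nth[OF s])
  show "?p (Suc i) \<le> ?p i" if "1 \<le> i" for i
  proof (cases "?p (Suc i) = 0")
    case False
    then have "(s, Suc i, ?p (Suc i)) \<in> D" using in_shape_iff[OF D] s by simp
    then have "(s, i, ?p (Suc i)) \<in> D" using D(1) that unfolding closed_diagram_def by fastforce
    then show ?thesis using in_shape_iff[OF D] by simp
  qed simp
  have "{i. ?p i \<noteq> 0} \<subseteq> (\<lambda>x. fst (snd x)) ` D"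
  proof
    fix i assume "i \<in> {i. ?p i \<noteq> 0}"
    then have "{j. (s, i, j) \<in> D} \<noteq> {}" using shape_row[OF D s, of i] by auto
    then obtain j where "(s, i, j) \<in> D" by auto
    then show "i \<in> (\<lambda>x. fst (snd x)) ` D" by force
  qed
  then show "finite {i. ?p i \<noteq> 0}" by (rule finite_subset) (simp add: D(2))
qed

lemma mp_nodes_shape:
  assumes D: "closed_diagram l D" "finite D"
  shows "mp_nodes (shape l D) = D"
proof -
  have "(s, i, j) \<in> mp_nodes (shape l D) \<longleftrightarrow> (s, i, j) \<in> D" for s i j
    unfolding in_shape_iff[OF D] by (auto simp: mp_nodes_def young_def)
  then show ?thesis by auto
qed

lemma card_mp_nodes:
  assumes "\<forall>p\<in>set \<Lambda>. is_partition p"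
  shows "finite (mp_nodes \<Lambda>)" "card (mp_nodes \<Lambda>) = mp_size \<Lambda>"
proof -
  have Sigma: "mp_nodes \<Lambda> = (SIGMA s:{..<length \<Lambda>}. young (\<Lambda> ! s))" by (auto simp: mp_nodes_def)
  have fin: "finite (young (\<Lambda> ! s))" if "s < length \<Lambda>" for s using assms that young_finite by simp
  show "finite (mp_nodes \<Lambda>)" unfolding Sigma using fin by (intro finite_SigmaI) auto
  have "card (mp_nodes \<Lambda>) = (\<Sum>s<length \<Lambda>. card (young (\<Lambda> ! s)))" unfolding Sigma using fin
    by (subst card_SigmaI) auto
  also have "\<dots> = (\<Sum>s<length \<Lambda>. psize (\<Lambda> ! s))" using assms card_young by (intro sum.cong) auto
  also have "\<dots> = mp_size \<Lambda>" by (simp add: mp_size_def sum_list_sum_nth atLeast0LessThan)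
  finally show "card (mp_nodes \<Lambda>) = mp_size \<Lambda>" .
qed

lemma shape_multipartition:
  assumes D: "closed_diagram l D" "finite D"
  shows "shape l D \<in> multipartitions l (card D)"
proof -
  have "\<forall>p\<in>set (shape l D). is_partition p"
    using shape_partition[OF D] by (metis in_set_conv_nth length_shape)
  then show ?thesis using card_mp_nodes(2)[of "shape l D"] mp_nodes_shape[OF D]
    by (simp add: multipartitions_def)
qed

lemma mp_nodes_multipartition:
  assumes "\<Lambda> \<in> multipartitions l m"
  shows "closed_diagram l (mp_nodes \<Lambda>)" "finite (mp_nodes \<Lambda>)" "card (mp_nodes \<Lambda>) = m" "shape l (mp_nodes \<Lambda>) = \<Lambda>"
proof -
  have components: "length \<Lambda> = l" "\<forall>p\<in>set \<Lambda>. is_partition p" "mp_size \<Lambda> = m" using assms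
    by (auto simp: multipartitions_def)
  have partition: "is_partition (\<Lambda> ! s)" if "s < l" for s using components that by auto
  show "finite (mp_nodes \<Lambda>)" "card (mp_nodes \<Lambda>) = m" using card_mp_nodes components by auto
  have "(\<Lambda> ! s) i \<le> (\<Lambda> ! s) (i - 1)" if "s < l" "1 < i" for s i
    using partition_antimono[OF partition[OF that(1)], of "i - 1" i] that by simp
  then show "closed_diagram l (mp_nodes \<Lambda>)"
    unfolding closed_diagram_def mp_nodes_def young_def using components by (auto intro: le_trans)
  show "shape l (mp_nodes \<Lambda>) = \<Lambda>"
  proof (rule nth_equalityI)
    fix s assume "s < length (shape l (mp_nodes \<Lambda>))"
    then have s: "s < l" by simp
    have "(shape l (mp_nodes \<Lambda>) ! s) i = (\<Lambda> ! s) i" for i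
    proof (cases "i = 0")
      case True
      then show ?thesis using partition[OF s]
        by (simp add: shape_nth[OF s] mp_nodes_def young_def is_partition_def)
    next
      case False
      then have "{j. (s, i, j) \<in> mp_nodes \<Lambda>} = {1..(\<Lambda> ! s) i}" using s components
        by (auto simp: mp_nodes_def young_def)
      then show ?thesis by (simp add: shape_nth[OF s])
    qed
    then show "shape l (mp_nodes \<Lambda>) ! s = \<Lambda> ! s" by blast
  qed (use components in simp)
qed

lemma addable_shape_iff:
  assumes D: "closed_diagram l D" "finite D"
  shows "addable l D (s, i, j) \<longleftrightarrow> s < l \<and> 1 \<le> i \<and> j = Suc ((shape l D ! s) i) \<and>
    (i = 1 \<or> (shape l D ! s) i < (shape l D ! s) (i - 1))"
  unfolding addable_def by (simp add: in_shape_iff[OF D]) (auto simp: not_le less_Suc_eq_le)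

lemma shape_insert:
  assumes D: "closed_diagram l D" "finite D" and x: "addable l D (s, i, j)"
  shows "shape l (insert (s, i, j) D) = (shape l D)[s := add_box (shape l D ! s) i]"
proof (rule nth_equalityI)
  have s: "s < l" and new: "(s, i, j) \<notin> D" using x by (auto simp: addable_def)
  have fin: "finite {j. (t, k, j) \<in> D}" for t k
    using D(2) by (rule finite_surj[of D _ "\<lambda>x. snd (snd x)"]) force
  fix t assume "t < length (shape l (insert (s, i, j) D))"
  then have t: "t < l" by simp
  have "(shape l (insert (s, i, j) D) ! t) k = ((shape l D)[s := add_box (shape l D ! s) i] ! t) k" for k
  proof (cases "t = s \<and> k = i")
    case True
    then have "{j'. (t, k, j') \<in> insert (s, i, j) D} = insert j {j. (t, k, j) \<in> D}" by auto
    then show ?thesis using True t new fin by (simp add: shape_nth add_box_def)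
  next
    case False
    then have "{j'. (t, k, j') \<in> insert (s, i, j) D} = {j. (t, k, j) \<in> D}" by auto
    then show ?thesis using False t s by (cases "t = s") (auto simp: shape_nth add_box_def)
  qed
  then show "shape l (insert (s, i, j) D) ! t = (shape l D)[s := add_box (shape l D ! s) i] ! t" by blast
qed simp

lemma separated_mono:
  assumes "separated l n q Q" "m \<le> n"
  shows "separated l m q Q"
  using assms unfolding separated_def by auto

context separated
begin

definition schur_of :: "node set \<Rightarrow> 'k" where "schur_of D = schur_formula l (card D) q Q (shape l D)"

lemma schur_of_empty: "schur_of {} = 1"
proof -
  have component: "p = (\<lambda>i. 0)" if "p \<in> set (shape l {})" for p using that by (auto simp: shape_def)
  then have "shape l {} ! s = (\<lambda>i. 0)" if "s < l" for s using that by simp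
  moreover have "is_partition (\<lambda>i. 0)" by (simp add: is_partition_def)
  then have "n_stat (mp_bar (shape l {})) = (\<Sum>j=1..0. \<Sum>k<(\<Sum>p\<leftarrow>shape l {}. conj_part p j). k)"
    using component by (intro n_stat_mp_bar) auto
  moreover have "young (\<lambda>i. 0) = {}" by (auto simp: young_def)
  ultimately show ?thesis unfolding schur_of_def schur_formula_def by simp
qed

lemma addable_row_le:
  assumes D: "closed_diagram l D" "finite D" and x: "addable l D (s, k, j)"
  shows "k \<le> Suc (num_rows (shape l D) s)"
proof (cases "k = 1")
  case False
  then have "s < l" "1 \<le> k - 1" "(shape l D ! s) (k - 1) \<noteq> 0" using x addable_shape_iff[OF D] by auto
  then show ?thesis using part_zero_iff[OF shape_partition[OF D]] by (simp add: num_rows_def)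
qed simp

lemma schur_of_insert:
  assumes D: "closed_diagram l D" "finite D" "card D < n" "schur_of D \<noteq> 0"
    and x: "addable l D (s, k, j)"
  shows "1 / schur_of (insert (s, k, j) D) = box_weight (shape l D) s k / schur_of D"
    "schur_of (insert (s, k, j) D) \<noteq> 0"
proof -
  let ?\<Lambda> = "shape l D" and ?D = "insert (s, k, j) D"
  have D': "closed_diagram l ?D" "finite ?D" using closed_diagram_insert[OF D(1) x] D(2) by auto
  have sk: "s < l" "1 \<le> k" "k \<le> Suc (num_rows ?\<Lambda> s)" "k = 1 \<or> (?\<Lambda> ! s) k < (?\<Lambda> ! s) (k - 1)"
    using x addable_shape_iff[OF D(1,2)] addable_row_le[OF D(1,2) x] by auto
  have \<Lambda>: "?\<Lambda> \<in> multipartitions l (card D)" by (rule shape_multipartition[OF D(1,2)])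
  have card: "card ?D = Suc (card D)" using x D(2) by (simp add: addable_def)
  have shape: "shape l ?D = ?\<Lambda>[s := add_box (?\<Lambda> ! s) k]" by (rule shape_insert[OF D(1,2) x])
  have \<Lambda>': "?\<Lambda>[s := add_box (?\<Lambda> ! s) k] \<in> multipartitions l (Suc (card D))"
    using shape_multipartition[OF D'] unfolding shape card .
  have partition': "is_partition (add_box (?\<Lambda> ! s) k)"
    using shape_partition[OF D' sk(1)] sk(1) unfolding shape by simp
  have denom: "weight_denom ?\<Lambda> s k \<noteq> 0" by (rule weight_denom_nonzero[OF \<Lambda> D(3) sk(1-3)])
  have recursion: "schur_of ?D * weight_numer ?\<Lambda> s (content (row_next ?\<Lambda> s k)) =
      (-1) ^ (l - 1) * schur_of D * weight_denom ?\<Lambda> s k"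
    unfolding schur_of_def shape card by (rule schur_formula_add_box[OF \<Lambda> D(3) sk(1,2) partition' refl \<Lambda>'])
  then show nonzero: "schur_of ?D \<noteq> 0"
    using D(4) denom by (metis mult_eq_0_iff power_eq_0_iff neg_equal_0_iff_equal zero_neq_one)
  have "weight_numer ?\<Lambda> s (content (row_next ?\<Lambda> s k)) =
      (-1) ^ (l - 1) * schur_of D * weight_denom ?\<Lambda> s k / schur_of ?D"
    using recursion nonzero by (simp add: field_simps)
  moreover have "(-1 :: 'k) ^ (l - 1) * (-1) ^ (l - 1) = 1" by (simp add: power_mult_distrib[symmetric])
  ultimately have "box_weight ?\<Lambda> s k = schur_of D / schur_of ?D"
    unfolding box_weight_def using denom by (simp add: field_simps)
  then show "1 / schur_of ?D = box_weight ?\<Lambda> s k / schur_of D" using D(4) by simp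
qed

lemma schur_of_nonzero:
  assumes "path l p" "length p \<le> n"
  shows "schur_of (set p) \<noteq> 0"
  using assms
proof (induction p rule: rev_induct)
  case Nil
  then show ?case using schur_of_empty by simp
next
  case (snoc x p)
  then have p: "path l p" "addable l (set p) x" by (auto simp: path_from_append)
  have "card (set p) < n" using snoc.prems card_length[of p] by simp
  then show ?case using schur_of_insert(2)[OF path_closed[OF p(1)] _ _ _ , of "fst x" "fst (snd x)"
    "snd (snd x)"] p snoc by simp
qed

lemma addable_eq_image_row_next:
  assumes D: "closed_diagram l D" "finite D"
  shows "{x. addable l D x} = (\<lambda>(s, k). row_next (shape l D) s k) `
    {(s, k) \<in> SIGMA s:{..<l}. {1..Suc (num_rows (shape l D) s)}. addable l D (row_next (shape l D) s k)}"
    (is "_ = ?node ` ?J")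
proof (intro equalityI subsetI)
  fix x assume "x \<in> {x. addable l D x}"
  then obtain s k j where x: "x = (s, k, j)" "addable l D (s, k, j)" by (cases x) auto
  then have "s < l" "1 \<le> k" "x = row_next (shape l D) s k" "k \<le> Suc (num_rows (shape l D) s)"
    using addable_shape_iff[OF D] addable_row_le[OF D] by (auto simp: row_next_def)
  then show "x \<in> ?node ` ?J" using x by (intro image_eqI[of _ _ "(s, k)"]) auto
qed auto

lemma sum_addable_eq_sum_box_weight:
  assumes D: "closed_diagram l D" "finite D" "card D < n" "schur_of D \<noteq> 0"
  shows "(\<Sum>x | addable l D x. g x / schur_of (insert x D)) =
    (\<Sum>s<l. \<Sum>k=1..Suc (num_rows (shape l D) s). box_weight (shape l D) s k * g (row_next (shape l D) s k)) /
      schur_of D"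
proof -
  let ?\<Lambda> = "shape l D" and ?node = "\<lambda>(s, k). row_next (shape l D) s k"
  let ?I = "SIGMA s:{..<l}. {1..Suc (num_rows ?\<Lambda> s)}"
  let ?J = "{(s, k) \<in> ?I. addable l D (row_next ?\<Lambda> s k)}"
  have addable_iff: "addable l D (row_next ?\<Lambda> s k) \<longleftrightarrow> k = 1 \<or> (?\<Lambda> ! s) k < (?\<Lambda> ! s) (k - 1)" if "(s, k) \<in> ?I"
    for s k
    using that unfolding row_next_def addable_shape_iff[OF D(1,2)] by auto
  have "(\<Sum>x | addable l D x. g x / schur_of (insert x D)) =
      (\<Sum>y\<in>?J. g (?node y) / schur_of (insert (?node y) D))"
    unfolding addable_eq_image_row_next[OF D(1,2)] by (subst sum.reindex) (auto simp: inj_on_def row_next_def)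
  also have "\<dots> = (\<Sum>(s, k)\<in>?I. box_weight ?\<Lambda> s k * g (row_next ?\<Lambda> s k) / schur_of D)"
  proof (rule sum.mono_neutral_cong_left)
    show "\<forall>y\<in>?I - ?J. (case y of (s, k) \<Rightarrow> box_weight ?\<Lambda> s k * g (row_next ?\<Lambda> s k) / schur_of D) = 0"
    proof
      fix y assume "y \<in> ?I - ?J"
      then obtain s k where y: "y = (s, k)" "(s, k) \<in> ?I" "\<not> addable l D (row_next ?\<Lambda> s k)" by (cases y) blast
      then have k: "s < l" "1 < k" "k \<le> Suc (num_rows ?\<Lambda> s)" using addable_iff[OF y(2)]
        by (auto simp: Suc_lessI)
      then have "(?\<Lambda> ! s) k = (?\<Lambda> ! s) (k - 1)"
        using partition_antimono[OF shape_partition[OF D(1,2) k(1)], of "k - 1" k] y(3) addable_iff[OF y(2)]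
        by simp
      then have "box_weight ?\<Lambda> s k = 0" by (rule box_weight_zero[OF shape_multipartition[OF D(1,2)] D(3) k])
      then show "(case y of (s, k) \<Rightarrow> box_weight ?\<Lambda> s k * g (row_next ?\<Lambda> s k) / schur_of D) = 0"
        by (simp add: y(1))
    qed
  next
    fix y assume "y \<in> ?J"
    then obtain s k where y: "y = (s, k)" "addable l D (row_next ?\<Lambda> s k)" by auto
    show "g (?node y) / schur_of (insert (?node y) D) =
        (case y of (s, k) \<Rightarrow> box_weight ?\<Lambda> s k * g (row_next ?\<Lambda> s k) / schur_of D)"
      using schur_of_insert(1)[OF D y(2)[unfolded row_next_def]]
      by (simp add: y(1) row_next_def divide_inverse mult_ac)
  qed auto
  also have "\<dots> = (\<Sum>s<l. \<Sum>k=1..Suc (num_rows ?\<Lambda> s). box_weight ?\<Lambda> s k * g (row_next ?\<Lambda> s k)) / schur_of D"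
    by (subst sum.Sigma[symmetric]) (auto simp: sum_divide_distrib simp del: sum.cl_ivl_Suc)
  finally show ?thesis .
qed

lemma sum_addable_residue_power:
  assumes D: "closed_diagram l D" "finite D" "card D < n" "schur_of D \<noteq> 0" and r: "r < l"
  shows "(\<Sum>x | addable l D x. res x ^ r / schur_of (insert x D)) = (if r = 0 then 1 / schur_of D else 0)"
  unfolding sum_addable_eq_sum_box_weight[OF D, of "\<lambda>x. res x ^ r"]
    sum_box_weight_residue_power[OF shape_multipartition[OF D(1,2)] D(3) r] by simp

lemma sum_addable_residue_power_coeff:
  assumes D: "closed_diagram l D" "finite D" "addable l D y"
    and insert_y: "card (insert y D) < n" "schur_of (insert y D) \<noteq> 0" and r: "r < l"
  shows "(\<Sum>x | addable l (insert y D) x. res x ^ r * a y x / schur_of (insert x (insert y D))) = 0"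
proof -
  obtain u v w where y: "y = (u, v, w)" by (cases y) auto
  let ?D = "insert y D"
  let ?\<Lambda> = "shape l ?D"
  have D': "closed_diagram l ?D" "finite ?D" using closed_diagram_insert[OF D(1,3)] D(2) by auto
  have uv: "u < l" "1 \<le> v" "w = Suc ((shape l D ! u) v)" using D(3) addable_shape_iff[OF D(1,2)] y by auto
  have shape: "?\<Lambda> ! u = add_box (shape l D ! u) v" using shape_insert[OF D(1,2), of u v w] D(3) y uv(1) by simp
  have "(?\<Lambda> ! u) v = w" unfolding shape by (simp add: add_box_def uv(3))
  then have row_last: "row_last ?\<Lambda> u v = y" by (simp add: row_last_def) (simp add: y)
  have "(shape l D ! u) (Suc v) \<le> (shape l D ! u) v"
    using partition_antimono[OF shape_partition[OF D(1,2) uv(1)], of v "Suc v"] uv by simp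
  then have removable: "(?\<Lambda> ! u) (Suc v) < (?\<Lambda> ! u) v" by (simp add: shape add_box_def)
  have v: "v \<le> num_rows ?\<Lambda> u"
    using part_zero_iff[OF shape_partition[OF D' uv(1)] uv(2)] removable by (simp add: num_rows_def)
  show ?thesis
    unfolding sum_addable_eq_sum_box_weight[OF D' insert_y, of "\<lambda>x. res x ^ r * a y x"]
      sum_box_weight_residue_power_coeff[OF shape_multipartition[OF D'] insert_y(1) r uv(1,2) v removable,
        unfolded row_last] by simp
qed

end

definition delta :: "'x \<Rightarrow> 'x \<Rightarrow> 'k::field" where "delta p r = (if r = p then 1 else 0)"

definition free_word :: "nat list \<Rightarrow> 'k::field free_alg" where "free_word u = Poly_Mapping.single (FM u) 1"

lemma free_word_append: "free_word (u @ v) = free_word u * free_word v"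
  by (simp add: free_word_def mult_single plus_free_monoid_def)

lemma free_word_Nil: "free_word [] = 1"
  by (simp add: free_word_def zero_free_monoid_def[symmetric])

lemma free_word_Cons: "free_word (i # u) = free_gen i * free_word u"
  using free_word_append[of "[i]" u] by (simp add: free_word_def free_gen_def)

lemma rep_word: "rep G (free_word u) v = foldr G u v"
  by (simp add: free_word_def rep_single fun_eq_iff)

lemma free_word_carrier: "set u \<subseteq> {..<n} \<Longrightarrow> free_word u \<in> carrier (free_algebra n)"
  by (simp add: free_algebra_carrier_iff free_word_def)

lemma free_algebra_mono: "m \<le> n \<Longrightarrow> x \<in> carrier (free_algebra m) \<Longrightarrow> x \<in> carrier (free_algebra n)"
  unfolding free_algebra_carrier_iff by (meson lessThan_subset_iff subset_trans)

lemma free_algebra_power: "x \<in> carrier (free_algebra n) \<Longrightarrow> x ^ k \<in> carrier (free_algebra n)"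
  for x :: "'k::field free_alg"
  by (induction k) (auto intro: free_algebra_closed)

lemma free_algebra_prod_list:
  fixes f :: "'b \<Rightarrow> 'k::field free_alg"
  shows "(\<And>k. k \<in> set ks \<Longrightarrow> f k \<in> carrier (free_algebra n)) \<Longrightarrow> (\<Prod>k\<leftarrow>ks. f k) \<in> carrier (free_algebra n)"
  by (induction ks) (auto intro: free_algebra_closed)

definition free_L :: "'k::field \<Rightarrow> nat \<Rightarrow> 'k free_alg" where
  "free_L q k = free_const (q powi (1 - int k)) * free_word (rev [1..<k] @ [0] @ [1..<k])"

definition free_L_monomial :: "'k::field \<Rightarrow> nat \<Rightarrow> (nat \<Rightarrow> nat) \<Rightarrow> 'k free_alg" where
  "free_L_monomial q m c = (\<Prod>k\<leftarrow>[1..<m + 1]. free_L q k ^ c k)"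

definition free_normal_monomial :: "'k::field \<Rightarrow> nat \<Rightarrow> (nat \<Rightarrow> nat) \<Rightarrow> (nat \<Rightarrow> nat) \<Rightarrow> 'k free_alg" where
  "free_normal_monomial q m c j = free_L_monomial q m c * free_word (normal_word j m)"

definition canonical_values :: "nat \<Rightarrow> nat \<Rightarrow> 'k::field \<Rightarrow> ('k free_alg \<Rightarrow> 'b::zero_neq_one) \<Rightarrow> bool" where
  "canonical_values l m q f \<longleftrightarrow> (\<forall>c j. (\<forall>k\<in>{1..m}. c k < l) \<longrightarrow> is_code m j \<longrightarrow>
     f (free_normal_monomial q m c j) = (if (\<forall>k\<in>{1..m}. c k = 0) \<and> normal_word j m = [] then 1 else 0))"

lemma free_L_carrier: "1 \<le> k \<Longrightarrow> k \<le> n \<Longrightarrow> free_L q k \<in> carrier (free_algebra n)"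
  unfolding free_L_def by (intro free_algebra_closed free_word_carrier) auto

lemma free_L_monomial_carrier: "m \<le> n \<Longrightarrow> free_L_monomial q m c \<in> carrier (free_algebra n)"
  unfolding free_L_monomial_def by (intro free_algebra_prod_list free_algebra_power free_L_carrier) auto

lemma free_normal_word_carrier: "is_code m j \<Longrightarrow> free_word (normal_word j m) \<in> carrier (free_algebra m)"
  using set_normal_word[of m j] by (intro free_word_carrier) auto

lemma free_normal_monomial_carrier: "is_code m j \<Longrightarrow> free_normal_monomial q m c j \<in> carrier (free_algebra m)"
  unfolding free_normal_monomial_def
  by (intro free_algebra_closed free_L_monomial_carrier free_normal_word_carrier) simp

lemma free_L_monomial_Suc: "free_L_monomial q (Suc m) c = free_L_monomial q m c * free_L q (Suc m) ^ c (Suc m)"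
  by (simp add: free_L_monomial_def)

context separated
begin

lemma path_rep_delta_zero:
  assumes x: "x \<in> carrier (free_algebra m)" and p: "p \<in> paths l m" and r: "set r \<noteq> set p"
  shows "rep F x (delta r) p = 0"
proof -
  have "rep F x (delta r) p = rep F x (\<lambda>_. 0) p"
    using r by (intro path_rep_cong[OF x p]) (auto simp: delta_def)
  then show ?thesis by (simp add: path_rep_zero)
qed

lemma path_rep_expand:
  assumes x: "x \<in> carrier (free_algebra m)" and p: "p \<in> paths l m"
  shows "rep F x v p = (\<Sum>r\<in>paths l m. v r * rep F x (delta r) p)"
proof -
  have "rep F x v p = rep F x (\<lambda>u. \<Sum>r\<in>paths l m. v r * delta r u) p"
  proof (rule path_rep_cong[OF x p])
    fix r assume r: "r \<in> paths l m"
    have "(\<Sum>r'\<in>paths l m. v r' * delta r' r) = (\<Sum>r'\<in>paths l m. if r' = r then v r else 0)"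
      by (intro sum.cong) (auto simp: delta_def)
    also have "\<dots> = v r" using r finite_paths by simp
    finally show "v r = (\<Sum>r'\<in>paths l m. v r' * delta r' r)" ..
  qed
  then show ?thesis using rep_linear_sum[OF linear_path_op finite_paths, of l q Q x v delta l m p] by simp
qed

definition path_trace :: "nat \<Rightarrow> 'k free_alg \<Rightarrow> 'k" where
  "path_trace m x = (\<Sum>p\<in>paths l m. 1 / schur_of (set p) * rep F x (delta p) p)"

lemma path_trace_add: "path_trace m (x + y) = path_trace m x + path_trace m y"
  by (simp add: path_trace_def rep_add distrib_left sum.distrib)

lemma path_trace_scale: "path_trace m (free_const c * x) = c * path_trace m x"
  by (simp add: path_trace_def rep_mult[OF linear_path_op] rep_const sum_distrib_left mult.left_commute)

lemma path_trace_commute: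
  assumes x: "x \<in> carrier (free_algebra m)" and y: "y \<in> carrier (free_algebra m)"
  shows "path_trace m (x * y) = path_trace m (y * x)"
proof -
  have expand: "path_trace m (x * y) = (\<Sum>p\<in>paths l m. \<Sum>r\<in>paths l m. 1 / schur_of (set p) *
      (rep F y (delta p) r * rep F x (delta r) p))"
    if x: "x \<in> carrier (free_algebra m)" for x y
    unfolding path_trace_def rep_mult[OF linear_path_op]
    by (rule sum.cong[OF refl], subst path_rep_expand[OF x]) (auto simp: sum_distrib_left)
  have "path_trace m (x * y) = (\<Sum>r\<in>paths l m. \<Sum>p\<in>paths l m. 1 / schur_of (set p) *
      (rep F y (delta p) r * rep F x (delta r) p))"
    unfolding expand[OF x] by (rule sum.swap)
  also have "\<dots> = (\<Sum>r\<in>paths l m. \<Sum>p\<in>paths l m. 1 / schur_of (set r) *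
      (rep F x (delta r) p * rep F y (delta p) r))"
  proof (intro sum.cong refl)
    fix r p assume r: "r \<in> paths l m" "p \<in> paths l m"
    show "1 / schur_of (set p) * (rep F y (delta p) r * rep F x (delta r) p) =
        1 / schur_of (set r) * (rep F x (delta r) p * rep F y (delta p) r)"
    proof (cases "set p = set r")
      case False
      then show ?thesis using path_rep_delta_zero[OF y r(1) False] by simp
    qed (simp only: mult_ac)
  qed
  also have "\<dots> = path_trace m (y * x)" unfolding expand[OF y] ..
  finally show ?thesis .
qed

lemma path_rep_scale: "rep F x (\<lambda>r. c * v r) p = c * rep F x v p"
  using rep_linear_sum[OF linear_path_op, of "{()}" l q Q x "\<lambda>_. c" "\<lambda>_. v" p] by simp

lemma path_rep_snoc:
  assumes h: "h \<in> carrier (free_algebra m)" and p: "p \<in> paths l m" "addable l (set p) x"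
  shows "rep F h v (p @ [x]) = rep F h (\<lambda>r. v (r @ [x])) p"
proof (rule rep_intertwine[of "{..<m}" "{r\<in>paths l m. set r = set p}"])
  show "\<And>w. w \<in> Poly_Mapping.keys h \<Longrightarrow> set (letters w) \<subseteq> {..<m}"
    using h by (simp add: free_algebra_carrier_iff)
  show "F k v r = F k v' r" if "k \<in> {..<m}" "r \<in> {r\<in>paths l m. set r = set p}"
    "\<And>r. r \<in> {r\<in>paths l m. set r = set p} \<Longrightarrow> v r = v' r" for k v v' r
    using that by (intro path_op_cong[of k m r l]) auto
  fix k v r assume k: "k \<in> {..<m}" and r: "r \<in> {r\<in>paths l m. set r = set p}"
  have len: "length r = m" using r by (simp add: paths_def)
  show "F k v (r @ [x]) = F k (\<lambda>r. v (r @ [x])) r"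
  proof (cases "k = 0")
    case True
    then show ?thesis using k len by (cases r) (auto simp: path_op_0)
  next
    case False
    then have "1 \<le> k" "k < length r" using k len by auto
    then obtain u y z w where s: "r = u @ y # z # w" "k = Suc (length u)" by (rule split_at_consecutive)
    have "set (u @ z # y # w) = set p" using r s by auto
    then have "path l (u @ z # y # w @ [x]) \<longleftrightarrow> path l (u @ z # y # w)"
      using p(2) path_from_append[of l "{}" "u @ z # y # w" "[x]"] by simp
    then show ?thesis
      unfolding s(1) path_op_swap[OF s(2)] using path_op_swap[OF s(2), of l q Q v y z "w @ [x]"] by simp
  qed
qed (use p in auto)

lemma path_rep_L:
  assumes "m \<le> n" "p \<in> paths l m" "1 \<le> k" "k \<le> m"
  shows "rep F (free_L q k) v p = res (p ! (k - 1)) * v p"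
proof -
  interpret m: separated l m q Q by (rule separated_mono[OF separated_axioms assms(1)])
  have "q powi (1 - int k) = inverse (q ^ (k - 1))"
    using assms by (simp add: power_int_def nat_diff_distrib power_inverse)
  then show ?thesis using q0 m.path_op_L_word[OF assms(2-4), of v]
    unfolding free_L_def rep_mult[OF linear_path_op] rep_word rep_const by simp
qed

lemma path_rep_L_power:
  assumes "m \<le> n" "p \<in> paths l m" "1 \<le> k" "k \<le> m"
  shows "rep F (free_L q k ^ c) v p = res (p ! (k - 1)) ^ c * v p"
  by (induction c) (simp_all add: rep_one rep_mult[OF linear_path_op] path_rep_L[OF assms] mult.assoc)

lemma paths_Suc_sum:
  "(\<Sum>p\<in>paths l (Suc m). f p) = (\<Sum>p\<in>paths l m. \<Sum>x | addable l (set p) x. f (p @ [x]))"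
proof -
  have "(\<Sum>p\<in>paths l m. \<Sum>x | addable l (set p) x. f (p @ [x])) =
     (\<Sum>y\<in>(SIGMA p:paths l m. {x. addable l (set p) x}). f (fst y @ [snd y]))"
    by (subst sum.Sigma) (auto simp: finite_paths finite_addable case_prod_beta')
  also have "\<dots> = (\<Sum>p\<in>paths l (Suc m). f p)"
    by (rule sum.reindex_bij_witness[of _ "\<lambda>p. (butlast p, last p)" "\<lambda>y. fst y @ [snd y]"])
       (auto simp: paths_Suc)
  finally show ?thesis ..
qed

lemma path_rep_L_power_snoc:
  assumes m: "m < n" and A: "A \<in> carrier (free_algebra m)" and B: "B \<in> carrier (free_algebra m)"
    and p: "p \<in> paths l m" "addable l (set p) x"
  shows "rep F (A * free_L q (Suc m) ^ c * B) v (p @ [x]) = res x ^ c * rep F (A * B) (\<lambda>r. v (r @ [x])) p"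
proof -
  let ?v = "\<lambda>r. v (r @ [x])"
  have "rep F (A * free_L q (Suc m) ^ c * B) v (p @ [x]) =
      rep F A (\<lambda>r. rep F (free_L q (Suc m) ^ c) (rep F B v) (r @ [x])) p"
    unfolding mult.assoc rep_mult[OF linear_path_op] by (rule path_rep_snoc[OF A p])
  also have "\<dots> = rep F A (\<lambda>r. res x ^ c * rep F B ?v r) p"
  proof (rule path_rep_cong[OF A p(1)])
    fix r assume r: "r \<in> paths l m" "set r = set p"
    have "r @ [x] \<in> paths l (Suc m)" using r p(2) by (simp add: paths_def path_from_append)
    from path_rep_L_power[OF _ this, of "Suc m" c]
    have "rep F (free_L q (Suc m) ^ c) (rep F B v) (r @ [x]) = res x ^ c * rep F B v (r @ [x])"
      using m r by (simp add: paths_def nth_append)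
    also have "rep F B v (r @ [x]) = rep F B ?v r" using r p(2) by (intro path_rep_snoc[OF B]) auto
    finally show "rep F (free_L q (Suc m) ^ c) (rep F B v) (r @ [x]) = res x ^ c * rep F B ?v r" .
  qed
  finally show ?thesis by (simp only: path_rep_scale rep_mult[OF linear_path_op])
qed

lemma path_trace_L_power:
  assumes m: "m < n" and A: "A \<in> carrier (free_algebra m)" and B: "B \<in> carrier (free_algebra m)" and c: "c < l"
  shows "path_trace (Suc m) (A * free_L q (Suc m) ^ c * B) = (if c = 0 then path_trace m (A * B) else 0)"
proof -
  have restrict: "(\<lambda>r. delta (p @ [x]) (r @ [x])) = delta p" for p and x :: node
    by (auto simp: delta_def fun_eq_iff)
  have "path_trace (Suc m) (A * free_L q (Suc m) ^ c * B) =
     (\<Sum>p\<in>paths l m. \<Sum>x | addable l (set p) x. res x ^ c / schur_of (insert x (set p)) * rep F (A * B) (delta p)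
       p)"
    unfolding path_trace_def paths_Suc_sum
    by (intro sum.cong refl) (simp add: path_rep_L_power_snoc[OF m A B] restrict)
  also have "\<dots> = (\<Sum>p\<in>paths l m. (if c = 0 then 1 / schur_of (set p) else 0) * rep F (A * B) (delta p) p)"
  proof (rule sum.cong[OF refl])
    fix p assume "p \<in> paths l m"
    then have p: "path l p" "length p = m" by (auto simp: paths_def)
    have "(\<Sum>x | addable l (set p) x. res x ^ c / schur_of (insert x (set p))) =
        (if c = 0 then 1 / schur_of (set p) else 0)"
      using p m schur_of_nonzero[OF p(1)] card_length[of p]
      by (intro sum_addable_residue_power[OF path_closed[OF p(1)] _ _ _ c]) auto
    then show "(\<Sum>x | addable l (set p) x. res x ^ c / schur_of (insert x (set p)) * rep F (A * B) (delta p) p) =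
       (if c = 0 then 1 / schur_of (set p) else 0) * rep F (A * B) (delta p) p"
      by (simp only: sum_distrib_right[symmetric])
  qed
  also have "\<dots> = (if c = 0 then path_trace m (A * B) else 0)" by (simp add: path_trace_def)
  finally show ?thesis .
qed

lemma path_op_delta_snoc:
  assumes "length p = m" "1 \<le> m" "set r = set p" "length r = m" "x \<notin> set p"
  shows "F m (delta (p @ [x])) (r @ [x]) = a (last p) x * delta p r"
proof -
  obtain u y where u: "r = u @ [y]" "m = Suc (length u)" using assms(2,4) by (cases r rule: rev_cases) auto
  then have "y \<noteq> x" using assms(3,5) by auto
  then have "delta (p @ [x]) (u @ [x, y]) = (0 :: 'k)" by (auto simp: delta_def dest: arg_cong[where f = last])
  moreover have "delta (p @ [x]) (u @ [y, x]) = (delta p r :: 'k)" using u by (simp add: delta_def)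
  moreover have "a y x * delta p r = a (last p) x * delta p r" using u by (auto simp: delta_def)
  ultimately show ?thesis using path_op_swap[OF u(2), of l q Q "delta (p @ [x])" y x "[]"] u(1) by simp
qed

lemma path_trace_L_power_T:
  assumes m: "1 \<le> m" "m < n" and A: "A \<in> carrier (free_algebra m)" and B: "B \<in> carrier (free_algebra m)"
    and c: "c < l"
  shows "path_trace (Suc m) (A * free_L q (Suc m) ^ c * B * free_gen m) = 0"
proof -
  have diagonal: "rep F (A * free_L q (Suc m) ^ c * B * free_gen m) (delta (p @ [x])) (p @ [x]) =
      res x ^ c * a (last p) x * rep F (A * B) (delta p) p"
    if p: "p \<in> paths l m" "addable l (set p) x" for p x
  proof -
    have "x \<notin> set p" using p(2) by (auto simp: addable_def split: prod.splits)
    then have "rep F (A * B) (\<lambda>r. F m (delta (p @ [x])) (r @ [x])) p =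
        rep F (A * B) (\<lambda>r. a (last p) x * delta p r) p"
      using p m(1) by (intro path_rep_cong[OF free_algebra_closed(3)[OF A B]])
        (auto simp: path_op_delta_snoc paths_def)
    then show ?thesis
      unfolding rep_mult[OF linear_path_op, where x = "A * free_L q (Suc m) ^ c * B"] rep_gen
        path_rep_L_power_snoc[OF m(2) A B p]
      by (simp add: path_rep_scale)
  qed
  have "path_trace (Suc m) (A * free_L q (Suc m) ^ c * B * free_gen m) =
     (\<Sum>p\<in>paths l m. \<Sum>x | addable l (set p) x. res x ^ c * a (last p) x / schur_of (insert x (set p)) * rep F
       (A * B) (delta p) p)"
    unfolding path_trace_def paths_Suc_sum by (intro sum.cong refl) (simp add: diagonal)
  also have "\<dots> = 0"
  proof (rule sum.neutral, rule ballI)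
    fix p assume "p \<in> paths l m"
    then have p: "path l p" "length p = m" by (auto simp: paths_def)
    then obtain u y where u: "p = u @ [y]" using m(1) by (cases p rule: rev_cases) auto
    have uy: "path l u" "addable l (set u) y" using p u by (auto simp: path_from_append)
    have set: "set p = insert y (set u)" using u by auto
    have "(\<Sum>x | addable l (insert y (set u)) x. res x ^ c * a y x / schur_of (insert x (insert y (set u)))) = 0"
      using m p schur_of_nonzero[OF p(1)] card_length[of p]
      by (intro sum_addable_residue_power_coeff[OF path_closed[OF uy(1)] _ uy(2) _ _ c])
        (auto simp: set[symmetric])
    then show "(\<Sum>x | addable l (set p) x. res x ^ c * a (last p) x / schur_of (insert x (set p)) *
        rep F (A * B) (delta p) p) = 0"
      unfolding sum_distrib_right[symmetric] set using u by simp
  qed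
  finally show ?thesis .
qed

lemma path_trace_L_power_descending:
  assumes i: "1 \<le> i" "i \<le> m" and m: "m < n" and A: "A \<in> carrier (free_algebra m)"
    and B: "B \<in> carrier (free_algebra m)" and c: "c < l"
  shows "path_trace (Suc m) (A * free_L q (Suc m) ^ c * B * free_word (rev [i..<Suc m])) = 0"
proof -
  let ?X = "free_L q (Suc m) ^ c" and ?R = "free_word (rev [i..<m]) :: 'k free_alg"
  have carriers: "?R \<in> carrier (free_algebra m)" "?X \<in> carrier (free_algebra (Suc m))"
    "free_gen m \<in> carrier (free_algebra (Suc m))"
    by (auto intro!: free_word_carrier free_algebra_power free_L_carrier free_algebra_closed)
  have "path_trace (Suc m) (A * ?X * B * free_word (rev [i..<Suc m])) =
      path_trace (Suc m) ((A * ?X * B * free_gen m) * ?R)"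
    using i by (simp add: free_word_Cons mult.assoc)
  also have "\<dots> = path_trace (Suc m) (?R * (A * ?X * B * free_gen m))"
    using A B carriers by (intro path_trace_commute free_algebra_closed) (auto intro: free_algebra_mono[of m])
  also have "?R * (A * ?X * B * free_gen m) = (?R * A) * ?X * B * free_gen m" by (simp only: mult.assoc)
  also have "path_trace (Suc m) \<dots> = 0"
    using i m by (intro path_trace_L_power_T B c free_algebra_closed A carriers) auto
  finally show ?thesis .
qed

lemma path_trace_normal_monomial:
  assumes "m \<le> n" "is_code m j" "\<forall>k\<in>{1..m}. c k < l"
  shows "path_trace m (free_normal_monomial q m c j) =
      (if (\<forall>k\<in>{1..m}. c k = 0) \<and> normal_word j m = [] then 1 else 0)"
  using assms
proof (induction m)
  case 0
  have "paths l 0 = {[]}" by (auto simp: paths_def)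
  then show ?case
    by (simp add: path_trace_def free_normal_monomial_def free_L_monomial_def free_word_Nil rep_one
      schur_of_empty delta_def)
next
  case (Suc m)
  have code: "is_code m j" "1 \<le> j (Suc m)" "j (Suc m) \<le> Suc m" using Suc.prems by (auto simp: is_code_Suc)
  have c: "c (Suc m) < l" "\<forall>k\<in>{1..m}. c k < l" using Suc.prems by auto
  have carriers: "free_L_monomial q m c \<in> carrier (free_algebra m)"
    "free_word (normal_word j m) \<in> carrier (free_algebra m)"
    by (rule free_L_monomial_carrier free_normal_word_carrier code order_refl)+
  have monomial: "free_normal_monomial q (Suc m) c j = free_L_monomial q m c * free_L q (Suc m) ^ c (Suc m) *
      free_word (normal_word j m) * free_word (rev [j (Suc m)..<Suc m])"
    by (simp add: free_normal_monomial_def free_L_monomial_Suc free_word_append mult.assoc del: upt_Suc)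
  show ?case
  proof (cases "j (Suc m) = Suc m")
    case True
    then have "path_trace (Suc m) (free_normal_monomial q (Suc m) c j) =
        (if c (Suc m) = 0 then path_trace m (free_normal_monomial q m c j) else 0)"
      unfolding monomial unfolding free_normal_monomial_def
      using path_trace_L_power[OF _ carriers c(1)] Suc.prems(1) by (simp add: free_word_Nil)
    moreover have "{1..Suc m} = insert (Suc m) {1..m}" by auto
    ultimately show ?thesis using Suc.IH[OF _ code(1) c(2)] Suc.prems(1) True by simp
  next
    case False
    then have "path_trace (Suc m) (free_normal_monomial q (Suc m) c j) = 0"
      unfolding monomial using code Suc.prems(1) by (intro path_trace_L_power_descending carriers c) auto
    moreover have "normal_word j (Suc m) \<noteq> []" using code False by simp
    ultimately show ?thesis by simp
  qed
qed

theorem path_trace_canonical_values: "m \<le> n \<Longrightarrow> canonical_values l m q (path_trace m)"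
  by (simp add: canonical_values_def path_trace_normal_monomial)

end

section \<open>Standard tableaux as paths\<close>

lemma path_iff_addable: "path l p \<longleftrightarrow> (\<forall>m<length p. addable l (set (take m p)) (p ! m))"
proof (induction p rule: rev_induct)
  case (snoc x p)
  have "(\<forall>m<length (p @ [x]). addable l (set (take m (p @ [x]))) ((p @ [x]) ! m)) \<longleftrightarrow>
     (\<forall>m<length p. addable l (set (take m p)) (p ! m)) \<and> addable l (set p) x"
    by (auto simp: less_Suc_eq nth_append)
  then show ?case using snoc by (simp add: path_from_append)
qed simp

definition path_tab :: "node list \<Rightarrow> tableau" where
  "path_tab p x = (if x \<in> set p then Suc (THE i. i < length p \<and> p ! i = x) else 0)"

lemma path_tab_nth:
  assumes "distinct p" "i < length p"
  shows "path_tab p (p ! i) = Suc i"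
proof -
  have "(THE i'. i' < length p \<and> p ! i' = p ! i) = i"
    using assms by (intro the_equality) (auto simp: nth_eq_iff_index_eq)
  then show ?thesis using assms by (simp add: path_tab_def)
qed

lemma path_tab_notin: "x \<notin> set p \<Longrightarrow> path_tab p x = 0" by (simp add: path_tab_def)

lemma path_tab_less:
  assumes "distinct p" "b < length p" "x \<in> set (take b p)"
  shows "path_tab p x < path_tab p (p ! b)"
proof -
  obtain i where i: "i < b" "x = p ! i" using assms by (auto simp: in_set_conv_nth)
  then show ?thesis using path_tab_nth[OF assms(1), of i] path_tab_nth[OF assms(1), of b] assms(2) by simp
qed

lemma path_tab_bij:
  assumes "distinct p"
  shows "bij_betw (path_tab p) (set p) {1..length p}"
proof -
  have "bij_betw Suc {..<length p} {1..length p}"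
    by (rule bij_betw_byWitness[of _ "\<lambda>k. k - 1"]) auto
  then have "bij_betw (path_tab p \<circ> (!) p) {..<length p} {1..length p}"
    by (rule bij_betw_cong[THEN iffD1, rotated]) (simp add: path_tab_nth[OF assms])
  then show ?thesis using bij_betw_comp_iff[OF bij_betw_nth[OF assms refl refl]] by blast
qed

lemma path_predecessors:
  assumes p: "path l p" "b < length p" "p ! b = (s, i, j)" and pos: "1 \<le> i'" "1 \<le> j'"
    and less: "(i' < i \<and> j' = j) \<or> (i' = i \<and> j' < j)"
  shows "(s, i', j') \<in> set (take b p)"
proof -
  have addable: "addable l (set (take b p)) (s, i, j)" using p unfolding path_iff_addable by metis
  have closed: "closed_diagram l (set (take b p))"
    using p(1) path_from_append[of l "{}" "take b p" "drop b p"] by (intro path_closed) simp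
  show ?thesis
  proof (cases "i' < i")
    case True
    then have "(s, i - 1, j) \<in> set (take b p)" using addable pos(1) by (simp add: addable_def)
    then show ?thesis using closed_diagram_down[OF closed, of s "i - 1" j i' j'] pos less True by auto
  next
    case False
    then have "(s, i, j - 1) \<in> set (take b p)" using addable pos(2) less by (simp add: addable_def)
    then show ?thesis using closed_diagram_down[OF closed, of s i "j - 1" i' j'] pos less False by auto
  qed
qed

definition shape_paths :: "multipartition \<Rightarrow> nat \<Rightarrow> nat \<Rightarrow> node list set" where
  "shape_paths \<Lambda> l n = {p \<in> paths l n. set p = mp_nodes \<Lambda>}"

lemma shape_pathsD:
  assumes "p \<in> shape_paths \<Lambda> l n"
  shows "path l p" "length p = n" "set p = mp_nodes \<Lambda>" "distinct p"
  using assms path_distinct by (auto simp: shape_paths_def paths_def)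

lemma path_tab_std:
  assumes p: "p \<in> shape_paths \<Lambda> l n" and size: "mp_size \<Lambda> = n"
  shows "path_tab p \<in> std_tableaux \<Lambda>"
proof -
  note p = shape_pathsD[OF p]
  have less: "path_tab p (s, i', j') < path_tab p (s, i, j)"
    if "(s, i, j) \<in> mp_nodes \<Lambda>" "(s, i', j') \<in> mp_nodes \<Lambda>" "(i' < i \<and> j' = j) \<or> (i' = i \<and> j' < j)"
    for s i j i' j'
  proof -
    have "(s, i, j) \<in> set p" using that(1) p(3) by simp
    then obtain b where b: "b < length p" "p ! b = (s, i, j)" by (metis in_set_conv_nth)
    have "1 \<le> i'" "1 \<le> j'" using that(2) by (auto simp: mp_nodes_def young_def)
    then have "(s, i', j') \<in> set (take b p)" using path_predecessors[OF p(1) b] that(3) by simp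
    then show ?thesis using path_tab_less[OF p(4) b(1)] b(2) by simp
  qed
  show ?thesis unfolding std_tableaux_def
  proof (intro CollectI conjI allI impI)
    show "bij_betw (path_tab p) (mp_nodes \<Lambda>) {1..mp_size \<Lambda>}" using path_tab_bij[OF p(4)] p(2,3) size by simp
    show "path_tab p x = 0" if "x \<notin> mp_nodes \<Lambda>" for x using that p(3) path_tab_notin by simp
  qed (rule less; auto)+
qed

lemma path_tab_inj:
  assumes p: "p \<in> shape_paths \<Lambda> l n" and r: "r \<in> shape_paths \<Lambda> l n" and tab: "path_tab p = path_tab r"
  shows "p = r"
proof (rule nth_equalityI)
  note p = shape_pathsD[OF p] and r = shape_pathsD[OF r]
  show "length p = length r" using p r by simp
  fix i assume i: "i < length p"
  then obtain j where j: "j < length r" "p ! i = r ! j" using p(3) r(3) by (metis in_set_conv_nth nth_mem)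
  then have "Suc i = Suc j" using path_tab_nth[OF p(4) i] path_tab_nth[OF r(4) j(1)] tab by simp
  then show "p ! i = r ! i" using j by simp
qed

definition tab_path :: "multipartition \<Rightarrow> nat \<Rightarrow> tableau \<Rightarrow> node list" where
  "tab_path \<Lambda> n T = map (\<lambda>k. node_of \<Lambda> T (Suc k)) [0..<n]"

lemma length_tab_path [simp]: "length (tab_path \<Lambda> n T) = n" by (simp add: tab_path_def)

lemma tab_path_nth:
  assumes "bij_betw T (mp_nodes \<Lambda>) {1..n}" "k < n"
  shows "tab_path \<Lambda> n T ! k \<in> mp_nodes \<Lambda>" "T (tab_path \<Lambda> n T ! k) = Suc k"
proof -
  have "Suc k \<in> T ` mp_nodes \<Lambda>" using assms by (auto simp: bij_betw_def)
  then show "tab_path \<Lambda> n T ! k \<in> mp_nodes \<Lambda>" "T (tab_path \<Lambda> n T ! k) = Suc k"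
    using assms(2) by (auto simp: tab_path_def node_of_def inv_into_into f_inv_into_f)
qed

lemma set_take_tab_path:
  assumes bij: "bij_betw T (mp_nodes \<Lambda>) {1..n}" and k: "k \<le> n"
  shows "set (take k (tab_path \<Lambda> n T)) = {x\<in>mp_nodes \<Lambda>. T x \<le> k}"
proof (intro equalityI subsetI)
  fix x assume "x \<in> set (take k (tab_path \<Lambda> n T))"
  then obtain i where "i < k" "x = tab_path \<Lambda> n T ! i" using k by (auto simp: in_set_conv_nth)
  then show "x \<in> {x\<in>mp_nodes \<Lambda>. T x \<le> k}" using tab_path_nth[OF bij, of i] k by simp
next
  fix x assume x: "x \<in> {x\<in>mp_nodes \<Lambda>. T x \<le> k}"
  then have "T x \<in> {1..n}" using bij by (auto simp: bij_betw_def)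
  then have i: "T x - 1 < k" "Suc (T x - 1) = T x" using x by auto
  then have "tab_path \<Lambda> n T ! (T x - 1) = x"
    using tab_path_nth[OF bij, of "T x - 1"] x k bij
    by (metis (lifting) bij_betw_def inj_onD less_le_trans mem_Collect_eq)
  then show "x \<in> set (take k (tab_path \<Lambda> n T))" using i k
    by (auto simp: in_set_conv_nth intro!: exI[of _ "T x - 1"])
qed

lemma set_tab_path:
  assumes "bij_betw T (mp_nodes \<Lambda>) {1..n}"
  shows "set (tab_path \<Lambda> n T) = mp_nodes \<Lambda>"
  using set_take_tab_path[OF assms order_refl] assms by (auto simp: bij_betw_def)

lemma path_tab_path:
  assumes \<Lambda>: "\<Lambda> \<in> multipartitions l n" and T: "T \<in> std_tableaux \<Lambda>"
  shows "path l (tab_path \<Lambda> n T)"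
  unfolding path_iff_addable
proof (intro allI impI)
  have bij: "bij_betw T (mp_nodes \<Lambda>) {1..n}"
    using \<Lambda> T by (simp add: std_tableaux_def multipartitions_def)
  fix k assume "k < length (tab_path \<Lambda> n T)"
  then have k: "k < n" by simp
  obtain s i j where x: "tab_path \<Lambda> n T ! k = (s, i, j)" by (cases "tab_path \<Lambda> n T ! k") auto
  have mem: "(s, i, j) \<in> mp_nodes \<Lambda>" "T (s, i, j) = Suc k" using tab_path_nth[OF bij k] x by auto
  have "closed_diagram l (mp_nodes \<Lambda>)" using mp_nodes_multipartition[OF \<Lambda>] by simp
  then have pred: "s < l" "1 \<le> i" "1 \<le> j" "1 < i \<Longrightarrow> (s, i - 1, j) \<in> mp_nodes \<Lambda>"
    "1 < j \<Longrightarrow> (s, i, j - 1) \<in> mp_nodes \<Lambda>"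
    using mem(1) unfolding closed_diagram_def by blast+
  have row_less: "T (s, i - 1, j) < T (s, i, j)" if "1 < i"
    using T pred(4)[OF that] mem(1) that by (simp add: std_tableaux_def)
  have column_less: "T (s, i, j - 1) < T (s, i, j)" if "1 < j"
    using T pred(5)[OF that] mem(1) that by (simp add: std_tableaux_def)
  show "addable l (set (take k (tab_path \<Lambda> n T))) (tab_path \<Lambda> n T ! k)"
    using row_less[unfolded mem(2) less_Suc_eq_le] column_less[unfolded mem(2) less_Suc_eq_le] pred mem
    unfolding x set_take_tab_path[OF bij less_imp_le[OF k]] addable_def by simp
qed

lemma path_tab_surj:
  assumes \<Lambda>: "\<Lambda> \<in> multipartitions l n" and T: "T \<in> std_tableaux \<Lambda>"
  shows "\<exists>p\<in>shape_paths \<Lambda> l n. path_tab p = T"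
proof
  let ?p = "tab_path \<Lambda> n T"
  have bij: "bij_betw T (mp_nodes \<Lambda>) {1..n}" and outside: "\<And>x. x \<notin> mp_nodes \<Lambda> \<Longrightarrow> T x = 0"
    using \<Lambda> T by (auto simp: std_tableaux_def multipartitions_def)
  note path = path_tab_path[OF assms]
  show "path_tab ?p = T"
  proof
    fix x show "path_tab ?p x = T x"
    proof (cases "x \<in> set ?p")
      case True
      then obtain k where "k < n" "x = ?p ! k" by (metis in_set_conv_nth length_tab_path)
      then show ?thesis using path_tab_nth[OF path_distinct[OF path], of k] tab_path_nth[OF bij] by simp
    qed (use outside set_tab_path[OF bij] in \<open>simp add: path_tab_notin\<close>)
  qed
  show "?p \<in> shape_paths \<Lambda> l n" using path set_tab_path[OF bij] by (simp add: shape_paths_def paths_def)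
qed

lemma std_tableaux_eq:
  assumes "\<Lambda> \<in> multipartitions l n"
  shows "std_tableaux \<Lambda> = path_tab ` shape_paths \<Lambda> l n" "inj_on path_tab (shape_paths \<Lambda> l n)"
    "finite (shape_paths \<Lambda> l n)"
proof -
  have "mp_size \<Lambda> = n" using assms by (simp add: multipartitions_def)
  then show "std_tableaux \<Lambda> = path_tab ` shape_paths \<Lambda> l n" using path_tab_std path_tab_surj[OF assms] by blast
  show "inj_on path_tab (shape_paths \<Lambda> l n)" using path_tab_inj by (blast intro: inj_onI)
  show "finite (shape_paths \<Lambda> l n)" using finite_paths by (simp add: shape_paths_def)
qed

lemma node_of_path_tab:
  assumes p: "p \<in> shape_paths \<Lambda> l n" and k: "1 \<le> k" "k \<le> n"
  shows "node_of \<Lambda> (path_tab p) k = p ! (k - 1)"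
proof -
  note p = shape_pathsD[OF p]
  have "path_tab p (p ! (k - 1)) = k" using path_tab_nth[OF p(4), of "k - 1"] p k by simp
  moreover have "p ! (k - 1) \<in> mp_nodes \<Lambda>" using nth_mem[of "k - 1" p] p k by simp
  moreover have "inj_on (path_tab p) (mp_nodes \<Lambda>)" using path_tab_bij[OF p(4)] p(3) by (simp add: bij_betw_def)
  ultimately show ?thesis unfolding node_of_def by (metis inv_into_f_f)
qed

lemma path_tab_swap:
  assumes distinct: "distinct (u @ x # y # w)" and k: "k = Suc (length u)"
  shows "Transposition.transpose k (k + 1) \<circ> path_tab (u @ x # y # w) = path_tab (u @ y # x # w)"
proof
  fix z
  let ?p = "u @ x # y # w" and ?r = "u @ y # x # w"
  have distinct': "distinct ?r" using distinct by auto
  show "(Transposition.transpose k (k + 1) \<circ> path_tab ?p) z = path_tab ?r z"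
  proof (cases "z \<in> set ?p")
    case False
    then have "path_tab ?p z = 0" "path_tab ?r z = 0" by (auto simp: path_tab_notin)
    then show ?thesis using k by (simp add: transpose_def)
  next
    case True
    then obtain i where i: "i < length ?p" "z = ?p ! i" by (metis in_set_conv_nth)
    have tab: "path_tab ?p z = Suc i" using path_tab_nth[OF distinct i(1)] i(2) by simp
    consider (first) "i = length u" | (second) "i = Suc (length u)"
      | (other) "i \<noteq> length u" "i \<noteq> Suc (length u)" by blast
    then show ?thesis
    proof cases
      case first
      then have "z = ?r ! Suc (length u)" using i by (simp add: nth_append)
      then have "path_tab ?r z = Suc (Suc (length u))" using path_tab_nth[OF distinct', of "Suc (length u)"]
        by simp
      then show ?thesis using tab first k by (simp add: transpose_def)
    next
      case second
      then have "z = ?r ! length u" using i by (simp add: nth_append)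
      then have "path_tab ?r z = Suc (length u)" using path_tab_nth[OF distinct', of "length u"] by simp
      then show ?thesis using tab second k by (simp add: transpose_def)
    next
      case other
      then have "z = ?r ! i" using i by (auto simp: nth_append nth_Cons split: nat.splits)
      then have "path_tab ?r z = Suc i" using path_tab_nth[OF distinct', of i] i by simp
      then show ?thesis using tab other k by (simp add: transpose_def)
    qed
  qed
qed

lemma closed_diagram_path:
  assumes "closed_diagram l D" "finite D"
  shows "\<exists>p. path l p \<and> set p = D \<and> length p = card D"
  using assms
proof (induction "card D" arbitrary: D)
  case 0
  then show ?case by simp
next
  case (Suc m)
  define height :: "node \<Rightarrow> nat" where "height = (\<lambda>(s, i, j). i + j)"
  have "D \<noteq> {}" using Suc by auto
  then have "Max (height ` D) \<in> height ` D" using Suc by (intro Max_in) auto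
  then obtain z where z: "z \<in> D" "height z = Max (height ` D)" by auto
  have max: "height x \<le> height z" if "x \<in> D" for x using that z Suc by simp
  obtain s i j where z_eq: "z = (s, i, j)" by (cases z) auto
  have "closed_diagram l (D - {z})" unfolding closed_diagram_def
  proof (intro allI impI)
    fix t i' j' assume mem: "(t, i', j') \<in> D - {z}"
    then have closed: "t < l \<and> 1 \<le> i' \<and> 1 \<le> j' \<and> (1 < i' \<longrightarrow> (t, i' - 1, j') \<in> D) \<and>
        (1 < j' \<longrightarrow> (t, i', j' - 1) \<in> D)"
      using Suc.prems(1) unfolding closed_diagram_def by blast
    have "i' + j' \<le> i + j" using max[of "(t, i', j')"] mem by (simp add: height_def z_eq)
    then show "t < l \<and> 1 \<le> i' \<and> 1 \<le> j' \<and> (1 < i' \<longrightarrow> (t, i' - 1, j') \<in> D - {z}) \<and>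
        (1 < j' \<longrightarrow> (t, i', j' - 1) \<in> D - {z})"
      using closed by (auto simp: z_eq)
  qed
  moreover have "m = card (D - {z})" using Suc z by simp
  ultimately obtain p where p: "path l p" "set p = D - {z}" "length p = card (D - {z})"
    using Suc.hyps(1)[of "D - {z}"] Suc.prems by auto
  have "addable l (D - {z}) z" using Suc.prems(1) z(1) unfolding z_eq addable_def closed_diagram_def by auto
  then have "path l (p @ [z])" using p by (simp add: path_from_append)
  then show ?case using p z Suc by (intro exI[of _ "p @ [z]"]) auto
qed

lemma paths_shape:
  assumes "p \<in> paths l n"
  shows "shape l (set p) \<in> multipartitions l n" "mp_nodes (shape l (set p)) = set p" "card (set p) = n"
proof -
  have D: "closed_diagram l (set p)" using assms path_closed by (simp add: paths_def)
  show card: "card (set p) = n" using assms path_from_distinct[of l "{}" p]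
    by (simp add: paths_def distinct_card)
  show "shape l (set p) \<in> multipartitions l n" using shape_multipartition[OF D] card by simp
  show "mp_nodes (shape l (set p)) = set p" using mp_nodes_shape[OF D] by simp
qed

lemma shape_paths_eq:
  assumes "\<Lambda> \<in> multipartitions l n"
  shows "shape_paths \<Lambda> l n = {p \<in> paths l n. shape l (set p) = \<Lambda>}"
  using paths_shape[of _ l n] mp_nodes_multipartition(4)[OF assms] by (auto simp: shape_paths_def)

lemma shape_paths_nonempty:
  assumes "\<Lambda> \<in> multipartitions l n"
  shows "\<exists>p. p \<in> shape_paths \<Lambda> l n"
  using closed_diagram_path[of l "mp_nodes \<Lambda>"] mp_nodes_multipartition[OF assms]
  by (auto simp: shape_paths_def paths_def)

lemma finite_multipartitions: "finite (multipartitions l n)"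
proof -
  have "multipartitions l n \<subseteq> (\<lambda>p. shape l (set p)) ` paths l n"
  proof
    fix \<Lambda> assume "\<Lambda> \<in> multipartitions l n"
    then obtain p where "p \<in> paths l n" "shape l (set p) = \<Lambda>" using shape_paths_nonempty shape_paths_eq by blast
    then show "\<Lambda> \<in> (\<lambda>p. shape l (set p)) ` paths l n" by blast
  qed
  then show ?thesis using finite_paths finite_subset by blast
qed

lemma addable_same_row:
  assumes D: "closed_diagram l D" and "addable l D (s, i, j)" "addable l D (s, i, j')"
  shows "j = j'"
proof -
  have not_less: False if "addable l D (s, i, j)" "addable l D (s, i, j')" "j < j'" for j j'
  proof -
    have "(s, i, j' - 1) \<in> D" "1 \<le> i" "1 \<le> j" "j \<le> j' - 1" "(s, i, j) \<notin> D" using that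
      by (auto simp: addable_def)
    then show False using closed_diagram_down[OF D] by blast
  qed
  show ?thesis using not_less[of j j'] not_less[of j' j] assms by (meson linorder_neqE_nat)
qed

lemma addable_same_col:
  assumes D: "closed_diagram l D" and "addable l D (s, i, j)" "addable l D (s, i', j)"
  shows "i = i'"
proof -
  have not_less: False if "addable l D (s, i, j)" "addable l D (s, i', j)" "i < i'" for i i'
  proof -
    have "(s, i' - 1, j) \<in> D" "1 \<le> i" "1 \<le> j" "i \<le> i' - 1" "(s, i, j) \<notin> D" using that
      by (auto simp: addable_def)
    then show False using closed_diagram_down[OF D] by blast
  qed
  show ?thesis using not_less[of i i'] not_less[of i' i] assms by (meson linorder_neqE_nat)
qed

context separated
begin

lemma path_consecutive_same_line:
  assumes "path l (u @ (s, i, j) # (s, i', j') # w)" "i = i' \<or> j = j'"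
  shows "adjacent (s, i, j) (s, i', j')"
proof (rule ccontr)
  let ?x = "(s, i, j)" and ?y = "(s, i', j')"
  assume not_adjacent: "\<not> adjacent ?x ?y"
  have D: "closed_diagram l (set u)" "addable l (set u) ?x" "addable l (insert ?x (set u)) ?y"
    using assms(1) path_closed[of l u] by (auto simp: path_from_append)
  then have "addable l (set u) ?y" using addable_swap[OF D(2,3)] not_adjacent by auto
  then have "?x = ?y" using addable_same_row[OF D(1)] addable_same_col[OF D(1)] D(2) assms(2) by blast
  then show False using D(3) by (auto simp: addable_def)
qed

lemma gen_basis_path_tab_vec:
  assumes r: "u @ x # y # w \<in> shape_paths \<Lambda> l n" and k: "k = Suc (length u)"
  shows "gen_basis q Q \<Lambda> k (path_tab (u @ x # y # w)) U = a x y * basis_vec (path_tab (u @ x # y # w)) U +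
    (if adjacent x y then 0 else (1 + a x y) * basis_vec (path_tab (u @ y # x # w)) U)"
proof -
  let ?r = "u @ x # y # w"
  obtain s i j t i' j' where xy: "x = (s, i, j)" "y = (t, i', j')" by (cases x, cases y) auto
  have nodes: "node_of \<Lambda> (path_tab ?r) k = (s, i, j)" "node_of \<Lambda> (path_tab ?r) (k + 1) = (t, i', j')"
    using node_of_path_tab[OF r, of k] node_of_path_tab[OF r, of "k + 1"] shape_pathsD(2)[OF r] k xy
    by (auto simp: nth_append)
  have swap: "Transposition.transpose k (k + 1) \<circ> path_tab ?r = path_tab (u @ y # x # w)"
    using shape_pathsD(4)[OF r] k by (rule path_tab_swap)
  have expand: "gen_basis q Q \<Lambda> k (path_tab ?r) U =
     (if s = t \<and> i = i' then q * basis_vec (path_tab ?r) U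
      else if s = t \<and> j = j' then - basis_vec (path_tab ?r) U
      else a x y * basis_vec (path_tab ?r) U + (1 + a x y) * basis_vec (path_tab (u @ y # x # w)) U)"
    unfolding gen_basis_def nodes swap using k by (simp add: Let_def xy)
  show ?thesis
  proof (cases "adjacent x y")
    case True
    then consider "y = (s, i, Suc j)" | "y = (s, Suc i, j)" by (auto simp: adjacent_def xy)
    then show ?thesis
      using True unfolding expand by cases (simp_all add: xy seminormal_coeff_same_row
        seminormal_coeff_same_column)
  next
    case False
    then have "\<not> (s = t \<and> (i = i' \<or> j = j'))"
      using path_consecutive_same_line shape_pathsD(1)[OF r] unfolding xy by blast
    then show ?thesis unfolding expand using False by auto
  qed
qed

lemma path_op_delta:
  assumes r: "path l (u @ x # y # w)" "length (u @ x # y # w) = n" and p: "path l p" "length p = n"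
    and k: "k = Suc (length u)"
  shows "F k (delta (u @ x # y # w)) p = a x y * delta (u @ x # y # w) p +
    (if adjacent x y then 0 else (1 + a x y) * delta (u @ y # x # w) p)"
proof -
  let ?r = "u @ x # y # w" and ?swapped = "u @ y # x # w"
  have "1 \<le> k" "k < length p" using r(2) p(2) k by auto
  then obtain u' x' y' w' where p_eq: "p = u' @ x' # y' # w'" "k = Suc (length u')"
    by (metis split_at_consecutive)
  have length: "length u' = length u" using k p_eq by simp
  have "x \<noteq> y" using path_distinct[OF r(1)] by auto
  have expand: "F k (delta ?r) p = a x' y' * delta ?r p +
      (if path l (u' @ y' # x' # w') then (q - a x' y') * delta ?r (u' @ y' # x' # w') else 0)"
    using path_op_swap[OF p_eq(2), of l q Q "delta ?r" x' y' w'] p_eq(1) by simp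
  consider (same) "p = ?r" | (swapped) "p = ?swapped" | (other) "p \<noteq> ?r" "p \<noteq> ?swapped" by blast
  then show ?thesis
  proof cases
    case same
    then have "u' = u" "x' = x" "y' = y" "w' = w" using p_eq(1) length by simp_all
    then show ?thesis unfolding expand using same \<open>x \<noteq> y\<close> by (simp add: delta_def)
  next
    case swapped
    then have swap: "u' = u" "x' = y" "y' = x" "w' = w" using p_eq(1) length by simp_all
    have "1 + a x y = q - a y x"
      using seminormal_coeff_add_swap[OF path_distinguishable_consecutive[of u x y w]] r
      by (simp add: algebra_simps)
    moreover have "\<not> adjacent x y" using path_swap_iff[OF r(1)] p(1) swapped by simp
    ultimately show ?thesis unfolding expand swap using swapped \<open>x \<noteq> y\<close> r(1) by (simp add: delta_def)
  next
    case other
    then have "u' @ y' # x' # w' \<noteq> ?r" using p_eq(1) length by auto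
    then show ?thesis unfolding expand using other by (simp add: delta_def)
  qed
qed

lemma shape_paths_swap:
  assumes "u @ x # y # w \<in> shape_paths \<Lambda> l n" "\<not> adjacent x y"
  shows "u @ y # x # w \<in> shape_paths \<Lambda> l n"
  using path_swap_iff[of u x y w] assms by (auto simp: shape_paths_def paths_def)

lemma basis_vec_path_tab:
  assumes "r \<in> shape_paths \<Lambda> l n" "p \<in> shape_paths \<Lambda> l n"
  shows "basis_vec (path_tab r) (path_tab p) = delta r p"
  using path_tab_inj[OF assms] by (auto simp: basis_vec_def delta_def)

lemma gen_basis_path_tab:
  assumes r: "r \<in> shape_paths \<Lambda> l n" and p: "p \<in> shape_paths \<Lambda> l n" and k: "k < n"
  shows "gen_basis q Q \<Lambda> k (path_tab r) (path_tab p) = F k (delta r) p"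
proof (cases "k = 0")
  case True
  have "node_of \<Lambda> (path_tab r) 1 = hd r"
    using node_of_path_tab[OF r, of 1] shape_pathsD(2)[OF r] k by (cases r) auto
  then show ?thesis using True by (simp add: gen_basis_def path_op_0 basis_vec_path_tab[OF r p] delta_def)
next
  case False
  have "1 \<le> k" "k < length r" using False k shape_pathsD(2)[OF r] by auto
  then obtain u x y w where r_eq: "r = u @ x # y # w" "k = Suc (length u)" by (rule split_at_consecutive)
  show ?thesis
    using gen_basis_path_tab_vec[of u x y w \<Lambda> k "path_tab p"] path_op_delta[of u x y w p k]
      r r_eq shape_paths_swap[of u x y w \<Lambda>] shape_pathsD(1,2)[OF r] shape_pathsD(1,2)[OF p]
    by (simp add: basis_vec_path_tab[OF _ p])
qed

context
  fixes \<Lambda> assumes \<Lambda>: "\<Lambda> \<in> multipartitions l n"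
begin

lemma gen_op_sum: "gen_op q Q \<Lambda> k v U = (\<Sum>r\<in>shape_paths \<Lambda> l n. v (path_tab r) *
    gen_basis q Q \<Lambda> k (path_tab r) U)"
  unfolding gen_op_def std_tableaux_eq(1)[OF \<Lambda>] using std_tableaux_eq(2)[OF \<Lambda>] by (simp add: sum.reindex)

lemma gen_op_path_tab:
  assumes p: "p \<in> shape_paths \<Lambda> l n" and k: "k < n"
  shows "gen_op q Q \<Lambda> k v (path_tab p) = F k (\<lambda>r. v (path_tab r)) p"
proof -
  have p_path: "p \<in> paths l n" "set p = mp_nodes \<Lambda>" using p by (auto simp: shape_paths_def)
  have gen_carrier: "free_gen k \<in> carrier (free_algebra n)" using k by (intro free_algebra_closed)
  have "F k (\<lambda>r. v (path_tab r)) p = (\<Sum>r\<in>paths l n. v (path_tab r) * F k (delta r) p)"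
    using path_rep_expand[OF gen_carrier p_path(1), of "\<lambda>r. v (path_tab r)"] by (simp add: rep_gen)
  also have "\<dots> = (\<Sum>r\<in>shape_paths \<Lambda> l n. v (path_tab r) * F k (delta r) p)"
  proof (rule sum.mono_neutral_right[OF finite_paths])
    show "shape_paths \<Lambda> l n \<subseteq> paths l n" by (auto simp: shape_paths_def)
    have "F k (delta r) p = 0" if "r \<in> paths l n - shape_paths \<Lambda> l n" for r
      using path_rep_delta_zero[OF gen_carrier p_path(1), of r] that p_path(2)
      by (auto simp: shape_paths_def rep_gen)
    then show "\<forall>r\<in>paths l n - shape_paths \<Lambda> l n. v (path_tab r) * F k (delta r) p = 0" by simp
  qed
  also have "\<dots> = gen_op q Q \<Lambda> k v (path_tab p)"
    unfolding gen_op_sum using gen_basis_path_tab[OF _ p k] by simp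
  finally show ?thesis by simp
qed

lemma gen_op_outside:
  assumes U: "U \<notin> std_tableaux \<Lambda>" and k: "k < n"
  shows "gen_op q Q \<Lambda> k v U = 0"
proof -
  have basis: "basis_vec (path_tab r) U = (0 :: 'k)" if "r \<in> shape_paths \<Lambda> l n" for r
    using std_tableaux_eq(1)[OF \<Lambda>] that U by (auto simp: basis_vec_def)
  have "gen_basis q Q \<Lambda> k (path_tab r) U = 0" if r: "r \<in> shape_paths \<Lambda> l n" for r
  proof (cases "k = 0")
    case True
    then show ?thesis using basis[OF r] by (simp add: gen_basis_def)
  next
    case False
    then have "1 \<le> k" "k < length r" using k shape_pathsD(2)[OF r] by auto
    then obtain u x y w where "r = u @ x # y # w" "k = Suc (length u)" by (rule split_at_consecutive)
    then show ?thesis using gen_basis_path_tab_vec[of u x y w \<Lambda> k U] shape_paths_swap[of u x y w] basis r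
      by simp
  qed
  then show ?thesis unfolding gen_op_sum by simp
qed

lemma free_op_path_tab:
  assumes x: "x \<in> carrier (free_algebra n)" and p: "p \<in> shape_paths \<Lambda> l n"
  shows "free_op q Q \<Lambda> x v (path_tab p) = rep F x (\<lambda>r. v (path_tab r)) p"
proof -
  have "rep (gen_op q Q \<Lambda>) x v (path_tab p) = rep F x (\<lambda>r. v (path_tab r)) p"
  proof (rule rep_intertwine[of "{..<n}" "shape_paths \<Lambda> l n"])
    show "\<And>w. w \<in> Poly_Mapping.keys x \<Longrightarrow> set (letters w) \<subseteq> {..<n}"
      using x by (simp add: free_algebra_carrier_iff)
    show "gen_op q Q \<Lambda> k v (path_tab p) = F k (\<lambda>r. v (path_tab r)) p" if "k \<in> {..<n}" "p \<in> shape_paths \<Lambda> l n"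
      for k v p
      using gen_op_path_tab that by simp
    show "F k v p = F k v' p" if "k \<in> {..<n}" "p \<in> shape_paths \<Lambda> l n" "\<And>r. r \<in> shape_paths \<Lambda> l n \<Longrightarrow> v r = v' r"
      for k v v' p
      using that by (intro path_op_cong[of k n p l]) (auto simp: shape_paths_def)
  qed (rule p)
  then show ?thesis by (simp add: free_op_def rep_def)
qed

lemma free_op_outside:
  assumes x: "x \<in> carrier (free_algebra n)" and U: "U \<notin> std_tableaux \<Lambda>" "v U = 0"
  shows "free_op q Q \<Lambda> x v U = 0"
proof -
  have "foldr (gen_op q Q \<Lambda>) (letters w) v U = 0" if "w \<in> Poly_Mapping.keys x" for w
  proof (cases "letters w")
    case (Cons k ks)
    then have "k < n" using x that by (auto simp: free_algebra_carrier_iff)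
    then show ?thesis using gen_op_outside[OF U(1)] Cons by simp
  qed (use U in simp)
  then show ?thesis unfolding free_op_def by simp
qed

lemma ak_op_coset:
  assumes n: "1 \<le> n" and x: "x \<in> carrier (free_algebra n)" and p: "p \<in> shape_paths \<Lambda> l n"
  shows "ak_op q Q \<Lambda> (ak_ideal l n q Q +>\<^bsub>free_algebra n\<^esub> x) (basis_vec (path_tab p)) =
      free_op q Q \<Lambda> x (basis_vec (path_tab p))"
proof -
  let ?I = "ak_ideal l n q Q" and ?R = "free_algebra n :: 'k free_alg ring"
  interpret I: ideal ?I ?R by (rule ideal_ak_ideal[OF n])
  have independent: "free_op q Q \<Lambda> (h + x) (basis_vec (path_tab p)) = free_op q Q \<Lambda> x (basis_vec (path_tab p))"
    if h: "h \<in> ?I" for h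
  proof
    fix U
    have carriers: "h + x \<in> carrier ?R" "h \<in> carrier ?R" using I.a_subset h x
      by (auto intro: free_algebra_closed)
    show "free_op q Q \<Lambda> (h + x) (basis_vec (path_tab p)) U = free_op q Q \<Lambda> x (basis_vec (path_tab p)) U"
    proof (cases "U \<in> std_tableaux \<Lambda>")
      case True
      then obtain r where r: "r \<in> shape_paths \<Lambda> l n" "U = path_tab r" using std_tableaux_eq(1)[OF \<Lambda>] by auto
      then have "r \<in> paths l n" by (simp add: shape_paths_def)
      then show ?thesis unfolding r(2) free_op_path_tab[OF carriers(1) r(1)] free_op_path_tab[OF x r(1)] rep_add
        using rep_ak_ideal[OF h _ n] by simp
    next
      case False
      have "path_tab p \<in> std_tableaux \<Lambda>" using std_tableaux_eq(1)[OF \<Lambda>] p by simp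
      then have "basis_vec (path_tab p) U = (0::'k)" using False by (auto simp: basis_vec_def)
      then show ?thesis using free_op_outside[OF carriers(1) False] free_op_outside[OF x False] by simp
    qed
  qed
  have coset: "?I +>\<^bsub>?R\<^esub> x = (\<lambda>h. h + x) ` ?I" by (auto simp: a_r_coset_def' free_algebra_simps)
  have "0 \<in> ?I" using I.zero_closed I.a_subset additive_subgroup.zero_closed[OF I.is_additive_subgroup]
    by (simp add: free_algebra_simps)
  then have "(\<lambda>x. free_op q Q \<Lambda> x (basis_vec (path_tab p))) ` (?I +>\<^bsub>?R\<^esub> x) =
      {free_op q Q \<Lambda> x (basis_vec (path_tab p))}"
    unfolding coset using independent by (auto simp: image_image)
  then show ?thesis unfolding ak_op_def by simp
qed

lemma ak_character_coset:
  assumes n: "1 \<le> n" and x: "x \<in> carrier (free_algebra n)"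
  shows "ak_character q Q \<Lambda> (ak_ideal l n q Q +>\<^bsub>free_algebra n\<^esub> x) =
      (\<Sum>p\<in>shape_paths \<Lambda> l n. rep F x (delta p) p)"
proof -
  have "ak_op q Q \<Lambda> (ak_ideal l n q Q +>\<^bsub>free_algebra n\<^esub> x) (basis_vec (path_tab p)) (path_tab p) =
      rep F x (delta p) p"
    if p: "p \<in> shape_paths \<Lambda> l n" for p
  proof -
    have p_path: "p \<in> paths l n" "set p = mp_nodes \<Lambda>" using p by (auto simp: shape_paths_def)
    have "ak_op q Q \<Lambda> (ak_ideal l n q Q +>\<^bsub>free_algebra n\<^esub> x) (basis_vec (path_tab p)) (path_tab p) =
       rep F x (\<lambda>r. basis_vec (path_tab p) (path_tab r)) p"
      unfolding ak_op_coset[OF n x p] by (rule free_op_path_tab[OF x p])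
    also have "\<dots> = rep F x (delta p) p"
    proof (rule path_rep_cong[OF x p_path(1)])
      fix r assume "r \<in> paths l n" "set r = set p"
      then have "r \<in> shape_paths \<Lambda> l n" using p_path by (simp add: shape_paths_def)
      then show "basis_vec (path_tab p) (path_tab r) = (delta p r :: 'k)"
        by (rule basis_vec_path_tab[OF p])
    qed
    finally show ?thesis .
  qed
  then show ?thesis
    unfolding ak_character_def std_tableaux_eq(1)[OF \<Lambda>] using std_tableaux_eq(2)[OF \<Lambda>]
    by (simp add: sum.reindex)
qed

lemma schur_formula_nonzero: "schur_formula l n q Q \<Lambda> \<noteq> 0"
proof -
  obtain p where "p \<in> paths l n" "shape l (set p) = \<Lambda>"
    using shape_paths_nonempty[OF \<Lambda>] shape_paths_eq[OF \<Lambda>] by auto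
  then show ?thesis using schur_of_nonzero[of p] paths_shape(3)[of p l n] by (simp add: schur_of_def paths_def)
qed

end

lemma path_trace_eq_sum_characters:
  assumes n: "1 \<le> n" and x: "x \<in> carrier (free_algebra n)"
  shows "path_trace n x = (\<Sum>\<Lambda>\<in>multipartitions l n. 1 / schur_formula l n q Q \<Lambda> *
    ak_character q Q \<Lambda> (ak_ideal l n q Q +>\<^bsub>free_algebra n\<^esub> x))"
proof -
  have "path_trace n x = (\<Sum>\<Lambda>\<in>multipartitions l n. \<Sum>p\<in>{p\<in>paths l n. shape l (set p) = \<Lambda>}. 1 / schur_of (set p) *
      rep F x (delta p) p)"
    unfolding path_trace_def using paths_shape(1)
    by (intro sum.group[symmetric] finite_paths finite_multipartitions) auto
  also have "\<dots> = (\<Sum>\<Lambda>\<in>multipartitions l n. 1 / schur_formula l n q Q \<Lambda> *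
    ak_character q Q \<Lambda> (ak_ideal l n q Q +>\<^bsub>free_algebra n\<^esub> x))"
  proof (rule sum.cong[OF refl])
    fix \<Lambda> assume \<Lambda>: "\<Lambda> \<in> multipartitions l n"
    have "schur_of (set p) = schur_formula l n q Q \<Lambda>" if "p \<in> paths l n" "shape l (set p) = \<Lambda>" for p
      using paths_shape(3)[OF that(1)] that(2) by (simp add: schur_of_def)
    then show "(\<Sum>p\<in>{p\<in>paths l n. shape l (set p) = \<Lambda>}. 1 / schur_of (set p) * rep F x (delta p) p) =
      1 / schur_formula l n q Q \<Lambda> * ak_character q Q \<Lambda> (ak_ideal l n q Q +>\<^bsub>free_algebra n\<^esub> x)"
      unfolding ak_character_coset[OF \<Lambda> n x] shape_paths_eq[OF \<Lambda>] sum_distrib_left by (intro sum.cong) auto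
  qed
  finally show ?thesis .
qed

end

section \<open>Linear forms on the algebra\<close>

lemma free_const_central: "free_const c * x = x * free_const c" for x :: "'k::field free_alg"
proof (induction x rule: poly_mapping_add_induct)
  case (step x w d)
  have "Poly_Mapping.single 0 c * Poly_Mapping.single w d =
      Poly_Mapping.single w d * Poly_Mapping.single (0 :: nat free_monoid) c"
    by (simp add: mult_single mult.commute)
  then show ?case using step by (simp add: distrib_left distrib_right free_const_def)
qed simp

lemma single_eq_const_word: "Poly_Mapping.single w c = free_const c * free_word (letters w)"
  by (simp add: free_word_def free_const_def mult_single plus_free_monoid_def zero_free_monoid_def)

lemma free_const_simps:
  "free_const (a + b) = free_const a + free_const b" "free_const (a - b) = free_const a - free_const b"
  "free_const (a * b) = free_const a * free_const b" "free_const 1 = 1" "free_const 0 = 0"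
  by (simp_all add: free_const_def single_add single_diff mult_single)

lemma free_L_monomial_zero: "free_L_monomial q m (\<lambda>k. 0) = 1"
proof (induction m)
  case (Suc m)
  then show ?case by (simp add: free_L_monomial_Suc)
qed (simp add: free_L_monomial_def)

lemma canonical_valuesD:
  assumes "canonical_values l m q f" "\<forall>k\<in>{1..m}. c k < l" "is_code m j"
  shows "f (free_normal_monomial q m c j) = (if (\<forall>k\<in>{1..m}. c k = 0) \<and> normal_word j m = [] then 1 else 0)"
  using assms by (simp add: canonical_values_def)

definition free_proj :: "nat \<Rightarrow> 'k::field free_alg \<Rightarrow> 'k free_alg" where
  "free_proj n x = Poly_Mapping.mapp (\<lambda>w c. if set (letters w) \<subseteq> {..<n} then c else 0) x"

lemma lookup_free_proj:
  "Poly_Mapping.lookup (free_proj n x) w = (if set (letters w) \<subseteq> {..<n} then Poly_Mapping.lookup x w else 0)"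
  by (auto simp: free_proj_def lookup_mapp when_def in_keys_iff)

lemma free_proj_add: "free_proj n (x + y) = free_proj n x + free_proj n y"
  by (rule poly_mapping_eqI) (simp add: lookup_free_proj lookup_add)

lemma free_proj_diff: "free_proj n (x - y) = free_proj n x - free_proj n y"
  by (rule poly_mapping_eqI) (simp add: lookup_free_proj lookup_minus)

lemma free_proj_0: "free_proj n 0 = 0"
  by (rule poly_mapping_eqI) (simp add: lookup_free_proj)

lemma free_proj_single:
  "free_proj n (Poly_Mapping.single w c) = (if set (letters w) \<subseteq> {..<n} then Poly_Mapping.single w c else 0)"
  by (rule poly_mapping_eqI) (auto simp: lookup_free_proj lookup_single when_def)

lemma free_proj_mult: "free_proj n (x * y) = free_proj n x * free_proj n y"
proof (induction x rule: poly_mapping_add_induct)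
  case (step x w c)
  have "free_proj n (Poly_Mapping.single w c * y) = free_proj n (Poly_Mapping.single w c) * free_proj n y"
  proof (induction y rule: poly_mapping_add_induct)
    case (step y w' c')
    have "free_proj n (Poly_Mapping.single w c * Poly_Mapping.single w' c') =
      free_proj n (Poly_Mapping.single w c) * free_proj n (Poly_Mapping.single w' c')"
      by (auto simp: mult_single free_proj_single plus_free_monoid_def)
    then show ?case using step by (simp add: distrib_left free_proj_add)
  qed (simp add: free_proj_0)
  then show ?case using step by (simp add: distrib_right free_proj_add)
qed (simp add: free_proj_0)

lemma free_proj_carrier: "free_proj n x \<in> carrier (free_algebra n)"
  by (auto simp: free_algebra_carrier_iff in_keys_iff lookup_free_proj split: if_splits)

lemma free_proj_id:
  assumes "x \<in> carrier (free_algebra n)"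
  shows "free_proj n x = x"
proof (rule poly_mapping_eqI)
  fix w
  show "Poly_Mapping.lookup (free_proj n x) w = Poly_Mapping.lookup x w"
    using assms by (auto simp: lookup_free_proj free_algebra_carrier_iff in_keys_iff)
qed

definition full_ideal :: "nat \<Rightarrow> nat \<Rightarrow> 'k::field \<Rightarrow> (nat \<Rightarrow> 'k) \<Rightarrow> 'k free_alg set" where
  "full_ideal l n q Q = {x. free_proj n x \<in> ak_ideal l n q Q}"

text \<open>The generators act by scalars in the quotients where the relations fail, so that the relations hold in
  every component.\<close>

definition scalar_gen :: "'k::field \<Rightarrow> (nat \<Rightarrow> 'k) \<Rightarrow> nat \<Rightarrow> 'k free_alg" where
  "scalar_gen q Q i = free_const (if i = 0 then Q 0 else q)"

definition component_gen :: "nat \<Rightarrow> nat \<Rightarrow> 'k::field \<Rightarrow> (nat \<Rightarrow> 'k) \<Rightarrow> 'k free_alg set \<Rightarrow> nat \<Rightarrow> 'k free_alg" where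
  "component_gen l n q Q J = (if ak_relations l n q Q \<subseteq> J then free_gen else scalar_gen q Q)"

definition quot_gen :: "nat \<Rightarrow> nat \<Rightarrow> 'k::field \<Rightarrow> (nat \<Rightarrow> 'k) \<Rightarrow> nat \<Rightarrow> 'k free_alg all_quotients" where
  "quot_gen l n q Q i = abs_all_quotients (\<lambda>J. component_gen l n q Q J i)"

definition quot_const :: "'k::field \<Rightarrow> 'k free_alg all_quotients" where
  "quot_const c = abs_all_quotients (\<lambda>J. free_const c)"

lemma ak_ideal_closed:
  assumes "1 \<le> n"
  shows "0 \<in> ak_ideal l n q Q"
    "x \<in> ak_ideal l n q Q \<Longrightarrow> y \<in> ak_ideal l n q Q \<Longrightarrow> x + y \<in> ak_ideal l n q Q"
    "x \<in> ak_ideal l n q Q \<Longrightarrow> y \<in> ak_ideal l n q Q \<Longrightarrow> x - y \<in> ak_ideal l n q Q"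
    "x \<in> ak_ideal l n q Q \<Longrightarrow> r \<in> carrier (free_algebra n) \<Longrightarrow> r * x \<in> ak_ideal l n q Q"
    "x \<in> ak_ideal l n q Q \<Longrightarrow> r \<in> carrier (free_algebra n) \<Longrightarrow> x * r \<in> ak_ideal l n q Q"
    "ak_ideal l n q Q \<subseteq> carrier (free_algebra n)" "ak_relations l n q Q \<subseteq> ak_ideal l n q Q"
proof -
  interpret I: ideal "ak_ideal l n q Q" "free_algebra n" by (rule ideal_ak_ideal[OF assms])
  show "0 \<in> ak_ideal l n q Q" using additive_subgroup.zero_closed[OF I.is_additive_subgroup]
    by (simp add: free_algebra_simps)
  show add: "x + y \<in> ak_ideal l n q Q" if "x \<in> ak_ideal l n q Q" "y \<in> ak_ideal l n q Q" for x y
    using additive_subgroup.a_closed[OF I.is_additive_subgroup that] by (simp add: free_algebra_simps)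
  show mul: "r * x \<in> ak_ideal l n q Q" if "x \<in> ak_ideal l n q Q" "r \<in> carrier (free_algebra n)" for x r
    using I.I_l_closed[OF that] by (simp add: free_algebra_simps)
  show "x * r \<in> ak_ideal l n q Q" if "x \<in> ak_ideal l n q Q" "r \<in> carrier (free_algebra n)"
    using I.I_r_closed[OF that] by (simp add: free_algebra_simps)
  show "x - y \<in> ak_ideal l n q Q" if "x \<in> ak_ideal l n q Q" "y \<in> ak_ideal l n q Q"
    using add[OF that(1) mul[OF that(2), of "- 1"]] by (simp add: free_algebra_closed)
  show "ak_ideal l n q Q \<subseteq> carrier (free_algebra n)" by (rule I.a_subset)
  show "ak_relations l n q Q \<subseteq> ak_ideal l n q Q" unfolding ak_ideal_def
    by (intro ring.genideal_self ring_free_algebra ak_relations_carrier assms)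
qed

lemma two_sided_full_ideal:
  assumes "1 \<le> n"
  shows "two_sided_ideal (full_ideal l n q Q)"
  unfolding two_sided_ideal_def full_ideal_def mem_Collect_eq free_proj_0 free_proj_diff free_proj_mult
  by (intro conjI ballI allI ak_ideal_closed[OF assms]) (simp_all add: free_proj_carrier)

lemma full_ideal_carrier: "x \<in> carrier (free_algebra n) \<Longrightarrow> x \<in> full_ideal l n q Q \<longleftrightarrow> x \<in> ak_ideal l n q Q"
  by (simp add: full_ideal_def free_proj_id)

lemma relations_full_ideal:
  assumes "1 \<le> n"
  shows "ak_relations l n q Q \<subseteq> full_ideal l n q Q"
  using full_ideal_carrier ak_ideal_closed(7)[OF assms] ak_relations_carrier[OF assms] by blast

lemma abs_all_quotients_eqI:
  assumes "\<And>J. two_sided_ideal J \<Longrightarrow> f J - g J \<in> J"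
  shows "abs_all_quotients f = abs_all_quotients g"
  using assms by (simp add: all_quotients.abs_eq_iff)

lemmas abs_all_quotients_simps = plus_all_quotients.abs_eq minus_all_quotients.abs_eq times_all_quotients.abs_eq
  one_all_quotients.abs_eq zero_all_quotients.abs_eq

lemma abs_all_quotients_prod_list:
  fixes f :: "'s \<Rightarrow> 'r::ring_1 set \<Rightarrow> 'r"
  shows "(\<Prod>s\<leftarrow>ss. abs_all_quotients (f s)) = abs_all_quotients (\<lambda>J. \<Prod>s\<leftarrow>ss. f s J)"
  by (induction ss) (simp_all add: one_all_quotients_def times_all_quotients.abs_eq)

lemma quot_relationI:
  assumes relation: "f free_gen - g free_gen \<in> ak_relations l n q Q"
    and scalar: "f (scalar_gen q Q) = g (scalar_gen q Q)"
  shows "abs_all_quotients (\<lambda>J. f (component_gen l n q Q J)) =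
      abs_all_quotients (\<lambda>J. g (component_gen l n q Q J))"
proof (rule abs_all_quotients_eqI)
  fix J :: "'a free_alg set"
  assume "two_sided_ideal J"
  then have "0 \<in> J" by (rule two_sided_idealD(1))
  then show "f (component_gen l n q Q J) - g (component_gen l n q Q J) \<in> J"
    using relation scalar by (auto simp: component_gen_def)
qed

lemma quot_cyclotomic:
  assumes "1 \<le> l"
  shows "(\<Prod>s\<leftarrow>[0..<l]. quot_gen l n q Q 0 - quot_const (Q s)) = 0"
  unfolding quot_gen_def quot_const_def minus_all_quotients.abs_eq abs_all_quotients_prod_list
    zero_all_quotients_def
proof (rule quot_relationI[where f = "\<lambda>G. \<Prod>s\<leftarrow>[0..<l]. G 0 - free_const (Q s)" and g = "\<lambda>G. 0"])
  show "(\<Prod>s\<leftarrow>[0..<l]. free_gen 0 - free_const (Q s)) - 0 \<in> ak_relations l n q Q" by (simp add: ak_relations_def)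
  show "(\<Prod>s\<leftarrow>[0..<l]. scalar_gen q Q 0 - free_const (Q s)) = 0"
    using assms upt_conv_Cons[of 0 l] by (simp add: scalar_gen_def)
qed

lemma quot_quadratic:
  assumes "1 \<le> i" "i < n"
  shows "quot_gen l n q Q i * quot_gen l n q Q i = quot_const (q - 1) * quot_gen l n q Q i + quot_const q"
  unfolding quot_gen_def quot_const_def abs_all_quotients_simps
proof (rule quot_relationI[where f = "\<lambda>G. G i * G i" and g = "\<lambda>G. free_const (q - 1) * G i + free_const q"])
  have "(free_gen i - free_const q) * (free_gen i + 1) \<in> ak_relations l n q Q"
    unfolding ak_relations_def using assms by blast
  then show "free_gen i * free_gen i - (free_const (q - 1) * free_gen i + free_const q) \<in> ak_relations l n q Q"
    by (simp add: free_const_simps algebra_simps)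
  show "scalar_gen q Q i * scalar_gen q Q i = free_const (q - 1) * scalar_gen q Q i + free_const q"
    using assms by (simp add: scalar_gen_def free_const_simps algebra_simps)
qed

lemma quot_braid0:
  assumes "2 \<le> n"
  shows "quot_gen l n q Q 0 * quot_gen l n q Q 1 * quot_gen l n q Q 0 * quot_gen l n q Q 1 =
      quot_gen l n q Q 1 * quot_gen l n q Q 0 * quot_gen l n q Q 1 * quot_gen l n q Q 0"
  unfolding quot_gen_def abs_all_quotients_simps
  using assms
  by (intro quot_relationI[where f = "\<lambda>G. G 0 * G 1 * G 0 * G 1" and g = "\<lambda>G. G 1 * G 0 * G 1 * G 0"])
     (simp_all add: ak_relations_def scalar_gen_def free_const_simps(3)[symmetric] mult_ac)

lemma quot_braid:
  assumes "1 \<le> i" "i + 1 < n"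
  shows "quot_gen l n q Q i * quot_gen l n q Q (i + 1) * quot_gen l n q Q i =
      quot_gen l n q Q (i + 1) * quot_gen l n q Q i * quot_gen l n q Q (i + 1)"
  unfolding quot_gen_def abs_all_quotients_simps
proof (rule quot_relationI[where f = "\<lambda>G. G i * G (i + 1) * G i" and g = "\<lambda>G. G (i + 1) * G i * G (i + 1)"])
  show "free_gen i * free_gen (i + 1) * free_gen i -
      free_gen (i + 1) * free_gen i * free_gen (i + 1) \<in> ak_relations l n q Q"
    unfolding ak_relations_def using assms by blast
qed (use assms in \<open>simp add: scalar_gen_def\<close>)

lemma quot_far_commute:
  assumes "i + 1 < j" "j < n"
  shows "quot_gen l n q Q i * quot_gen l n q Q j = quot_gen l n q Q j * quot_gen l n q Q i"
  unfolding quot_gen_def abs_all_quotients_simps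
proof (rule quot_relationI[where f = "\<lambda>G. G i * G j" and g = "\<lambda>G. G j * G i"])
  show "free_gen i * free_gen j - free_gen j * free_gen i \<in> ak_relations l n q Q"
    unfolding ak_relations_def using assms by blast
qed (simp add: scalar_gen_def free_const_simps(3)[symmetric] mult.commute)

lemma ak_ring_quot:
  fixes q :: "'k::field"
  assumes "1 \<le> l" "q \<noteq> 0"
  shows "ak_ring quot_const l n q Q (quot_gen l n q Q)"
proof
  show "quot_const a * x = x * quot_const a" for a :: 'k and x
  proof (induction x rule: all_quotients.abs_induct)
    case (1 f)
    then show ?case by (simp add: quot_const_def abs_all_quotients_simps free_const_central)
  qed
  show "quot_const (1::'k) = 1" by (simp add: quot_const_def one_all_quotients_def free_const_simps)
  show "quot_const (a + b) = quot_const a + quot_const b" "quot_const (a * b) = quot_const a * quot_const b"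
    for a b :: 'k
    by (simp_all add: quot_const_def abs_all_quotients_simps free_const_simps)
  show "1 \<le> l" "q \<noteq> 0" by fact+
  show "(\<Prod>s\<leftarrow>[0..<l]. quot_gen l n q Q 0 - quot_const (Q s)) = 0" by (rule quot_cyclotomic[OF assms(1)])
qed (rule quot_quadratic quot_braid0 quot_braid quot_far_commute; assumption)+

definition models :: "nat \<Rightarrow> nat \<Rightarrow> 'k::field \<Rightarrow> (nat \<Rightarrow> 'k) \<Rightarrow> 'k free_alg all_quotients \<Rightarrow> 'k free_alg \<Rightarrow> bool" where
  "models l n q Q X x \<longleftrightarrow> x \<in> carrier (free_algebra n) \<and>
     (\<exists>f. X = abs_all_quotients f \<and> f (full_ideal l n q Q) - x \<in> full_ideal l n q Q)"

locale ak_params =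
  fixes l n :: nat and q :: "'k::field" and Q :: "nat \<Rightarrow> 'k"
  assumes l_pos: "1 \<le> l" and n_pos: "1 \<le> n" and q_nonzero: "q \<noteq> 0"
begin

sublocale H: ak_ring quot_const l n q Q "quot_gen l n q Q" using l_pos q_nonzero by (rule ak_ring_quot)

abbreviation "I \<equiv> ak_ideal l n q Q"
abbreviation "C \<equiv> carrier (free_algebra n) :: 'k free_alg set"
abbreviation "mod_eq \<equiv> models l n q Q"

lemmas full = two_sided_full_ideal[OF n_pos, of l q Q]
lemmas ak_ideal_simps = ak_ideal_closed[OF n_pos, where l=l and q=q and Q=Q]

lemma models_unique:
  assumes "mod_eq X x" "mod_eq X y"
  shows "x - y \<in> I"
proof -
  let ?J = "full_ideal l n q Q"
  obtain f g where fg: "X = abs_all_quotients f" "f ?J - x \<in> ?J" "X = abs_all_quotients g" "g ?J - y \<in> ?J"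
    using assms unfolding models_def by blast
  have "f ?J - g ?J \<in> ?J" using abs_all_quotients_eqD[of f g] fg full by simp
  then have "(f ?J - g ?J) - (f ?J - x) + (g ?J - y) \<in> ?J"
    using two_sided_idealD(2,4)[OF full] fg by blast
  then have "x - y \<in> ?J" by simp
  moreover have "x - y \<in> C" using assms by (intro free_algebra_closed) (auto simp: models_def)
  ultimately show ?thesis using full_ideal_carrier by blast
qed

lemma models_add: "mod_eq X x \<Longrightarrow> mod_eq Y y \<Longrightarrow> mod_eq (X + Y) (x + y)"
proof -
  let ?J = "full_ideal l n q Q"
  assume models: "mod_eq X x" "mod_eq Y y"
  then obtain f g where fg: "X = abs_all_quotients f" "f ?J - x \<in> ?J" "Y = abs_all_quotients g" "g ?J - y \<in> ?J"
    unfolding models_def by blast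
  have "(f ?J - x) + (g ?J - y) \<in> ?J" by (intro two_sided_idealD(4)[OF full] fg)
  then have "f ?J + g ?J - (x + y) \<in> ?J" by (simp add: algebra_simps)
  then show ?thesis using models fg unfolding models_def
    by (auto intro: free_algebra_closed simp: abs_all_quotients_simps)
qed

lemma models_mult: "mod_eq X x \<Longrightarrow> mod_eq Y y \<Longrightarrow> mod_eq (X * Y) (x * y)"
proof -
  let ?J = "full_ideal l n q Q"
  assume models: "mod_eq X x" "mod_eq Y y"
  then obtain f g where fg: "X = abs_all_quotients f" "f ?J - x \<in> ?J" "Y = abs_all_quotients g" "g ?J - y \<in> ?J"
    unfolding models_def by blast
  have "(f ?J - x) * g ?J + x * (g ?J - y) \<in> ?J"
    by (intro two_sided_idealD(4)[OF full] two_sided_idealD(5,6)[OF full] fg)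
  then have "f ?J * g ?J - (x * y) \<in> ?J" by (simp add: algebra_simps)
  then show ?thesis using models fg unfolding models_def
    by (auto intro: free_algebra_closed simp: abs_all_quotients_simps)
qed

lemma models_const: "mod_eq (quot_const c) (free_const c)"
  using two_sided_idealD(1)[OF full] unfolding models_def quot_const_def
  by (intro conjI free_algebra_closed exI[of _ "\<lambda>J. free_const c"]) auto

lemma models_one: "mod_eq 1 1" using models_const[of 1] by (simp add: free_const_simps H.eta_one)
lemma models_zero: "mod_eq 0 0" using models_const[of 0] by (simp add: free_const_simps H.eta_zero)

lemma models_gen: "i < n \<Longrightarrow> mod_eq (quot_gen l n q Q i) (free_gen i)"
  using two_sided_idealD(1)[OF full] relations_full_ideal[OF n_pos, of l q Q]
  unfolding models_def quot_gen_def component_gen_def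
  by (intro conjI free_algebra_closed exI[of _ "\<lambda>J. (if ak_relations l n q Q \<subseteq> J then free_gen else scalar_gen q Q) i"]) auto

lemma models_word: "set u \<subseteq> {..<n} \<Longrightarrow> mod_eq (H.T_word u) (free_word u)"
  by (induction u) (auto simp: free_word_Nil free_word_Cons intro: models_one models_mult models_gen)

lemma models_L: "1 \<le> k \<Longrightarrow> k \<le> n \<Longrightarrow> mod_eq (H.L k) (free_L q k)"
  unfolding H.L_def free_L_def by (intro models_mult models_const models_word) auto

lemma models_power: "mod_eq X x \<Longrightarrow> mod_eq (X ^ c) (x ^ c)"
  by (induction c) (auto intro: models_one models_mult)

lemma models_prod_list: "(\<And>k. k \<in> set ks \<Longrightarrow> mod_eq (X k) (x k)) \<Longrightarrow> mod_eq (\<Prod>k\<leftarrow>ks. X k) (\<Prod>k\<leftarrow>ks. x k)"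
  by (induction ks) (auto intro: models_one models_mult)

lemma models_normal_monomial:
  assumes "is_code n j"
  shows "mod_eq (H.L_monomial c * H.T_word (normal_word j n)) (free_normal_monomial q n c j)"
proof -
  have "set (normal_word j n) \<subseteq> {..<n}" using set_normal_word[of n j] assms by fastforce
  then show ?thesis unfolding H.L_monomial_def free_normal_monomial_def free_L_monomial_def
    by (intro models_mult models_prod_list models_power models_L models_word) auto
qed

definition linear_mod :: "('k free_alg \<Rightarrow> 'k) \<Rightarrow> bool" where
  "linear_mod f \<longleftrightarrow> (\<forall>x\<in>C. \<forall>y\<in>C. f (x + y) = f x + f y) \<and> (\<forall>c. \<forall>x\<in>C. f (free_const c * x) = c * f x) \<and>
      (\<forall>x\<in>I. f x = 0)"

lemma linear_modD:
  assumes "linear_mod f"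
  shows "x \<in> C \<Longrightarrow> y \<in> C \<Longrightarrow> f (x + y) = f x + f y" "x \<in> C \<Longrightarrow> f (free_const c * x) = c * f x" "x \<in> I \<Longrightarrow> f x = 0"
    "f 0 = 0"
    "x \<in> C \<Longrightarrow> y \<in> C \<Longrightarrow> x - y \<in> I \<Longrightarrow> f x = f y"
proof -
  show add: "x \<in> C \<Longrightarrow> y \<in> C \<Longrightarrow> f (x + y) = f x + f y" for x y using assms by (simp add: linear_mod_def)
  show "x \<in> C \<Longrightarrow> f (free_const c * x) = c * f x" "x \<in> I \<Longrightarrow> f x = 0" "f 0 = 0"
    using assms ak_ideal_simps(1) by (auto simp: linear_mod_def)
  show "f x = f y" if "x \<in> C" "y \<in> C" "x - y \<in> I"
    using add[OF that(2), of "x - y"] that assms ak_ideal_simps(6) by (auto simp: linear_mod_def)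
qed

lemma lin_span_models:
  assumes f: "linear_mod f" and M: "0 \<in> M" "\<And>x y. x \<in> M \<Longrightarrow> y \<in> M \<Longrightarrow> x + y \<in> M" "\<And>a x. a \<in> A \<Longrightarrow> x \<in> M \<Longrightarrow> a * x \<in> M"
    and generators: "\<And>b. b \<in> B \<Longrightarrow> \<exists>z. mod_eq b z \<and> f z \<in> M" and X: "X \<in> H.lin_span A B"
  shows "\<exists>z. mod_eq X z \<and> f z \<in> M"
  using X
proof (induction rule: H.lin_span.induct)
  case zero
  then show ?case using models_zero linear_modD(4)[OF f] M(1) by metis
next
  case (step a b x)
  obtain y z where y: "mod_eq b y" "f y \<in> M" and z: "mod_eq x z" "f z \<in> M" using generators step by blast
  have C: "y \<in> C" "z \<in> C" using y z by (auto simp: models_def)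
  have "mod_eq (quot_const a * b + x) (free_const a * y + z)" by (intro models_add models_mult models_const y z)
  moreover have "f (free_const a * y + z) = a * f y + f z"
    using linear_modD(1,2)[OF f] C by (simp add: free_algebra_closed)
  ultimately show ?case using M step.hyps y z by metis
qed

lemma linear_mod_word_values:
  assumes f: "linear_mod f" and M: "0 \<in> M" "\<And>x y. x \<in> M \<Longrightarrow> y \<in> M \<Longrightarrow> x + y \<in> M" "\<And>a x. a \<in> A \<Longrightarrow> x \<in> M \<Longrightarrow> a * x \<in> M"
    and A: "unital_subring A" "q \<in> A" "\<And>s. s < l \<Longrightarrow> Q s \<in> A"
    and monomials: "\<And>c j. (\<forall>k\<in>{1..n}. c k < l) \<Longrightarrow> is_code n j \<Longrightarrow> f (free_normal_monomial q n c j) \<in> M"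
    and u: "set u \<subseteq> {..<n}"
  shows "f (free_word u) \<in> M"
proof -
  have "H.T_word u \<in> H.lin_span A H.normal_monomials" by (rule H.T_word_in_span_normal_monomials[OF n_pos A u])
  then have "\<exists>z. mod_eq (H.T_word u) z \<and> f z \<in> M"
  proof (rule lin_span_models[OF f M, rotated -1])
    fix b assume "b \<in> H.normal_monomials"
    then show "\<exists>z. mod_eq b z \<and> f z \<in> M" unfolding H.normal_monomials_def using models_normal_monomial monomials
      by blast
  qed
  then obtain z where z: "mod_eq (H.T_word u) z" "f z \<in> M" by blast
  have "free_word u - z \<in> I" by (rule models_unique[OF models_word[OF u] z(1)])
  moreover have "z \<in> C" using z by (simp add: models_def)
  ultimately show ?thesis using linear_modD(5)[OF f free_word_carrier[OF u]] z by simp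
qed

lemma linear_mod_unique:
  assumes f: "linear_mod f" and g: "linear_mod g"
    and monomials: "\<And>c j. (\<forall>k\<in>{1..n}. c k < l) \<Longrightarrow> is_code n j \<Longrightarrow>
      f (free_normal_monomial q n c j) = g (free_normal_monomial q n c j)"
    and x: "x \<in> C"
  shows "f x = g x"
proof -
  have difference: "linear_mod (\<lambda>x. f x - g x)"
    using f g unfolding linear_mod_def by (auto simp: algebra_simps)
  have "f (free_word u) - g (free_word u) \<in> {0}" if "set u \<subseteq> {..<n}" for u
    by (rule linear_mod_word_values[OF difference, of "{0}" UNIV])
      (use monomials that unital_subring_UNIV in auto)
  then have words: "f (free_word u) = g (free_word u)" if "set u \<subseteq> {..<n}" for u using that by simp
  show ?thesis using x
  proof (induction x rule: poly_mapping_add_induct)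
    case zero
    then show ?case using linear_modD(4)[OF f] linear_modD(4)[OF g] by simp
  next
    case (step x w c)
    note keys = free_algebra_single_add(1)[OF step.prems step.hyps]
      and x_carrier = free_algebra_single_add(2)[OF step.prems step.hyps]
    have word_carrier: "free_word (letters w) \<in> C" by (rule free_word_carrier[OF keys])
    then have "free_const c * free_word (letters w) \<in> C" by (intro free_algebra_closed)
    note linear = linear_modD(1)[OF _ this x_carrier] linear_modD(2)[OF _ word_carrier]
    show ?case unfolding single_eq_const_word linear[OF f] linear[OF g] words[OF keys] step.IH[OF x_carrier] ..
  qed
qed

lemma reduced_expr_normal_word:
  assumes "reduced_expr n w u"
  shows "\<exists>j. is_code n j \<and> word_perm (normal_word j n) = w \<and> free_word u - free_word (normal_word j n) \<in> I"
proof -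
  obtain j where j: "is_code n j" "word_perm (normal_word j n) = w" "braid_eq u (normal_word j n)"
    using reduced_expr_braid_eq_normal_word[OF assms] by blast
  have u: "set u \<subseteq> {1..<n}" using assms by (simp add: reduced_expr_def)
  then have u': "set u \<subseteq> {..<n}" "set (normal_word j n) \<subseteq> {..<n}" using braid_eq_length_set[OF j(3)] by auto
  have "H.T_word u = H.T_word (normal_word j n)" by (rule H.T_word_braid_eq[OF j(3) u])
  then show ?thesis using models_unique[of "H.T_word u"] models_word[OF u'(1)] models_word[OF u'(2)] j by auto
qed

lemma canonical_value_one:
  assumes "canonical_values l n q f"
  shows "f 1 = 1"
  using canonical_valuesD[OF assms, of "\<lambda>k. 0" "\<lambda>k. k"] normal_word_id[of n] l_pos
  by (simp add: free_normal_monomial_def free_L_monomial_zero free_word_Nil)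

lemma canonical_value_nontrivial_span:
  assumes f: "linear_mod f" "canonical_values l n q f" and r: "r \<in> H.lin_span UNIV H.nontrivial_monomials"
  shows "\<exists>z. mod_eq r z \<and> f z = 0"
proof -
  have "\<exists>z. mod_eq b z \<and> f z \<in> {0}" if "b \<in> H.nontrivial_monomials" for b
    using that f(2) models_normal_monomial unfolding H.nontrivial_monomials_def canonical_values_def
    by (smt (verit, ccfv_SIG) mem_Collect_eq singletonI)
  then show ?thesis using lin_span_models[OF f(1) _ _ _ _ r, of "{0}"] by simp
qed

lemma char_element_representative:
  assumes f: "linear_mod f" "canonical_values l n q f" and s: "s < l"
  shows "\<exists>y\<in>C. f y = (\<Prod>t\<leftarrow>H.other_indices s. - Q t) ^ n \<and>
    (\<forall>u. set u \<subseteq> {..<n} \<longrightarrow> y * free_word u - free_const (H.linear_char s u) * y \<in> I) \<and>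
    y * y - free_const (H.char_square s) * y \<in> I"
proof -
  let ?\<kappa> = "(\<Prod>t\<leftarrow>H.other_indices s. - Q t) ^ n"
  obtain r where r: "r \<in> H.lin_span UNIV H.nontrivial_monomials" "H.char_element s = quot_const ?\<kappa> + r"
    using H.char_element_expand[OF s] by blast
  then obtain z where z: "mod_eq r z" "f z = 0" using canonical_value_nontrivial_span[OF f] by blast
  define y where "y = free_const ?\<kappa> + z"
  have y: "mod_eq (H.char_element s) y" unfolding r(2) y_def by (intro models_add models_const z)
  have carriers: "y \<in> C" "z \<in> C" using y z by (auto simp: models_def)
  have "f (free_const ?\<kappa> * 1) = ?\<kappa>"
    using linear_modD(2)[OF f(1), of 1 ?\<kappa>] canonical_value_one[OF f(2)] by (simp add: free_algebra_closed)
  then have "f y = ?\<kappa>"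
    unfolding y_def using linear_modD(1)[OF f(1), of "free_const ?\<kappa>" z] z carriers
    by (simp add: free_algebra_closed)
  moreover have "y * free_word u - free_const (H.linear_char s u) * y \<in> I" if u: "set u \<subseteq> {..<n}" for u
    using models_unique[of "H.char_element s * H.T_word u"] models_mult[OF y models_word[OF u]]
      models_mult[OF models_const y] H.char_element_word[OF n_pos s u] by simp
  moreover have "y * y - free_const (H.char_square s) * y \<in> I"
    using models_unique[OF models_mult[OF y y]] models_mult[OF models_const y]
    unfolding H.char_element_square[OF s] by blast
  ultimately show ?thesis using carriers by blast
qed

end

lemma (in separated) separated_ak_params:
  assumes "1 \<le> n"
  shows "ak_params l n q"
  using l q0 assms by unfold_locales

lemma (in separated) linear_mod_path_trace:
  assumes "1 \<le> n"
  shows "ak_params.linear_mod l n q Q (path_trace n)"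
proof -
  interpret P: ak_params l n q Q by (rule separated_ak_params[OF assms])
  have "path_trace n x = 0" if "x \<in> ak_ideal l n q Q" for x
    unfolding path_trace_def using rep_ak_ideal[OF that] assms by simp
  then show ?thesis unfolding P.linear_mod_def by (simp add: path_trace_add path_trace_scale)
qed

section \<open>Specialisation of generic parameters\<close>

definition lin_ext :: "(nat list \<Rightarrow> 'k) \<Rightarrow> 'k::field free_alg \<Rightarrow> 'k" where
  "lin_ext \<phi> x = rep (\<lambda>k v u. v (u @ [k])) x \<phi> []"

lemma foldr_append_letters: "foldr (\<lambda>k v u. v (u @ [k])) ks \<phi> u = \<phi> (u @ ks)"
  by (induction ks arbitrary: u) auto

lemma lin_ext_add: "lin_ext \<phi> (x + y) = lin_ext \<phi> x + lin_ext \<phi> y"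
  by (simp add: lin_ext_def rep_add)

lemma lin_ext_zero: "lin_ext \<phi> 0 = 0"
  by (simp add: lin_ext_def rep_zero)

lemma lin_ext_single: "lin_ext \<phi> (Poly_Mapping.single w c) = c * \<phi> (letters w)"
  by (simp add: lin_ext_def rep_single foldr_append_letters)

lemma lin_ext_scale: "lin_ext \<phi> (free_const c * x) = c * lin_ext \<phi> x"
proof -
  have "linear_ops (\<lambda>k v u. v (u @ [k]) :: 'a)" by (simp add: linear_ops_def)
  then show ?thesis unfolding lin_ext_def by (simp add: rep_mult rep_const)
qed

definition integral_elts :: "'a::field fls set" where "integral_elts = range fps_to_fls"

lemma integral_closed:
  fixes x y :: "'a::field fls"
  shows "(0::'a fls) \<in> integral_elts" "(1::'a fls) \<in> integral_elts"
    "x \<in> integral_elts \<Longrightarrow> y \<in> integral_elts \<Longrightarrow> x + y \<in> integral_elts"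
  "x \<in> integral_elts \<Longrightarrow> y \<in> integral_elts \<Longrightarrow> x - y \<in> integral_elts"
  "x \<in> integral_elts \<Longrightarrow> - x \<in> integral_elts"
  "x \<in> integral_elts \<Longrightarrow> y \<in> integral_elts \<Longrightarrow> x * y \<in> integral_elts" "fls_const (c::'a) \<in> integral_elts"
proof -
  have integral: "fps_to_fls f \<in> integral_elts" for f :: "'a fps" by (simp add: integral_elts_def)
  show "(0::'a fls) \<in> integral_elts" "(1::'a fls) \<in> integral_elts" "fls_const c \<in> integral_elts"
    using integral[of 0] integral[of 1] integral[of "fps_const c"] by simp_all
  show "- x \<in> integral_elts" if "x \<in> integral_elts"
  proof -
    obtain f where "x = fps_to_fls f" using \<open>x \<in> integral_elts\<close> by (auto simp: integral_elts_def)
    then show ?thesis using integral[of "- f"] by simp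
  qed
  assume "x \<in> integral_elts" "y \<in> integral_elts"
  then obtain f g where "x = fps_to_fls f" "y = fps_to_fls g" by (auto simp: integral_elts_def)
  then show "x + y \<in> integral_elts" "x - y \<in> integral_elts" "x * y \<in> integral_elts"
    using integral[of "f + g"] integral[of "f - g"] integral[of "f * g"] by (simp_all add: fls_times_fps_to_fls)
qed

lemma unital_subring_integral_elts: "unital_subring integral_elts"
  by (auto simp: unital_subring_def integral_closed)

lemma integral_mult_nth_0:
  assumes "x \<in> integral_elts" "y \<in> integral_elts"
  shows "fls_nth (x * y) 0 = fls_nth x 0 * fls_nth y 0"
proof -
  obtain f g where "x = fps_to_fls f" "y = fps_to_fls g" using assms by (auto simp: integral_elts_def)
  then show ?thesis by (simp add: fls_times_fps_to_fls[symmetric])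
qed

lemma integral_inverse:
  assumes "x \<in> integral_elts" "fls_nth x 0 \<noteq> 0"
  shows "inverse x \<in> integral_elts" "fls_nth (inverse x) 0 = inverse (fls_nth x 0)"
proof -
  obtain f where f: "x = fps_to_fls f" using assms by (auto simp: integral_elts_def)
  then have "fps_nth f 0 \<noteq> 0" using assms by simp
  then have "inverse x = fps_to_fls (inverse f)" using f by (simp add: fls_inverse_fps_to_fls)
  then show "inverse x \<in> integral_elts" "fls_nth (inverse x) 0 = inverse (fls_nth x 0)"
    using f by (simp_all add: integral_elts_def)
qed

lemma integral_power:
  assumes "x \<in> integral_elts"
  shows "x ^ m \<in> integral_elts \<and> fls_nth (x ^ m) 0 = fls_nth x 0 ^ m"
  by (induction m) (auto simp: integral_closed integral_mult_nth_0 assms)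

lemma integral_powi:
  assumes "x \<in> integral_elts" "fls_nth x 0 \<noteq> 0"
  shows "x powi d \<in> integral_elts" "fls_nth (x powi d) 0 = fls_nth x 0 powi d"
  using integral_power[OF assms(1)] integral_power[OF integral_inverse(1)[OF assms]]
    integral_inverse(2)[OF assms]
  by (auto simp: power_int_def)

inductive lifts :: "nat \<Rightarrow> 'a::field free_alg \<Rightarrow> 'a fls free_alg \<Rightarrow> bool" for n where
  lifts_zero: "lifts n 0 0"
| lifts_step: "a \<in> integral_elts \<Longrightarrow> set (letters w) \<subseteq> {..<n} \<Longrightarrow> lifts n x X \<Longrightarrow>
    lifts n (Poly_Mapping.single w (fls_nth a 0) + x) (Poly_Mapping.single w a + X)"

lemma lifts_add: "lifts n x X \<Longrightarrow> lifts n y Y \<Longrightarrow> lifts n (x + y) (X + Y)"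
  by (induction rule: lifts.induct) (auto simp: add.assoc intro: lifts.intros)

lemma lifts_single: "a \<in> integral_elts \<Longrightarrow> set (letters w) \<subseteq> {..<n} \<Longrightarrow>
    lifts n (Poly_Mapping.single w (fls_nth a 0)) (Poly_Mapping.single w a)"
  using lifts_step[OF _ _ lifts_zero] by fastforce

lemma lifts_mult:
  assumes x: "lifts n x X" and y: "lifts n y Y"
  shows "lifts n (x * y) (X * Y)"
  using x
proof (induction rule: lifts.induct)
  case lifts_zero
  then show ?case by (simp add: lifts.lifts_zero)
next
  case (lifts_step a w x X)
  have "lifts n (Poly_Mapping.single w (fls_nth a 0) * y) (Poly_Mapping.single w a * Y)"
    using y
  proof (induction rule: lifts.induct)
    case lifts_zero
    then show ?case by (simp add: lifts.lifts_zero)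
  next
    case (lifts_step b u y Y)
    have "lifts n (Poly_Mapping.single (w + u) (fls_nth (a * b) 0)) (Poly_Mapping.single (w + u) (a * b))"
      using lifts_step \<open>a \<in> integral_elts\<close> \<open>set (letters w) \<subseteq> {..<n}\<close>
      by (intro lifts_single integral_closed) (auto simp: plus_free_monoid_def)
    then show ?case using lifts_step \<open>a \<in> integral_elts\<close>
      by (simp add: distrib_left mult_single integral_mult_nth_0 lifts_add)
  qed
  then show ?case using lifts_step by (simp add: distrib_right lifts_add)
qed

lemma lifts_const: "a \<in> integral_elts \<Longrightarrow> lifts n (free_const (fls_nth a 0)) (free_const a)"
  unfolding free_const_def by (rule lifts_single) (simp_all add: zero_free_monoid_def)

lemma lifts_one: "lifts n 1 1"
  using lifts_const[of 1 n] by (simp add: free_const_simps integral_closed)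

lemma lifts_uminus: "lifts n x X \<Longrightarrow> lifts n (- x) (- X)"
  using lifts_mult[OF lifts_const[of "- 1" n]] by (fastforce simp: free_const_def integral_closed single_uminus)

lemma lifts_diff: "lifts n x X \<Longrightarrow> lifts n y Y \<Longrightarrow> lifts n (x - y) (X - Y)"
  using lifts_add[OF _ lifts_uminus] by fastforce

lemma lifts_word: "set u \<subseteq> {..<n} \<Longrightarrow> lifts n (free_word u) (free_word u)"
  unfolding free_word_def using lifts_single[of 1 "FM u" n] by (simp add: integral_closed)

lemma lifts_gen: "i < n \<Longrightarrow> lifts n (free_gen i) (free_gen i)"
  using lifts_word[of "[i]" n] by (simp add: free_word_Cons free_word_Nil)

lemma lifts_power: "lifts n x X \<Longrightarrow> lifts n (x ^ c) (X ^ c)"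
  by (induction c) (auto intro: lifts_one lifts_mult)

lemma lifts_prod_list: "(\<And>k. k \<in> set ks \<Longrightarrow> lifts n (x k) (X k)) \<Longrightarrow> lifts n (\<Prod>k\<leftarrow>ks. x k) (\<Prod>k\<leftarrow>ks. X k)"
  by (induction ks) (auto intro: lifts_one lifts_mult)

lemma lifts_carrier: "lifts n x X \<Longrightarrow> x \<in> carrier (free_algebra n) \<and> X \<in> carrier (free_algebra n)"
proof (induction rule: lifts.induct)
  case (lifts_step a w x X)
  then have "Poly_Mapping.single w (fls_nth a 0) \<in> carrier (free_algebra n)"
    "Poly_Mapping.single w a \<in> carrier (free_algebra n)"
    by (auto simp: free_algebra_carrier_iff)
  then show ?case using lifts_step by (simp add: free_algebra_closed(1))
qed (simp add: free_algebra_closed(5))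

lemma lifts_exists: "x \<in> carrier (free_algebra n) \<Longrightarrow> \<exists>X. lifts n x X"
proof (induction x rule: poly_mapping_add_induct)
  case zero
  then show ?case using lifts_zero by blast
next
  case (step x w c)
  note w = free_algebra_single_add[OF step.prems step.hyps]
  obtain X where "lifts n x X" using step.IH w by blast
  then show ?case using lifts_step[of "fls_const c" w n x X] w by (auto simp: integral_closed)
qed

lemma ak_relations_lift:
  assumes r: "r \<in> ak_relations l n q Q" and n: "1 \<le> n"
    and q': "q' \<in> integral_elts" "fls_nth q' 0 = q"
    and Q': "\<And>s. s < l \<Longrightarrow> Q' s \<in> integral_elts \<and> fls_nth (Q' s) 0 = Q s"
  shows "\<exists>R\<in>ak_relations l n q' Q'. lifts n r R"
proof -
  have lift_q: "lifts n (free_const q) (free_const q')" using lifts_const q' by metis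
  have lift_Q: "lifts n (free_const (Q s)) (free_const (Q' s))" if "s < l" for s using lifts_const Q'[OF that]
    by metis
  note lift = lifts_mult lifts_diff lifts_add lifts_gen lifts_one lift_q
  show ?thesis
    using r
  proof (cases rule: ak_relationsE)
    case cyclotomic
    have "lifts n r (\<Prod>s\<leftarrow>[0..<l]. free_gen 0 - free_const (Q' s))"
      unfolding cyclotomic using n by (intro lifts_prod_list lifts_diff lifts_gen lift_Q) auto
    then show ?thesis unfolding ak_relations_def by blast
  next
    case (quadratic i)
    then have "lifts n r ((free_gen i - free_const q') * (free_gen i + 1))" by (auto intro: lift)
    then show ?thesis unfolding ak_relations_def using quadratic by blast
  next
    case braid0
    then have "lifts n r (free_gen 0 * free_gen 1 * free_gen 0 * free_gen 1 -
        free_gen 1 * free_gen 0 * free_gen 1 * free_gen 0)"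
      by (auto intro!: lift)
    then show ?thesis unfolding ak_relations_def using braid0(1) by auto
  next
    case (braid i)
    then have "lifts n r (free_gen i * free_gen (i + 1) * free_gen i -
        free_gen (i + 1) * free_gen i * free_gen (i + 1))"
      by (auto intro!: lift)
    then show ?thesis unfolding ak_relations_def using braid by blast
  next
    case (far_commute i j)
    then have "lifts n r (free_gen i * free_gen j - free_gen j * free_gen i)" by (auto intro!: lift)
    then show ?thesis unfolding ak_relations_def using far_commute by blast
  qed
qed

lemma ak_ideal_lift:
  assumes n: "1 \<le> n" and q': "q' \<in> integral_elts" "fls_nth q' 0 = q"
    and Q': "\<And>s. s < l \<Longrightarrow> Q' s \<in> integral_elts \<and> fls_nth (Q' s) 0 = Q s"
    and x: "x \<in> ak_ideal l n (q :: 'a::field) Q"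
  shows "\<exists>X\<in>ak_ideal l n q' Q'. lifts n x X"
proof -
  let ?N = "{x. \<exists>X\<in>ak_ideal l n q' Q'. lifts n x X}"
  note closed = ak_ideal_closed[OF n, where l=l and q=q' and Q=Q']
  have "ideal ?N (free_algebra n)"
  proof (rule ideal_free_algebraI)
    show "?N \<subseteq> carrier (free_algebra n)" using lifts_carrier by blast
    show "0 \<in> ?N" using closed(1) lifts_zero by blast
    show "x + y \<in> ?N" if "x \<in> ?N" "y \<in> ?N" for x y using that closed(2) lifts_add by blast
    fix x r :: "'a free_alg" assume x: "x \<in> ?N" and r: "r \<in> carrier (free_algebra n)"
    obtain X Y where X: "X \<in> ak_ideal l n q' Q'" "lifts n x X" "lifts n r Y" using x lifts_exists[OF r] by blast
    then show "r * x \<in> ?N" "x * r \<in> ?N" using closed(4,5)[OF X(1), of Y] lifts_carrier lifts_mult by blast+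
  qed
  moreover have "ak_relations l n q Q \<subseteq> ?N"
    using ak_relations_lift[where q=q and Q=Q and l=l, OF _ n q' Q'] closed(7) by blast
  ultimately have "ak_ideal l n q Q \<subseteq> ?N" unfolding ak_ideal_def
    by (intro ring.genideal_minimal[OF ring_free_algebra])
  then show ?thesis using x by blast
qed

definition poly_to_fls :: "'a::field poly \<Rightarrow> 'a fls" where "poly_to_fls p = fps_to_fls (fps_of_poly p)"

lemma poly_to_fls_simps: "poly_to_fls (p + r) = poly_to_fls p + poly_to_fls r"
  "poly_to_fls (p * r) = poly_to_fls p * poly_to_fls r"
  "poly_to_fls 1 = 1" "poly_to_fls 0 = 0" "poly_to_fls (p ^ m) = poly_to_fls p ^ m"
    "poly_to_fls p = poly_to_fls r \<longleftrightarrow> p = r"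
  "poly_to_fls p \<in> integral_elts" "fls_nth (poly_to_fls p) 0 = coeff p 0"
proof -
  show mult: "poly_to_fls (p * r) = poly_to_fls p * poly_to_fls r" for p r :: "'a poly"
    by (simp add: poly_to_fls_def fps_of_poly_mult fls_times_fps_to_fls)
  show one: "poly_to_fls 1 = 1" by (simp add: poly_to_fls_def)
  show "poly_to_fls (p ^ m) = poly_to_fls p ^ m" by (induction m) (simp_all add: mult one)
qed (simp_all add: poly_to_fls_def fps_of_poly_add integral_elts_def)

lemma poly_to_fls_sum: "poly_to_fls (\<Sum>k\<in>S. f k) = (\<Sum>k\<in>S. poly_to_fls (f k))"
  by (induction S rule: infinite_finite_induct) (simp_all add: poly_to_fls_simps)

lemma poly_to_fls_nonzero: "p \<noteq> 0 \<Longrightarrow> poly_to_fls p \<noteq> 0"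
  using poly_to_fls_simps(6)[of p 0] by (simp add: poly_to_fls_simps(4))

lemma separatedI:
  assumes "1 \<le> l" "q \<noteq> 0" "\<And>s. s < l \<Longrightarrow> Q s \<noteq> 0" "\<And>m. 1 \<le> m \<Longrightarrow> m \<le> n \<Longrightarrow> q_int q m \<noteq> 0"
    and powers: "\<And>s t m. s < l \<Longrightarrow> t < l \<Longrightarrow> s \<noteq> t \<Longrightarrow> m < n \<Longrightarrow> q ^ m * Q s \<noteq> Q t"
  shows "separated l n q Q"
proof
  show "q powi d * Q s \<noteq> Q t" if "s < l" "t < l" "s \<noteq> t" "\<bar>d\<bar> < int n" for s t d
  proof (cases "0 \<le> d")
    case True
    then show ?thesis using powers[of s t "nat d"] that by (simp add: power_int_def)
  next
    case False
    have "q ^ nat (- d) * Q t \<noteq> Q s" using powers[of t s "nat (- d)"] that False by simp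
    then show ?thesis using False assms(2) by (auto simp: power_int_def power_inverse field_simps)
  qed
qed (use assms in auto)

definition generic_q :: "'a::field \<Rightarrow> 'a poly" where "generic_q q = [:q, 1:]"

definition generic_Q :: "nat \<Rightarrow> (nat \<Rightarrow> 'a::field) \<Rightarrow> nat \<Rightarrow> 'a poly" where
  "generic_Q n Q s = [:Q s:] + monom 1 (n * Suc s)"

lemma degree_generic_q_power: "degree (generic_q q ^ k) = k"
  by (simp add: generic_q_def degree_power_eq)

lemma degree_generic_Q:
  assumes "1 \<le> n"
  shows "degree (generic_Q n Q s) = n * Suc s" "generic_Q n Q s \<noteq> 0"
proof -
  show degree: "degree (generic_Q n Q s) = n * Suc s"
    unfolding generic_Q_def using assms by (subst degree_add_eq_right) (auto simp: degree_monom_eq)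
  show "generic_Q n Q s \<noteq> 0" using degree assms
    by (metis degree_0 mult_eq_0_iff nat.distinct(1) not_one_le_zero)
qed

lemma q_int_generic_nonzero:
  assumes "1 \<le> m"
  shows "q_int (poly_to_fls (generic_q q)) m \<noteq> 0"
proof -
  have "coeff (generic_q q ^ k) (m - 1) = (if k = m - 1 then 1 else 0)" if "k < m" for k
  proof (cases "k = m - 1")
    case True
    then show ?thesis
      using lead_coeff_power[of "generic_q q" k] degree_generic_q_power[of q k] by (simp add: generic_q_def)
  next
    case False
    then show ?thesis using that degree_generic_q_power[of q k] by (simp add: coeff_eq_0)
  qed
  then have "coeff (\<Sum>k<m. generic_q q ^ k) (m - 1) = (\<Sum>k<m. if k = m - 1 then 1 else 0)"
    unfolding coeff_sum by (intro sum.cong) auto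
  also have "\<dots> = 1" using assms by simp
  finally have "(\<Sum>k<m. generic_q q ^ k) \<noteq> 0" by auto
  then show ?thesis
    unfolding q_int_def poly_to_fls_simps(5)[symmetric] poly_to_fls_sum[symmetric] by (rule poly_to_fls_nonzero)
qed

lemma generic_parameters_distinct:
  assumes n: "1 \<le> n" and "s \<noteq> t" "k < n"
  shows "poly_to_fls (generic_q q) ^ k * poly_to_fls (generic_Q n Q s) \<noteq> poly_to_fls (generic_Q n Q t)"
proof
  assume "poly_to_fls (generic_q q) ^ k * poly_to_fls (generic_Q n Q s) = poly_to_fls (generic_Q n Q t)"
  then have "generic_q q ^ k * generic_Q n Q s = generic_Q n Q t"
    unfolding poly_to_fls_simps(5)[symmetric] poly_to_fls_simps(2)[symmetric] poly_to_fls_simps(6) .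
  moreover have "generic_q q ^ k \<noteq> 0" by (simp add: generic_q_def)
  ultimately have "k + n * Suc s = n * Suc t"
    using degree_generic_Q[OF n] degree_generic_q_power[of q k]
      degree_mult_eq[of "generic_q q ^ k" "generic_Q n Q s"] by metis
  then have "(k + n * Suc s) div n = (n * Suc t) div n" by (rule arg_cong)
  moreover have "(k + n * Suc s) div n = k div n + Suc s" "(n * Suc t) div n = Suc t"
    using n div_mult_self2[of n k "Suc s"] nonzero_mult_div_cancel_left[of n "Suc t"] by linarith+
  ultimately show False using assms by simp
qed

lemma separated_generic:
  assumes "1 \<le> l" "1 \<le> n"
  shows "separated l n (poly_to_fls (generic_q q)) (\<lambda>s. poly_to_fls (generic_Q n Q s))"
proof (rule separatedI)
  show "poly_to_fls (generic_q q) \<noteq> 0" by (rule poly_to_fls_nonzero) (simp add: generic_q_def)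
  show "poly_to_fls (generic_Q n Q s) \<noteq> 0" for s by (intro poly_to_fls_nonzero degree_generic_Q assms)
  show "poly_to_fls (generic_q q) ^ m * poly_to_fls (generic_Q n Q s) \<noteq> poly_to_fls (generic_Q n Q t)"
    if "s \<noteq> t" "m < n" for s t m by (rule generic_parameters_distinct[OF assms(2) that])
qed (use assms q_int_generic_nonzero in auto)

definition constant_term_form :: "('a::field fls free_alg \<Rightarrow> 'a fls) \<Rightarrow> 'a free_alg \<Rightarrow> 'a" where
  "constant_term_form \<phi> = lin_ext (\<lambda>u. fls_nth (\<phi> (free_word u)) 0)"

lemma constant_term_form_lifts:
  assumes add: "\<And>x y. \<phi> (x + y) = \<phi> x + \<phi> y" and scale: "\<And>c x. \<phi> (free_const c * x) = c * \<phi> x"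
    and words: "\<And>u. set u \<subseteq> {..<n} \<Longrightarrow> \<phi> (free_word u) \<in> integral_elts"
    and "lifts n x X"
  shows "\<phi> X \<in> integral_elts \<and> fls_nth (\<phi> X) 0 = constant_term_form \<phi> x"
  using \<open>lifts n x X\<close>
proof (induction rule: lifts.induct)
  case lifts_zero
  have "\<phi> 0 = 0" using scale[of 0 0] by simp
  then show ?case by (simp add: integral_closed constant_term_form_def lin_ext_zero)
next
  case (lifts_step a w x X)
  show ?case unfolding single_eq_const_word[of w a] add scale
    using lifts_step words by (simp add: integral_closed integral_mult_nth_0 constant_term_form_def lin_ext_add
      lin_ext_single)
qed

lemma lifts_free_normal_monomial:
  assumes q': "q' \<in> integral_elts" "fls_nth q' 0 = q" "q \<noteq> 0" and j: "is_code n j"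
  shows "lifts n (free_normal_monomial q n c j) (free_normal_monomial q' n c j)"
proof -
  have "lifts n (free_L q k) (free_L q' k)" if "k \<in> set [1..<n + 1]" for k
  proof -
    have "lifts n (free_const (fls_nth (q' powi (1 - int k)) 0)) (free_const (q' powi (1 - int k)))"
      using integral_powi(1)[of q' "1 - int k"] q' by (intro lifts_const) simp
    then have "lifts n (free_const (q powi (1 - int k))) (free_const (q' powi (1 - int k)))"
      using integral_powi(2)[of q' "1 - int k"] q' by simp
    then show ?thesis unfolding free_L_def using that by (intro lifts_mult lifts_word) auto
  qed
  moreover have "set (normal_word j n) \<subseteq> {..<n}" using set_normal_word[OF j] by auto
  ultimately show ?thesis
    unfolding free_normal_monomial_def free_L_monomial_def
    by (intro lifts_mult lifts_prod_list lifts_power lifts_word)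
qed

theorem (in ak_params) canonical_form_exists: "\<exists>f. linear_mod f \<and> canonical_values l n q f"
proof -
  define q' where "q' = poly_to_fls (generic_q q)"
  define Q' where "Q' = (\<lambda>s. poly_to_fls (generic_Q n Q s))"
  interpret K: separated l n q' Q' unfolding q'_def Q'_def using l_pos n_pos by (rule separated_generic)
  interpret KP: ak_params l n q' Q' by (rule K.separated_ak_params[OF n_pos])
  have q': "q' \<in> integral_elts" "fls_nth q' 0 = q"
    by (simp_all add: q'_def generic_q_def poly_to_fls_simps)
  have Q': "Q' s \<in> integral_elts \<and> fls_nth (Q' s) 0 = Q s" for s
    using n_pos unfolding Q'_def by (simp add: poly_to_fls_simps(7,8) generic_Q_def)
  have linear: "KP.linear_mod (K.path_trace n)" by (rule K.linear_mod_path_trace[OF n_pos])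
  have canonical: "canonical_values l n q' (K.path_trace n)"
    by (rule K.path_trace_canonical_values[OF order_refl])
  have integral: "K.path_trace n (free_word u) \<in> integral_elts" if "set u \<subseteq> {..<n}" for u
    by (rule KP.linear_mod_word_values[OF linear _ _ _ unital_subring_integral_elts])
       (use that q' Q' canonical in \<open>auto simp: integral_closed canonical_values_def\<close>)
  let ?f = "constant_term_form (K.path_trace n)"
  have lifted: "K.path_trace n X \<in> integral_elts \<and> fls_nth (K.path_trace n X) 0 = ?f x" if "lifts n x X" for x X
    by (rule constant_term_form_lifts[OF K.path_trace_add K.path_trace_scale integral that])
  have "linear_mod ?f" unfolding linear_mod_def
  proof (intro conjI ballI allI)
    fix x assume "x \<in> I"
    then obtain X where "X \<in> ak_ideal l n q' Q'" "lifts n x X"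
      using ak_ideal_lift[where q=q and Q=Q and l=l, OF n_pos q' Q'] by blast
    then show "?f x = 0" using lifted KP.linear_modD(3)[OF linear] by fastforce
  qed (simp_all add: constant_term_form_def lin_ext_add lin_ext_scale)
  moreover have "canonical_values l n q ?f" unfolding canonical_values_def
  proof (intro allI impI)
    fix c :: "nat \<Rightarrow> nat" and j assume c: "\<forall>k\<in>{1..n}. c k < l" and j: "is_code n j"
    show "?f (free_normal_monomial q n c j) = (if (\<forall>k\<in>{1..n}. c k = 0) \<and> normal_word j n = [] then 1 else 0)"
      using lifted[OF lifts_free_normal_monomial[OF q' q_nonzero j, of c]]
      unfolding canonical_valuesD[OF canonical c j]
      by (auto split: if_splits)
  qed
  ultimately show ?thesis by blast
qed
section \<open>Semisimplicity and the symmetrizing form\<close>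

context ak_params
begin

abbreviation "H_alg \<equiv> ak_algebra l n q Q"

definition coset :: "'k free_alg \<Rightarrow> 'k free_alg set" where
  "coset x = I +>\<^bsub>free_algebra n\<^esub> x"

lemma
  shows coset_carrier: "carrier H_alg = coset ` C"
    and coset_mult: "x \<in> C \<Longrightarrow> y \<in> C \<Longrightarrow> coset x \<otimes>\<^bsub>H_alg\<^esub> coset y = coset (x * y)"
    and coset_add: "x \<in> C \<Longrightarrow> y \<in> C \<Longrightarrow> coset x \<oplus>\<^bsub>H_alg\<^esub> coset y = coset (x + y)"
    and coset_one: "\<one>\<^bsub>H_alg\<^esub> = coset 1" and coset_zero: "\<zero>\<^bsub>H_alg\<^esub> = coset 0"
    and coset_eq: "x \<in> C \<Longrightarrow> y \<in> C \<Longrightarrow> coset x = coset y \<longleftrightarrow> x - y \<in> I"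
proof -
  interpret J: ideal I "free_algebra n" by (rule ideal_ak_ideal[OF n_pos])
  have hom: "coset \<in> ring_hom (free_algebra n) H_alg"
    using J.rcos_ring_hom unfolding ak_algebra_def coset_def[abs_def] .
  show "carrier H_alg = coset ` C"
    unfolding ak_algebra_def FactRing_def A_RCOSETS_def' coset_def[abs_def] by auto
  show "x \<in> C \<Longrightarrow> y \<in> C \<Longrightarrow> coset x \<otimes>\<^bsub>H_alg\<^esub> coset y = coset (x * y)"
    using ring_hom_mult[OF hom] by (simp add: free_algebra_simps)
  show "x \<in> C \<Longrightarrow> y \<in> C \<Longrightarrow> coset x \<oplus>\<^bsub>H_alg\<^esub> coset y = coset (x + y)"
    using ring_hom_add[OF hom] by (simp add: free_algebra_simps)
  show "\<one>\<^bsub>H_alg\<^esub> = coset 1" using ring_hom_one[OF hom] by (simp add: free_algebra_simps)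
  have "coset 0 = I" using J.a_rcos_const[OF ak_ideal_simps(1)] by (simp add: coset_def)
  then show "\<zero>\<^bsub>H_alg\<^esub> = coset 0" by (simp add: ak_algebra_def FactRing_def)
  show "coset x = coset y \<longleftrightarrow> x - y \<in> I" if "x \<in> C" "y \<in> C"
  proof -
    have "\<ominus>\<^bsub>free_algebra n\<^esub> y = - y"
      using that by (intro J.minus_equality) (auto simp: free_algebra_simps free_algebra_closed)
    then have "x \<ominus>\<^bsub>free_algebra n\<^esub> y = x - y" by (simp add: a_minus_def free_algebra_simps)
    then show ?thesis using J.quotient_eq_iff_same_a_r_cos[OF J.ideal_axioms that] by (simp add: coset_def)
  qed
qed

lemma regular_module_ops:
  "carrier (regular_module H_alg) = coset ` C" "add (regular_module H_alg) = add H_alg"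
  "zero (regular_module H_alg) = coset 0" "Module.smult (regular_module H_alg) = mult H_alg"
  using coset_carrier coset_zero by (simp_all add: regular_module_def)

lemma submodule_principal:
  assumes y: "y \<in> C"
  shows "submodule {coset (x * y) | x. x \<in> C} H_alg (regular_module H_alg)"
proof (intro submodule.intro submodule_axioms.intro)
  let ?M = "regular_module H_alg" and ?N = "{coset (x * y) | x. x \<in> C}"
  note ops = regular_module_ops and closed = free_algebra_closed
  interpret A: ring H_alg by (rule ring_ak_algebra[OF n_pos])
  interpret M: left_module H_alg ?M by (rule A.left_module_regular)
  show "subgroup ?N (add_monoid ?M)"
  proof (rule M.M.add.subgroupI)
    show "?N \<subseteq> carrier ?M" unfolding ops using y by (auto intro: closed)
    show "?N \<noteq> {}" using closed(5) by blast
    fix a assume "a \<in> ?N"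
    then obtain x where x: "x \<in> C" "a = coset (x * y)" by blast
    have carriers: "x * y \<in> C" "- x * y \<in> C" using x y by (intro closed; simp)+
    have "coset (- x * y) \<oplus>\<^bsub>?M\<^esub> coset (x * y) = \<zero>\<^bsub>?M\<^esub>"
      unfolding ops coset_add[OF carriers(2,1)] by (simp add: distrib_right[symmetric])
    then have "\<ominus>\<^bsub>?M\<^esub> a = coset (- x * y)"
      using carriers unfolding x(2) by (intro M.M.minus_equality) (auto simp: ops)
    moreover have "coset (- x * y) \<in> ?N" using x closed(4) by blast
    ultimately show "\<ominus>\<^bsub>?M\<^esub> a \<in> ?N" by simp
    fix b assume "b \<in> ?N"
    then obtain z where z: "z \<in> C" "b = coset (z * y)" by blast
    have "a \<oplus>\<^bsub>?M\<^esub> b = coset ((x + z) * y)"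
      using x z y by (simp add: ops coset_add closed distrib_right)
    then show "a \<oplus>\<^bsub>?M\<^esub> b \<in> ?N" using x z closed(1) by blast
  qed
  fix a b assume "a \<in> carrier H_alg" "b \<in> ?N"
  then obtain x z where xz: "x \<in> C" "a = coset x" "z \<in> C" "b = coset (z * y)" using coset_carrier by auto
  have "a \<odot>\<^bsub>?M\<^esub> b = coset ((x * z) * y)" using xz y by (simp add: ops coset_mult closed mult.assoc)
  then show "a \<odot>\<^bsub>?M\<^esub> b \<in> ?N" using xz closed(3) by blast
qed

lemma semisimple_square_notin:
  assumes semisimple: "semisimple_module H_alg (regular_module H_alg)"
    and y: "y \<in> C" "y \<notin> I" and eigenvector: "\<And>x. x \<in> C \<Longrightarrow> \<exists>c. y * x - free_const c * y \<in> I"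
  shows "y * y \<notin> I"
proof
  assume square: "y * y \<in> I"
  let ?M = "regular_module H_alg" and ?N = "{coset (x * y) | x. x \<in> C}"
  note ops = regular_module_ops and closed = free_algebra_closed
  obtain N' where N': "submodule N' H_alg ?M" "?N \<inter> N' = {\<zero>\<^bsub>?M\<^esub>}" "?N <+>\<^bsub>?M\<^esub> N' = carrier ?M"
    using semisimple submodule_principal[OF y(1)] unfolding semisimple_module_def by blast
  have "coset 1 \<in> ?N <+>\<^bsub>?M\<^esub> N'" unfolding N'(3) ops using closed(6) by blast
  then obtain x e where x: "x \<in> C" and e: "e \<in> N'" and one: "coset 1 = coset (x * y) \<oplus>\<^bsub>?M\<^esub> e"
    unfolding set_add_def' by auto
  have "N' \<subseteq> carrier ?M" using subgroup.subset[OF submodule.axioms(1)[OF N'(1)]] by simp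
  then obtain z where z: "z \<in> C" "e = coset z" using e ops(1) by auto
  have "1 - (x * y + z) \<in> I"
    using one coset_eq[OF closed(6), of "x * y + z"] x y z by (simp add: ops coset_add closed)
  then have decomposition: "y * (1 - (x * y + z)) \<in> I" using ak_ideal_simps(4) y by blast
  obtain c where c: "y * x - free_const c * y \<in> I" using eigenvector[OF x] by blast
  have "(y * x - free_const c * y) * y + free_const c * (y * y) \<in> I"
    using ak_ideal_simps(2) ak_ideal_simps(5)[OF c y(1)] ak_ideal_simps(4)[OF square closed(7)] by blast
  then have "y * x * y \<in> I" by (simp add: algebra_simps)
  with decomposition have "y * (1 - (x * y + z)) + y * x * y \<in> I" by (rule ak_ideal_simps(2))
  then have "y - y * z \<in> I" by (simp add: algebra_simps)
  then have "coset y = coset (y * z)" using y z by (subst coset_eq) (auto intro: closed)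
  also have "\<dots> = coset y \<odot>\<^bsub>?M\<^esub> e" using y z by (simp add: ops coset_mult)
  also have "\<dots> \<in> N'" using submodule.smult_closed[OF N'(1) _ e] y coset_carrier by blast
  finally have "coset y \<in> N'" .
  moreover have "coset y = coset (1 * y)" by simp
  then have "coset y \<in> ?N" using closed(6) by blast
  ultimately have "coset y = coset 0" using N'(2) ops(3) by blast
  then show False using coset_eq[OF y(1) closed(5)] y(2) by simp
qed

lemma eigenvector_of_words:
  assumes y: "y \<in> C" and words: "\<And>u. set u \<subseteq> {..<n} \<Longrightarrow> y * free_word u - free_const (\<chi> u) * y \<in> I" and x: "x \<in> C"
  shows "\<exists>c. y * x - free_const c * y \<in> I"
  using x
proof (induction x rule: poly_mapping_add_induct)
  case zero
  then show ?case using ak_ideal_simps(1) by (intro exI[of _ 0]) (simp add: free_const_simps)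
next
  case (step x w c)
  note w = free_algebra_single_add[OF step.prems step.hyps]
  obtain d where d: "y * x - free_const d * y \<in> I" using step.IH w by blast
  have single: "Poly_Mapping.single w c = free_word (letters w) * free_const c"
    unfolding single_eq_const_word by (rule free_const_central)
  have "(y * free_word (letters w) - free_const (\<chi> (letters w)) * y) * free_const c \<in> I"
    by (intro ak_ideal_simps(5) words[OF w(1)] free_algebra_closed)
  from ak_ideal_simps(2)[OF this d]
  have "y * (Poly_Mapping.single w c + x) - free_const (\<chi> (letters w) * c + d) * y \<in> I"
    unfolding single free_const_simps using free_const_central[of c y] by (simp add: algebra_simps)
  then show ?case by blast
qed

lemma char_square_nonzero:
  assumes semisimple: "semisimple_module H_alg (regular_module H_alg)" and Q0: "\<And>s. s < l \<Longrightarrow> Q s \<noteq> 0"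
    and s: "s < l"
  shows "H.char_square s \<noteq> 0"
proof
  assume zero: "H.char_square s = 0"
  obtain f where f: "linear_mod f" "canonical_values l n q f" using canonical_form_exists by blast
  obtain y where y: "y \<in> C" "f y = (\<Prod>t\<leftarrow>H.other_indices s. - Q t) ^ n"
    "\<And>u. set u \<subseteq> {..<n} \<Longrightarrow> y * free_word u - free_const (H.linear_char s u) * y \<in> I"
    "y * y - free_const (H.char_square s) * y \<in> I"
    using char_element_representative[OF f s] by blast
  have "0 \<notin> set (map (\<lambda>t. - Q t) (H.other_indices s))" using Q0 s by (auto simp: H.other_indices_def)
  then have "f y \<noteq> 0" unfolding y(2) by (simp add: prod_list_zero_iff)
  then have "y \<notin> I" using linear_modD(3)[OF f(1)] by blast
  moreover have "\<exists>c. y * x - free_const c * y \<in> I" if "x \<in> C" for x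
    by (rule eigenvector_of_words[OF y(1) y(3) that])
  ultimately have "y * y \<notin> I" by (rule semisimple_square_notin[OF semisimple y(1)])
  then show False using y(4) unfolding zero by (simp add: free_const_simps)
qed

lemma prod_list_nonzeroD: "(\<Prod>k\<leftarrow>ks. g k) \<noteq> 0 \<Longrightarrow> k \<in> set ks \<Longrightarrow> g k \<noteq> 0" for g :: "'b \<Rightarrow> 'k"
  by (auto simp: prod_list_zero_iff)

theorem separated_of_semisimple:
  assumes semisimple: "semisimple_module H_alg (regular_module H_alg)" and Q0: "\<And>s. s < l \<Longrightarrow> Q s \<noteq> 0"
  shows "separated l n q Q"
proof (rule separatedI)
  note nonzero = char_square_nonzero[OF semisimple Q0, unfolded H.char_square_def]
  show "1 \<le> l" "q \<noteq> 0" by (rule l_pos, rule q_nonzero)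
  show "q_int q m \<noteq> 0" if "1 \<le> m" "m \<le> n" for m using nonzero[of 0] l_pos that by simp
  show "q ^ m * Q s \<noteq> Q t" if "s < l" "t < l" "s \<noteq> t" "m < n" for s t m
  proof -
    have "(\<Prod>k\<leftarrow>[1..<n + 1]. \<Prod>t\<leftarrow>H.other_indices s. q ^ (k - 1) * Q s - Q t) \<noteq> 0"
      using nonzero[OF _ that(1)] by simp
    then have "(\<Prod>t\<leftarrow>H.other_indices s. q ^ (Suc m - 1) * Q s - Q t) \<noteq> 0"
      by (rule prod_list_nonzeroD) (use that in auto)
    then have "q ^ (Suc m - 1) * Q s - Q t \<noteq> 0"
      by (rule prod_list_nonzeroD) (use that in \<open>auto simp: H.other_indices_def\<close>)
    then show ?thesis by simp
  qed
qed (rule Q0)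

lemma coset_word:
  assumes "set u \<subseteq> {..<n}"
  shows "ak_word l n q Q u = coset (free_word u)"
  using assms
proof (induction u)
  case Nil
  then show ?case by (simp add: ak_word_def free_word_Nil coset_one)
next
  case (Cons i u)
  have "ak_word l n q Q (i # u) = coset (free_gen i) \<otimes>\<^bsub>H_alg\<^esub> coset (free_word u)"
    using Cons by (simp add: ak_word_def ak_gen_def coset_def)
  also have "\<dots> = coset (free_gen i * free_word u)"
    using Cons.prems by (intro coset_mult free_algebra_closed free_word_carrier) auto
  finally show ?case by (simp add: free_word_Cons)
qed

lemma coset_pow: "x \<in> C \<Longrightarrow> coset x [^]\<^bsub>H_alg\<^esub> (c::nat) = coset (x ^ c)"
proof (induction c)
  case (Suc c)
  then show ?case using coset_mult[of "x ^ c" x] by (simp add: free_algebra_power power_Suc2 del: power_Suc)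
qed (simp add: coset_one nat_pow_def)

lemma coset_L:
  assumes "1 \<le> k" "k \<le> n"
  shows "ak_L l n q Q k = coset (free_L q k)"
proof -
  have letters: "set (rev [1..<k] @ [0] @ [1..<k]) \<subseteq> {..<n}" using assms by auto
  have "ak_L l n q Q k = coset (free_const (q powi (1 -
      int k))) \<otimes>\<^bsub>H_alg\<^esub> coset (free_word (rev [1..<k] @ [0] @ [1..<k]))"
    unfolding ak_L_def coset_word[OF letters] by (simp add: ak_scalar_def coset_def)
  then show ?thesis
    unfolding free_L_def using coset_mult[OF free_algebra_closed(7) free_word_carrier[OF letters]] by simp
qed

lemma coset_L_powers:
  fixes c :: "nat \<Rightarrow> nat"
  assumes "set ks \<subseteq> {1..n}" "z \<in> C"
  shows "foldr (\<lambda>k X. ak_L l n q Q k [^]\<^bsub>H_alg\<^esub> c k \<otimes>\<^bsub>H_alg\<^esub> X) ks (coset z) =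
      coset ((\<Prod>k\<leftarrow>ks. free_L q k ^ c k) * z)"
  using assms(1)
proof (induction ks)
  case (Cons k ks)
  have power: "free_L q k ^ c k \<in> C" using Cons.prems by (intro free_algebra_power free_L_carrier) auto
  have tail: "(\<Prod>k\<leftarrow>ks. free_L q k ^ c k) * z \<in> C"
    using Cons.prems assms(2) by (intro free_algebra_closed free_algebra_prod_list free_algebra_power
      free_L_carrier) auto
  have "ak_L l n q Q k [^]\<^bsub>H_alg\<^esub> c k = coset (free_L q k ^ c k)"
    using Cons.prems coset_L[of k] coset_pow[OF free_L_carrier[of k n q]] by simp
  then show ?case using Cons coset_mult[OF power tail] by (simp add: mult.assoc)
qed simp

lemma coset_basis:
  assumes "w permutes {1..n}"
  shows "\<exists>j. is_code n j \<and> word_perm (normal_word j n) = w \<and>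
      (\<forall>c. ak_basis l n q Q c w = coset (free_normal_monomial q n c j))"
proof -
  define u where "u = (SOME u. reduced_expr n w u)"
  have reduced: "reduced_expr n w u" unfolding u_def by (rule someI_ex[OF reduced_expr_exists[OF assms]])
  then obtain j where j: "is_code n j" "word_perm (normal_word j n) = w"
    "free_word u - free_word (normal_word j n) \<in> I"
    using reduced_expr_normal_word by blast
  have u: "set u \<subseteq> {..<n}" using reduced by (auto simp: reduced_expr_def)
  have "ak_basis l n q Q c w = coset (free_normal_monomial q n c j)" for c
  proof -
    note L_carrier = free_L_monomial_carrier[OF order_refl, of q n c]
    have T_w: "ak_T l n q Q w = coset (free_word u)" using coset_word[OF u] by (simp add: ak_T_def u_def)
    have "ak_basis l n q Q c w = coset (free_L_monomial q n c * free_word u)"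
      unfolding ak_basis_def free_L_monomial_def T_w using free_word_carrier[OF u]
      by (intro coset_L_powers) auto
    moreover have "free_L_monomial q n c * (free_word u - free_word (normal_word j n)) \<in> I"
      using j(3) L_carrier by (rule ak_ideal_simps(4))
    then have "coset (free_L_monomial q n c * free_word u) = coset (free_normal_monomial q n c j)"
      unfolding free_normal_monomial_def
      using L_carrier free_word_carrier[OF u] free_normal_word_carrier[OF j(1)]
      by (subst coset_eq) (auto simp: right_diff_distrib intro: free_algebra_closed)
    ultimately show ?thesis by simp
  qed
  then show ?thesis using j by blast
qed

lemma word_perm_normal_word_eq_id_iff: "is_code n j \<Longrightarrow> word_perm (normal_word j n) = id \<longleftrightarrow> normal_word j n = []"
  using normal_word_inj[OF _ normal_word_id(2), of n j] by (auto simp: normal_word_id word_perm_def)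

lemma basis_values_iff_canonical_values:
  "(\<forall>c \<in> {1..n} \<rightarrow> {..<l}. \<forall>w. w permutes {1..n} \<longrightarrow>
      f (ak_basis l n q Q c w) = (if (\<forall>k\<in>{1..n}. c k = 0) \<and> w = id then 1 else 0)) \<longleftrightarrow>
    canonical_values l n q (\<lambda>x. f (coset x))" (is "?basis \<longleftrightarrow> _")
proof
  assume basis: ?basis
  show "canonical_values l n q (\<lambda>x. f (coset x))" unfolding canonical_values_def
  proof (intro allI impI)
    fix c :: "nat \<Rightarrow> nat" and j assume c: "\<forall>k\<in>{1..n}. c k < l" and j: "is_code n j"
    have w: "word_perm (normal_word j n) permutes {1..n}" using word_perm_permutes[OF set_normal_word[OF j]] .
    then obtain j' where j': "is_code n j'" "word_perm (normal_word j' n) = word_perm (normal_word j n)"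
      "\<And>c. ak_basis l n q Q c (word_perm (normal_word j n)) = coset (free_normal_monomial q n c j')"
      using coset_basis by blast
    have "free_normal_monomial q n c j' = free_normal_monomial q n c j"
      using normal_word_inj[OF j'(1) j j'(2)] by (simp add: free_normal_monomial_def)
    moreover have "f (ak_basis l n q Q c (word_perm (normal_word j n))) =
        (if (\<forall>k\<in>{1..n}. c k = 0) \<and> word_perm (normal_word j n) = id then 1 else 0)"
      using basis c w by auto
    ultimately show "f (coset (free_normal_monomial q n c j)) =
        (if (\<forall>k\<in>{1..n}. c k = 0) \<and> normal_word j n = [] then 1 else 0)"
      using j'(3) word_perm_normal_word_eq_id_iff[OF j] by simp
  qed
next
  assume canonical: "canonical_values l n q (\<lambda>x. f (coset x))"
  show ?basis
  proof (intro ballI allI impI)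
    fix c :: "nat \<Rightarrow> nat" and w assume c: "c \<in> {1..n} \<rightarrow> {..<l}" and w: "w permutes {1..n}"
    obtain j where j: "is_code n j" "word_perm (normal_word j n) = w"
      "\<And>c. ak_basis l n q Q c w = coset (free_normal_monomial q n c j)"
      using coset_basis[OF w] by blast
    have "\<forall>k\<in>{1..n}. c k < l" using c by auto
    then show "f (ak_basis l n q Q c w) = (if (\<forall>k\<in>{1..n}. c k = 0) \<and> w = id then 1 else 0)"
      using canonical j word_perm_normal_word_eq_id_iff[OF j(1)] unfolding canonical_values_def by simp
  qed
qed

definition quotient_form :: "('k free_alg \<Rightarrow> 'k) \<Rightarrow> 'k free_alg set \<Rightarrow> 'k" where
  "quotient_form g = restrict (\<lambda>X. g (SOME x. x \<in> C \<and> coset x = X)) (carrier H_alg)"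

lemma quotient_form_coset:
  assumes g: "linear_mod g" and x: "x \<in> C"
  shows "quotient_form g (coset x) = g x"
proof -
  let ?z = "SOME z. z \<in> C \<and> coset z = coset x"
  have z: "?z \<in> C \<and> coset ?z = coset x" using x by (intro someI_ex[of "\<lambda>z. z \<in> C \<and> coset z = coset x"]) blast
  then have "?z - x \<in> I" using coset_eq x by blast
  then have "g ?z = g x" using linear_modD(5)[OF g] z x by blast
  then show ?thesis using x coset_carrier by (simp add: quotient_form_def)
qed

lemma coset_scalar: "ak_scalar l n q Q c = coset (free_const c)" by (simp add: ak_scalar_def coset_def)

lemma ak_linear_form_quotient_form:
  assumes "linear_mod g"
  shows "ak_linear_form l n q Q (quotient_form g)"
  unfolding ak_linear_form_def coset_carrier coset_scalar
  using linear_modD(1,2)[OF assms] quotient_form_coset[OF assms]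
  by (auto simp: coset_add coset_mult free_algebra_closed)

lemma linear_mod_ak_linear_form:
  assumes f: "ak_linear_form l n q Q f"
  shows "linear_mod (\<lambda>x. f (coset x))"
  unfolding linear_mod_def
proof (intro conjI ballI allI)
  show "f (coset (x + y)) = f (coset x) + f (coset y)" if "x \<in> C" "y \<in> C" for x y
    using f that unfolding ak_linear_form_def coset_carrier by (simp add: coset_add[symmetric])
  show scale: "f (coset (free_const c * x)) = c * f (coset x)" if "x \<in> C" for c x
    using f that unfolding ak_linear_form_def coset_carrier coset_scalar
    by (simp add: coset_mult[symmetric] free_algebra_closed)
  fix x assume "x \<in> I"
  then have "coset x = coset (free_const 0 * 0)"
    using coset_eq[OF _ free_algebra_closed(5), of x] ak_ideal_simps(6) by auto
  then show "f (coset x) = 0" using scale[of 0 0] by (simp add: free_algebra_closed)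
qed

theorem ak_tau_eq:
  assumes g: "linear_mod g" "canonical_values l n q g" and x: "x \<in> C"
  shows "ak_tau l n q Q (coset x) = g x"
proof -
  have canonical: "canonical_values l n q (\<lambda>x. quotient_form g (coset x))"
    using g(2) quotient_form_coset[OF g(1) free_normal_monomial_carrier] by (simp add: canonical_values_def)
  have "ak_tau l n q Q = quotient_form g"
    unfolding ak_tau_def basis_values_iff_canonical_values
  proof (rule the_equality)
    show "quotient_form g \<in> extensional (carrier H_alg) \<and> ak_linear_form l n q Q (quotient_form g) \<and>
        canonical_values l n q (\<lambda>x. quotient_form g (coset x))"
      using canonical ak_linear_form_quotient_form[OF g(1)] by (simp add: quotient_form_def)
    fix f assume f: "f \<in> extensional (carrier H_alg) \<and> ak_linear_form l n q Q f \<and>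
        canonical_values l n q (\<lambda>x. f (coset x))"
    then have linear_f: "linear_mod (\<lambda>x. f (coset x))"
      and canonical_f: "canonical_values l n q (\<lambda>x. f (coset x))"
      using linear_mod_ak_linear_form by auto
    have "f (coset x) = g x" if "x \<in> C" for x
    proof (rule linear_mod_unique[OF linear_f g(1) _ that])
      show "f (coset (free_normal_monomial q n c j)) = g (free_normal_monomial q n c j)"
        if "\<forall>k\<in>{1..n}. c k < l" "is_code n j" for c j
        unfolding canonical_valuesD[OF canonical_f that] canonical_valuesD[OF g(2) that] ..
    qed
    then have "f X = quotient_form g X" if "X \<in> carrier H_alg" for X
      using that quotient_form_coset[OF g(1)] coset_carrier by auto
    then show "f = quotient_form g"
      using f by (intro extensionalityI[of _ "carrier H_alg"]) (auto simp: quotient_form_def)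
  qed
  then show ?thesis using quotient_form_coset[OF g(1) x] by simp
qed

end

section \<open>Independence of the characters\<close>

context separated
begin

definition diagonal :: "(node list \<Rightarrow> 'k) \<Rightarrow> bool" where
  "diagonal d \<longleftrightarrow> (\<exists>x\<in>carrier (free_algebra n). \<forall>r\<in>paths l n. \<forall>v. rep F x v r = d r * v r)"

lemma diagonal_const: "diagonal (\<lambda>r. c)"
  unfolding diagonal_def using free_algebra_closed(7)
  by (intro bexI[of _ "free_const c"]) (auto simp: rep_const)

lemma diagonal_add:
  assumes "diagonal d" "diagonal e"
  shows "diagonal (\<lambda>r. d r + e r)"
proof -
  obtain x y where "x \<in> carrier (free_algebra n)" "\<forall>r\<in>paths l n. \<forall>v. rep F x v r = d r * v r"
    "y \<in> carrier (free_algebra n)" "\<forall>r\<in>paths l n. \<forall>v. rep F y v r = e r * v r"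
    using assms unfolding diagonal_def by blast
  then show ?thesis unfolding diagonal_def
    by (intro bexI[of _ "x + y"]) (auto simp: rep_add distrib_right intro: free_algebra_closed)
qed

lemma diagonal_mult:
  assumes "diagonal d" "diagonal e"
  shows "diagonal (\<lambda>r. d r * e r)"
proof -
  obtain x y where "x \<in> carrier (free_algebra n)" "\<forall>r\<in>paths l n. \<forall>v. rep F x v r = d r * v r"
    "y \<in> carrier (free_algebra n)" "\<forall>r\<in>paths l n. \<forall>v. rep F y v r = e r * v r"
    using assms unfolding diagonal_def by blast
  then show ?thesis unfolding diagonal_def
    by (intro bexI[of _ "x * y"]) (auto simp: rep_mult[OF linear_path_op] mult.assoc intro: free_algebra_closed)
qed

lemma diagonal_sum: "(\<And>i. i \<in> X \<Longrightarrow> diagonal (d i)) \<Longrightarrow> diagonal (\<lambda>r. \<Sum>i\<in>X. d i r)"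
  by (induction X rule: infinite_finite_induct) (auto intro: diagonal_const diagonal_add)

lemma diagonal_prod: "(\<And>i. i \<in> X \<Longrightarrow> diagonal (d i)) \<Longrightarrow> diagonal (\<lambda>r. \<Prod>i\<in>X. d i r)"
  by (induction X rule: infinite_finite_induct) (auto intro: diagonal_const diagonal_mult)

lemma diagonal_cong: "diagonal d \<Longrightarrow> (\<And>r. r \<in> paths l n \<Longrightarrow> d r = e r) \<Longrightarrow> diagonal e"
  unfolding diagonal_def by simp

lemma diagonal_affine:
  assumes "diagonal d"
  shows "diagonal (\<lambda>r. (d r - c) / b)"
proof -
  have "diagonal (\<lambda>r. (d r + (- c)) * (1 / b))" by (intro diagonal_mult diagonal_add diagonal_const assms)
  then show ?thesis by simp
qed

lemma diagonal_residue:
  assumes "1 \<le> k" "k \<le> n"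
  shows "diagonal (\<lambda>r. res (r ! (k - 1)))"
  unfolding diagonal_def using path_rep_L[OF order_refl _ assms] free_L_carrier[OF assms] by blast

lemma diagonal_indicator:
  assumes "diagonal d"
  shows "diagonal (\<lambda>r. if d r = c then 1 else 0)"
proof (rule diagonal_cong)
  let ?S = "d ` paths l n - {c}"
  show "diagonal (\<lambda>r. \<Prod>c'\<in>?S. (d r - c') / (c - c'))" by (intro diagonal_prod diagonal_affine assms)
  fix r assume r: "r \<in> paths l n"
  show "(\<Prod>c'\<in>?S. (d r - c') / (c - c')) = (if d r = c then 1 else 0)"
  proof (cases "d r = c")
    case True
    then show ?thesis by (simp, intro prod.neutral ballI) auto
  next
    case False
    then have "d r \<in> ?S" using r by simp
    then show ?thesis using False finite_paths by (auto intro!: prod_zero)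
  qed
qed

lemma path_component_less:
  assumes "r \<in> paths l n" "m < n"
  shows "fst (r ! m) < l"
proof -
  have "addable l (set (take m r)) (r ! m)" using assms path_iff_addable[of l r] by (simp add: paths_def)
  then show ?thesis by (cases "r ! m") (simp add: addable_def)
qed

lemma diagonal_same_component:
  assumes q: "q = 1" and k: "Suc k < n"
  shows "diagonal (\<lambda>r. if fst (r ! k) = fst (r ! Suc k) then 1 else 0)"
proof (rule diagonal_cong)
  let ?d = "\<lambda>m r. res (r ! m)"
  have residue: "res x = Q (fst x)" for x by (simp add: residue_def q)
  have Q_eq_iff: "Q s = Q t \<longleftrightarrow> s = t" if "s < l" "t < l" for s t
    using Q_separated[OF that, of 0] k by auto
  have "diagonal (?d m)" if "m < n" for m using diagonal_residue[of "Suc m"] that by simp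
  then show "diagonal (\<lambda>r. \<Sum>s<l. (if ?d k r = Q s then 1 else 0) * (if ?d (Suc k) r = Q s then 1 else 0))"
    using k by (intro diagonal_sum diagonal_mult diagonal_indicator) auto
  fix r assume "r \<in> paths l n"
  then have components: "fst (r ! k) < l" "fst (r ! Suc k) < l" using path_component_less k by auto
  have "(\<Sum>s<l. (if ?d k r = Q s then 1 else 0) * (if ?d (Suc k) r = Q s then 1 else 0)) =
    (\<Sum>s<l. if s = fst (r ! k) then (if fst (r ! Suc k) = fst (r ! k) then 1 else 0) else (0::'k))"
    using Q_eq_iff components by (intro sum.cong) (auto simp: residue)
  also have "\<dots> = (if fst (r ! k) = fst (r ! Suc k) then 1 else 0)" using components by auto
  finally show "(\<Sum>s<l. (if ?d k r = Q s then 1 else 0) * (if ?d (Suc k) r = Q s then 1 else 0)) =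
    (if fst (r ! k) = fst (r ! Suc k) then 1 else (0::'k))" .
qed

text \<open>For q = 1 the contents are not functions of the residues; they are diagonal by the relation
  \<open>T\<^sub>k J\<^sub>k\<^sub>+\<^sub>1 = J\<^sub>k T\<^sub>k + E\<^sub>k\<close> of the degenerate algebra, where \<open>E\<^sub>k\<close> tests whether the k-th and
  (k+1)-st nodes lie in the same component.\<close>

lemma path_op_content:
  assumes q: "q = 1" and p: "p \<in> paths l n" and k: "Suc k < n"
  shows "of_int (content (p ! k)) * F (Suc k) v p + (if fst (p ! k) = fst (p ! Suc k) then 1 else 0) * v p =
    F (Suc k) (\<lambda>r. of_int (content (r ! Suc k)) * v r) p"
proof -
  have "1 \<le> Suc k" "Suc k < length p" using p k by (auto simp: paths_def)
  then obtain u x y w where split: "p = u @ x # y # w" "Suc k = Suc (length u)" by (rule split_at_consecutive)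
  have path: "path l (u @ x # y # w)" "length (u @ x # y # w) \<le> n" using p split by (auto simp: paths_def)
  have nth: "p ! k = x" "p ! Suc k = y" "(u @ y # x # w) ! Suc k = x" using split by (auto simp: nth_append)
  have "of_int (content y - content x) \<noteq> (0::'k)" if "fst x = fst y"
    using path_distinguishable_consecutive[OF path] that q unfolding distinguishable_def by auto
  then have coefficient: "(if fst x = fst y then 1 else 0) = a x y * (of_int (content y) - of_int (content x))"
    unfolding seminormal_coeff_q_1[OF q] by auto
  show ?thesis unfolding nth coefficient unfolding split(1) path_op_swap[OF split(2)]
    using nth(2,3) split(1) by (auto simp: algebra_simps)
qed

lemma diagonal_content:
  assumes q: "q = 1" and k: "k < n"
  shows "diagonal (\<lambda>r. of_int (content (r ! k)))"
  using k
proof (induction k)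
  case 0
  have "content (r ! 0) = 0" if "r \<in> paths l n" for r
  proof -
    have "addable l {} (r ! 0)" using that 0 path_iff_addable[of l r] by (auto simp: paths_def)
    then show ?thesis by (cases "r ! 0") (auto simp: addable_def content_def)
  qed
  then show ?case using diagonal_cong[OF diagonal_const[of 0]] by simp
next
  case (Suc k)
  obtain E where E: "E \<in> carrier (free_algebra n)"
    "\<And>r v. r \<in> paths l n \<Longrightarrow> rep F E v r = (if fst (r ! k) = fst (r ! Suc k) then 1 else 0) * v r"
    using diagonal_same_component[OF q Suc.prems] unfolding diagonal_def by blast
  obtain J where J: "J \<in> carrier (free_algebra n)"
    "\<And>r v. r \<in> paths l n \<Longrightarrow> rep F J v r = of_int (content (r ! k)) * v r"
    using Suc unfolding diagonal_def by auto
  let ?T = "free_gen (Suc k) :: 'k free_alg" and ?c = "\<lambda>r. of_int (content (r ! Suc k))"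
  have "rep F (?T * (J * ?T + E)) v r = ?c r * v r" if r: "r \<in> paths l n" for r v
  proof -
    have "rep F (J * ?T + E) v p = F (Suc k) (\<lambda>r. ?c r * v r) p" if "p \<in> paths l n" for p
      using J(2)[OF that] E(2)[OF that] path_op_content[OF q that Suc.prems]
      by (simp add: rep_add rep_mult[OF linear_path_op] rep_gen)
    then have "rep F (?T * (J * ?T + E)) v r = F (Suc k) (F (Suc k) (\<lambda>r. ?c r * v r)) r"
      unfolding rep_mult[OF linear_path_op, where x = "?T"] rep_gen
      using Suc.prems r by (intro path_op_cong[of _ n r l]) auto
    then show ?thesis using path_op_quadratic[OF r, of "Suc k"] Suc.prems q by simp
  qed
  moreover have "?T * (J * ?T + E) \<in> carrier (free_algebra n)"
    using Suc.prems by (intro free_algebra_closed J E)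
  ultimately show ?case unfolding diagonal_def by blast
qed

lemma distinguishable_addable:
  assumes D: "closed_diagram l D" "finite D" "card D < n"
    and x: "addable l D x" and y: "addable l D y" and "x \<noteq> y"
  shows "distinguishable x y"
proof (rule distinguishableI)
  let ?D = "insert y (insert x D)"
  have "addable l (insert x D) y" using y \<open>x \<noteq> y\<close> by (auto simp: addable_def split: prod.splits)
  then have "closed_diagram l ?D" by (intro closed_diagram_insert D x)
  from content_diff_less[OF this, of x y]
  have diff: "\<bar>content x - content y\<bar> < int (card ?D) - (if fst x = fst y then 0 else 1)" using D(2) by simp
  have card: "card ?D \<le> n + 1" using D by (simp add: card_insert_if)
  show "fst x < l" "fst y < l" using x y by (auto simp: addable_def split: prod.splits)
  show "content x \<noteq> content y \<and> \<bar>content x - content y\<bar> \<le> int n" if "fst x = fst y"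
    using addable_distinct_content[OF D(1) x y that \<open>x \<noteq> y\<close>] diff card that by simp
  show "\<bar>content x - content y\<bar> < int n" if "fst x \<noteq> fst y"
    using diff card that by simp
qed

lemma diagonal_separates:
  assumes p: "p \<in> paths l n" and r: "r \<in> paths l n" and "p \<noteq> r"
  shows "\<exists>d. diagonal d \<and> d p \<noteq> d r"
proof -
  have "length p = length r" using p r by (simp add: paths_def)
  then obtain u x w y w' where split: "x \<noteq> y" "p = u @ [x] @ w" "r = u @ [y] @ w'"
    using same_length_different[OF \<open>p \<noteq> r\<close>] by blast
  have u: "path l u" "addable l (set u) x" "addable l (set u) y" "length u < n"
    using p r split by (auto simp: paths_def path_from_append)
  have nth: "p ! length u = x" "r ! length u = y" by (simp_all add: split)
  have "card (set u) < n" using card_length[of u] u(4) by simp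
  then have distinguishable: "distinguishable x y"
    using u split(1) path_closed by (intro distinguishable_addable[of "set u"]) auto
  show ?thesis
  proof (cases "fst x = fst y \<and> q = 1")
    case True
    then have "of_int (content x) \<noteq> (of_int (content y) :: 'k)"
      using distinguishable[unfolded distinguishable_def] by auto
    then show ?thesis using diagonal_content[of "length u"] True u(4) nth
      by (intro exI[of _ "\<lambda>r. of_int (content (r ! length u))"]) simp
  next
    case False
    then have "res x \<noteq> res y" using distinguishable by (auto simp: distinguishable_def)
    then show ?thesis using diagonal_residue[of "Suc (length u)"] u(4) nth
      by (intro exI[of _ "\<lambda>r. res (r ! length u)"]) simp
  qed
qed

lemma diagonal_unit:
  assumes p: "p \<in> paths l n"
  shows "diagonal (\<lambda>r. if r = p then 1 else 0)"
proof -
  have "\<forall>r. \<exists>d. r \<in> paths l n \<and> p \<noteq> r \<longrightarrow> diagonal d \<and> d p \<noteq> d r" using diagonal_separates[OF p] by metis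
  then obtain d where d: "\<And>r. r \<in> paths l n \<Longrightarrow> p \<noteq> r \<Longrightarrow> diagonal (d r) \<and> d r p \<noteq> d r r" by metis
  let ?S = "paths l n - {p}"
  have "diagonal (\<lambda>r. \<Prod>c\<in>?S. (d c r - d c c) / (d c p - d c c))"
    using d by (intro diagonal_prod diagonal_affine) auto
  moreover have "(\<Prod>c\<in>?S. (d c r - d c c) / (d c p - d c c)) = (if r = p then 1 else 0)" if r: "r \<in> paths l n"
    for r
  proof (cases "r = p")
    case True
    then show ?thesis using d by (simp, intro prod.neutral ballI) auto
  next
    case False
    then show ?thesis using r finite_paths by (auto intro!: prod_zero bexI[of _ r])
  qed
  ultimately show ?thesis by (rule diagonal_cong)
qed

lemma character_dual_element:
  assumes n: "1 \<le> n" and \<Lambda>: "\<Lambda> \<in> multipartitions l n"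
  shows "\<exists>x\<in>carrier (free_algebra n). \<forall>\<Gamma>\<in>multipartitions l n.
    ak_character q Q \<Gamma> (ak_ideal l n q Q +>\<^bsub>free_algebra n\<^esub> x) = (if \<Gamma> = \<Lambda> then 1 else 0)"
proof -
  obtain p where p: "p \<in> paths l n" "shape l (set p) = \<Lambda>"
    using shape_paths_nonempty[OF \<Lambda>] shape_paths_eq[OF \<Lambda>] by auto
  obtain x where x: "x \<in> carrier (free_algebra n)"
    "\<And>r v. r \<in> paths l n \<Longrightarrow> rep F x v r = (if r = p then 1 else 0) * v r"
    using diagonal_unit[OF p(1)] unfolding diagonal_def by blast
  have "ak_character q Q \<Gamma> (ak_ideal l n q Q +>\<^bsub>free_algebra n\<^esub> x) = (if \<Gamma> = \<Lambda> then 1 else 0)"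
    if \<Gamma>: "\<Gamma> \<in> multipartitions l n" for \<Gamma>
  proof -
    have "ak_character q Q \<Gamma> (ak_ideal l n q Q +>\<^bsub>free_algebra n\<^esub> x) =
        (\<Sum>r\<in>shape_paths \<Gamma> l n. if r = p then 1 else 0)"
      unfolding ak_character_coset[OF \<Gamma> n x(1)]
      using x(2) by (intro sum.cong) (auto simp: shape_paths_def delta_def)
    also have "\<dots> = (if p \<in> shape_paths \<Gamma> l n then 1 else 0)" using std_tableaux_eq(3)[OF \<Gamma>] by simp
    also have "p \<in> shape_paths \<Gamma> l n \<longleftrightarrow> \<Gamma> = \<Lambda>" using p shape_paths_eq[OF \<Gamma>] by auto
    finally show ?thesis .
  qed
  then show ?thesis using x(1) by blast
qed

lemma character_coefficients_unique:
  assumes n: "1 \<le> n" and \<Lambda>: "\<Lambda> \<in> multipartitions l n"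
    and "\<And>X. X \<in> carrier (ak_algebra l n q Q) \<Longrightarrow>
      (\<Sum>\<Gamma>\<in>multipartitions l n. s \<Gamma> * ak_character q Q \<Gamma> X) =
        (\<Sum>\<Gamma>\<in>multipartitions l n. t \<Gamma> * ak_character q Q \<Gamma> X)"
  shows "s \<Lambda> = t \<Lambda>"
proof -
  interpret P: ak_params l n q Q by (rule separated_ak_params[OF n])
  obtain x where x: "x \<in> carrier (free_algebra n)"
    "\<And>\<Gamma>. \<Gamma> \<in> multipartitions l n \<Longrightarrow> ak_character q Q \<Gamma> (P.coset x) = (if \<Gamma> = \<Lambda> then 1 else 0)"
    using character_dual_element[OF n \<Lambda>] unfolding P.coset_def by blast
  have dual: "(\<Sum>\<Gamma>\<in>multipartitions l n. s \<Gamma> * ak_character q Q \<Gamma> (P.coset x)) = s \<Lambda>" for s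
  proof -
    have "(\<Sum>\<Gamma>\<in>multipartitions l n. s \<Gamma> * ak_character q Q \<Gamma> (P.coset x)) =
        (\<Sum>\<Gamma>\<in>multipartitions l n. if \<Gamma> = \<Lambda> then s \<Lambda> else 0)"
      using x(2) by (intro sum.cong) auto
    then show ?thesis using \<Lambda> finite_multipartitions by simp
  qed
  show ?thesis using assms(3)[of "P.coset x"] x(1) unfolding dual P.coset_carrier by blast
qed

theorem schur_element_eq_formula:
  assumes n: "1 \<le> n" and \<Lambda>: "\<Lambda> \<in> multipartitions l n"
  shows "schur_element l n q Q \<Lambda> = schur_formula l n q Q \<Lambda>"
proof -
  interpret P: ak_params l n q Q by (rule separated_ak_params[OF n])
  let ?M = "multipartitions l n" and ?A = "ak_algebra l n q Q"
  let ?schur = "\<lambda>s. s \<in> ?M \<rightarrow>\<^sub>E (UNIV - {0}) \<and>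
    (\<forall>X\<in>carrier ?A. ak_tau l n q Q X = (\<Sum>\<Lambda>\<in>?M. 1 / s \<Lambda> * ak_character q Q \<Lambda> X))"
  define s where "s = restrict (schur_formula l n q Q) ?M"
  have tau: "ak_tau l n q Q (P.coset x) = path_trace n x" if "x \<in> carrier (free_algebra n)" for x
    by (rule P.ak_tau_eq[OF linear_mod_path_trace[OF n] path_trace_canonical_values[OF order_refl] that])
  have s: "?schur s"
  proof
    show "s \<in> ?M \<rightarrow>\<^sub>E (UNIV - {0})" using schur_formula_nonzero by (auto simp: s_def)
    show "\<forall>X\<in>carrier ?A. ak_tau l n q Q X = (\<Sum>\<Lambda>\<in>?M. 1 / s \<Lambda> * ak_character q Q \<Lambda> X)"
      unfolding P.coset_carrier using tau path_trace_eq_sum_characters[OF n] by (auto simp: P.coset_def s_def)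
  qed
  moreover have "s' = s" if s': "?schur s'" for s'
  proof (rule extensionalityI)
    show "s' \<in> extensional ?M" "s \<in> extensional ?M" using s' s by (auto simp: PiE_def)
    fix \<Lambda> assume \<Lambda>: "\<Lambda> \<in> ?M"
    have "1 / s' \<Lambda> = 1 / s \<Lambda>"
    proof (rule character_coefficients_unique[OF n \<Lambda>])
      fix X assume X: "X \<in> carrier ?A"
      show "(\<Sum>\<Gamma>\<in>?M. 1 / s' \<Gamma> * ak_character q Q \<Gamma> X) = (\<Sum>\<Gamma>\<in>?M. 1 / s \<Gamma> * ak_character q Q \<Gamma> X)"
        using bspec[OF conjunct2[OF s'] X] bspec[OF conjunct2[OF s] X] by (rule trans[OF sym])
    qed
    then show "s' \<Lambda> = s \<Lambda>" by simp
  qed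
  ultimately have "schur_element l n q Q = s" unfolding schur_element_def by (rule the_equality)
  then show ?thesis using \<Lambda> by (simp add: s_def)
qed

lemma schur_formula_eq_full_product:
  assumes q: "q \<noteq> 1" and \<Lambda>: "\<Lambda> \<in> multipartitions l n"
  shows "schur_formula l n q Q \<Lambda> =
        (-1) ^ (n * (l - 1)) * q powi (- int (n_stat (mp_bar \<Lambda>))) * (q - 1) powi (- int n) *
        (\<Prod>s<l. \<Prod>(i, j)\<in>young (\<Lambda> ! s). \<Prod>t<l.
           (q powi hook (\<Lambda> ! s) (\<Lambda> ! t) i j * Q s * inverse (Q t) - 1))"
proof -
  have components: "length \<Lambda> = l" "\<forall>p\<in>set \<Lambda>. is_partition p" "mp_size \<Lambda> = n" using \<Lambda>
    by (auto simp: multipartitions_def)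
  let ?f = "\<lambda>s i j t. q powi hook (\<Lambda> ! s) (\<Lambda> ! t) i j * Q s * inverse (Q t) - 1"
  have factor: "q_int q (nat (hook (\<Lambda> ! s) (\<Lambda> ! s) i j)) * (\<Prod>t\<in>{..<l} - {s}. ?f s i j t) =
      inverse (q - 1) * (\<Prod>t<l. ?f s i j t)"
    if "s < l" "(i, j) \<in> young (\<Lambda> ! s)" for s i j
  proof -
    have "1 \<le> hook (\<Lambda> ! s) (\<Lambda> ! s) i j" using hook_pos that components by simp
    then have "?f s i j s = (q - 1) * q_int q (nat (hook (\<Lambda> ! s) (\<Lambda> ! s) i j))"
      using Q0[OF that(1)] by (simp add: q_int_eq power_int_def)
    then show ?thesis using that q by (subst prod.remove[of "{..<l}" s]) simp_all
  qed
  have "(\<Prod>s<l. \<Prod>(i, j)\<in>young (\<Lambda> ! s). q_int q (nat (hook (\<Lambda> ! s) (\<Lambda> ! s) i j)) * (\<Prod>t\<in>{..<l} - {s}. ?f s i j t)) =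
    (\<Prod>s<l. \<Prod>x\<in>young (\<Lambda> ! s). inverse (q - 1) * (case x of (i, j) \<Rightarrow> \<Prod>t<l. ?f s i j t))"
    using factor by (intro prod.cong refl) auto
  also have "\<dots> = (\<Prod>s<l. inverse (q - 1) ^ card (young (\<Lambda> ! s))) *
      (\<Prod>s<l. \<Prod>(i, j)\<in>young (\<Lambda> ! s). \<Prod>t<l. ?f s i j t)"
    by (simp add: prod.distrib)
  also have "(\<Prod>s<l. inverse (q - 1) ^ card (young (\<Lambda> ! s))) = inverse (q - 1) ^ (\<Sum>s<l. card (young (\<Lambda> ! s)))"
    by (simp add: power_sum)
  also have "(\<Sum>s<l. card (young (\<Lambda> ! s))) = n"
    using components card_young unfolding mp_size_def sum_list_sum_nth
    by (auto simp: atLeast0LessThan intro!: sum.cong)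
  finally show ?thesis unfolding schur_formula_def by (simp add: power_int_minus power_inverse mult.assoc)
qed

end

theorem theorem3p2:
  fixes l n :: nat and q :: "'a::field" and Q :: "nat \<Rightarrow> 'a" and \<Lambda> :: multipartition
  assumes "1 \<le> l" and "1 \<le> n"
    and "q \<noteq> 0" and "\<And>s. s < l \<Longrightarrow> Q s \<noteq> 0"
    and "split_semisimple (ak_algebra l n q Q) (ak_scalar l n q Q)"
    and "\<Lambda> \<in> multipartitions l n"
  shows "(q \<noteq> 1 \<longrightarrow>
      schur_element l n q Q \<Lambda> =
        (-1) ^ (n * (l - 1)) * q powi (- int (n_stat (mp_bar \<Lambda>))) * (q - 1) powi (- int n) *
        (\<Prod>s<l. \<Prod>(i, j)\<in>young (\<Lambda> ! s). \<Prod>t<l.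
           (q powi hook (\<Lambda> ! s) (\<Lambda> ! t) i j * Q s * inverse (Q t) - 1))) \<and>
    schur_element l n q Q \<Lambda> =
        (-1) ^ (n * (l - 1)) * q powi (- int (n_stat (mp_bar \<Lambda>))) *
        (\<Prod>s<l. \<Prod>(i, j)\<in>young (\<Lambda> ! s).
           q_int q (nat (hook (\<Lambda> ! s) (\<Lambda> ! s) i j)) *
           (\<Prod>t\<in>{..<l} - {s}.
              (q powi hook (\<Lambda> ! s) (\<Lambda> ! t) i j * Q s * inverse (Q t) - 1)))"
proof -
  interpret P: ak_params l n q Q using assms(1-3) by unfold_locales
  interpret separated l n q Q
    using assms(4,5) by (intro P.separated_of_semisimple) (auto simp: split_semisimple_def)
  show ?thesis
    using schur_element_eq_formula[OF assms(2,6)] schur_formula_eq_full_product[OF _ assms(6)]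
    unfolding schur_formula_def by simp
qed

end
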